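(* Let $\mathcal{C}$ be a finite EI-category, $\alpha\in Z^2(\mathcal{O}_{\mathcal{C}};\mathbb{F}_p^\times)$, and $b$ a central idempotent of $k_\alpha\mathcal{C}$. Then for every idempotent endomorphism $e$ in $\mathcal{C}$, setting $\hat{e}=\alpha(e,e)^{-1}e$, the element $\hat{e}b$ is a central idempotent in $k_\alpha G_e$. If for every idempotent endomorphism $e$ in $\mathcal{C}$ there is a $\Gamma_b$-equivariant bijection $\mathcal{S}(k_\alpha G_e \hat{e}b)\to \mathcal{W}(k_\alpha \mathcal{O}_{G_e},\hat{e}b)$, then there exists a $\Gamma_b$-equivariant bijection $\mathcal{S}(k_\alpha \mathcal{C} b)\to \mathcal{W}(k_\alpha\mathcal{O}_{\mathcal{C}},b)$.
   Context: Fix a prime $p$, an algebraic closure $k$ of $\mathbb{F}_p$, and $\Gamma=\mathrm{Gal}(k/\mathbb{F}_p)$. Modules are left modules. A category is finite if its morphism class is a finite set, and EI if every endomorphism is an isomorphism. A finite group is regarded as a category with one object. Twisted category algebras. For a finite category $\mathcal{D}$, $\alpha\in Z^2(\mathcal{D};k^\times)$ assigns to each pair of morphisms $t,s$ with $t\circ s$ defined an element $\alpha(t,s)\in k^\times$ such that $\alpha(u,t\circ s)\alpha(t,s)=\alpha(u\circ t,s)\alpha(u,t)$ whenever $t\circ s$, $u\circ t$ are defined. $k_\alpha\mathcal{D}$ has $k$-basis $\mathrm{Mor}(\mathcal{D})$ and product $ts=\alpha(t,s)\,t\circ s$ if $t\circ s$ is defined, $0$ otherwise. For an idempotent endomorphism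 $e$ of $X$, $G_e$ is the group of invertible elements of $e\circ\mathrm{End}_{\mathcal{D}}(X)\circ e$. In an EI-category the only idempotent endomorphism of $X$ is $e=\mathrm{Id}_X$ and $G_e=\mathrm{End}_{\mathcal{D}}(X)$. Transporter and orbit categories. The objects of the $p$-transporter category $\mathcal{T}_{\mathcal{C}}$ are pairs $(X,P)$ with $X\in\mathrm{Ob}(\mathcal{C})$ and $P$ a $p$-subgroup of the monoid $\mathrm{End}_{\mathcal{C}}(X)$ (in general with unit $1_P$ any idempotent; for EI-categories $1_P=\mathrm{Id}_X$). Morphisms $(X,P)\to(Y,Q)$ are triples $(s,P,Q)$ with $s\in\mathrm{Hom}_{\mathcal{C}}(X,Y)$, $s=s\circ1_P=1_Q\circ s$, $s\circ P\subseteq Q\circ s$, with composition induced from $\mathcal{C}$. The $p$-orbit category $\mathcal{O}_{\mathcal{C}}$ has the same objects and $\mathrm{Hom}_{\mathcal{O}_{\mathcal{C}}}((X,P),(Y,Q))=Q\backslash\mathrm{Hom}_{\mathcal{T}_{\mathcal{C}}}((X,P),(Y,Q))/P$. Cocycles on $\mathcal{O}_{\mathcal{C}}$ restrict to $\mathcal{C}$ along $X\mapsto(X,\{\mathrm{Id}_X\})$, hence to each $G_e$, and to $\mathcal{O}_{G_e}$ ($e=\mathrm{Id}_X$) along $P\mapsto(X,P)$; restrictions are again denoted $\alpha$. If $\mathcal{C}$ is EI, so is $\mathcal{O}_{\mathcal{C}}$, and for $e=\mathrm{Id}_X$ one has $\mathrm{End}_{\mathcal{O}_{\mathcal{C}}}((X,P))=N_{G_e}(P)/P$.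 Weights. Idempotents $e\in\mathrm{End}_{\mathcal{D}}(X)$, $f\in\mathrm{End}_{\mathcal{D}}(Y)$ are isomorphic if there are $s\in f\circ\mathrm{Hom}_{\mathcal{D}}(X,Y)\circ e$, $t\in e\circ\mathrm{Hom}_{\mathcal{D}}(Y,X)\circ f$ with $t\circ s=e$, $s\circ t=f$. Then $x\mapsto\alpha(x,t)\alpha(s,x\circ t)\alpha(e,e)^{-1}\alpha(t,s)^{-1}(s\circ x\circ t)$ induces an algebra isomorphism $\varphi:k_\alpha G_e\to k_\alpha G_f$, unique up to inner automorphisms. Pairs $(e,T)$, $(f,T')$ ($T$ a $k_\alpha G_e$-module, $T'$ a $k_\alpha G_f$-module) are isomorphic if $e,f$ are isomorphic and ${}_\varphi T\cong T'$, where ${}_\varphi T$ is $T$ with structure map precomposed with $\varphi^{-1}$. A weight of $k_\alpha\mathcal{D}$ is a pair $(e,T)$ with $T$ a simple projective $k_\alpha G_e$-module. Thus for $\mathcal{C}$ EI a weight of $k_\alpha\mathcal{O}_{\mathcal{C}}$ is given by an object $(X,P)$ of $\mathcal{O}_{\mathcal{C}}$ and a simple projective $k_\alpha(N_{G_e}(P)/P)$-module $T$, where $e=\mathrm{Id}_X$. $b$-weights ($\mathcal{C}$ EI). For a finite group $G$ acting on $k_\alpha G$ by conjugation and a $p$-subgroup $P$, let $(k_\alpha G)(P)=(k_\alpha G)^P/\sum_{Q<P}\mathrm{Tr}_Q^P((k_\alpha G)^Q)$ be the Brauer quotient, where $\mathrm{Tr}_Q^P$ is the relative trace. One has $k_\alpha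 C_G(P)\subseteq(k_\alpha G)^P$, and this inclusion followed by the quotient map is an isomorphism $k_\alpha C_G(P)\cong(k_\alpha G)(P)$. Let $\mathrm{br}_P^{k_\alpha G}$ be the composition $(k_\alpha G)^P\to(k_\alpha G)(P)\cong k_\alpha C_G(P)\subseteq k_\alpha N_G(P)$. For a weight of $k_\alpha\mathcal{O}_{\mathcal{C}}$ given by $(X,P)$ and $T$, with $e=\mathrm{Id}_X$, regard $T$ as a $k_\alpha N_{G_e}(P)$-module via the canonical surjection $k_\alpha N_{G_e}(P)\to k_\alpha(N_{G_e}(P)/P)$; explicitly, with $u:(X,\{\mathrm{Id}_X\})\to(X,P)$ the morphism of $\mathcal{O}_{\mathcal{C}}$ represented by $\mathrm{Id}_X$ and $\bar x$ the image of $x\in N_{G_e}(P)$ in $N_{G_e}(P)/P$, it sends $x$ to $\alpha(u,x)\alpha(\bar x,u)^{-1}\bar x$ (the unique map $\theta$ with $u\,x=\theta(x)\,u$ in $k_\alpha\mathcal{O}_{\mathcal{C}}$). The weight is a $b$-weight if $\mathrm{br}_P^{k_\alpha G_e}(\hat e b)T\neq0$; this depends only on the isomorphism class of the weight. $\mathcal{W}(k_\alpha\mathcal{O}_{\mathcal{C}},b)$ is the set of isomorphism classes of $b$-weights. The same definition applied to the one-object EI-category $G_e$ defines $\mathcal{W}(k_\alpha\mathcal{O}_{G_e},\hat eb)$. $\mathcal{S}(A)$ is the set of isomorphism classes of simple $A$-modules. Galois action. For $\alpha$ with values in $\mathbb{F}_p^\times$, $\sigma\in\Gamma$ acts on $k_\alpha\mathcal{D}$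 through the coefficients with respect to the basis $\mathrm{Mor}(\mathcal{D})$. $\Gamma_b$ is the stabiliser of $b$ in $\Gamma$. ${}^\sigma U$ is $U$ with structure map precomposed with $\sigma^{-1}$, and $\sigma$ acts on weights by ${}^\sigma(e,T)=(e,{}^\sigma T)$. These induce actions of $\Gamma_b$ on $\mathcal{S}(k_\alpha\mathcal{C}b)$, $\mathcal{W}(k_\alpha\mathcal{O}_{\mathcal{C}},b)$, $\mathcal{S}(k_\alpha G_e\hat eb)$ and $\mathcal{W}(k_\alpha\mathcal{O}_{G_e},\hat eb)$. *)

theory Defs
  imports "HOL-Algebra.Module" "HOL-Algebra.AbelCoset" "HOL-Computational_Algebra.Computational_Algebra"
begin

section \<open>The coefficient field\<close>

definition prime_subfield :: "'k::field set" where
  "prime_subfield = range of_int"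

text \<open>The type \<open>'k\<close> is an algebraic closure of the field with \<open>p\<close> elements; algebraic
  closedness is supplied by the type class.\<close>

definition alg_closure_Fp :: "nat \<Rightarrow> 'k::alg_closed_field itself \<Rightarrow> bool" where
  "alg_closure_Fp p _ \<longleftrightarrow> prime p \<and> CHAR('k) = p \<and>
     (\<forall>x::'k. \<exists>f. f \<noteq> 0 \<and> range (coeff f) \<subseteq> prime_subfield \<and> poly f x = 0)"

definition galois_group :: "('k::field \<Rightarrow> 'k) set" where
  "galois_group = {\<sigma>. bij \<sigma> \<and> (\<forall>x y. \<sigma> (x + y) = \<sigma> x + \<sigma> y) \<and> (\<forall>x y. \<sigma> (x * y) = \<sigma> x * \<sigma> y) \<and>
     (\<forall>x\<in>prime_subfield. \<sigma> x = x)}"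


section \<open>Finite categories\<close>

text \<open>\<open>t \<cdot> s\<close> is only meaningful if \<open>Dom t = Cod s\<close>.\<close>

record ('o, 'm) cat =
  Obj :: "'o set"
  Mor :: "'m set"
  Dom :: "'m \<Rightarrow> 'o"
  Cod :: "'m \<Rightarrow> 'o"
  Ide :: "'o \<Rightarrow> 'm"
  Comp :: "'m \<Rightarrow> 'm \<Rightarrow> 'm" (infixl \<open>\<cdot>\<index>\<close> 70)

locale category =
  fixes D :: "('o, 'm) cat" (structure)
  assumes dom_closed: "s \<in> Mor D \<Longrightarrow> Dom D s \<in> Obj D"
    and cod_closed: "s \<in> Mor D \<Longrightarrow> Cod D s \<in> Obj D"
    and ide_mor: "X \<in> Obj D \<Longrightarrow> Ide D X \<in> Mor D \<and> Dom D (Ide D X) = X \<and> Cod D (Ide D X) = X"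
    and comp_mor: "\<lbrakk>t \<in> Mor D; s \<in> Mor D; Dom D t = Cod D s\<rbrakk> \<Longrightarrow>
      t \<cdot> s \<in> Mor D \<and> Dom D (t \<cdot> s) = Dom D s \<and> Cod D (t \<cdot> s) = Cod D t"
    and comp_ide: "s \<in> Mor D \<Longrightarrow> s \<cdot> Ide D (Dom D s) = s"
    and ide_comp: "s \<in> Mor D \<Longrightarrow> Ide D (Cod D s) \<cdot> s = s"
    and comp_assoc: "\<lbrakk>u \<in> Mor D; t \<in> Mor D; s \<in> Mor D; Dom D u = Cod D t; Dom D t = Cod D s\<rbrakk> \<Longrightarrow>
      u \<cdot> (t \<cdot> s) = (u \<cdot> t) \<cdot> s"

locale finite_category = category +
  assumes finite_mor: "finite (Mor D)"

definition Hom :: "('o, 'm) cat \<Rightarrow> 'o \<Rightarrow> 'o \<Rightarrow> 'm set" where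
  "Hom D X Y = {s \<in> Mor D. Dom D s = X \<and> Cod D s = Y}"

definition is_iso :: "('o, 'm) cat \<Rightarrow> 'm \<Rightarrow> bool" where
  "is_iso D s \<longleftrightarrow> s \<in> Mor D \<and> (\<exists>t\<in>Hom D (Cod D s) (Dom D s).
     t \<cdot>\<^bsub>D\<^esub> s = Ide D (Dom D s) \<and> s \<cdot>\<^bsub>D\<^esub> t = Ide D (Cod D s))"

definition EI_category :: "('o, 'm) cat \<Rightarrow> bool" where
  "EI_category D \<longleftrightarrow> category D \<and> (\<forall>X\<in>Obj D. \<forall>s\<in>Hom D X X. is_iso D s)"

definition idem_endo :: "('o, 'm) cat \<Rightarrow> 'm \<Rightarrow> bool" where
  "idem_endo D e \<longleftrightarrow> e \<in> Mor D \<and> Dom D e = Cod D e \<and> e \<cdot>\<^bsub>D\<^esub> e = e"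

definition idem_group :: "('o, 'm) cat \<Rightarrow> 'm \<Rightarrow> 'm monoid" where
  "idem_group D e = units_of
     \<lparr>carrier = {e \<cdot>\<^bsub>D\<^esub> x \<cdot>\<^bsub>D\<^esub> e | x. x \<in> Hom D (Dom D e) (Dom D e)},
      monoid.mult = Comp D, one = e\<rparr>"

text \<open>The group \<open>G\<^sub>e\<close> as a category whose single object is the object of which \<open>e\<close> is an
  endomorphism.\<close>

definition idem_cat :: "('o, 'm) cat \<Rightarrow> 'm \<Rightarrow> ('o, 'm) cat" where
  "idem_cat D e = \<lparr>Obj = {Dom D e}, Mor = carrier (idem_group D e), Dom = \<lambda>_. Dom D e,
     Cod = \<lambda>_. Dom D e, Ide = \<lambda>_. one (idem_group D e), Comp = monoid.mult (idem_group D e)\<rparr>"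


section \<open>Transporter and orbit categories\<close>

definition p_subgroup :: "nat \<Rightarrow> ('o, 'm) cat \<Rightarrow> 'o \<Rightarrow> 'm set \<Rightarrow> bool" where
  "p_subgroup p C X P \<longleftrightarrow> P \<subseteq> Hom C X X \<and>
     (\<exists>u. group \<lparr>carrier = P, monoid.mult = Comp C, one = u\<rparr>) \<and> (\<exists>n. card P = p ^ n)"

definition p_unit :: "('o, 'm) cat \<Rightarrow> 'm set \<Rightarrow> 'm" where
  "p_unit C P = (THE u. u \<in> P \<and> u \<cdot>\<^bsub>C\<^esub> u = u)"

type_synonym 'm tmor = "'m \<times> 'm set \<times> 'm set"

definition transporter_cat :: "nat \<Rightarrow> ('o, 'm) cat \<Rightarrow> ('o \<times> 'm set, 'm tmor) cat" where
  "transporter_cat p C =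
    \<lparr>Obj = {(X, P). X \<in> Obj C \<and> p_subgroup p C X P},
     Mor = {(s, P, Q). s \<in> Mor C \<and> p_subgroup p C (Dom C s) P \<and> p_subgroup p C (Cod C s) Q \<and>
       s = s \<cdot>\<^bsub>C\<^esub> p_unit C P \<and> s = p_unit C Q \<cdot>\<^bsub>C\<^esub> s \<and>
       (\<lambda>x. s \<cdot>\<^bsub>C\<^esub> x) ` P \<subseteq> (\<lambda>y. y \<cdot>\<^bsub>C\<^esub> s) ` Q},
     Dom = \<lambda>(s, P, Q). (Dom C s, P),
     Cod = \<lambda>(s, P, Q). (Cod C s, Q),
     Ide = \<lambda>(X, P). (p_unit C P, P, P),
     Comp = \<lambda>(t, Q', R) (s, P, Q). (t \<cdot>\<^bsub>C\<^esub> s, P, R)\<rparr>"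

definition orbit_class :: "('o, 'm) cat \<Rightarrow> 'm tmor \<Rightarrow> 'm tmor set" where
  "orbit_class C = (\<lambda>(s, P, Q). {(y \<cdot>\<^bsub>C\<^esub> (s \<cdot>\<^bsub>C\<^esub> x), P, Q) | x y. x \<in> P \<and> y \<in> Q})"

text \<open>Every transporter morphism \<open>(s, P, Q)\<close> satisfies \<open>Q s P = Q s\<close>, hence the set of all
  products of elements of two composable classes is again a single class.\<close>

definition orbit_cat :: "nat \<Rightarrow> ('o, 'm) cat \<Rightarrow> ('o \<times> 'm set, 'm tmor set) cat" where
  "orbit_cat p C =
    \<lparr>Obj = Obj (transporter_cat p C),
     Mor = orbit_class C ` Mor (transporter_cat p C),
     Dom = \<lambda>c. the_elem (Dom (transporter_cat p C) ` c),
     Cod = \<lambda>c. the_elem (Cod (transporter_cat p C) ` c),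
     Ide = \<lambda>X. orbit_class C (Ide (transporter_cat p C) X),
     Comp = \<lambda>d c. {t \<cdot>\<^bsub>transporter_cat p C\<^esub> s | t s. t \<in> d \<and> s \<in> c}\<rparr>"

definition orbit_embed :: "('o, 'm) cat \<Rightarrow> 'm \<Rightarrow> 'm tmor set" where
  "orbit_embed C s = orbit_class C (s, {Ide C (Dom C s)}, {Ide C (Cod C s)})"


section \<open>Twisted category algebras\<close>

text \<open>Values of a cocycle on pairs of non-composable morphisms are irrelevant.\<close>

definition cocycle :: "('o, 'm) cat \<Rightarrow> 'k::field set \<Rightarrow> ('m \<Rightarrow> 'm \<Rightarrow> 'k) \<Rightarrow> bool" where
  "cocycle D U \<alpha> \<longleftrightarrow>
     (\<forall>t\<in>Mor D. \<forall>s\<in>Mor D. Dom D t = Cod D s \<longrightarrow> \<alpha> t s \<in> U) \<and>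
     (\<forall>u\<in>Mor D. \<forall>t\<in>Mor D. \<forall>s\<in>Mor D. Dom D u = Cod D t \<and> Dom D t = Cod D s \<longrightarrow>
        \<alpha> u (t \<cdot>\<^bsub>D\<^esub> s) * \<alpha> t s = \<alpha> (u \<cdot>\<^bsub>D\<^esub> t) s * \<alpha> u t)"

definition res_cocycle ::
    "('o, 'm) cat \<Rightarrow> ('m tmor set \<Rightarrow> 'm tmor set \<Rightarrow> 'k) \<Rightarrow> 'm \<Rightarrow> 'm \<Rightarrow> 'k" where
  "res_cocycle C \<alpha> t s = \<alpha> (orbit_embed C t) (orbit_embed C s)"

definition span_of :: "'m set \<Rightarrow> ('m \<Rightarrow> 'k::field) set" where
  "span_of S = {a. \<forall>s. s \<notin> S \<longrightarrow> a s = 0}"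

definition basis_elt :: "'m \<Rightarrow> 'm \<Rightarrow> 'k::field" where
  "basis_elt s = (\<lambda>_. 0)(s := 1)"

text \<open>Elements are coefficient functions, so for a subcategory of \<open>D\<close> the carrier of its algebra
  is literally a subset of the carrier of the algebra of \<open>D\<close>.  The unit is
  \<open>\<Sum>\<^sub>X \<alpha>(Id\<^sub>X, Id\<^sub>X)\<^sup>-\<^sup>1 Id\<^sub>X\<close>.\<close>

definition tw_alg :: "('o, 'm) cat \<Rightarrow> ('m \<Rightarrow> 'm \<Rightarrow> 'k::field) \<Rightarrow> ('m \<Rightarrow> 'k) ring" where
  "tw_alg D \<alpha> =
    \<lparr>carrier = span_of (Mor D),
     monoid.mult = \<lambda>a b r. \<Sum>(t, s) | t \<in> Mor D \<and> s \<in> Mor D \<and> Dom D t = Cod D s \<and> t \<cdot>\<^bsub>D\<^esub> s = r.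
       a t * b s * \<alpha> t s,
     one = \<lambda>s. if s \<in> Ide D ` Obj D then inverse (\<alpha> s s) else 0,
     zero = \<lambda>_. 0,
     add = \<lambda>a b s. a s + b s\<rparr>"

abbreviation idem_alg :: "('o, 'm) cat \<Rightarrow> ('m \<Rightarrow> 'm \<Rightarrow> 'k::field) \<Rightarrow> 'm \<Rightarrow> ('m \<Rightarrow> 'k) ring" where
  "idem_alg D \<alpha> e \<equiv> tw_alg (idem_cat D e) \<alpha>"

definition idem_hat :: "('m \<Rightarrow> 'm \<Rightarrow> 'k::field) \<Rightarrow> 'm \<Rightarrow> 'm \<Rightarrow> 'k" where
  "idem_hat \<alpha> e = (\<lambda>_. 0)(e := inverse (\<alpha> e e))"

abbreviation idem_part :: "('o, 'm) cat \<Rightarrow> ('m \<Rightarrow> 'm \<Rightarrow> 'k::field) \<Rightarrow> 'm \<Rightarrow> ('m \<Rightarrow> 'k) \<Rightarrow> 'm \<Rightarrow> 'k" where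
  "idem_part D \<alpha> e b \<equiv> idem_hat \<alpha> e \<otimes>\<^bsub>tw_alg D \<alpha>\<^esub> b"

definition central_idempotent :: "('r, 'x) ring_scheme \<Rightarrow> 'r \<Rightarrow> bool" where
  "central_idempotent R b \<longleftrightarrow> b \<in> carrier R \<and> b \<otimes>\<^bsub>R\<^esub> b = b \<and>
     (\<forall>a\<in>carrier R. a \<otimes>\<^bsub>R\<^esub> b = b \<otimes>\<^bsub>R\<^esub> a)"

definition block_alg :: "'r ring \<Rightarrow> 'r \<Rightarrow> 'r ring" where
  "block_alg R b = R\<lparr>carrier := (\<lambda>a. a \<otimes>\<^bsub>R\<^esub> b) ` carrier R, one := b\<rparr>"


section \<open>Left modules\<close>

text \<open>The locale \<open>module\<close> requires a commutative ring.  As there, the fields \<open>mult\<close> and \<open>one\<close>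
  of the record \<open>M\<close> play no role.\<close>

locale left_module = R?: ring R + M?: abelian_group M
  for R :: "('r, 'x) ring_scheme" (structure) and M :: "('r, 'v) module" (structure) +
  assumes lsmult_closed: "\<lbrakk>a \<in> carrier R; v \<in> carrier M\<rbrakk> \<Longrightarrow> a \<odot>\<^bsub>M\<^esub> v \<in> carrier M"
    and lsmult_l_distr: "\<lbrakk>a \<in> carrier R; b \<in> carrier R; v \<in> carrier M\<rbrakk> \<Longrightarrow>
      (a \<oplus>\<^bsub>R\<^esub> b) \<odot>\<^bsub>M\<^esub> v = a \<odot>\<^bsub>M\<^esub> v \<oplus>\<^bsub>M\<^esub> b \<odot>\<^bsub>M\<^esub> v"
    and lsmult_r_distr: "\<lbrakk>a \<in> carrier R; v \<in> carrier M; w \<in> carrier M\<rbrakk> \<Longrightarrow>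
      a \<odot>\<^bsub>M\<^esub> (v \<oplus>\<^bsub>M\<^esub> w) = a \<odot>\<^bsub>M\<^esub> v \<oplus>\<^bsub>M\<^esub> a \<odot>\<^bsub>M\<^esub> w"
    and lsmult_assoc: "\<lbrakk>a \<in> carrier R; b \<in> carrier R; v \<in> carrier M\<rbrakk> \<Longrightarrow>
      (a \<otimes>\<^bsub>R\<^esub> b) \<odot>\<^bsub>M\<^esub> v = a \<odot>\<^bsub>M\<^esub> (b \<odot>\<^bsub>M\<^esub> v)"
    and lsmult_one: "v \<in> carrier M \<Longrightarrow> \<one>\<^bsub>R\<^esub> \<odot>\<^bsub>M\<^esub> v = v"

definition lmod_hom ::
    "('r, 'x) ring_scheme \<Rightarrow> ('r, 'v) module \<Rightarrow> ('r, 'w) module \<Rightarrow> ('v \<Rightarrow> 'w) set" where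
  "lmod_hom R M N = {h \<in> carrier M \<rightarrow> carrier N.
     (\<forall>v\<in>carrier M. \<forall>w\<in>carrier M. h (v \<oplus>\<^bsub>M\<^esub> w) = h v \<oplus>\<^bsub>N\<^esub> h w) \<and>
     (\<forall>a\<in>carrier R. \<forall>v\<in>carrier M. h (a \<odot>\<^bsub>M\<^esub> v) = a \<odot>\<^bsub>N\<^esub> h v)}"

definition lmod_iso :: "('r, 'x) ring_scheme \<Rightarrow> ('r, 'v) module \<Rightarrow> ('r, 'w) module \<Rightarrow> bool" where
  "lmod_iso R M N \<longleftrightarrow> (\<exists>h\<in>lmod_hom R M N. bij_betw h (carrier M) (carrier N))"

definition simple_lmod :: "('r, 'x) ring_scheme \<Rightarrow> ('r, 'v) module \<Rightarrow> bool" where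
  "simple_lmod R M \<longleftrightarrow> left_module R M \<and> carrier M \<noteq> {\<zero>\<^bsub>M\<^esub>} \<and>
     (\<forall>N. submodule N R M \<longrightarrow> N = {\<zero>\<^bsub>M\<^esub>} \<or> N = carrier M)"

text \<open>Modules are given on subsets of a fixed type \<open>'v\<close>, and the lifting property is tested against
  modules on subsets of the same type.  Below \<open>'v\<close> is \<open>nat \<Rightarrow> 'k\<close>, on which every \<open>'k\<close>-vector space
  of finite (even countable) dimension can be realised.  The twisted category algebras of finite
  categories are finite-dimensional, so all their finitely generated modules, in particular all
  simple modules and all free modules of finite rank, occur up to isomorphism; hence isomorphism
  classes and (for finitely generated modules) projectivity have their usual meaning.\<close>

definition projective_lmod :: "('r, 'x) ring_scheme \<Rightarrow> ('r, 'v) module \<Rightarrow> bool" where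
  "projective_lmod R M \<longleftrightarrow> left_module R M \<and>
     (\<forall>(N :: ('r, 'v) module) (N' :: ('r, 'v) module) g h.
        left_module R N \<and> left_module R N' \<and> g \<in> lmod_hom R N N' \<and> g ` carrier N = carrier N' \<and>
        h \<in> lmod_hom R M N' \<longrightarrow> (\<exists>h'\<in>lmod_hom R M N. \<forall>v\<in>carrier M. g (h' v) = h v))"

definition pull_module :: "('s \<Rightarrow> 'r) \<Rightarrow> ('r, 'v) module \<Rightarrow> ('s, 'v) module" where
  "pull_module \<psi> M = \<lparr>carrier = carrier M, monoid.mult = monoid.mult M, one = one M,
     zero = zero M, add = add M, module.smult = \<lambda>a v. \<psi> a \<odot>\<^bsub>M\<^esub> v\<rparr>"

type_synonym ('m, 'k) kmod = "('m \<Rightarrow> 'k, nat \<Rightarrow> 'k) module"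

definition simple_classes :: "('m \<Rightarrow> 'k::field) ring \<Rightarrow> ('m, 'k) kmod set set" where
  "simple_classes A = {M. simple_lmod A M} //
     {(M, N). simple_lmod A M \<and> simple_lmod A N \<and> lmod_iso A M N}"


section \<open>Weights\<close>

type_synonym ('m, 'k) weight_pair = "'m \<times> ('m, 'k) kmod"

definition is_weight :: "('o, 'm) cat \<Rightarrow> ('m \<Rightarrow> 'm \<Rightarrow> 'k::field) \<Rightarrow> ('m, 'k) weight_pair \<Rightarrow> bool" where
  "is_weight D \<alpha> = (\<lambda>(e, T). idem_endo D e \<and>
     simple_lmod (idem_alg D \<alpha> e) T \<and> projective_lmod (idem_alg D \<alpha> e) T)"

definition idem_iso_by :: "('o, 'm) cat \<Rightarrow> 'm \<Rightarrow> 'm \<Rightarrow> 'm \<Rightarrow> 'm \<Rightarrow> bool" where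
  "idem_iso_by D e f s t \<longleftrightarrow>
     s \<in> {f \<cdot>\<^bsub>D\<^esub> x \<cdot>\<^bsub>D\<^esub> e | x. x \<in> Hom D (Dom D e) (Dom D f)} \<and>
     t \<in> {e \<cdot>\<^bsub>D\<^esub> x \<cdot>\<^bsub>D\<^esub> f | x. x \<in> Hom D (Dom D f) (Dom D e)} \<and>
     t \<cdot>\<^bsub>D\<^esub> s = e \<and> s \<cdot>\<^bsub>D\<^esub> t = f"

text \<open>The linear extension of
  \<open>x \<mapsto> \<alpha>(x, t) \<alpha>(s, x \<circ> t) \<alpha>(e, e)\<^sup>-\<^sup>1 \<alpha>(t, s)\<^sup>-\<^sup>1 (s \<circ> x \<circ> t)\<close>.\<close>

definition idem_transfer :: "('o, 'm) cat \<Rightarrow> ('m \<Rightarrow> 'm \<Rightarrow> 'k::field) \<Rightarrow> 'm \<Rightarrow> 'm \<Rightarrow> 'm \<Rightarrow>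
    ('m \<Rightarrow> 'k) \<Rightarrow> 'm \<Rightarrow> 'k" where
  "idem_transfer D \<alpha> e s t a = (\<lambda>y. \<Sum>x | x \<in> carrier (idem_group D e) \<and> s \<cdot>\<^bsub>D\<^esub> (x \<cdot>\<^bsub>D\<^esub> t) = y.
     a x * (\<alpha> x t * \<alpha> s (x \<cdot>\<^bsub>D\<^esub> t) * inverse (\<alpha> e e) * inverse (\<alpha> t s)))"

definition pair_iso :: "('o, 'm) cat \<Rightarrow> ('m \<Rightarrow> 'm \<Rightarrow> 'k::field) \<Rightarrow>
    ('m, 'k) weight_pair \<Rightarrow> ('m, 'k) weight_pair \<Rightarrow> bool" where
  "pair_iso D \<alpha> = (\<lambda>(e, T) (f, T'). \<exists>s t. idem_iso_by D e f s t \<and>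
     lmod_iso (idem_alg D \<alpha> f)
       (pull_module (inv_into (carrier (idem_alg D \<alpha> e)) (idem_transfer D \<alpha> e s t)) T) T')"


section \<open>The Brauer homomorphism\<close>

definition normaliser :: "('g, 'x) monoid_scheme \<Rightarrow> 'g set \<Rightarrow> 'g set" where
  "normaliser G P = {x \<in> carrier G. x <#\<^bsub>G\<^esub> P #>\<^bsub>G\<^esub> m_inv G x = P}"

definition centraliser :: "('g, 'x) monoid_scheme \<Rightarrow> 'g set \<Rightarrow> 'g set" where
  "centraliser G P = {x \<in> carrier G. \<forall>y\<in>P. x \<otimes>\<^bsub>G\<^esub> y = y \<otimes>\<^bsub>G\<^esub> x}"

text \<open>Here \<open>A\<close> is a twisted group algebra of \<open>G\<close>; the inverse is taken in \<open>A\<close>.\<close>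

definition conj_act :: "('g \<Rightarrow> 'k::field) ring \<Rightarrow> 'g \<Rightarrow> ('g \<Rightarrow> 'k) \<Rightarrow> 'g \<Rightarrow> 'k" where
  "conj_act A x a = basis_elt x \<otimes>\<^bsub>A\<^esub> a \<otimes>\<^bsub>A\<^esub> m_inv A (basis_elt x)"

definition fixed_elts :: "('g \<Rightarrow> 'k::field) ring \<Rightarrow> 'g set \<Rightarrow> ('g \<Rightarrow> 'k) set" where
  "fixed_elts A P = {a \<in> carrier A. \<forall>x\<in>P. conj_act A x a = a}"

definition rel_trace :: "'g monoid \<Rightarrow> ('g \<Rightarrow> 'k::field) ring \<Rightarrow> 'g set \<Rightarrow> 'g set \<Rightarrow>
    ('g \<Rightarrow> 'k) \<Rightarrow> 'g \<Rightarrow> 'k" where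
  "rel_trace G A Q P a =
     (\<Oplus>\<^bsub>A\<^esub>c\<in>(\<lambda>x. x <#\<^bsub>G\<^esub> Q) ` P. conj_act A (SOME x. x \<in> c) a)"

definition trace_ideal :: "'g monoid \<Rightarrow> ('g \<Rightarrow> 'k::field) ring \<Rightarrow> 'g set \<Rightarrow> ('g \<Rightarrow> 'k) set" where
  "trace_ideal G A P = {(\<Oplus>\<^bsub>A\<^esub>Q\<in>{Q. subgroup Q G \<and> Q \<subset> P}. rel_trace G A Q P (a Q)) | a.
     \<forall>Q. subgroup Q G \<and> Q \<subset> P \<longrightarrow> a Q \<in> fixed_elts A Q}"

text \<open>The class of \<open>a\<close> in the Brauer quotient, followed by the inverse of the bijection from the span
  of the centraliser of \<open>P\<close> onto the Brauer quotient.\<close>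

definition brauer_map :: "'g monoid \<Rightarrow> ('g \<Rightarrow> 'k::field) ring \<Rightarrow> 'g set \<Rightarrow>
    ('g \<Rightarrow> 'k) \<Rightarrow> 'g \<Rightarrow> 'k" where
  "brauer_map G A P a =
     inv_into (span_of (centraliser G P))
       (\<lambda>c. trace_ideal G A P +>\<^bsub>A\<lparr>carrier := fixed_elts A P\<rparr>\<^esub> c)
       (trace_ideal G A P +>\<^bsub>A\<lparr>carrier := fixed_elts A P\<rparr>\<^esub> a)"


section \<open>Weights belonging to a central idempotent\<close>

text \<open>The surjection from the algebra of the normaliser of \<open>P\<close> onto that of its quotient by \<open>P\<close>, with
  respect to the morphism \<open>u\<close> represented by \<open>Id\<^sub>X\<close>; the element \<open>x P\<close> of the quotient is the
  endomorphism \<open>orbit_class C (x, P, P)\<close> of \<open>(X, P)\<close> in the orbit category.\<close>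

definition quot_map :: "('o, 'm) cat \<Rightarrow> ('m tmor set \<Rightarrow> 'm tmor set \<Rightarrow> 'k::field) \<Rightarrow> 'o \<Rightarrow> 'm set \<Rightarrow>
    ('m \<Rightarrow> 'k) \<Rightarrow> 'm tmor set \<Rightarrow> 'k" where
  "quot_map C \<alpha> X P a =
    (let u = orbit_class C (Ide C X, {Ide C X}, P) in
     (\<lambda>y. \<Sum>x | x \<in> normaliser (idem_group C (Ide C X)) P \<and> orbit_class C (x, P, P) = y.
       a x * (\<alpha> u (orbit_embed C x) * inverse (\<alpha> y u))))"

definition is_b_weight :: "nat \<Rightarrow> ('o, 'm) cat \<Rightarrow> ('m tmor set \<Rightarrow> 'm tmor set \<Rightarrow> 'k::field) \<Rightarrow>
    ('m \<Rightarrow> 'k) \<Rightarrow> ('m tmor set, 'k) weight_pair \<Rightarrow> bool" where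
  "is_b_weight p C \<alpha> b = (\<lambda>(\<epsilon>, T). is_weight (orbit_cat p C) \<alpha> (\<epsilon>, T) \<and>
     (let (X, P) = Dom (orbit_cat p C) \<epsilon>;
          e = Ide C X;
          \<beta> = res_cocycle C \<alpha>;
          c = brauer_map (idem_group C e) (idem_alg C \<beta> e) P (idem_part C \<beta> e b)
      in \<exists>v\<in>carrier T. quot_map C \<alpha> X P c \<odot>\<^bsub>T\<^esub> v \<noteq> \<zero>\<^bsub>T\<^esub>))"

text \<open>For \<open>e = Id\<^sub>X\<close> in an EI-category \<open>C\<close>, the category \<open>orbit_cat p (idem_cat C e)\<close> is literally the
  full subcategory of \<open>orbit_cat p C\<close> on the objects \<open>(X, P)\<close>, so the restriction of a
  cocycle along \<open>P \<mapsto> (X, P)\<close> is the same function \<open>\<alpha>\<close>.\<close>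

definition weight_classes :: "nat \<Rightarrow> ('o, 'm) cat \<Rightarrow> ('m tmor set \<Rightarrow> 'm tmor set \<Rightarrow> 'k::field) \<Rightarrow>
    ('m \<Rightarrow> 'k) \<Rightarrow> ('m tmor set, 'k) weight_pair set set" where
  "weight_classes p C \<alpha> b = {w. is_b_weight p C \<alpha> b w} //
     {(w, w'). is_weight (orbit_cat p C) \<alpha> w \<and> is_weight (orbit_cat p C) \<alpha> w' \<and>
        pair_iso (orbit_cat p C) \<alpha> w w'}"


section \<open>Galois action\<close>

definition gal_stab :: "('m \<Rightarrow> 'k::field) \<Rightarrow> ('k \<Rightarrow> 'k) set" where
  "gal_stab b = {\<sigma> \<in> galois_group. \<sigma> \<circ> b = b}"

definition gal_module :: "('k \<Rightarrow> 'k) \<Rightarrow> ('m, 'k) kmod \<Rightarrow> ('m, 'k) kmod" where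
  "gal_module \<sigma> = pull_module (\<lambda>a. inv_into UNIV \<sigma> \<circ> a)"

definition gal_weight :: "('k \<Rightarrow> 'k) \<Rightarrow> ('m, 'k) weight_pair \<Rightarrow> ('m, 'k) weight_pair" where
  "gal_weight \<sigma> = (\<lambda>(e, T). (e, gal_module \<sigma> T))"

definition equivariant_bij :: "('k \<Rightarrow> 'k) set \<Rightarrow> ('m, 'k) kmod set set \<Rightarrow>
    ('n, 'k) weight_pair set set \<Rightarrow> (('m, 'k) kmod set \<Rightarrow> ('n, 'k) weight_pair set) \<Rightarrow> bool" where
  "equivariant_bij \<Gamma> S W f \<longleftrightarrow> bij_betw f S W \<and>
     (\<forall>\<sigma>\<in>\<Gamma>. \<forall>K\<in>S. f (gal_module \<sigma> ` K) = gal_weight \<sigma> ` f K)"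

end

theory Submission
  imports Defs "HOL-Algebra.QuotRing" "HOL-Library.Countable_Set" "HOL-Library.Disjoint_Sets"
begin

text \<open>
Write \<open>A\<close> for the twisted category algebra of \<open>C\<close>, \<open>R = Ab\<close>, and for an object \<open>X\<close> let
\<open>j\<^sub>X\<close> be the product of the normalised identity of \<open>X\<close> with \<open>b\<close>.  In an EI-category the identities
are the only idempotent endomorphisms, so the idempotent parts of \<open>b\<close> are exactly the \<open>j\<^sub>X\<close>.  As \<open>b\<close>
commutes with all identities, it is supported on endomorphisms, \<open>j\<^sub>X\<close> is its restriction to
\<open>G\<^sub>X = End(X)\<close>, and the block of the algebra of \<open>G\<^sub>X\<close> cut out by \<open>j\<^sub>X\<close> is the corner \<open>j\<^sub>X R j\<^sub>X\<close>.
The theorem holds because both sides decompose over the isomorphism classes of objects, compatibly with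
the Galois action, into the two sides for the groups \<open>G\<^sub>X\<close>; one glues the given bijections.

Simple modules.  For any idempotent \<open>j\<close> of a ring, \<open>S \<mapsto> jS\<close> classifies the simple modules with
\<open>jS \<noteq> 0\<close> by the simple modules of the corner (\<open>corner_class_bij\<close>).  The \<open>j\<^sub>X\<close> add up to the unit \<open>b\<close>
of \<open>R\<close>, so a simple module is nonzero on some of them; isomorphic objects have equivalent idempotents;
and if \<open>X\<close> and \<open>Y\<close> are not isomorphic then there are no morphisms in one of the two directions, whence
\<open>j\<^sub>X R j\<^sub>Y R j\<^sub>X = 0\<close> and no simple module is nonzero on both (\<open>simple_classes_partition\<close>).

Weights.  The orbit category of \<open>G\<^sub>X\<close> is the full subcategory of that of \<open>C\<close> on the objects \<open>(X, P)\<close>, and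
isomorphic objects of the orbit category lie over isomorphic objects of \<open>C\<close>.  Hence the weights of
the orbit category fall into pieces indexed by the isomorphism classes of \<open>C\<close>
(\<open>weight_classes_partition\<close>), provided that the property of being a \<open>b\<close>-weight can be moved along an
isomorphism.  For this the Brauer map is computed: on an element fixed by \<open>P\<close> it is the restriction
of coefficients to the centraliser of \<open>P\<close> (\<open>brauer_map_eq\<close>).  The element which decides whether a
weight at \<open>(X, P)\<close> is a \<open>b\<close>-weight is then characterised by an intertwining relation with the morphism
\<open>u\<close> from \<open>(X, 1)\<close> to \<open>(X, P)\<close>, and its invariance follows from \<open>s b = b s\<close>
(\<open>transfer_brauer_elt\<close>).

All maps involved commute with the action on coefficients of those field automorphisms that fix \<open>b\<close>,
because the cocycle takes values in the prime field.
\<close>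

section \<open>Left modules, pulling back, and corners\<close>

lemma (in left_module) zero_lsmult:
  assumes "v \<in> carrier M" shows "\<zero>\<^bsub>R\<^esub> \<odot>\<^bsub>M\<^esub> v = \<zero>\<^bsub>M\<^esub>"
proof -
  have c: "\<zero>\<^bsub>R\<^esub> \<odot>\<^bsub>M\<^esub> v \<in> carrier M" using assms lsmult_closed by simp
  have "\<zero>\<^bsub>R\<^esub> \<odot>\<^bsub>M\<^esub> v \<oplus>\<^bsub>M\<^esub> \<zero>\<^bsub>R\<^esub> \<odot>\<^bsub>M\<^esub> v = \<zero>\<^bsub>R\<^esub> \<odot>\<^bsub>M\<^esub> v \<oplus>\<^bsub>M\<^esub> \<zero>\<^bsub>M\<^esub>"
    using lsmult_l_distr[of "\<zero>\<^bsub>R\<^esub>" "\<zero>\<^bsub>R\<^esub>" v] assms c by simp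
  then show ?thesis using c by simp
qed

lemma (in left_module) lsmult_zero:
  assumes "a \<in> carrier R" shows "a \<odot>\<^bsub>M\<^esub> \<zero>\<^bsub>M\<^esub> = \<zero>\<^bsub>M\<^esub>"
proof -
  have c: "a \<odot>\<^bsub>M\<^esub> \<zero>\<^bsub>M\<^esub> \<in> carrier M" using assms lsmult_closed by simp
  have "a \<odot>\<^bsub>M\<^esub> \<zero>\<^bsub>M\<^esub> \<oplus>\<^bsub>M\<^esub> a \<odot>\<^bsub>M\<^esub> \<zero>\<^bsub>M\<^esub> = a \<odot>\<^bsub>M\<^esub> \<zero>\<^bsub>M\<^esub> \<oplus>\<^bsub>M\<^esub> \<zero>\<^bsub>M\<^esub>"
    using lsmult_r_distr[of a "\<zero>\<^bsub>M\<^esub>" "\<zero>\<^bsub>M\<^esub>"] assms c by simp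
  then show ?thesis using c by simp
qed

lemma (in left_module) minus_lsmult:
  assumes "a \<in> carrier R" "v \<in> carrier M" shows "(\<ominus>\<^bsub>R\<^esub> a) \<odot>\<^bsub>M\<^esub> v = \<ominus>\<^bsub>M\<^esub> (a \<odot>\<^bsub>M\<^esub> v)"
proof -
  have "(\<ominus>\<^bsub>R\<^esub> a) \<odot>\<^bsub>M\<^esub> v \<oplus>\<^bsub>M\<^esub> a \<odot>\<^bsub>M\<^esub> v = \<zero>\<^bsub>M\<^esub>"
    using assms lsmult_l_distr[of "\<ominus>\<^bsub>R\<^esub> a" a v] zero_lsmult R.l_neg by simp
  then show ?thesis using assms lsmult_closed by (simp add: M.minus_equality)
qed

text \<open>The elements \<open>a v\<close> form a submodule, so a module is simple if and only if every nonzero vector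
  generates it.  All arguments about simple modules below are arguments about generators.\<close>

lemma simple_lmod_iff:
  "simple_lmod R M \<longleftrightarrow> left_module R M \<and> (\<exists>v\<in>carrier M. v \<noteq> \<zero>\<^bsub>M\<^esub>) \<and>
     (\<forall>v\<in>carrier M. v \<noteq> \<zero>\<^bsub>M\<^esub> \<longrightarrow> (\<forall>w\<in>carrier M. \<exists>a\<in>carrier R. w = a \<odot>\<^bsub>M\<^esub> v))"
  (is "?L \<longleftrightarrow> ?R")
proof
  assume s: ?L
  then interpret left_module R M by (simp add: simple_lmod_def)
  have "\<exists>a\<in>carrier R. w = a \<odot>\<^bsub>M\<^esub> v"
    if v: "v \<in> carrier M" "v \<noteq> \<zero>\<^bsub>M\<^esub>" and w: "w \<in> carrier M" for v w
  proof -
    let ?N = "{a \<odot>\<^bsub>M\<^esub> v | a. a \<in> carrier R}"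
    have "submodule ?N R M"
    proof (intro submodule.intro subgroup.intro submodule_axioms.intro)
      show "?N \<subseteq> carrier (add_monoid M)" using v lsmult_closed by auto
      show "x \<otimes>\<^bsub>add_monoid M\<^esub> y \<in> ?N" if xy: "x \<in> ?N" "y \<in> ?N" for x y
      proof -
        obtain a c where ac: "a \<in> carrier R" "c \<in> carrier R" "x = a \<odot>\<^bsub>M\<^esub> v" "y = c \<odot>\<^bsub>M\<^esub> v"
          using xy by auto
        have "x \<oplus>\<^bsub>M\<^esub> y = (a \<oplus>\<^bsub>R\<^esub> c) \<odot>\<^bsub>M\<^esub> v" using ac v lsmult_l_distr by simp
        then show ?thesis using ac by auto
      qed
      show "\<one>\<^bsub>add_monoid M\<^esub> \<in> ?N" using zero_lsmult[OF v(1)] by (simp, metis R.zero_closed)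
      show "inv\<^bsub>add_monoid M\<^esub> x \<in> ?N" if x: "x \<in> ?N" for x
      proof -
        obtain a where a: "a \<in> carrier R" "x = a \<odot>\<^bsub>M\<^esub> v" using x by auto
        then have "\<ominus>\<^bsub>M\<^esub> x = (\<ominus>\<^bsub>R\<^esub> a) \<odot>\<^bsub>M\<^esub> v" using minus_lsmult v by simp
        then show ?thesis unfolding a_inv_def using a R.a_inv_closed by auto
      qed
      show "a \<odot>\<^bsub>M\<^esub> x \<in> ?N" if a: "a \<in> carrier R" and x: "x \<in> ?N" for a x
      proof -
        obtain c where c: "c \<in> carrier R" "x = c \<odot>\<^bsub>M\<^esub> v" using x by auto
        then have "a \<odot>\<^bsub>M\<^esub> x = (a \<otimes>\<^bsub>R\<^esub> c) \<odot>\<^bsub>M\<^esub> v" using a v lsmult_assoc by simp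
        then show ?thesis using a c by auto
      qed
    qed
    moreover have "v \<in> ?N" using lsmult_one[OF v(1)] by (simp, metis R.one_closed)
    ultimately have "?N = carrier M" using s v by (auto simp: simple_lmod_def)
    then show ?thesis using w by auto
  qed
  moreover have "\<exists>v\<in>carrier M. v \<noteq> \<zero>\<^bsub>M\<^esub>" using s M.zero_closed by (auto simp: simple_lmod_def)
  ultimately show ?R using s by (auto simp: simple_lmod_def)
next
  assume r: ?R
  then interpret left_module R M by simp
  have "N = {\<zero>\<^bsub>M\<^esub>} \<or> N = carrier M" if N: "submodule N R M" for N
  proof (cases "N = {\<zero>\<^bsub>M\<^esub>}")
    case False
    interpret N: submodule N R M by (fact N)
    have "\<zero>\<^bsub>M\<^esub> \<in> N" using N.one_closed by simp
    then obtain v where v: "v \<in> N" "v \<noteq> \<zero>\<^bsub>M\<^esub>" using False by blast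
    then have "v \<in> carrier M" using N.subset by auto
    then have "carrier M \<subseteq> N" using r v N.smult_closed by (metis subsetI)
    then show ?thesis using N.subset by auto
  qed simp
  then show ?L using r by (auto simp: simple_lmod_def)
qed

lemma simple_lmodD:
  assumes "simple_lmod R M"
  shows "left_module R M" and "\<exists>v\<in>carrier M. v \<noteq> \<zero>\<^bsub>M\<^esub>"
    and "\<lbrakk>v \<in> carrier M; v \<noteq> \<zero>\<^bsub>M\<^esub>; w \<in> carrier M\<rbrakk> \<Longrightarrow> \<exists>a\<in>carrier R. w = a \<odot>\<^bsub>M\<^esub> v"
  using assms unfolding simple_lmod_iff by blast+

lemma lmod_iso_iff:
  "lmod_iso R M N \<longleftrightarrow> (\<exists>h. bij_betw h (carrier M) (carrier N) \<and>
     (\<forall>v\<in>carrier M. \<forall>w\<in>carrier M. h (v \<oplus>\<^bsub>M\<^esub> w) = h v \<oplus>\<^bsub>N\<^esub> h w) \<and>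
     (\<forall>a\<in>carrier R. \<forall>v\<in>carrier M. h (a \<odot>\<^bsub>M\<^esub> v) = a \<odot>\<^bsub>N\<^esub> h v))"
  unfolding lmod_iso_def lmod_hom_def by (auto dest: bij_betwE)

lemma pull_module_simps [simp]:
  "carrier (pull_module \<psi> M) = carrier M" "add (pull_module \<psi> M) = add M"
  "zero (pull_module \<psi> M) = zero M" "module.smult (pull_module \<psi> M) a v = \<psi> a \<odot>\<^bsub>M\<^esub> v"
  by (simp_all add: pull_module_def)

lemma pull_module_pull_module: "pull_module \<phi> (pull_module \<psi> M) = pull_module (\<lambda>a. \<psi> (\<phi> a)) M"
  by (simp add: pull_module_def)

lemma pull_module_id: "pull_module (\<lambda>a. a) M = M"
  by (simp add: pull_module_def)

lemma abelian_group_cong: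
  fixes M :: "('a, 'c) ring_scheme" and N :: "('a, 'd) ring_scheme"
  assumes "abelian_group M" "carrier N = carrier M" "add N = add M" "zero N = zero M"
  shows "abelian_group N"
proof -
  interpret abelian_group M by fact
  show ?thesis
  proof (rule abelian_groupI, goal_cases)
    case (6 x) then show ?case using assms by (intro bexI[of _ "\<ominus>\<^bsub>M\<^esub> x"]) (auto simp: l_neg)
  qed (auto simp: assms(2-4) a_ac)
qed

lemma left_module_pull:
  assumes "\<psi> \<in> ring_hom S R" "ring S" "left_module R M"
  shows "left_module S (pull_module \<psi> M)"
proof -
  interpret left_module R M by fact
  interpret S: ring S by fact
  note h = ring_hom_closed[OF assms(1)] ring_hom_add[OF assms(1)] ring_hom_mult[OF assms(1)]
    ring_hom_one[OF assms(1)]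
  show ?thesis
  proof (intro left_module.intro left_module_axioms.intro)
    show "ring S" by fact
    show "abelian_group (pull_module \<psi> M)"
      by (rule abelian_group_cong[of M]) (auto intro: M.abelian_group_axioms)
  qed (auto simp: h lsmult_closed lsmult_l_distr lsmult_r_distr lsmult_assoc lsmult_one)
qed

lemma ring_iso_surj:
  assumes "\<psi> \<in> ring_iso S R" "a \<in> carrier R"
  obtains c where "c \<in> carrier S" "a = \<psi> c"
  using assms by (auto simp: ring_iso_def bij_betw_def)

lemma simple_lmod_pull:
  assumes "\<psi> \<in> ring_iso S R" "ring S" "simple_lmod R M"
  shows "simple_lmod S (pull_module \<psi> M)"
  unfolding simple_lmod_iff
proof (intro conjI ballI impI)
  show "left_module S (pull_module \<psi> M)"
    using assms left_module_pull[of \<psi> S R M] by (auto simp: ring_iso_def simple_lmod_def)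
  show "\<exists>v\<in>carrier (pull_module \<psi> M). v \<noteq> \<zero>\<^bsub>pull_module \<psi> M\<^esub>"
    using simple_lmodD(2)[OF assms(3)] by simp
  fix v w
  assume "v \<in> carrier (pull_module \<psi> M)" "v \<noteq> \<zero>\<^bsub>pull_module \<psi> M\<^esub>" "w \<in> carrier (pull_module \<psi> M)"
  then obtain a where a: "a \<in> carrier R" "w = a \<odot>\<^bsub>M\<^esub> v"
    using simple_lmodD(3)[OF assms(3), of v w] by auto
  then obtain c where "c \<in> carrier S" "a = \<psi> c" using ring_iso_surj[OF assms(1)] by blast
  then show "\<exists>c\<in>carrier S. w = c \<odot>\<^bsub>pull_module \<psi> M\<^esub> v" using a by auto
qed

text \<open>The modules on which the lifting property is tested are moved to the other ring along the
  inverse isomorphism; a linear map stays the same function.\<close>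

lemma projective_lmod_pull:
  fixes M :: "('r, 'v) module" and S :: "'s ring" and R :: "'r ring"
  assumes iso: "\<psi> \<in> ring_iso S R" and S: "ring S" and R: "ring R" and M: "projective_lmod R M"
  shows "projective_lmod S (pull_module \<psi> M)"
  unfolding projective_lmod_def
proof (intro conjI allI impI)
  show "left_module S (pull_module \<psi> M)"
    using iso S M left_module_pull[of \<psi> S R M] by (auto simp: ring_iso_def projective_lmod_def)
  define \<chi> where "\<chi> = inv_into (carrier S) \<psi>"
  have \<chi>: "\<chi> \<in> ring_iso R S" unfolding \<chi>_def using ring_iso_set_sym[OF S iso] .
  have \<chi>h: "\<chi> \<in> ring_hom R S" using \<chi> by (simp add: ring_iso_def)
  have bij: "bij_betw \<psi> (carrier S) (carrier R)" using iso by (simp add: ring_iso_def)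
  have \<chi>\<psi>: "\<chi> (\<psi> a) = a" if "a \<in> carrier S" for a
    using bij that by (simp add: \<chi>_def bij_betw_def)
  have \<psi>c: "\<psi> a \<in> carrier R" if "a \<in> carrier S" for a using bij that by (auto dest: bij_betwE)
  have \<chi>c: "\<chi> a \<in> carrier S" if "a \<in> carrier R" for a using \<chi>h that by (auto dest: ring_hom_closed)
  have \<psi>\<chi>: "\<psi> (\<chi> a) = a" if "a \<in> carrier R" for a
    using bij that by (simp add: \<chi>_def bij_betw_inv_into_right)
  fix N N' :: "('s, 'v) module" and g h
  assume a: "left_module S N \<and> left_module S N' \<and> g \<in> lmod_hom S N N' \<and> g ` carrier N = carrier N' \<and>
    h \<in> lmod_hom S (pull_module \<psi> M) N'"
  let ?N = "pull_module \<chi> N" and ?N' = "pull_module \<chi> N'"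
  have g: "g \<in> lmod_hom R ?N ?N'" using a \<chi>c by (auto simp: lmod_hom_def)
  have h: "h \<in> lmod_hom R M ?N'"
  proof -
    have "h (c \<odot>\<^bsub>M\<^esub> v) = \<chi> c \<odot>\<^bsub>N'\<^esub> h v" if "c \<in> carrier R" "v \<in> carrier M" for c v
    proof -
      have "h (\<psi> (\<chi> c) \<odot>\<^bsub>M\<^esub> v) = \<chi> c \<odot>\<^bsub>N'\<^esub> h v"
        using a \<chi>c[OF that(1)] that(2) by (auto simp: lmod_hom_def)
      then show ?thesis by (simp add: \<psi>\<chi>[OF that(1)])
    qed
    then show ?thesis using a by (auto simp: lmod_hom_def)
  qed
  have "\<exists>h'\<in>lmod_hom R M ?N. \<forall>v\<in>carrier M. g (h' v) = h v"
  proof -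
    have "left_module R ?N" "left_module R ?N'" using left_module_pull[OF \<chi>h R] a by blast+
    moreover have "g ` carrier ?N = carrier ?N'" using a by simp
    ultimately show ?thesis using M g h unfolding projective_lmod_def by blast
  qed
  then obtain h' where h': "h' \<in> lmod_hom R M ?N" "\<forall>v\<in>carrier M. g (h' v) = h v" by blast
  have "h' \<in> lmod_hom S (pull_module \<psi> M) N"
  proof -
    have "h' (\<psi> c \<odot>\<^bsub>M\<^esub> v) = c \<odot>\<^bsub>N\<^esub> h' v" if "c \<in> carrier S" "v \<in> carrier M" for c v
      using h'(1) \<psi>c[OF that(1)] that \<chi>\<psi>[OF that(1)] by (auto simp: lmod_hom_def)
    then show ?thesis using h'(1) by (auto simp: lmod_hom_def)
  qed
  then show "\<exists>h'\<in>lmod_hom S (pull_module \<psi> M) N. \<forall>v\<in>carrier (pull_module \<psi> M). g (h' v) = h v"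
    using h'(2) by auto
qed

lemma lmod_iso_refl: "lmod_iso R M M"
  unfolding lmod_iso_iff by (rule exI[of _ "\<lambda>v. v"]) (auto simp: bij_betw_def)

lemma lmod_iso_sym:
  assumes "lmod_iso R M N" "left_module R M"
  shows "lmod_iso R N M"
proof -
  interpret left_module R M by fact
  obtain h where h: "bij_betw h (carrier M) (carrier N)"
     "\<And>v w. v\<in>carrier M \<Longrightarrow> w\<in>carrier M \<Longrightarrow> h (v \<oplus>\<^bsub>M\<^esub> w) = h v \<oplus>\<^bsub>N\<^esub> h w"
     "\<And>a v. a\<in>carrier R \<Longrightarrow> v\<in>carrier M \<Longrightarrow> h (a \<odot>\<^bsub>M\<^esub> v) = a \<odot>\<^bsub>N\<^esub> h v"
    using assms(1) by (auto simp: lmod_iso_iff)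
  let ?g = "inv_into (carrier M) h"
  have b: "bij_betw ?g (carrier N) (carrier M)" using h(1) by (rule bij_betw_inv_into)
  have g: "?g v \<in> carrier M" "h (?g v) = v" if "v \<in> carrier N" for v
    using that b h(1) by (auto dest: bij_betwE simp: bij_betw_inv_into_right)
  have gh: "?g (h v) = v" if "v \<in> carrier M" for v using h(1) that by (simp add: bij_betw_inv_into_left)
  show ?thesis unfolding lmod_iso_iff
  proof (intro exI[of _ ?g] conjI ballI)
    fix v w assume "v \<in> carrier N" "w \<in> carrier N"
    then show "?g (v \<oplus>\<^bsub>N\<^esub> w) = ?g v \<oplus>\<^bsub>M\<^esub> ?g w"
      using h(2)[of "?g v" "?g w"] g gh[of "?g v \<oplus>\<^bsub>M\<^esub> ?g w"] by simp
  next
    fix a v assume "a \<in> carrier R" "v \<in> carrier N"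
    then show "?g (a \<odot>\<^bsub>N\<^esub> v) = a \<odot>\<^bsub>M\<^esub> ?g v"
      using h(3)[of a "?g v"] g gh[of "a \<odot>\<^bsub>M\<^esub> ?g v"] lsmult_closed by simp
  qed (rule b)
qed

lemma lmod_iso_trans:
  assumes "lmod_iso R M N" "lmod_iso R N L"
  shows "lmod_iso R M L"
proof -
  obtain h where h: "bij_betw h (carrier M) (carrier N)"
     "\<forall>v\<in>carrier M. \<forall>w\<in>carrier M. h (v \<oplus>\<^bsub>M\<^esub> w) = h v \<oplus>\<^bsub>N\<^esub> h w"
     "\<forall>a\<in>carrier R. \<forall>v\<in>carrier M. h (a \<odot>\<^bsub>M\<^esub> v) = a \<odot>\<^bsub>N\<^esub> h v"
    using assms(1) by (auto simp: lmod_iso_iff)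
  obtain g where g: "bij_betw g (carrier N) (carrier L)"
     "\<forall>v\<in>carrier N. \<forall>w\<in>carrier N. g (v \<oplus>\<^bsub>N\<^esub> w) = g v \<oplus>\<^bsub>L\<^esub> g w"
     "\<forall>a\<in>carrier R. \<forall>v\<in>carrier N. g (a \<odot>\<^bsub>N\<^esub> v) = a \<odot>\<^bsub>L\<^esub> g v"
    using assms(2) by (auto simp: lmod_iso_iff)
  have "\<And>v. v \<in> carrier M \<Longrightarrow> h v \<in> carrier N" using h(1) by (auto dest: bij_betwE)
  then show ?thesis unfolding lmod_iso_iff
    by (intro exI[of _ "g \<circ> h"]) (use h g in \<open>auto intro: bij_betw_trans\<close>)
qed

lemma lmod_iso_pull:
  assumes "lmod_iso R M N" "\<psi> \<in> carrier S \<rightarrow> carrier R"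
  shows "lmod_iso S (pull_module \<psi> M) (pull_module \<psi> N)"
  using assms unfolding lmod_iso_iff by (auto simp: Pi_iff)

text \<open>For simple \<open>M\<close> this is the element of \<open>simple_classes R\<close> that contains \<open>M\<close>.\<close>

definition iso_class :: "('r, 'x) ring_scheme \<Rightarrow> ('r, 'v) module \<Rightarrow> ('r, 'v) module set" where
  "iso_class R M = {N. simple_lmod R N \<and> lmod_iso R M N}"

lemma simple_classes_iso_class: "simple_classes A = iso_class A ` {M. simple_lmod A M}"
  by (auto simp: simple_classes_def quotient_def iso_class_def)

lemma iso_class_eq_iff:
  assumes "simple_lmod A M" "simple_lmod A N"
  shows "iso_class A M = iso_class A N \<longleftrightarrow> lmod_iso A M N"
  unfolding iso_class_def set_eq_iff
  using assms lmod_iso_refl lmod_iso_trans lmod_iso_sym simple_lmodD(1) by (smt (verit) mem_Collect_eq)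

subsection \<open>Corners\<close>

definition corner_ring :: "'r ring \<Rightarrow> 'r \<Rightarrow> 'r ring" where
  "corner_ring R j = R\<lparr>carrier := (\<lambda>a. j \<otimes>\<^bsub>R\<^esub> a \<otimes>\<^bsub>R\<^esub> j) ` carrier R, one := j\<rparr>"

definition corner_module :: "'r \<Rightarrow> ('r, 'v) module \<Rightarrow> ('r, 'v) module" where
  "corner_module j M = M\<lparr>carrier := (\<lambda>v. j \<odot>\<^bsub>M\<^esub> v) ` carrier M\<rparr>"

lemma corner_simps [simp]:
  "carrier (corner_ring R j) = (\<lambda>a. j \<otimes>\<^bsub>R\<^esub> a \<otimes>\<^bsub>R\<^esub> j) ` carrier R"
  "one (corner_ring R j) = j" "monoid.mult (corner_ring R j) = monoid.mult R" "add (corner_ring R j) = add R"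
  "zero (corner_ring R j) = zero R"
  "carrier (corner_module j M) = (\<lambda>v. j \<odot>\<^bsub>M\<^esub> v) ` carrier M"
  "zero (corner_module j M) = zero M" "add (corner_module j M) = add M"
  "module.smult (corner_module j M) = module.smult M"
  by (simp_all add: corner_ring_def corner_module_def)

locale corner = ring R for R :: "'r ring" (structure) +
  fixes j
  assumes j_closed: "j \<in> carrier R" and j_idem: "j \<otimes> j = j"
begin

lemma corner_carrier_iff: "a \<in> carrier (corner_ring R j) \<longleftrightarrow> a \<in> carrier R \<and> j \<otimes> a = a \<and> a \<otimes> j = a"
proof
  assume "a \<in> carrier (corner_ring R j)"
  then obtain c where c: "c \<in> carrier R" "a = j \<otimes> c \<otimes> j" by auto
  have "j \<otimes> (j \<otimes> c \<otimes> j) = (j \<otimes> j) \<otimes> c \<otimes> j" "j \<otimes> c \<otimes> j \<otimes> j = j \<otimes> c \<otimes> (j \<otimes> j)"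
    using c j_closed by (simp_all only: m_assoc m_closed)
  then show "a \<in> carrier R \<and> j \<otimes> a = a \<and> a \<otimes> j = a" using c j_closed j_idem by simp
next
  assume "a \<in> carrier R \<and> j \<otimes> a = a \<and> a \<otimes> j = a"
  then show "a \<in> carrier (corner_ring R j)" by (auto intro!: image_eqI[of _ _ a])
qed

lemma corner_cong: "\<lbrakk>a \<in> carrier R; c \<in> carrier R\<rbrakk> \<Longrightarrow> j \<otimes> (j \<otimes> a) = j \<otimes> a \<and> a \<otimes> j \<otimes> j = a \<otimes> j"
  using j_closed j_idem by (metis m_assoc)

lemma corner_is_ring: "ring (corner_ring R j)"
proof (rule ringI)
  note iff = corner_carrier_iff[simplified]
  show "abelian_group (corner_ring R j)"
  proof (rule abelian_groupI, goal_cases)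
    case (1 x y) then show ?case using j_closed by (simp add: iff l_distr r_distr)
  next case 2 then show ?case using j_closed by (simp add: iff)
  next case (6 x) 
    then show ?case using j_closed by (intro bexI[of _ "\<ominus> x"]) (auto simp: iff l_neg r_minus l_minus)
  qed (auto simp: iff a_ac)
  show "Group.monoid (corner_ring R j)"
  proof (rule monoidI, goal_cases)
    case (1 x y)
    then show ?case unfolding corner_simps(1,3) iff using j_closed by (metis m_assoc m_closed)
  next case (3 x y z) then show ?case by (simp add: iff m_assoc)
  qed (auto simp: iff j_closed j_idem)
qed (auto simp: corner_carrier_iff[simplified] l_distr r_distr)

end

locale corner_mod = corner R j + left_module R M for R :: "'r ring" (structure) and j and M :: "('r, 'v) module"
begin

lemma corner_module_iff: "v \<in> carrier (corner_module j M) \<longleftrightarrow> v \<in> carrier M \<and> j \<odot>\<^bsub>M\<^esub> v = v"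
proof
  assume "v \<in> carrier (corner_module j M)"
  then obtain w where w: "w \<in> carrier M" "v = j \<odot>\<^bsub>M\<^esub> w" by auto
  then have "j \<odot>\<^bsub>M\<^esub> v = (j \<otimes> j) \<odot>\<^bsub>M\<^esub> w" by (simp add: lsmult_assoc j_closed)
  then show "v \<in> carrier M \<and> j \<odot>\<^bsub>M\<^esub> v = v" using w by (simp add: j_idem lsmult_closed j_closed)
next
  assume "v \<in> carrier M \<and> j \<odot>\<^bsub>M\<^esub> v = v"
  then show "v \<in> carrier (corner_module j M)" by (auto intro!: image_eqI[of _ _ v])
qed

lemma corner_module_left_module: "left_module (corner_ring R j) (corner_module j M)"
proof (intro left_module.intro left_module_axioms.intro)
  note iff = corner_module_iff[simplified] corner_carrier_iff[simplified]
  show "ring (corner_ring R j)" by (rule corner_is_ring)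
  show "abelian_group (corner_module j M)"
  proof (rule abelian_groupI, goal_cases)
    case (1 x y) then show ?case using j_closed by (simp add: iff lsmult_r_distr)
  next case 2 then show ?case using j_closed by (simp add: iff lsmult_zero)
  next case (6 x)
    have "j \<odot>\<^bsub>M\<^esub> (\<ominus>\<^bsub>M\<^esub> x) \<oplus>\<^bsub>M\<^esub> j \<odot>\<^bsub>M\<^esub> x = \<zero>\<^bsub>M\<^esub>"
      using 6 j_closed lsmult_r_distr[of j "\<ominus>\<^bsub>M\<^esub> x" x] by (simp add: iff M.l_neg lsmult_zero)
    then have "j \<odot>\<^bsub>M\<^esub> (\<ominus>\<^bsub>M\<^esub> x) = \<ominus>\<^bsub>M\<^esub> x" using 6 j_closed
      by (metis M.minus_equality corner_module_iff lsmult_closed M.add.inv_closed)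
    then show ?case using 6 by (intro bexI[of _ "\<ominus>\<^bsub>M\<^esub> x"]) (auto simp: iff M.l_neg)
  qed (auto simp: iff M.a_ac)
qed (auto simp: corner_module_iff[simplified] corner_carrier_iff[simplified] lsmult_closed
      lsmult_l_distr lsmult_r_distr lsmult_assoc simp flip: lsmult_assoc[OF j_closed])

end

lemma (in abelian_group) add_minus_eq_zero_iff:
  assumes "x \<in> carrier G" "y \<in> carrier G" shows "x \<oplus> \<ominus> y = \<zero> \<longleftrightarrow> x = y"
  using assms minus_equality[of x "\<ominus> y"] r_neg by auto

lemma (in corner_mod) corner_module_simple:
  assumes M: "simple_lmod R M" and ne: "u \<in> carrier M" "j \<odot>\<^bsub>M\<^esub> u \<noteq> \<zero>\<^bsub>M\<^esub>"
  shows "simple_lmod (corner_ring R j) (corner_module j M)"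
  unfolding simple_lmod_iff
proof (intro conjI ballI impI)
  show "left_module (corner_ring R j) (corner_module j M)" by (rule corner_module_left_module)
  show "\<exists>v\<in>carrier (corner_module j M). v \<noteq> \<zero>\<^bsub>corner_module j M\<^esub>" using ne by auto
  fix v w
  assume v: "v \<in> carrier (corner_module j M)" "v \<noteq> \<zero>\<^bsub>corner_module j M\<^esub>"
    and w: "w \<in> carrier (corner_module j M)"
  obtain a where a: "a \<in> carrier R" "w = a \<odot>\<^bsub>M\<^esub> v"
    using simple_lmodD(3)[OF M] v w by (auto simp: corner_module_iff[simplified])
  have "w = (j \<otimes> a \<otimes> j) \<odot>\<^bsub>M\<^esub> v"
    using v(1) w a unfolding corner_module_iff by (simp add: lsmult_assoc j_closed lsmult_closed)
  then show "\<exists>a\<in>carrier (corner_ring R j). w = a \<odot>\<^bsub>corner_module j M\<^esub> v" using a(1) by auto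
qed

lemma corner_module_lmod_iso:
  assumes "lmod_iso R M N" "j \<in> carrier R" "left_module R M"
    and sub: "carrier (corner_ring R j) \<subseteq> carrier R"
  shows "lmod_iso (corner_ring R j) (corner_module j M) (corner_module j N)"
proof -
  interpret left_module R M by fact
  obtain h where h: "bij_betw h (carrier M) (carrier N)"
     "\<And>v w. v\<in>carrier M \<Longrightarrow> w\<in>carrier M \<Longrightarrow> h (v \<oplus>\<^bsub>M\<^esub> w) = h v \<oplus>\<^bsub>N\<^esub> h w"
     "\<And>a v. a\<in>carrier R \<Longrightarrow> v\<in>carrier M \<Longrightarrow> h (a \<odot>\<^bsub>M\<^esub> v) = a \<odot>\<^bsub>N\<^esub> h v"
    using assms(1) unfolding lmod_iso_iff by auto
  have s: "(\<lambda>v. j \<odot>\<^bsub>M\<^esub> v) ` carrier M \<subseteq> carrier M" using assms(2) lsmult_closed by auto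
  have "h ` (\<lambda>v. j \<odot>\<^bsub>M\<^esub> v) ` carrier M = (\<lambda>v. j \<odot>\<^bsub>N\<^esub> v) ` h ` carrier M"
    unfolding image_image using assms(2) h(3) by (auto intro!: image_cong)
  then have "bij_betw h (carrier (corner_module j M)) (carrier (corner_module j N))"
    using h(1) s by (auto simp: bij_betw_def intro: inj_on_subset)
  then show ?thesis unfolding lmod_iso_iff
    by (rule_tac exI[of _ h]) (use h(2,3) s sub in \<open>auto simp: subset_iff\<close>)
qed

text \<open>If \<open>a v = 0\<close> but \<open>a w \<noteq> 0\<close>, then \<open>w = c a w\<close> for some \<open>c\<close>, so \<open>j c a j\<close> kills \<open>v\<close> and fixes
  \<open>w = h v\<close>.\<close>

lemma annihilator_le_of_corner_hom:
  assumes M: "left_module R M" and N: "simple_lmod R N" and j: "corner R j"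
    and h: "\<And>a v. \<lbrakk>a \<in> carrier (corner_ring R j); v \<in> carrier (corner_module j M)\<rbrakk> \<Longrightarrow>
      h (a \<odot>\<^bsub>M\<^esub> v) = a \<odot>\<^bsub>N\<^esub> h v"
    and v: "v \<in> carrier (corner_module j M)" and w: "h v = w" "w \<in> carrier (corner_module j N)"
    and a: "a \<in> carrier R" "a \<odot>\<^bsub>M\<^esub> v = \<zero>\<^bsub>M\<^esub>"
  shows "a \<odot>\<^bsub>N\<^esub> w = \<zero>\<^bsub>N\<^esub>"
proof (rule ccontr)
  interpret j: corner R j by (fact j)
  interpret M: corner_mod R j M by (intro corner_mod.intro M j)
  interpret N: corner_mod R j N by (intro corner_mod.intro j simple_lmodD(1)[OF N])
  have v': "v \<in> carrier M" "j \<odot>\<^bsub>M\<^esub> v = v" and w': "w \<in> carrier N" "j \<odot>\<^bsub>N\<^esub> w = w"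
    using v w by (auto simp: M.corner_module_iff[simplified] N.corner_module_iff[simplified])
  assume n: "a \<odot>\<^bsub>N\<^esub> w \<noteq> \<zero>\<^bsub>N\<^esub>"
  then obtain c where c: "c \<in> carrier R" "w = c \<odot>\<^bsub>N\<^esub> (a \<odot>\<^bsub>N\<^esub> w)"
    using simple_lmodD(3)[OF N] w' a N.lsmult_closed by blast
  let ?x = "j \<otimes>\<^bsub>R\<^esub> (c \<otimes>\<^bsub>R\<^esub> a) \<otimes>\<^bsub>R\<^esub> j"
  have x: "?x \<in> carrier (corner_ring R j)" using a c by simp
  have "?x \<odot>\<^bsub>M\<^esub> v = \<zero>\<^bsub>M\<^esub>"
    using a c v' by (simp add: M.lsmult_assoc M.lsmult_closed j.j_closed M.lsmult_zero)
  moreover have "?x \<odot>\<^bsub>N\<^esub> w = w"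
    using a(1) c w' by (simp add: N.lsmult_assoc N.lsmult_closed j.j_closed)
  moreover have "h \<zero>\<^bsub>M\<^esub> = \<zero>\<^bsub>N\<^esub>"
  proof -
    have "\<zero>\<^bsub>R\<^esub> \<in> carrier (corner_ring R j)" using j.j_closed by (simp add: j.corner_carrier_iff[simplified])
    from h[OF this v] show ?thesis using v' w w' by (simp add: M.zero_lsmult N.zero_lsmult)
  qed
  ultimately have "w = \<zero>\<^bsub>N\<^esub>" using h[OF x v] w by simp
  then show False using n a N.lsmult_zero by simp
qed

text \<open>A nonzero \<open>v\<close> in \<open>jM\<close> and its image \<open>w\<close> in \<open>jN\<close> have the same annihilator in \<open>R\<close>, so
  \<open>a v \<mapsto> a w\<close> is a well-defined isomorphism of \<open>R v\<close> with \<open>R w\<close>; by simplicity these are \<open>M\<close> and \<open>N\<close>.\<close>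

lemma simple_lmod_iso_of_corner_iso:
  assumes M: "simple_lmod R M" and N: "simple_lmod R N" and j: "corner R j"
    and ne: "u \<in> carrier M" "j \<odot>\<^bsub>M\<^esub> u \<noteq> \<zero>\<^bsub>M\<^esub>"
    and iso: "lmod_iso (corner_ring R j) (corner_module j M) (corner_module j N)"
  shows "lmod_iso R M N"
proof -
  interpret j: corner R j by (fact j)
  interpret M: corner_mod R j M by (intro corner_mod.intro j simple_lmodD(1)[OF M])
  interpret N: corner_mod R j N by (intro corner_mod.intro j simple_lmodD(1)[OF N])
  obtain h where h: "bij_betw h (carrier (corner_module j M)) (carrier (corner_module j N))"
     "\<And>a v. a\<in>carrier (corner_ring R j) \<Longrightarrow> v\<in>carrier (corner_module j M) \<Longrightarrow> h (a \<odot>\<^bsub>M\<^esub> v) = a \<odot>\<^bsub>N\<^esub> h v"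
    using iso unfolding lmod_iso_iff corner_simps(7-9) by (elim exE conjE) (rule that, assumption, simp only: Ball_def)
  obtain g where g: "bij_betw g (carrier (corner_module j N)) (carrier (corner_module j M))"
     "\<And>a v. a\<in>carrier (corner_ring R j) \<Longrightarrow> v\<in>carrier (corner_module j N) \<Longrightarrow> g (a \<odot>\<^bsub>N\<^esub> v) = a \<odot>\<^bsub>M\<^esub> g v"
     and gh: "\<And>v. v \<in> carrier (corner_module j M) \<Longrightarrow> g (h v) = v"
  proof -
    let ?g = "inv_into (carrier (corner_module j M)) h"
    have b: "bij_betw ?g (carrier (corner_module j N)) (carrier (corner_module j M))"
      using h(1) by (rule bij_betw_inv_into)
    have gh: "\<And>v. v \<in> carrier (corner_module j M) \<Longrightarrow> ?g (h v) = v"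
      using h(1) by (simp add: bij_betw_inv_into_left)
    have "?g (a \<odot>\<^bsub>N\<^esub> v) = a \<odot>\<^bsub>M\<^esub> ?g v"
      if "a\<in>carrier (corner_ring R j)" "v\<in>carrier (corner_module j N)" for a v
    proof -
      have v: "?g v \<in> carrier (corner_module j M)" "h (?g v) = v"
        using b that h(1) by (auto dest: bij_betwE simp: bij_betw_inv_into_right)
      have "a \<odot>\<^bsub>M\<^esub> ?g v \<in> carrier (corner_module j M)"
        using left_module.lsmult_closed[OF M.corner_module_left_module that(1) v(1)] by simp
      then show ?thesis using gh[of "a \<odot>\<^bsub>M\<^esub> ?g v"] h(2)[OF that(1) v(1)] v(2) by simp
    qed
    then show ?thesis using that b gh by blast
  qed
  define v where "v = j \<odot>\<^bsub>M\<^esub> u"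
  define w where "w = h v"
  have v: "v \<in> carrier (corner_module j M)" unfolding v_def using ne by simp
  then have w: "w \<in> carrier (corner_module j N)" unfolding w_def using h(1) by (auto dest: bij_betwE)
  have gw: "g w = v" using gh v by (simp add: w_def)
  have vM: "v \<in> carrier M" and wN: "w \<in> carrier N"
    using v w by (simp_all add: M.corner_module_iff[simplified] N.corner_module_iff[simplified])
  have ann: "a \<odot>\<^bsub>M\<^esub> v = \<zero>\<^bsub>M\<^esub> \<longleftrightarrow> a \<odot>\<^bsub>N\<^esub> w = \<zero>\<^bsub>N\<^esub>" if a: "a \<in> carrier R" for a
    using annihilator_le_of_corner_hom[OF simple_lmodD(1)[OF M] N j h(2) v refl w[unfolded w_def] a]
      annihilator_le_of_corner_hom[OF simple_lmodD(1)[OF N] M j g(2) w gw v a] w_def by auto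
  have eq: "a \<odot>\<^bsub>M\<^esub> v = c \<odot>\<^bsub>M\<^esub> v \<longleftrightarrow> a \<odot>\<^bsub>N\<^esub> w = c \<odot>\<^bsub>N\<^esub> w" if ac: "a \<in> carrier R" "c \<in> carrier R" for a c
  proof -
    have "a \<odot>\<^bsub>M\<^esub> v = c \<odot>\<^bsub>M\<^esub> v \<longleftrightarrow> (a \<oplus>\<^bsub>R\<^esub> \<ominus>\<^bsub>R\<^esub> c) \<odot>\<^bsub>M\<^esub> v = \<zero>\<^bsub>M\<^esub>"
      using ac vM by (simp add: M.lsmult_l_distr M.minus_lsmult M.lsmult_closed M.add_minus_eq_zero_iff)
    moreover have "a \<odot>\<^bsub>N\<^esub> w = c \<odot>\<^bsub>N\<^esub> w \<longleftrightarrow> (a \<oplus>\<^bsub>R\<^esub> \<ominus>\<^bsub>R\<^esub> c) \<odot>\<^bsub>N\<^esub> w = \<zero>\<^bsub>N\<^esub>"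
      using ac wN by (simp add: N.lsmult_l_distr N.minus_lsmult N.lsmult_closed N.add_minus_eq_zero_iff)
    ultimately show ?thesis using ann[of "a \<oplus>\<^bsub>R\<^esub> \<ominus>\<^bsub>R\<^esub> c"] ac by simp
  qed
  have vn: "v \<noteq> \<zero>\<^bsub>M\<^esub>" using ne by (simp add: v_def)
  have wn: "w \<noteq> \<zero>\<^bsub>N\<^esub>" using ann[of "\<one>\<^bsub>R\<^esub>"] vn vM wN by (simp add: M.lsmult_one N.lsmult_one)
  define k where "k x = (SOME a. a \<in> carrier R \<and> x = a \<odot>\<^bsub>M\<^esub> v) \<odot>\<^bsub>N\<^esub> w" for x
  have k: "k (a \<odot>\<^bsub>M\<^esub> v) = a \<odot>\<^bsub>N\<^esub> w" if "a \<in> carrier R" for a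
  proof -
    have "\<exists>c. c \<in> carrier R \<and> a \<odot>\<^bsub>M\<^esub> v = c \<odot>\<^bsub>M\<^esub> v" using that by auto
    from someI_ex[OF this] show ?thesis unfolding k_def using eq that by metis
  qed
  have gen: "\<exists>a\<in>carrier R. x = a \<odot>\<^bsub>M\<^esub> v" if "x \<in> carrier M" for x
    using simple_lmodD(3)[OF M vM vn that] .
  show ?thesis unfolding lmod_iso_iff
  proof (intro exI[of _ k] conjI ballI)
    show "bij_betw k (carrier M) (carrier N)"
    proof (rule bij_betw_imageI)
      show "inj_on k (carrier M)" 
      proof (rule inj_onI)
        fix x y assume "x \<in> carrier M" "y \<in> carrier M" and e: "k x = k y"
        then obtain a c where "a \<in> carrier R" "x = a \<odot>\<^bsub>M\<^esub> v" "c \<in> carrier R" "y = c \<odot>\<^bsub>M\<^esub> v"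
          using gen by blast
        then show "x = y" using e k eq by simp
      qed
      show "k ` carrier M = carrier N"
      proof
        show "k ` carrier M \<subseteq> carrier N" 
        proof
          fix y assume "y \<in> k ` carrier M"
          then obtain a where "a \<in> carrier R" "y = k (a \<odot>\<^bsub>M\<^esub> v)" using gen by blast
          then show "y \<in> carrier N" using k N.lsmult_closed wN by simp
        qed
        show "carrier N \<subseteq> k ` carrier M"
        proof
          fix y assume "y \<in> carrier N"
          then obtain a where "a \<in> carrier R" "y = a \<odot>\<^bsub>N\<^esub> w" using simple_lmodD(3)[OF N wN wn] by blast
          then have "y = k (a \<odot>\<^bsub>M\<^esub> v)" "a \<odot>\<^bsub>M\<^esub> v \<in> carrier M" using k M.lsmult_closed vM by simp_all
          then show "y \<in> k ` carrier M" by blast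
        qed
      qed
    qed
  next
    fix x y assume "x \<in> carrier M" "y \<in> carrier M"
    then obtain a c where "a \<in> carrier R" "x = a \<odot>\<^bsub>M\<^esub> v" "c \<in> carrier R" "y = c \<odot>\<^bsub>M\<^esub> v" using gen by blast
    then show "k (x \<oplus>\<^bsub>M\<^esub> y) = k x \<oplus>\<^bsub>N\<^esub> k y"
      using k[of "a \<oplus>\<^bsub>R\<^esub> c"] k vM wN by (simp add: M.lsmult_l_distr N.lsmult_l_distr)
  next
    fix r x assume "r \<in> carrier R" "x \<in> carrier M"
    then obtain a where "a \<in> carrier R" "x = a \<odot>\<^bsub>M\<^esub> v" "r \<in> carrier R" using gen by blast
    then show "k (r \<odot>\<^bsub>M\<^esub> x) = r \<odot>\<^bsub>N\<^esub> k x"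
      using k[of "r \<otimes>\<^bsub>R\<^esub> a"] k vM wN by (simp add: M.lsmult_assoc N.lsmult_assoc)
  qed
qed

text \<open>A cyclic module presented by a labelling \<open>q\<close> of the elements of \<open>R\<close> that is compatible with
  addition and left multiplication.\<close>

definition cyclic_module :: "'r ring \<Rightarrow> ('r \<Rightarrow> 'v) \<Rightarrow> ('r, 'v) module" where
  "cyclic_module R q = (let rep = inv_into (carrier R) q in
     \<lparr>carrier = q ` carrier R, monoid.mult = undefined, one = undefined, zero = q \<zero>\<^bsub>R\<^esub>,
      add = \<lambda>x y. q (rep x \<oplus>\<^bsub>R\<^esub> rep y), module.smult = \<lambda>a x. q (a \<otimes>\<^bsub>R\<^esub> rep x)\<rparr>)"

locale cyclic_presentation = ring R for R :: "'r ring" (structure) +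
  fixes q :: "'r \<Rightarrow> 'v"
  assumes qadd: "\<lbrakk>a \<in> carrier R; a' \<in> carrier R; c \<in> carrier R; c' \<in> carrier R; q a = q a'; q c = q c'\<rbrakk>
      \<Longrightarrow> q (a \<oplus> c) = q (a' \<oplus> c')"
    and qmul: "\<lbrakk>r \<in> carrier R; a \<in> carrier R; a' \<in> carrier R; q a = q a'\<rbrakk> \<Longrightarrow> q (r \<otimes> a) = q (r \<otimes> a')"

lemma (in cyclic_presentation) cyclic_module:
  shows "left_module R (cyclic_module R q)"
    and "\<And>a c. \<lbrakk>a \<in> carrier R; c \<in> carrier R\<rbrakk> \<Longrightarrow> q a \<oplus>\<^bsub>cyclic_module R q\<^esub> q c = q (a \<oplus>\<^bsub>R\<^esub> c)"
    and "\<And>a c. \<lbrakk>a \<in> carrier R; c \<in> carrier R\<rbrakk> \<Longrightarrow> a \<odot>\<^bsub>cyclic_module R q\<^esub> q c = q (a \<otimes>\<^bsub>R\<^esub> c)"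
    and "carrier (cyclic_module R q) = q ` carrier R" and "\<zero>\<^bsub>cyclic_module R q\<^esub> = q \<zero>\<^bsub>R\<^esub>"
proof -
  let ?M = "cyclic_module R q"
  have rep: "inv_into (carrier R) q (q a) \<in> carrier R" "q (inv_into (carrier R) q (q a)) = q a"
    if "a \<in> carrier R" for a
    using that by (auto intro: inv_into_into f_inv_into_f)
  show add: "q a \<oplus>\<^bsub>?M\<^esub> q c = q (a \<oplus>\<^bsub>R\<^esub> c)" if "a \<in> carrier R" "c \<in> carrier R" for a c
    using that rep by (auto simp: cyclic_module_def Let_def intro!: qadd)
  show mul: "a \<odot>\<^bsub>?M\<^esub> q c = q (a \<otimes>\<^bsub>R\<^esub> c)" if "a \<in> carrier R" "c \<in> carrier R" for a c
    using that rep by (auto simp: cyclic_module_def Let_def intro!: qmul)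
  show car: "carrier ?M = q ` carrier R" and zero: "\<zero>\<^bsub>?M\<^esub> = q \<zero>\<^bsub>R\<^esub>"
    by (simp_all add: cyclic_module_def Let_def)
  show "left_module R ?M"
  proof (intro left_module.intro left_module_axioms.intro ring_axioms)
    show "abelian_group ?M"
    proof (rule abelian_groupI)
      show "\<exists>y\<in>carrier ?M. y \<oplus>\<^bsub>?M\<^esub> x = \<zero>\<^bsub>?M\<^esub>" if x: "x \<in> carrier ?M" for x
      proof -
        obtain a where a: "a \<in> carrier R" "x = q a" using x by (auto simp: car)
        then have "q (\<ominus>\<^bsub>R\<^esub> a) \<oplus>\<^bsub>?M\<^esub> x = \<zero>\<^bsub>?M\<^esub>" by (simp add: add zero l_neg)
        then show ?thesis using a by (auto simp: car)
      qed
      show "x \<oplus>\<^bsub>?M\<^esub> y = y \<oplus>\<^bsub>?M\<^esub> x" if "x \<in> carrier ?M" "y \<in> carrier ?M" for x y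
        using that by (auto simp: add car a_comm)
    qed (auto simp: add zero car a_assoc)
  qed (auto simp: add mul car m_assoc l_distr r_distr)
qed

text \<open>The module is \<open>R/N\<close> with \<open>N\<close> the left ideal of all \<open>a\<close> such that \<open>j c a j\<close> kills a fixed
  nonzero \<open>v\<close> in \<open>V\<close> for all \<open>c\<close>; equivalently, the submodule generated by \<open>v\<close> of the coinduced
  module.  As \<open>R\<close> is countable, \<open>R/N\<close> can be realised on any infinite type.\<close>

lemma (in corner) exists_simple_lmod_with_corner:
  fixes V :: "('r, 'v) module"
  assumes V: "simple_lmod (corner_ring R j) V"
    and cnt: "countable (carrier R)" and inf: "infinite (UNIV :: 'v set)"
  obtains M :: "('r, 'v) module" and u where "simple_lmod R M" "u \<in> carrier M" "j \<odot>\<^bsub>M\<^esub> u \<noteq> \<zero>\<^bsub>M\<^esub>"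
    "lmod_iso (corner_ring R j) (corner_module j M) V"
proof -
  interpret V: left_module "corner_ring R j" V using simple_lmodD(1)[OF V] .
  obtain v where v: "v \<in> carrier V" "v \<noteq> \<zero>\<^bsub>V\<^esub>" using simple_lmodD(2)[OF V] by blast
  \<comment> \<open>A map to the coinduced module, with the left ideal \<open>N\<close> as kernel.\<close>
  define \<Phi> where "\<Phi> a = (\<lambda>c\<in>carrier R. (j \<otimes> (c \<otimes> a) \<otimes> j) \<odot>\<^bsub>V\<^esub> v)" for a
  obtain \<iota> :: "('r \<Rightarrow> 'v) \<Rightarrow> 'v" where \<iota>: "inj_on \<iota> (\<Phi> ` carrier R)"
  proof -
    obtain A :: "'v set" where "countable A" "infinite A" using inf infinite_countable_subset'
      by (metis countable_image_eq countable_image countableI_type infinite_countable_subset range_inj_infinite)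
    then obtain g :: "nat \<Rightarrow> 'v" where g: "bij_betw g UNIV A" using bij_betw_from_nat_into by blast
    have "countable (\<Phi> ` carrier R)" using cnt by simp
    then obtain f :: "('r \<Rightarrow> 'v) \<Rightarrow> nat" where "inj_on f (\<Phi> ` carrier R)" by (auto simp: countable_def)
    then have "inj_on (g \<circ> f) (\<Phi> ` carrier R)"
      using g by (auto intro!: comp_inj_on intro: inj_on_subset simp: bij_betw_def)
    then show ?thesis by (rule that)
  qed
  define q where "q a = \<iota> (\<Phi> a)" for a
  have qeq: "q a = q a' \<longleftrightarrow> (\<forall>c\<in>carrier R. (j \<otimes> (c \<otimes> a) \<otimes> j) \<odot>\<^bsub>V\<^esub> v = (j \<otimes> (c \<otimes> a') \<otimes> j) \<odot>\<^bsub>V\<^esub> v)"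
    if "a \<in> carrier R" "a' \<in> carrier R" for a a'
  proof -
    have "q a = q a' \<longleftrightarrow> \<Phi> a = \<Phi> a'" using \<iota> that by (auto simp: q_def inj_on_def)
    then show ?thesis unfolding \<Phi>_def by (auto simp: fun_eq_iff restrict_def)
  qed
  have jcj: "j \<otimes> a \<otimes> j \<in> carrier (corner_ring R j)" if "a \<in> carrier R" for a using that by simp
  have qadd: "q (a \<oplus> c) = q (a' \<oplus> c')"
    if "a \<in> carrier R" "a' \<in> carrier R" "c \<in> carrier R" "c' \<in> carrier R" "q a = q a'" "q c = q c'" for a a' c c'
  proof -
    have "(j \<otimes> (d \<otimes> (a \<oplus> c)) \<otimes> j) \<odot>\<^bsub>V\<^esub> v
       = (j \<otimes> (d \<otimes> a) \<otimes> j) \<odot>\<^bsub>V\<^esub> v \<oplus>\<^bsub>V\<^esub> (j \<otimes> (d \<otimes> c) \<otimes> j) \<odot>\<^bsub>V\<^esub> v"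
      if "a \<in> carrier R" "c \<in> carrier R" "d \<in> carrier R" for a c d
      using that V.lsmult_l_distr[OF jcj[of "d \<otimes> a"] jcj[of "d \<otimes> c"] v(1)]
      by (simp add: r_distr l_distr j_closed)
    then show ?thesis using that by (simp add: qeq)
  qed
  have qmul: "q (r \<otimes> a) = q (r \<otimes> a')"
    if "r \<in> carrier R" "a \<in> carrier R" "a' \<in> carrier R" "q a = q a'" for r a a'
    using that by (auto simp: qeq simp flip: m_assoc)
  define M where "M = cyclic_module R q"
  interpret cyc: cyclic_presentation R q by unfold_locales (fact qadd, fact qmul)
  note cm = cyc.cyclic_module[folded M_def]
  interpret M: corner_mod R j M by (intro corner_mod.intro corner_axioms cm(1))
  have jv: "j \<odot>\<^bsub>V\<^esub> v = v" using V.lsmult_one v by simp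
  have split: "(j \<otimes> (c \<otimes> (j \<otimes> a)) \<otimes> j) \<odot>\<^bsub>V\<^esub> v
      = (j \<otimes> c \<otimes> j) \<odot>\<^bsub>V\<^esub> ((j \<otimes> a \<otimes> j) \<odot>\<^bsub>V\<^esub> v)" if "a \<in> carrier R" "c \<in> carrier R" for a c
  proof -
    have "(j \<otimes> c \<otimes> j) \<odot>\<^bsub>V\<^esub> ((j \<otimes> a \<otimes> j) \<odot>\<^bsub>V\<^esub> v) = ((j \<otimes> c \<otimes> j) \<otimes> (j \<otimes> a \<otimes> j)) \<odot>\<^bsub>V\<^esub> v"
      using V.lsmult_assoc[OF jcj jcj v(1)] that by simp
    also have "(j \<otimes> c \<otimes> j) \<otimes> (j \<otimes> a \<otimes> j) = j \<otimes> (c \<otimes> (j \<otimes> a)) \<otimes> j"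
      using that j_closed corner_cong by (simp add: m_assoc)
    finally show ?thesis by simp
  qed
  have simple: "simple_lmod R M"
    unfolding simple_lmod_iff
  proof (intro conjI cm(1) ballI impI)
    have "q \<one> \<noteq> q \<zero>"
    proof
      assume "q \<one> = q \<zero>"
      then have "(j \<otimes> (j \<otimes> \<one>) \<otimes> j) \<odot>\<^bsub>V\<^esub> v = (j \<otimes> (j \<otimes> \<zero>) \<otimes> j) \<odot>\<^bsub>V\<^esub> v"
        using j_closed by (simp add: qeq del: r_one r_null)
      then show False using v jv V.zero_lsmult[OF v(1)] j_closed by (simp add: j_idem)
    qed
    then show "\<exists>v\<in>carrier M. v \<noteq> \<zero>\<^bsub>M\<^esub>" unfolding cm(4,5) by blast
    fix x y assume "x \<in> carrier M" "x \<noteq> \<zero>\<^bsub>M\<^esub>" "y \<in> carrier M"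
    then obtain a c where a: "a \<in> carrier R" "x = q a" "q a \<noteq> q \<zero>" and c: "c \<in> carrier R" "y = q c"
      unfolding cm(4,5) by blast
    then obtain d where d: "d \<in> carrier R" "(j \<otimes> (d \<otimes> a) \<otimes> j) \<odot>\<^bsub>V\<^esub> v \<noteq> \<zero>\<^bsub>V\<^esub>"
      using V.zero_lsmult[OF v(1)] j_closed by (auto simp: qeq)
    obtain f where f: "f \<in> carrier (corner_ring R j)" "v = f \<odot>\<^bsub>V\<^esub> ((j \<otimes> (d \<otimes> a) \<otimes> j) \<odot>\<^bsub>V\<^esub> v)"
      using simple_lmodD(3)[OF V _ d(2) v(1)] V.lsmult_closed[OF jcj v(1)] a d by blast
    have f': "f \<in> carrier R" "j \<otimes> f = f" "f \<otimes> j = f" using f(1) unfolding corner_carrier_iff by auto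
    \<comment> \<open>As \<open>f\<close> maps \<open>j d a j v\<close> back to \<open>v\<close>, multiplication by \<open>c f d\<close> sends the class of \<open>a\<close> to that of \<open>c\<close>.\<close>
    have "q (c \<otimes> f \<otimes> d \<otimes> a) = q c"
    proof (subst qeq; (intro ballI)?)
      fix g assume g: "g \<in> carrier R"
      have fa: "f \<otimes> (d \<otimes> a) \<in> carrier R" using f' a d by simp
      have "(j \<otimes> (g \<otimes> (c \<otimes> f \<otimes> d \<otimes> a)) \<otimes> j) = j \<otimes> (g \<otimes> c \<otimes> (j \<otimes> (f \<otimes> (d \<otimes> a)))) \<otimes> j"
        using a c d f' g j_closed by (simp add: m_assoc flip: m_assoc[of j f])
      moreover have "(j \<otimes> (f \<otimes> (d \<otimes> a)) \<otimes> j) \<odot>\<^bsub>V\<^esub> v = v"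
      proof -
        have "j \<otimes> (f \<otimes> (d \<otimes> a)) \<otimes> j = f \<otimes> (j \<otimes> (d \<otimes> a) \<otimes> j)"
          using a d f' j_closed by (metis m_assoc m_closed)
        then show ?thesis using V.lsmult_assoc[OF f(1) jcj v(1)] f(2) a d by simp
      qed
      ultimately show "(j \<otimes> (g \<otimes> (c \<otimes> f \<otimes> d \<otimes> a)) \<otimes> j) \<odot>\<^bsub>V\<^esub> v = (j \<otimes> (g \<otimes> c) \<otimes> j) \<odot>\<^bsub>V\<^esub> v"
        using split[OF fa, of "g \<otimes> c"] g c by simp
    qed (use a c d f' in auto)
    then have "y = (c \<otimes> f \<otimes> d) \<odot>\<^bsub>M\<^esub> x" using a c d f' cm(3) by simp
    then show "\<exists>r\<in>carrier R. y = r \<odot>\<^bsub>M\<^esub> x" using a c d f' by blast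
  qed
  \<comment> \<open>Evaluation of an element of the coinduced module at the unit.\<close>
  define g where "g x = (j \<otimes> inv_into (carrier R) q x \<otimes> j) \<odot>\<^bsub>V\<^esub> v" for x
  have g: "g (q a) = (j \<otimes> a \<otimes> j) \<odot>\<^bsub>V\<^esub> v" if "a \<in> carrier R" for a
  proof -
    let ?a = "inv_into (carrier R) q (q a)"
    have "?a \<in> carrier R" "q ?a = q a" using that by (auto intro: inv_into_into f_inv_into_f)
    then have "(j \<otimes> (j \<otimes> ?a) \<otimes> j) \<odot>\<^bsub>V\<^esub> v = (j \<otimes> (j \<otimes> a) \<otimes> j) \<odot>\<^bsub>V\<^esub> v" "?a \<in> carrier R"
      using that qeq j_closed by auto
    then show ?thesis unfolding g_def using that corner_cong by simp
  qed
  have carM: "carrier (corner_module j M) = (\<lambda>a. q (j \<otimes> a)) ` carrier R"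
    using j_closed by (auto simp: cm(4) cm(3) image_iff)
  have iso: "lmod_iso (corner_ring R j) (corner_module j M) V"
    unfolding lmod_iso_iff
  proof (intro exI[of _ g] conjI ballI)
    show "bij_betw g (carrier (corner_module j M)) (carrier V)"
    proof (rule bij_betw_imageI)
      show "inj_on g (carrier (corner_module j M))"
      proof (rule inj_onI)
        fix x y assume "x \<in> carrier (corner_module j M)" "y \<in> carrier (corner_module j M)" and e: "g x = g y"
        then obtain a c where ac: "a \<in> carrier R" "x = q (j \<otimes> a)" "c \<in> carrier R" "y = q (j \<otimes> c)"
          unfolding carM by auto
        then have "(j \<otimes> a \<otimes> j) \<odot>\<^bsub>V\<^esub> v = (j \<otimes> c \<otimes> j) \<odot>\<^bsub>V\<^esub> v"
          using e g[of "j \<otimes> a"] g[of "j \<otimes> c"] j_closed corner_cong by simp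
        then show "x = y" using ac split j_closed by (simp add: qeq)
      qed
      show "g ` carrier (corner_module j M) = carrier V"
      proof
        show "g ` carrier (corner_module j M) \<subseteq> carrier V"
          unfolding carM using g j_closed V.lsmult_closed[OF jcj v(1)] by auto
        show "carrier V \<subseteq> g ` carrier (corner_module j M)"
        proof
          fix y assume "y \<in> carrier V"
          then obtain a where a: "a \<in> carrier (corner_ring R j)" "y = a \<odot>\<^bsub>V\<^esub> v"
            using simple_lmodD(3)[OF V v] by blast
          then have "a \<in> carrier R" "j \<otimes> a = a" "a \<otimes> j = a" unfolding corner_carrier_iff by auto
          then have "y = g (q (j \<otimes> a))" "a \<in> carrier R" using g[of a] a(2) by auto
          then show "y \<in> g ` carrier (corner_module j M)" unfolding carM by blast
        qed
      qed
    qed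
  next
    fix x y assume "x \<in> carrier (corner_module j M)" "y \<in> carrier (corner_module j M)"
    then obtain a c where ac: "a \<in> carrier R" "x = q a" "c \<in> carrier R" "y = q c"
      unfolding carM using m_closed[OF j_closed] by blast
    then show "g (x \<oplus>\<^bsub>corner_module j M\<^esub> y) = g x \<oplus>\<^bsub>V\<^esub> g y"
      using V.lsmult_l_distr[OF jcj[of a] jcj[of c] v(1)]
      by (simp add: cm(2) g r_distr l_distr j_closed)
  next
    fix r x assume r: "r \<in> carrier (corner_ring R j)" and "x \<in> carrier (corner_module j M)"
    then obtain a where a: "a \<in> carrier R" "x = q a"
      unfolding carM using m_closed[OF j_closed] by blast
    have r': "r \<in> carrier R" "j \<otimes> r = r" "r \<otimes> j = r" using r unfolding corner_carrier_iff by auto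
    have "j \<otimes> (r \<otimes> a) \<otimes> j = r \<otimes> (j \<otimes> a \<otimes> j)"
      using a r' j_closed by (metis m_assoc m_closed)
    then show "g (r \<odot>\<^bsub>corner_module j M\<^esub> x) = r \<odot>\<^bsub>V\<^esub> g x"
      using V.lsmult_assoc[OF r jcj[of a] v(1)] a r' by (simp add: cm(3) g)
  qed
  have "\<exists>u\<in>carrier M. j \<odot>\<^bsub>M\<^esub> u \<noteq> \<zero>\<^bsub>M\<^esub>"
  proof (rule ccontr)
    assume "\<not> ?thesis"
    then have "carrier (corner_module j M) \<subseteq> {\<zero>\<^bsub>M\<^esub>}" by auto
    moreover obtain g where "bij_betw g (carrier (corner_module j M)) (carrier V)"
      using iso unfolding lmod_iso_iff by blast
    then have "carrier V = g ` carrier (corner_module j M)" by (simp only: bij_betw_def)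
    ultimately have "carrier V \<subseteq> {g \<zero>\<^bsub>M\<^esub>}" by blast
    then have "v = g \<zero>\<^bsub>M\<^esub>" "\<zero>\<^bsub>V\<^esub> = g \<zero>\<^bsub>M\<^esub>" using v(1) V.M.zero_closed by blast+
    then show False using v(2) by simp
  qed
  then show ?thesis using that simple iso by blast
qed

text \<open>If \<open>i\<close> and \<open>j\<close> were both nonzero on \<open>M\<close>, then, as nonzero vectors generate, some vector of
  \<open>iM\<close> could be moved into \<open>jM\<close> and back to itself, by an element of \<open>i R j R i\<close>.\<close>

lemma simple_lmod_orthogonal_idempotents:
  assumes M: "simple_lmod R M" and i: "i \<in> carrier R" "i \<otimes>\<^bsub>R\<^esub> i = i" and j: "j \<in> carrier R"
    and orth: "\<And>a c. \<lbrakk>a \<in> carrier R; c \<in> carrier R\<rbrakk> \<Longrightarrow> i \<otimes>\<^bsub>R\<^esub> a \<otimes>\<^bsub>R\<^esub> j \<otimes>\<^bsub>R\<^esub> c \<otimes>\<^bsub>R\<^esub> i = \<zero>\<^bsub>R\<^esub>"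
    and u: "u \<in> carrier M" "i \<odot>\<^bsub>M\<^esub> u \<noteq> \<zero>\<^bsub>M\<^esub>" and v: "v \<in> carrier M"
  shows "j \<odot>\<^bsub>M\<^esub> v = \<zero>\<^bsub>M\<^esub>"
proof (rule ccontr)
  assume n: "j \<odot>\<^bsub>M\<^esub> v \<noteq> \<zero>\<^bsub>M\<^esub>"
  interpret left_module R M using simple_lmodD(1)[OF M] .
  have iu: "i \<odot>\<^bsub>M\<^esub> u \<in> carrier M" and jv: "j \<odot>\<^bsub>M\<^esub> v \<in> carrier M" using u v i j lsmult_closed by auto
  obtain a where a: "a \<in> carrier R" "i \<odot>\<^bsub>M\<^esub> u = a \<odot>\<^bsub>M\<^esub> (j \<odot>\<^bsub>M\<^esub> v)" using simple_lmodD(3)[OF M jv n iu] by blast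
  obtain c where c: "c \<in> carrier R" "v = c \<odot>\<^bsub>M\<^esub> (i \<odot>\<^bsub>M\<^esub> u)" using simple_lmodD(3)[OF M iu u(2) v] by blast
  have "i \<odot>\<^bsub>M\<^esub> u = i \<odot>\<^bsub>M\<^esub> (i \<odot>\<^bsub>M\<^esub> u)" using lsmult_assoc[of i i u] i u by simp
  also have "\<dots> = i \<odot>\<^bsub>M\<^esub> (a \<odot>\<^bsub>M\<^esub> (j \<odot>\<^bsub>M\<^esub> (c \<odot>\<^bsub>M\<^esub> (i \<odot>\<^bsub>M\<^esub> u))))" using a(2) c(2) by metis
  also have "\<dots> = (i \<otimes>\<^bsub>R\<^esub> a \<otimes>\<^bsub>R\<^esub> j \<otimes>\<^bsub>R\<^esub> c \<otimes>\<^bsub>R\<^esub> i) \<odot>\<^bsub>M\<^esub> u" using a(1) c(1) i j u by (simp add: lsmult_assoc lsmult_closed)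
  finally show False using orth[OF a(1) c(1)] u zero_lsmult by simp
qed

section \<open>Finite EI-categories\<close>

context category
begin

lemma HomD: assumes "s \<in> Hom D X Y" shows "s \<in> Mor D" "Dom D s = X" "Cod D s = Y" "X \<in> Obj D" "Y \<in> Obj D"
  using assms dom_closed cod_closed by (auto simp: Hom_def)

lemma comp_Hom: "\<lbrakk>t \<in> Hom D Y Z; s \<in> Hom D X Y\<rbrakk> \<Longrightarrow> t \<cdot> s \<in> Hom D X Z"
  using comp_mor by (auto simp: Hom_def)

lemma ide_Hom: "X \<in> Obj D \<Longrightarrow> Ide D X \<in> Hom D X X"
  using ide_mor by (auto simp: Hom_def)

lemma Hom_ide: "s \<in> Hom D X Y \<Longrightarrow> s \<cdot> Ide D X = s" "s \<in> Hom D X Y \<Longrightarrow> Ide D Y \<cdot> s = s"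
  using comp_ide ide_comp by (auto simp: Hom_def)

lemma Hom_assoc: "\<lbrakk>u \<in> Hom D Z W; t \<in> Hom D Y Z; s \<in> Hom D X Y\<rbrakk> \<Longrightarrow> u \<cdot> t \<cdot> s = u \<cdot> (t \<cdot> s)"
  using comp_assoc by (auto simp: Hom_def)

definition inverse_mors :: "'o \<Rightarrow> 'o \<Rightarrow> 'm \<Rightarrow> 'm \<Rightarrow> bool" where
  "inverse_mors X Y s t \<longleftrightarrow> s \<in> Hom D X Y \<and> t \<in> Hom D Y X \<and> t \<cdot> s = Ide D X \<and> s \<cdot> t = Ide D Y"

lemma inverse_morsD:
  assumes "inverse_mors X Y s t"
  shows "s \<in> Hom D X Y" "t \<in> Hom D Y X" "t \<cdot> s = Ide D X" "s \<cdot> t = Ide D Y" "X \<in> Obj D" "Y \<in> Obj D"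
  using assms by (auto simp: inverse_mors_def dest: HomD)

lemma inverse_mors_sym: "inverse_mors X Y s t \<Longrightarrow> inverse_mors Y X t s"
  by (auto simp: inverse_mors_def)

lemma inverse_mors_ide: "X \<in> Obj D \<Longrightarrow> inverse_mors X X (Ide D X) (Ide D X)"
  using ide_Hom Hom_ide by (auto simp: inverse_mors_def)

lemma inverse_mors_comp:
  assumes "inverse_mors X Y s t" "inverse_mors Y Z s' t'"
  shows "inverse_mors X Z (s' \<cdot> s) (t \<cdot> t')"
proof -
  note a = inverse_morsD[OF assms(1)] and b = inverse_morsD[OF assms(2)]
  have "t \<cdot> t' \<cdot> (s' \<cdot> s) = t \<cdot> (t' \<cdot> s' \<cdot> s)"
    using Hom_assoc[OF a(2) b(2) comp_Hom[OF b(1) a(1)]] Hom_assoc[OF b(2) b(1) a(1)] by simp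
  moreover have "s' \<cdot> s \<cdot> (t \<cdot> t') = s' \<cdot> (s \<cdot> t \<cdot> t')"
    using Hom_assoc[OF b(1) a(1) comp_Hom[OF a(2) b(2)]] Hom_assoc[OF a(1) a(2) b(2)] by simp
  ultimately show ?thesis using a b comp_Hom[OF b(1) a(1)] comp_Hom[OF a(2) b(2)] Hom_ide
    by (simp add: inverse_mors_def)
qed

lemma inverse_mors_cancel:
  assumes "inverse_mors X Y s t"
  shows "r \<in> Hom D Z X \<Longrightarrow> t \<cdot> (s \<cdot> r) = r" "r \<in> Hom D Z Y \<Longrightarrow> s \<cdot> (t \<cdot> r) = r"
    "r \<in> Hom D Y Z \<Longrightarrow> r \<cdot> s \<cdot> t = r" "r \<in> Hom D X Z \<Longrightarrow> r \<cdot> t \<cdot> s = r"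
proof -
  note a = inverse_morsD[OF assms]
  show "r \<in> Hom D Z X \<Longrightarrow> t \<cdot> (s \<cdot> r) = r" using Hom_assoc[OF a(2) a(1)] a(3) Hom_ide by metis
  show "r \<in> Hom D Z Y \<Longrightarrow> s \<cdot> (t \<cdot> r) = r" using Hom_assoc[OF a(1) a(2)] a(4) Hom_ide by metis
  show "r \<in> Hom D Y Z \<Longrightarrow> r \<cdot> s \<cdot> t = r" using Hom_assoc[OF _ a(1) a(2)] a(4) Hom_ide by metis
  show "r \<in> Hom D X Z \<Longrightarrow> r \<cdot> t \<cdot> s = r" using Hom_assoc[OF _ a(2) a(1)] a(3) Hom_ide by metis
qed

end

locale ei_category = finite_category D for D :: "('o, 'm) cat" (structure) +
  assumes EI: "EI_category D"
begin

lemma endo_iso: assumes "s \<in> Hom D X X" obtains t where "inverse_mors X X s t"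
proof -
  have "is_iso D s" using EI assms HomD[OF assms] by (auto simp: EI_category_def)
  then show ?thesis using that assms HomD[OF assms] by (auto simp: is_iso_def inverse_mors_def)
qed

text \<open>The composites \<open>t s\<close> and \<open>s t\<close> are automorphisms, which gives \<open>s\<close> a left and a right inverse.\<close>

lemma opposed_mors_iso: assumes s: "s \<in> Hom D X Y" and t: "t \<in> Hom D Y X" obtains s' where "inverse_mors X Y s s'"
proof -
  obtain g where g: "inverse_mors X X (t \<cdot> s) g" using endo_iso comp_Hom[OF t s] by blast
  obtain h where h: "inverse_mors Y Y (s \<cdot> t) h" using endo_iso comp_Hom[OF s t] by blast
  note g' = inverse_morsD[OF g] and h' = inverse_morsD[OF h]
  have l: "g \<cdot> t \<cdot> s = Ide D X" using g' Hom_assoc[OF g'(2) t s] by simp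
  have r: "s \<cdot> (t \<cdot> h) = Ide D Y" using h' Hom_assoc[OF s t h'(2)] by simp
  have "g \<cdot> t = g \<cdot> t \<cdot> (s \<cdot> (t \<cdot> h))" using r Hom_ide(1)[OF comp_Hom[OF g'(2) t]] by simp
  also have "\<dots> = g \<cdot> t \<cdot> s \<cdot> (t \<cdot> h)"
    using Hom_assoc[OF comp_Hom[OF g'(2) t] s comp_Hom[OF t h'(2)]] by simp
  also have "\<dots> = t \<cdot> h" using l Hom_ide(2)[OF comp_Hom[OF t h'(2)]] by simp
  finally have "inverse_mors X Y s (t \<cdot> h)" using l r s comp_Hom[OF t h'(2)] by (simp add: inverse_mors_def)
  then show ?thesis using that by blast
qed

lemma idem_endo_iff: "idem_endo D e \<longleftrightarrow> (\<exists>X\<in>Obj D. e = Ide D X)"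
proof
  assume e: "idem_endo D e"
  let ?X = "Dom D e"
  have h: "e \<in> Hom D ?X ?X" using e by (auto simp: idem_endo_def Hom_def)
  then obtain t where t: "inverse_mors ?X ?X e t" using endo_iso by blast
  have "e = e \<cdot> e \<cdot> t" using inverse_mors_cancel(3)[OF inverse_mors_sym[OF inverse_mors_sym[OF t]] h] by simp
  then have "e = Ide D ?X" using e t by (simp add: idem_endo_def inverse_mors_def)
  then show "\<exists>X\<in>Obj D. e = Ide D X" using HomD[OF h] by blast
next
  assume "\<exists>X\<in>Obj D. e = Ide D X"
  then show "idem_endo D e" using ide_mor comp_ide by (auto simp: idem_endo_def) (metis)
qed

lemma idem_group_ide:
  assumes X: "X \<in> Obj D"
  shows "carrier (idem_group D (Ide D X)) = Hom D X X" "monoid.mult (idem_group D (Ide D X)) = Comp D"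
    "one (idem_group D (Ide D X)) = Ide D X" "group (idem_group D (Ide D X))"
proof -
  define M where "M = \<lparr>carrier = Hom D X X, monoid.mult = Comp D, one = Ide D X\<rparr>"
  have dom: "Dom D (Ide D X) = X" using ide_mor X by simp
  have c: "{Ide D X \<cdot> x \<cdot> Ide D X | x. x \<in> Hom D X X} = Hom D X X"
  proof -
    have "Ide D X \<cdot> x \<cdot> Ide D X = x" if "x \<in> Hom D X X" for x using that Hom_ide by metis
    then show ?thesis by force
  qed
  have G: "idem_group D (Ide D X) = units_of M" unfolding idem_group_def dom c M_def ..
  interpret M: Group.monoid M
    by (rule monoidI) (auto simp: M_def comp_Hom ide_Hom X Hom_ide Hom_assoc)
  have U: "Units M = Hom D X X"
  proof
    show "Hom D X X \<subseteq> Units M"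
    proof
      fix x assume x: "x \<in> Hom D X X"
      then obtain t where "inverse_mors X X x t" using endo_iso by blast
      then show "x \<in> Units M" using x by (auto simp: Units_def M_def inverse_mors_def)
    qed
  qed (auto simp: Units_def M_def)
  show "carrier (idem_group D (Ide D X)) = Hom D X X" using U by (simp add: G units_of_def)
  show "monoid.mult (idem_group D (Ide D X)) = Comp D" "one (idem_group D (Ide D X)) = Ide D X"
    by (simp_all add: G units_of_def M_def)
  show "group (idem_group D (Ide D X))" unfolding G by (rule M.units_group)
qed

lemma idem_group_inv:
  assumes "inverse_mors X X s t" shows "inv\<^bsub>idem_group D (Ide D X)\<^esub> s = t"
proof -
  note a = inverse_morsD[OF assms]
  interpret G: group "idem_group D (Ide D X)" by (rule idem_group_ide(4)[OF a(5)])
  show ?thesis using a G.inv_equality[of t s] by (simp add: idem_group_ide)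
qed

lemma idem_cat_simps:
  assumes X: "X \<in> Obj D"
  shows "Obj (idem_cat D (Ide D X)) = {X}" "Mor (idem_cat D (Ide D X)) = Hom D X X"
    "Dom (idem_cat D (Ide D X)) s = X" "Cod (idem_cat D (Ide D X)) s = X"
    "Ide (idem_cat D (Ide D X)) Y = Ide D X" "Comp (idem_cat D (Ide D X)) = Comp D"
  using X ide_mor by (simp_all add: idem_cat_def idem_group_ide)

lemma idem_cat_ei:
  assumes X: "X \<in> Obj D" shows "ei_category (idem_cat D (Ide D X))"
proof -
  note s = idem_cat_simps[OF X]
  interpret I: category "idem_cat D (Ide D X)"
    by unfold_locales (auto simp: s X comp_Hom ide_Hom Hom_ide Hom_assoc)
  have "is_iso (idem_cat D (Ide D X)) x" if x: "x \<in> Hom D X X" for x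
  proof -
    obtain t where "inverse_mors X X x t" using endo_iso[OF x] by blast
    then show ?thesis by (auto simp: is_iso_def s Hom_def[of "idem_cat D (Ide D X)"] inverse_mors_def)
  qed
  then have "EI_category (idem_cat D (Ide D X))"
    by (auto simp: EI_category_def s Hom_def[of "idem_cat D (Ide D X)"] intro: I.category_axioms)
  moreover have "finite (Hom D X X)" using finite_mor by (auto simp: Hom_def)
  ultimately show ?thesis by unfold_locales (auto simp: s)
qed

end

section \<open>Twisted category algebras\<close>

abbreviation single :: "'m \<Rightarrow> 'k \<Rightarrow> 'm \<Rightarrow> 'k::zero" where
  "single s c \<equiv> (\<lambda>_. 0)(s := c)"

locale twisted_category = finite_category D for D :: "('o, 'm) cat" (structure) +
  fixes \<alpha> :: "'m \<Rightarrow> 'm \<Rightarrow> 'k::field"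
  assumes coc: "cocycle D (- {0}) \<alpha>"
begin

abbreviation A where "A \<equiv> tw_alg D \<alpha>"

text \<open>The structure constant of the product of \<open>t\<close> and \<open>s\<close> at \<open>r\<close>.\<close>

definition sconst :: "'m \<Rightarrow> 'm \<Rightarrow> 'm \<Rightarrow> 'k" where
  "sconst t s r = (if Dom D t = Cod D s \<and> t \<cdot> s = r then \<alpha> t s else 0)"

lemma alg_simps [simp]: "carrier A = span_of (Mor D)" "zero A = (\<lambda>_. 0)" "a \<oplus>\<^bsub>A\<^esub> b = (\<lambda>s. a s + b s)"
  by (simp_all add: tw_alg_def)

lemma \<alpha>_nz: "\<lbrakk>t \<in> Hom D Y Z; s \<in> Hom D X Y\<rbrakk> \<Longrightarrow> \<alpha> t s \<noteq> 0"
  using coc by (auto simp: cocycle_def Hom_def)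

lemma \<alpha>_cocycle: "\<lbrakk>u \<in> Hom D Z W; t \<in> Hom D Y Z; s \<in> Hom D X Y\<rbrakk> \<Longrightarrow>
    \<alpha> u (t \<cdot> s) * \<alpha> t s = \<alpha> (u \<cdot> t) s * \<alpha> u t"
  using coc by (auto simp: cocycle_def Hom_def)

lemma \<alpha>_ide_left: "s \<in> Hom D X Y \<Longrightarrow> \<alpha> (Ide D Y) s = \<alpha> (Ide D Y) (Ide D Y)"
  using \<alpha>_cocycle[of "Ide D Y" Y Y "Ide D Y" Y s X] ide_Hom Hom_ide \<alpha>_nz HomD
  by (metis (no_types, lifting) mult.commute mult_cancel_left)

lemma \<alpha>_ide_right: "s \<in> Hom D X Y \<Longrightarrow> \<alpha> s (Ide D X) = \<alpha> (Ide D X) (Ide D X)"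
  using \<alpha>_cocycle[of s X Y "Ide D X" X "Ide D X" X] ide_Hom Hom_ide \<alpha>_nz HomD
  by (metis (no_types, lifting) mult.commute mult_cancel_left)

lemma mult_eq: "(a \<otimes>\<^bsub>A\<^esub> b) r = (\<Sum>t\<in>Mor D. \<Sum>s\<in>Mor D. a t * b s * sconst t s r)"
proof -
  have e: "{(t, s). t \<in> Mor D \<and> s \<in> Mor D \<and> Dom D t = Cod D s \<and> t \<cdot> s = r}
      = {x \<in> Mor D \<times> Mor D. Dom D (fst x) = Cod D (snd x) \<and> fst x \<cdot> snd x = r}" by auto
  have "(a \<otimes>\<^bsub>A\<^esub> b) r = (\<Sum>(t, s) | t \<in> Mor D \<and> s \<in> Mor D \<and> Dom D t = Cod D s \<and> t \<cdot> s = r. a t * b s * \<alpha> t s)"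
    by (simp add: tw_alg_def)
  also have "\<dots> = (\<Sum>(t, s)\<in>Mor D \<times> Mor D. a t * b s * sconst t s r)"
    unfolding e by (rule sum.mono_neutral_cong_left) (auto simp: sconst_def finite_mor split: if_splits)
  finally show ?thesis by (simp add: sum.cartesian_product)
qed

lemma sconst_out: "\<lbrakk>t \<in> Mor D; s \<in> Mor D; r \<notin> Mor D\<rbrakk> \<Longrightarrow> sconst t s r = 0"
  using comp_mor by (auto simp: sconst_def)

lemma mult_span: "a \<otimes>\<^bsub>A\<^esub> b \<in> span_of (Mor D)"
  by (auto simp: span_of_def mult_eq sconst_out)

text \<open>Associativity of the algebra, expressed through structure constants, is the cocycle identity.\<close>

lemma sconst_assoc:
  assumes "t \<in> Mor D" "s \<in> Mor D" "u \<in> Mor D"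
  shows "(\<Sum>q\<in>Mor D. sconst t s q * sconst q u r) = (\<Sum>q\<in>Mor D. sconst s u q * sconst t q r)"
proof -
  have l: "(\<Sum>q\<in>Mor D. sconst t s q * sconst q u r) = (if Dom D t = Cod D s then \<alpha> t s * sconst (t \<cdot> s) u r else 0)"
  proof (cases "Dom D t = Cod D s")
    case True
    then have "(\<Sum>q\<in>Mor D. sconst t s q * sconst q u r) = (\<Sum>q\<in>Mor D. if t \<cdot> s = q then \<alpha> t s * sconst q u r else 0)"
      by (intro sum.cong) (auto simp: sconst_def)
    then show ?thesis using True assms comp_mor finite_mor by simp
  qed (simp add: sconst_def)
  have r: "(\<Sum>q\<in>Mor D. sconst s u q * sconst t q r) = (if Dom D s = Cod D u then \<alpha> s u * sconst t (s \<cdot> u) r else 0)"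
  proof (cases "Dom D s = Cod D u")
    case True
    then have "(\<Sum>q\<in>Mor D. sconst s u q * sconst t q r) = (\<Sum>q\<in>Mor D. if s \<cdot> u = q then \<alpha> s u * sconst t q r else 0)"
      by (intro sum.cong) (auto simp: sconst_def)
    then show ?thesis using True assms comp_mor finite_mor by simp
  qed (simp add: sconst_def)
  show ?thesis unfolding l r using assms comp_mor comp_assoc[of t s u] \<alpha>_cocycle[of t "Cod D s" "Cod D t" s "Dom D s" u "Dom D u"]
    by (auto simp: sconst_def Hom_def mult.commute)
qed

lemma mult_assoc: "(a \<otimes>\<^bsub>A\<^esub> b) \<otimes>\<^bsub>A\<^esub> c = a \<otimes>\<^bsub>A\<^esub> (b \<otimes>\<^bsub>A\<^esub> c)"
proof
  fix r
  let ?M = "Mor D"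
  have "((a \<otimes>\<^bsub>A\<^esub> b) \<otimes>\<^bsub>A\<^esub> c) r = (\<Sum>q\<in>?M. \<Sum>u\<in>?M. \<Sum>t\<in>?M. \<Sum>s\<in>?M. a t * b s * c u * (sconst t s q * sconst q u r))"
    by (simp add: mult_eq sum_distrib_left sum_distrib_right mult_ac)
  also have "\<dots> = (\<Sum>t\<in>?M. \<Sum>s\<in>?M. \<Sum>u\<in>?M. a t * b s * c u * (\<Sum>q\<in>?M. sconst t s q * sconst q u r))"
  proof -
    have "(\<Sum>q\<in>?M. \<Sum>u\<in>?M. \<Sum>t\<in>?M. \<Sum>s\<in>?M. f q u t s) = (\<Sum>t\<in>?M. \<Sum>s\<in>?M. \<Sum>u\<in>?M. \<Sum>q\<in>?M. f q u t s)"
      for f :: "'m \<Rightarrow> 'm \<Rightarrow> 'm \<Rightarrow> 'm \<Rightarrow> 'k"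
    proof -
      have "(\<Sum>q\<in>?M. \<Sum>u\<in>?M. \<Sum>t\<in>?M. \<Sum>s\<in>?M. f q u t s) = (\<Sum>q\<in>?M. \<Sum>t\<in>?M. \<Sum>u\<in>?M. \<Sum>s\<in>?M. f q u t s)"
        by (intro sum.cong refl sum.swap)
      also have "\<dots> = (\<Sum>t\<in>?M. \<Sum>q\<in>?M. \<Sum>u\<in>?M. \<Sum>s\<in>?M. f q u t s)" by (rule sum.swap)
      also have "\<dots> = (\<Sum>t\<in>?M. \<Sum>q\<in>?M. \<Sum>s\<in>?M. \<Sum>u\<in>?M. f q u t s)" by (intro sum.cong refl sum.swap)
      also have "\<dots> = (\<Sum>t\<in>?M. \<Sum>s\<in>?M. \<Sum>q\<in>?M. \<Sum>u\<in>?M. f q u t s)" by (intro sum.cong refl sum.swap)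
      also have "\<dots> = (\<Sum>t\<in>?M. \<Sum>s\<in>?M. \<Sum>u\<in>?M. \<Sum>q\<in>?M. f q u t s)" by (intro sum.cong refl sum.swap)
      finally show ?thesis .
    qed
    then show ?thesis by (simp add: sum_distrib_left)
  qed
  also have "\<dots> = (\<Sum>t\<in>?M. \<Sum>s\<in>?M. \<Sum>u\<in>?M. a t * b s * c u * (\<Sum>q\<in>?M. sconst s u q * sconst t q r))"
    by (intro sum.cong refl) (simp add: sconst_assoc)
  also have "\<dots> = (\<Sum>t\<in>?M. \<Sum>q\<in>?M. \<Sum>s\<in>?M. \<Sum>u\<in>?M. a t * b s * c u * (sconst s u q * sconst t q r))"
  proof -
    have sw: "(\<Sum>s\<in>?M. \<Sum>u\<in>?M. \<Sum>q\<in>?M. f q u s) = (\<Sum>q\<in>?M. \<Sum>s\<in>?M. \<Sum>u\<in>?M. f q u s)"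
      for f :: "'m \<Rightarrow> 'm \<Rightarrow> 'm \<Rightarrow> 'k"
    proof -
      have "(\<Sum>s\<in>?M. \<Sum>u\<in>?M. \<Sum>q\<in>?M. f q u s) = (\<Sum>s\<in>?M. \<Sum>q\<in>?M. \<Sum>u\<in>?M. f q u s)"
        by (intro sum.cong refl sum.swap)
      also have "\<dots> = (\<Sum>q\<in>?M. \<Sum>s\<in>?M. \<Sum>u\<in>?M. f q u s)" by (rule sum.swap)
      finally show ?thesis .
    qed
    show ?thesis unfolding sum_distrib_left by (intro sum.cong refl sw)
  qed
  also have "\<dots> = (a \<otimes>\<^bsub>A\<^esub> (b \<otimes>\<^bsub>A\<^esub> c)) r"
    by (simp add: mult_eq sum_distrib_left sum_distrib_right mult_ac)
  finally show "((a \<otimes>\<^bsub>A\<^esub> b) \<otimes>\<^bsub>A\<^esub> c) r = (a \<otimes>\<^bsub>A\<^esub> (b \<otimes>\<^bsub>A\<^esub> c)) r" .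
qed

lemma single_mult:
  assumes "s \<in> Mor D" shows "(single s c \<otimes>\<^bsub>A\<^esub> a) r = (\<Sum>t\<in>Mor D. c * a t * sconst s t r)"
proof -
  have "(\<Sum>t\<in>Mor D. \<Sum>u\<in>Mor D. single s c t * a u * sconst t u r)
      = (\<Sum>t\<in>Mor D. if s = t then \<Sum>u\<in>Mor D. c * a u * sconst t u r else 0)"
    by (intro sum.cong) auto
  then show ?thesis using assms finite_mor by (simp add: mult_eq)
qed

lemma mult_single:
  assumes "s \<in> Mor D" shows "(a \<otimes>\<^bsub>A\<^esub> single s c) r = (\<Sum>t\<in>Mor D. a t * c * sconst t s r)"
proof -
  have "(\<Sum>u\<in>Mor D. a t * single s c u * sconst t u r) = a t * c * sconst t s r" for t
  proof -
    have "(\<Sum>u\<in>Mor D. a t * single s c u * sconst t u r) = (\<Sum>u\<in>Mor D. if s = u then a t * c * sconst t u r else 0)"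
      by (intro sum.cong) auto
    then show ?thesis using assms finite_mor by simp
  qed
  then show ?thesis by (simp add: mult_eq)
qed

lemma single_mult_single:
  assumes "t \<in> Hom D Y Z" "s \<in> Hom D X Y"
  shows "single t c \<otimes>\<^bsub>A\<^esub> single s d = single (t \<cdot> s) (c * d * \<alpha> t s)"
proof
  fix r
  have "(\<Sum>u\<in>Mor D. c * single s d u * sconst t u r) = (\<Sum>u\<in>Mor D. if s = u then c * d * sconst t u r else 0)"
    by (intro sum.cong) auto
  then show "(single t c \<otimes>\<^bsub>A\<^esub> single s d) r = single (t \<cdot> s) (c * d * \<alpha> t s) r"
    using assms HomD[OF assms(1)] HomD[OF assms(2)] finite_mor by (auto simp: single_mult sconst_def)
qed

text \<open>Composition with an isomorphism permutes morphisms, so at each \<open>r\<close> only one term of the product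
  survives.\<close>

lemma single_mult_iso:
  assumes "inverse_mors X Y s t"
  shows "(single s c \<otimes>\<^bsub>A\<^esub> a) r = (if r \<in> Mor D \<and> Cod D r = Y then c * a (t \<cdot> r) * \<alpha> s (t \<cdot> r) else 0)"
proof -
  note i = inverse_morsD[OF assms]
  note s = HomD[OF i(1)] and t = HomD[OF i(2)]
  have e: "sconst s u r = (if r \<in> Mor D \<and> Cod D r = Y \<and> u = t \<cdot> r then \<alpha> s (t \<cdot> r) else 0)" if u: "u \<in> Mor D" for u
  proof -
    have "(X = Cod D u \<and> s \<cdot> u = r) \<longleftrightarrow> (r \<in> Mor D \<and> Cod D r = Y \<and> u = t \<cdot> r)"
    proof
      assume a: "X = Cod D u \<and> s \<cdot> u = r"
      then have h: "u \<in> Hom D (Dom D u) X" using u by (simp add: Hom_def)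
      show "r \<in> Mor D \<and> Cod D r = Y \<and> u = t \<cdot> r"
        using inverse_mors_cancel(1)[OF assms h] HomD[OF comp_Hom[OF i(1) h]] a by simp
    next
      assume "r \<in> Mor D \<and> Cod D r = Y \<and> u = t \<cdot> r"
      then show "X = Cod D u \<and> s \<cdot> u = r"
        using inverse_mors_cancel(2)[OF assms, of r "Dom D r"] t comp_mor by (auto simp: Hom_def)
    qed
    then show ?thesis by (auto simp: sconst_def s)
  qed
  have "(single s c \<otimes>\<^bsub>A\<^esub> a) r = (\<Sum>u\<in>Mor D. if u = t \<cdot> r then (if r \<in> Mor D \<and> Cod D r = Y then c * a (t \<cdot> r) * \<alpha> s (t \<cdot> r) else 0) else 0)"
    unfolding single_mult[OF s(1)] by (intro sum.cong) (auto simp: e)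
  then show ?thesis using t comp_mor finite_mor by (auto simp: sum.delta)
qed

lemma mult_single_iso:
  assumes "inverse_mors X Y s t"
  shows "(a \<otimes>\<^bsub>A\<^esub> single s c) r = (if r \<in> Mor D \<and> Dom D r = X then a (r \<cdot> t) * c * \<alpha> (r \<cdot> t) s else 0)"
proof -
  note i = inverse_morsD[OF assms]
  note s = HomD[OF i(1)] and t = HomD[OF i(2)]
  have e: "sconst u s r = (if r \<in> Mor D \<and> Dom D r = X \<and> u = r \<cdot> t then \<alpha> (r \<cdot> t) s else 0)" if u: "u \<in> Mor D" for u
  proof -
    have "(Dom D u = Y \<and> u \<cdot> s = r) \<longleftrightarrow> (r \<in> Mor D \<and> Dom D r = X \<and> u = r \<cdot> t)"
    proof
      assume a: "Dom D u = Y \<and> u \<cdot> s = r"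
      then have h: "u \<in> Hom D Y (Cod D u)" using u by (simp add: Hom_def)
      show "r \<in> Mor D \<and> Dom D r = X \<and> u = r \<cdot> t"
        using inverse_mors_cancel(3)[OF assms h] HomD[OF comp_Hom[OF h i(1)]] a by simp
    next
      assume "r \<in> Mor D \<and> Dom D r = X \<and> u = r \<cdot> t"
      then show "Dom D u = Y \<and> u \<cdot> s = r"
        using inverse_mors_cancel(4)[OF assms, of r "Cod D r"] t comp_mor by (auto simp: Hom_def)
    qed
    then show ?thesis by (auto simp: sconst_def s)
  qed
  have "(a \<otimes>\<^bsub>A\<^esub> single s c) r = (\<Sum>u\<in>Mor D. if u = r \<cdot> t then (if r \<in> Mor D \<and> Dom D r = X then a (r \<cdot> t) * c * \<alpha> (r \<cdot> t) s else 0) else 0)"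
    unfolding mult_single[OF s(1)] by (intro sum.cong) (auto simp: e)
  then show ?thesis using t comp_mor finite_mor by (auto simp: sum.delta)
qed

definition hat :: "'o \<Rightarrow> 'm \<Rightarrow> 'k" where
  "hat X = idem_hat \<alpha> (Ide D X)"

lemma hat_single: "hat X = single (Ide D X) (inverse (\<alpha> (Ide D X) (Ide D X)))"
  by (simp add: hat_def idem_hat_def)

text \<open>By the cocycle identity \<open>\<alpha>(Id, s)\<close> does not depend on \<open>s\<close>; the normalised identity of \<open>X\<close>
  therefore acts as the projection onto the morphisms into \<open>X\<close>.\<close>

lemma hat_mult:
  assumes "X \<in> Obj D" shows "(hat X \<otimes>\<^bsub>A\<^esub> a) r = (if r \<in> Mor D \<and> Cod D r = X then a r else 0)"
proof -
  have "Ide D X \<cdot> r = r \<and> \<alpha> (Ide D X) r = \<alpha> (Ide D X) (Ide D X) \<and> \<alpha> (Ide D X) (Ide D X) \<noteq> 0"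
    if "r \<in> Mor D" "Cod D r = X"
    using that Hom_ide(2)[of r "Dom D r" X] \<alpha>_ide_left[of r "Dom D r" X] \<alpha>_nz[OF ide_Hom ide_Hom] assms
    by (simp add: Hom_def)
  then show ?thesis unfolding hat_single using single_mult_iso[OF inverse_mors_ide[OF assms]] by auto
qed

lemma mult_hat:
  assumes "X \<in> Obj D" shows "(a \<otimes>\<^bsub>A\<^esub> hat X) r = (if r \<in> Mor D \<and> Dom D r = X then a r else 0)"
proof -
  have "r \<cdot> Ide D X = r \<and> \<alpha> r (Ide D X) = \<alpha> (Ide D X) (Ide D X) \<and> \<alpha> (Ide D X) (Ide D X) \<noteq> 0"
    if "r \<in> Mor D" "Dom D r = X"
    using that Hom_ide(1)[of r X "Cod D r"] \<alpha>_ide_right[of r X "Cod D r"] \<alpha>_nz[OF ide_Hom ide_Hom] assms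
    by (simp add: Hom_def)
  then show ?thesis unfolding hat_single using mult_single_iso[OF inverse_mors_ide[OF assms]] by auto
qed

lemma hat_in: "X \<in> Obj D \<Longrightarrow> hat X \<in> span_of (Hom D X X)"
  using ide_Hom by (auto simp: hat_single span_of_def)

lemma span_mono: "S \<subseteq> T \<Longrightarrow> a \<in> span_of S \<Longrightarrow> a \<in> span_of T"
  by (auto simp: span_of_def)

lemma Hom_span: "a \<in> span_of (Hom D X Y) \<Longrightarrow> a \<in> span_of (Mor D)"
  by (rule span_mono) (auto simp: Hom_def)

lemma finite_obj: "finite (Obj D)"
proof -
  have "Obj D \<subseteq> Dom D ` Mor D" using ide_mor by force
  then show ?thesis using finite_mor finite_surj by blast
qed

lemma one_eq: "\<one>\<^bsub>A\<^esub> r = (\<Sum>X\<in>Obj D. hat X r)"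
proof -
  have "(\<Sum>X\<in>Obj D. hat X r) = (\<Sum>X\<in>Obj D. if X = Dom D r then hat (Dom D r) r else 0)"
    using ide_mor by (intro sum.cong) (auto simp: hat_single)
  also have "\<dots> = (if Dom D r \<in> Obj D then hat (Dom D r) r else 0)" using finite_obj by simp
  also have "\<dots> = \<one>\<^bsub>A\<^esub> r" using ide_mor by (auto simp: tw_alg_def hat_single)
  finally show ?thesis by simp
qed

lemma mult_sum_left: "((\<lambda>r. \<Sum>i\<in>I. f i r) \<otimes>\<^bsub>A\<^esub> a) r = (\<Sum>i\<in>I. (f i \<otimes>\<^bsub>A\<^esub> a) r)"
proof -
  have "((\<lambda>r. \<Sum>i\<in>I. f i r) \<otimes>\<^bsub>A\<^esub> a) r = (\<Sum>t\<in>Mor D. \<Sum>s\<in>Mor D. \<Sum>i\<in>I. f i t * a s * sconst t s r)"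
    by (simp add: mult_eq sum_distrib_right)
  also have "\<dots> = (\<Sum>t\<in>Mor D. \<Sum>i\<in>I. \<Sum>s\<in>Mor D. f i t * a s * sconst t s r)" by (intro sum.cong refl sum.swap)
  also have "\<dots> = (\<Sum>i\<in>I. (f i \<otimes>\<^bsub>A\<^esub> a) r)" unfolding mult_eq by (rule sum.swap)
  finally show ?thesis .
qed

lemma mult_sum_right: "(a \<otimes>\<^bsub>A\<^esub> (\<lambda>r. \<Sum>i\<in>I. f i r)) r = (\<Sum>i\<in>I. (a \<otimes>\<^bsub>A\<^esub> f i) r)"
proof -
  have "(a \<otimes>\<^bsub>A\<^esub> (\<lambda>r. \<Sum>i\<in>I. f i r)) r = (\<Sum>t\<in>Mor D. \<Sum>s\<in>Mor D. \<Sum>i\<in>I. a t * f i s * sconst t s r)"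
    by (simp add: mult_eq sum_distrib_left sum_distrib_right)
  also have "\<dots> = (\<Sum>t\<in>Mor D. \<Sum>i\<in>I. \<Sum>s\<in>Mor D. a t * f i s * sconst t s r)" by (intro sum.cong refl sum.swap)
  also have "\<dots> = (\<Sum>i\<in>I. (a \<otimes>\<^bsub>A\<^esub> f i) r)" unfolding mult_eq by (rule sum.swap)
  finally show ?thesis .
qed

lemma alg_ring: "ring A"
proof (rule ringI)
  show "abelian_group A"
  proof (rule abelian_groupI)
    show "\<exists>y\<in>carrier A. y \<oplus>\<^bsub>A\<^esub> x = \<zero>\<^bsub>A\<^esub>" if "x \<in> carrier A" for x
      using that by (intro bexI[of _ "\<lambda>s. - x s"]) (auto simp: span_of_def)
  qed (auto simp: span_of_def algebra_simps)
  have one: "\<one>\<^bsub>A\<^esub> = (\<lambda>r. \<Sum>X\<in>Obj D. hat X r)" using one_eq by blast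
  show "Group.monoid A"
  proof (rule monoidI)
    show "\<one>\<^bsub>A\<^esub> \<in> carrier A" using ide_mor by (auto simp: tw_alg_def span_of_def)
    show "\<one>\<^bsub>A\<^esub> \<otimes>\<^bsub>A\<^esub> x = x" if "x \<in> carrier A" for x
    proof
      fix r
      have "(\<one>\<^bsub>A\<^esub> \<otimes>\<^bsub>A\<^esub> x) r = (\<Sum>X\<in>Obj D. if X = Cod D r then (if r \<in> Mor D then x r else 0) else 0)"
        unfolding one mult_sum_left by (intro sum.cong) (auto simp: hat_mult)
      then show "(\<one>\<^bsub>A\<^esub> \<otimes>\<^bsub>A\<^esub> x) r = x r" using that finite_obj cod_closed by (auto simp: span_of_def)
    qed
    show "x \<otimes>\<^bsub>A\<^esub> \<one>\<^bsub>A\<^esub> = x" if "x \<in> carrier A" for x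
    proof
      fix r
      have "(x \<otimes>\<^bsub>A\<^esub> \<one>\<^bsub>A\<^esub>) r = (\<Sum>X\<in>Obj D. if X = Dom D r then (if r \<in> Mor D then x r else 0) else 0)"
        unfolding one mult_sum_right by (intro sum.cong) (auto simp: mult_hat)
      then show "(x \<otimes>\<^bsub>A\<^esub> \<one>\<^bsub>A\<^esub>) r = x r" using that finite_obj dom_closed by (auto simp: span_of_def)
    qed
  qed (auto simp: mult_span mult_assoc)
qed (auto simp: mult_eq algebra_simps sum.distrib intro!: ext)

sublocale ring A by (rule alg_ring)

lemma scale_mult: "(\<lambda>s. c * a s) \<otimes>\<^bsub>A\<^esub> b = (\<lambda>s. c * (a \<otimes>\<^bsub>A\<^esub> b) s)"
  by (rule ext) (simp add: mult_eq sum_distrib_left mult_ac)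

lemma mult_scale: "a \<otimes>\<^bsub>A\<^esub> (\<lambda>s. c * b s) = (\<lambda>s. c * (a \<otimes>\<^bsub>A\<^esub> b) s)"
  by (rule ext) (simp add: mult_eq sum_distrib_left mult_ac)

lemma map_mult:
  assumes \<sigma>: "\<And>x y. \<sigma> (x + y) = \<sigma> x + \<sigma> y" "\<And>x y. \<sigma> (x * y) = \<sigma> x * \<sigma> y" "\<sigma> 0 = 0"
    and fixed: "\<And>t s. \<lbrakk>t \<in> Mor D; s \<in> Mor D; Dom D t = Cod D s\<rbrakk> \<Longrightarrow> \<sigma> (\<alpha> t s) = \<alpha> t s"
  shows "\<sigma> \<circ> (a \<otimes>\<^bsub>A\<^esub> b) = (\<sigma> \<circ> a) \<otimes>\<^bsub>A\<^esub> (\<sigma> \<circ> b)"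
proof
  fix r
  have sum: "\<sigma> (\<Sum>i\<in>I. f i) = (\<Sum>i\<in>I. \<sigma> (f i))" for f :: "'m \<Rightarrow> 'k" and I
    by (induction I rule: infinite_finite_induct) (auto simp: \<sigma>)
  show "(\<sigma> \<circ> (a \<otimes>\<^bsub>A\<^esub> b)) r = ((\<sigma> \<circ> a) \<otimes>\<^bsub>A\<^esub> (\<sigma> \<circ> b)) r"
    by (auto simp: mult_eq sum \<sigma> sconst_def fixed intro!: sum.cong)
qed

end

section \<open>Weights of a twisted EI-category algebra\<close>

text \<open>The inverse in the definition of \<open>pair_iso\<close> can be moved to the other side: the same maps are
  semilinear with respect to \<open>\<phi>\<close>.\<close>

lemma lmod_iso_pull_inv_into:
  assumes b: "bij_betw \<phi> (carrier S) (carrier R)"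
  shows "lmod_iso R (pull_module (inv_into (carrier S) \<phi>) T) T' \<longleftrightarrow> lmod_iso S T (pull_module \<phi> T')"
proof -
  have "(\<forall>c\<in>carrier R. \<forall>v\<in>carrier T. h (inv_into (carrier S) \<phi> c \<odot>\<^bsub>T\<^esub> v) = c \<odot>\<^bsub>T'\<^esub> h v) \<longleftrightarrow>
    (\<forall>a\<in>carrier S. \<forall>v\<in>carrier T. h (a \<odot>\<^bsub>T\<^esub> v) = \<phi> a \<odot>\<^bsub>T'\<^esub> h v)" (is "?L \<longleftrightarrow> ?R") for h
  proof
    assume l: ?L
    show ?R
    proof (intro ballI)
      fix a v assume "a \<in> carrier S" "v \<in> carrier T"
      then show "h (a \<odot>\<^bsub>T\<^esub> v) = \<phi> a \<odot>\<^bsub>T'\<^esub> h v"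
        using l b bij_betwE[OF b] by (auto simp: bij_betw_inv_into_left[OF b] dest!: bspec[of _ _ "\<phi> a"])
    qed
  next
    assume r: ?R
    show ?L
    proof (intro ballI)
      fix c v assume "c \<in> carrier R" "v \<in> carrier T"
      then show "h (inv_into (carrier S) \<phi> c \<odot>\<^bsub>T\<^esub> v) = c \<odot>\<^bsub>T'\<^esub> h v"
        using r bij_betw_inv_into_right[OF b] bij_betwE[OF bij_betw_inv_into[OF b]] by auto
    qed
  qed
  then show ?thesis unfolding lmod_iso_iff by simp
qed

lemma lmod_iso_pull_cong:
  assumes "\<And>a. a \<in> carrier R \<Longrightarrow> \<theta> a = \<theta>' a"
  shows "lmod_iso R (pull_module \<theta> T) (pull_module \<theta>' T)"
  unfolding lmod_iso_iff by (rule exI[of _ "\<lambda>v. v"]) (auto simp: bij_betw_def assms)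

abbreviation ginv :: "('k \<Rightarrow> 'k) \<Rightarrow> 'k \<Rightarrow> 'k" where
  "ginv \<equiv> inv_into UNIV"

lemma galois_group_simps:
  assumes "\<sigma> \<in> galois_group"
  shows "\<sigma> (x + y) = \<sigma> x + \<sigma> y" "\<sigma> (x * y) = \<sigma> x * \<sigma> y" "\<sigma> 0 = 0" "\<sigma> 1 = 1"
    "x \<in> prime_subfield \<Longrightarrow> \<sigma> x = x" "bij \<sigma>" "ginv \<sigma> (\<sigma> z) = z" "\<sigma> (ginv \<sigma> z) = z"
proof -
  show "\<sigma> (x + y) = \<sigma> x + \<sigma> y" "\<sigma> (x * y) = \<sigma> x * \<sigma> y" "x \<in> prime_subfield \<Longrightarrow> \<sigma> x = x" "bij \<sigma>"
    using assms by (auto simp: galois_group_def)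
  have "(0::'a) \<in> prime_subfield" "(1::'a) \<in> prime_subfield"
    unfolding prime_subfield_def by (metis of_int_0 rangeI) (metis of_int_1 rangeI)
  then show "\<sigma> 0 = 0" "\<sigma> 1 = 1" using assms by (auto simp: galois_group_def)
  show "ginv \<sigma> (\<sigma> z) = z" "\<sigma> (ginv \<sigma> z) = z" using assms
    by (auto simp: galois_group_def bij_def surj_f_inv_f)
qed

lemma inv_galois_group: assumes "\<sigma> \<in> galois_group" shows "ginv \<sigma> \<in> galois_group"
proof -
  note s = galois_group_simps[OF assms]
  have "ginv \<sigma> (x + y) = ginv \<sigma> x + ginv \<sigma> y" for x y
    using s(7)[of "ginv \<sigma> x + ginv \<sigma> y"] by (simp add: s(1,8))
  moreover have "ginv \<sigma> (x * y) = ginv \<sigma> x * ginv \<sigma> y" for x y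
    using s(7)[of "ginv \<sigma> x * ginv \<sigma> y"] by (simp add: s(2,8))
  moreover have "ginv \<sigma> x = x" if "x \<in> prime_subfield" for x using s(5)[OF that] s(7)[of x] by simp
  ultimately show ?thesis using s(6) by (auto simp: galois_group_def bij_imp_bij_inv)
qed

lemma inv_inv_galois: "\<sigma> \<in> galois_group \<Longrightarrow> ginv (ginv \<sigma>) = \<sigma>"
  by (simp add: galois_group_def inv_inv_eq)

lemma gal_module_inv:
  fixes M :: "('m, 'k::field) kmod"
  assumes "\<sigma> \<in> galois_group"
  shows "gal_module \<sigma> (gal_module (ginv \<sigma>) M) = M" "gal_module (ginv \<sigma>) (gal_module \<sigma> M) = M"
proof -
  have inverse: "pull_module \<phi> (pull_module \<psi> M) = M" if "\<And>a. \<psi> (\<phi> a) = a"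
    for \<phi> \<psi> :: "('m \<Rightarrow> 'k) \<Rightarrow> 'm \<Rightarrow> 'k"
    unfolding pull_module_pull_module that by (rule pull_module_id)
  have e: "ginv \<sigma> \<circ> (ginv (ginv \<sigma>) \<circ> a) = a" "ginv (ginv \<sigma>) \<circ> (ginv \<sigma> \<circ> a) = a" for a :: "'m \<Rightarrow> 'k"
    unfolding inv_inv_galois[OF assms] using galois_group_simps(7,8)[OF assms] by (auto simp: fun_eq_iff)
  show "gal_module \<sigma> (gal_module (ginv \<sigma>) M) = M" "gal_module (ginv \<sigma>) (gal_module \<sigma> M) = M"
    unfolding gal_module_def by (rule inverse, rule e)+
qed

lemma gal_weight_inv:
  assumes "\<sigma> \<in> galois_group"
  shows "gal_weight \<sigma> (gal_weight (ginv \<sigma>) w) = w" "gal_weight (ginv \<sigma>) (gal_weight \<sigma> w) = w"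
  by (cases w, simp only: gal_weight_def prod.case gal_module_inv[OF assms])+

context twisted_category
begin

lemma mult_Hom:
  assumes "a \<in> span_of (Hom D Y Z)" "b \<in> span_of (Hom D X Y)"
  shows "a \<otimes>\<^bsub>A\<^esub> b \<in> span_of (Hom D X Z)"
  unfolding span_of_def
proof (intro CollectI allI impI)
  fix r assume r: "r \<notin> Hom D X Z"
  have z: "a t * b s * sconst t s r = 0" for t s
  proof (cases "t \<in> Hom D Y Z \<and> s \<in> Hom D X Y")
    case True then show ?thesis using r comp_Hom by (auto simp: sconst_def)
  qed (use assms in \<open>auto simp: span_of_def\<close>)
  show "(a \<otimes>\<^bsub>A\<^esub> b) r = 0" unfolding mult_eq by (intro sum.neutral ballI z)
qed

lemma hat_mult_Hom: "\<lbrakk>Y \<in> Obj D; a \<in> span_of (Hom D X Y)\<rbrakk> \<Longrightarrow> hat Y \<otimes>\<^bsub>A\<^esub> a = a"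
  by (rule ext) (auto simp: hat_mult span_of_def Hom_def)

lemma mult_hat_Hom: "\<lbrakk>X \<in> Obj D; a \<in> span_of (Hom D X Y)\<rbrakk> \<Longrightarrow> a \<otimes>\<^bsub>A\<^esub> hat X = a"
  by (rule ext) (auto simp: mult_hat span_of_def Hom_def)

lemma gal_ring_iso:
  assumes \<sigma>: "\<sigma> \<in> galois_group"
    and fp: "cocycle D (prime_subfield - {0}) \<alpha>"
  shows "(\<lambda>a. \<sigma> \<circ> a) \<in> ring_iso A A"
proof -
  note s = galois_group_simps[OF \<sigma>] and s' = galois_group_simps[OF inv_galois_group[OF \<sigma>]]
  have fixed: "\<sigma> (\<alpha> t s) = \<alpha> t s" if "t \<in> Mor D" "s \<in> Mor D" "Dom D t = Cod D s" for t s
    using fp s(5) that by (auto simp: cocycle_def)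
  have inv: "\<sigma> (inverse x) = inverse (\<sigma> x)" for x
  proof (cases "x = 0")
    case False
    then have "\<sigma> x * \<sigma> (inverse x) = 1" by (metis s(2,4) right_inverse)
    then show ?thesis by (metis inverse_unique)
  qed (simp add: s(3))
  show ?thesis
  proof (intro ring_iso_memI)
    show "\<sigma> \<circ> \<one>\<^bsub>A\<^esub> = \<one>\<^bsub>A\<^esub>"
    proof
      fix r show "(\<sigma> \<circ> \<one>\<^bsub>A\<^esub>) r = \<one>\<^bsub>A\<^esub> r"
        using ide_mor fixed by (auto simp: tw_alg_def s(3) inv)
    qed
    show "bij_betw (\<lambda>a. \<sigma> \<circ> a) (carrier A) (carrier A)"
      unfolding alg_simps
      by (rule bij_betwI[of _ _ _ "\<lambda>a. ginv \<sigma> \<circ> a"]) (auto simp: span_of_def s(3) s'(3) s(7,8))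
    show "\<sigma> \<circ> a \<oplus>\<^bsub>A\<^esub> b = (\<sigma> \<circ> a) \<oplus>\<^bsub>A\<^esub> (\<sigma> \<circ> b)" for a b
      unfolding alg_simps by (rule ext) (simp add: s(1))
    show "\<sigma> \<circ> a \<in> carrier A" if "a \<in> carrier A" for a
      using that by (simp add: span_of_def s(3))
    show "\<sigma> \<circ> a \<otimes>\<^bsub>A\<^esub> b = (\<sigma> \<circ> a) \<otimes>\<^bsub>A\<^esub> (\<sigma> \<circ> b)" for a b
      by (rule map_mult[OF s(1,2,3) fixed])
  qed
qed

end

locale twisted_ei_category = twisted_category D \<alpha> + ei_category D
  for D :: "('o, 'm) cat" (structure) and \<alpha> :: "'m \<Rightarrow> 'm \<Rightarrow> 'k::field"
begin

abbreviation B where "B X \<equiv> idem_alg D \<alpha> (Ide D X)"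

lemma idem_cat_twisted:
  assumes X: "X \<in> Obj D" shows "twisted_ei_category (idem_cat D (Ide D X)) \<alpha>"
proof -
  interpret I: ei_category "idem_cat D (Ide D X)" by (rule idem_cat_ei[OF X])
  have "cocycle (idem_cat D (Ide D X)) (- {0}) \<alpha>"
    using \<alpha>_nz \<alpha>_cocycle by (auto simp: cocycle_def idem_cat_simps[OF X])
  then show ?thesis by unfold_locales
qed

lemma idem_alg_simps:
  assumes X: "X \<in> Obj D"
  shows "carrier (B X) = span_of (Hom D X X)" "zero (B X) = (\<lambda>_. 0)" "\<And>a b. a \<oplus>\<^bsub>B X\<^esub> b = (\<lambda>s. a s + b s)"
    "one (B X) = hat X"
    "\<And>a b. \<lbrakk>a \<in> span_of (Hom D X X); b \<in> span_of (Hom D X X)\<rbrakk> \<Longrightarrow> a \<otimes>\<^bsub>B X\<^esub> b = a \<otimes>\<^bsub>A\<^esub> b"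
proof -
  interpret I: twisted_ei_category "idem_cat D (Ide D X)" \<alpha> by (rule idem_cat_twisted[OF X])
  note s = idem_cat_simps[OF X]
  show "carrier (B X) = span_of (Hom D X X)" "zero (B X) = (\<lambda>_. 0)" "\<And>a b. a \<oplus>\<^bsub>B X\<^esub> b = (\<lambda>s. a s + b s)"
    by (simp_all add: s)
  show "one (B X) = hat X" by (auto simp: tw_alg_def s hat_single fun_eq_iff)
  fix a b :: "'m \<Rightarrow> 'k" assume ab: "a \<in> span_of (Hom D X X)" "b \<in> span_of (Hom D X X)"
  show "a \<otimes>\<^bsub>B X\<^esub> b = a \<otimes>\<^bsub>A\<^esub> b"
  proof
    fix r
    have h: "Hom D X X \<subseteq> Mor D" by (auto simp: Hom_def)
    have "(a \<otimes>\<^bsub>B X\<^esub> b) r = (\<Sum>t\<in>Hom D X X. \<Sum>s\<in>Hom D X X. a t * b s * sconst t s r)"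
      unfolding I.mult_eq s by (intro sum.cong refl) (auto simp: I.sconst_def sconst_def s Hom_def)
    also have "\<dots> = (\<Sum>t\<in>Hom D X X. \<Sum>s\<in>Mor D. a t * b s * sconst t s r)"
      by (intro sum.cong refl sum.mono_neutral_left finite_mor h) (use ab in \<open>auto simp: span_of_def\<close>)
    also have "\<dots> = (\<Sum>t\<in>Mor D. \<Sum>s\<in>Mor D. a t * b s * sconst t s r)"
      by (intro sum.mono_neutral_left finite_mor h) (use ab in \<open>auto simp: span_of_def\<close>)
    finally show "(a \<otimes>\<^bsub>B X\<^esub> b) r = (a \<otimes>\<^bsub>A\<^esub> b) r" by (simp add: mult_eq)
  qed
qed

lemma idem_alg_ring: "X \<in> Obj D \<Longrightarrow> ring (B X)"
  using twisted_category.alg_ring idem_cat_twisted twisted_ei_category.axioms(1) by blast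

lemma idem_iso_by_iff:
  assumes X: "X \<in> Obj D" and Y: "Y \<in> Obj D"
  shows "idem_iso_by D (Ide D X) (Ide D Y) s t \<longleftrightarrow> inverse_mors X Y s t"
proof -
  have d: "Dom D (Ide D X) = X" "Dom D (Ide D Y) = Y" using ide_mor X Y by auto
  have "{Ide D Y \<cdot> x \<cdot> Ide D X | x. x \<in> Hom D X Y} = Hom D X Y" for X Y
  proof -
    have "Ide D Y \<cdot> x \<cdot> Ide D X = x" if "x \<in> Hom D X Y" for x using that Hom_ide by metis
    then show ?thesis by force
  qed
  then show ?thesis by (simp add: idem_iso_by_def inverse_mors_def d)
qed

text \<open>How a scalar is distributed between the two factors does not matter, only the product of \<open>c\<close>
  and \<open>d\<close> does; this freedom makes the composition of transfers computable.\<close>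

lemma transfer_eq:
  assumes i: "inverse_mors X Y s t" and cd: "c * d * (\<alpha> t s * \<alpha> (Ide D X) (Ide D X)) = 1"
    and a: "a \<in> span_of (Hom D X X)"
  shows "idem_transfer D \<alpha> (Ide D X) s t a = single s c \<otimes>\<^bsub>A\<^esub> (a \<otimes>\<^bsub>A\<^esub> single t d)"
proof
  fix y
  note h = inverse_morsD[OF i]
  have k: "inverse (\<alpha> (Ide D X) (Ide D X)) * inverse (\<alpha> t s) = c * d"
    using inverse_unique[of "\<alpha> t s * \<alpha> (Ide D X) (Ide D X)" "c * d"] cd by (simp add: mult_ac inverse_mult_distrib)
  have r: "(single s c \<otimes>\<^bsub>A\<^esub> (a \<otimes>\<^bsub>A\<^esub> single t d)) y =
      (if y \<in> Hom D Y Y then c * (a (t \<cdot> y \<cdot> s) * d * \<alpha> (t \<cdot> y \<cdot> s) t) * \<alpha> s (t \<cdot> y) else 0)"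
  proof (cases "y \<in> Mor D \<and> Cod D y = Y")
    case True
    then have y: "y \<in> Hom D (Dom D y) Y" by (simp add: Hom_def)
    note c = comp_Hom[OF h(2) y]
    show ?thesis unfolding single_mult_iso[OF i] mult_single_iso[OF inverse_mors_sym[OF i]]
      using True HomD(1,2)[OF c] by (auto simp: Hom_def)
  qed (auto simp: single_mult_iso[OF i] Hom_def)
  have set: "{x. x \<in> Hom D X X \<and> s \<cdot> (x \<cdot> t) = y} = (if y \<in> Hom D Y Y then {t \<cdot> y \<cdot> s} else {})"
  proof (cases "y \<in> Hom D Y Y")
    case True
    have "x = t \<cdot> y \<cdot> s" if "x \<in> Hom D X X" "s \<cdot> (x \<cdot> t) = y" for x
    proof -
      have "t \<cdot> y = x \<cdot> t" using inverse_mors_cancel(1)[OF i comp_Hom[OF that(1) h(2)]] that(2) by simp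
      then show ?thesis using inverse_mors_cancel(4)[OF i that(1)] by simp
    qed
    moreover have "s \<cdot> (t \<cdot> y \<cdot> s \<cdot> t) = y"
      using inverse_mors_cancel(3)[OF i comp_Hom[OF h(2) True]] inverse_mors_cancel(2)[OF i True] by simp
    moreover have "t \<cdot> y \<cdot> s \<in> Hom D X X" using comp_Hom[OF comp_Hom[OF h(2) True] h(1)] .
    ultimately have "{x. x \<in> Hom D X X \<and> s \<cdot> (x \<cdot> t) = y} = {t \<cdot> y \<cdot> s}" by blast
    then show ?thesis using True by simp
  next
    case False
    have "s \<cdot> (x \<cdot> t) \<in> Hom D Y Y" if "x \<in> Hom D X X" for x using that comp_Hom h by blast
    then show ?thesis using False by auto
  qed
  have car: "carrier (idem_group D (Ide D X)) = Hom D X X" using idem_group_ide h by simp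
  show "idem_transfer D \<alpha> (Ide D X) s t a y = (single s c \<otimes>\<^bsub>A\<^esub> (a \<otimes>\<^bsub>A\<^esub> single t d)) y"
  proof (cases "y \<in> Hom D Y Y")
    case True
    have "t \<cdot> y \<cdot> s \<cdot> t = t \<cdot> y" using inverse_mors_cancel(3)[OF i comp_Hom[OF h(2) True]] .
    then show ?thesis using True by (simp add: idem_transfer_def car set r mult_ac flip: k)
  qed (simp add: idem_transfer_def car set r)
qed

text \<open>\<open>idem_transfer\<close> is conjugation by mutually inverse elements \<open>S\<close> and \<open>T\<close> of the algebra.\<close>

lemma transfer_conj:
  assumes i: "inverse_mors X Y s t"
  obtains S T where "S \<in> span_of (Hom D X Y)" "T \<in> span_of (Hom D Y X)"
    "T \<otimes>\<^bsub>A\<^esub> S = hat X" "S \<otimes>\<^bsub>A\<^esub> T = hat Y" "S = single s 1"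
    "\<And>a. a \<in> span_of (Hom D X X) \<Longrightarrow> idem_transfer D \<alpha> (Ide D X) s t a = S \<otimes>\<^bsub>A\<^esub> (a \<otimes>\<^bsub>A\<^esub> T)"
    "\<And>a. a \<in> span_of (Hom D Y Y) \<Longrightarrow> idem_transfer D \<alpha> (Ide D Y) t s a = T \<otimes>\<^bsub>A\<^esub> (a \<otimes>\<^bsub>A\<^esub> S)"
proof -
  note h = inverse_morsD[OF i]
  let ?e = "\<alpha> (Ide D X) (Ide D X)" and ?f = "\<alpha> (Ide D Y) (Ide D Y)"
  have nz: "?e \<noteq> 0" "?f \<noteq> 0" "\<alpha> t s \<noteq> 0" "\<alpha> s t \<noteq> 0" using \<alpha>_nz h ide_Hom by blast+
  \<comment> \<open>The scalar for which the product of \<open>T\<close> and \<open>S\<close> is the normalised identity.\<close>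
  define d where "d = inverse (\<alpha> t s * ?e)"
  define S where "S = single s (1::'k)"
  define T where "T = single t d"
  have S: "S \<in> span_of (Hom D X Y)" and T: "T \<in> span_of (Hom D Y X)"
    using h by (auto simp: S_def T_def span_of_def)
  have TS: "T \<otimes>\<^bsub>A\<^esub> S = hat X"
    unfolding S_def T_def single_mult_single[OF h(2,1)] hat_single h(3) using nz by (simp add: d_def field_simps)
  have ST': "S \<otimes>\<^bsub>A\<^esub> T = single (Ide D Y) (d * \<alpha> s t)"
    unfolding S_def T_def single_mult_single[OF h(1,2)] h(4) by simp
  have d2: "d * 1 * (\<alpha> s t * ?f) = 1"
  proof -
    have "S \<otimes>\<^bsub>A\<^esub> T \<otimes>\<^bsub>A\<^esub> S = S" using mult_hat_Hom[OF h(5) S] by (simp add: mult_assoc TS)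
    then have "single (Ide D Y) (d * \<alpha> s t) \<otimes>\<^bsub>A\<^esub> S = S" unfolding ST' .
    then have "single s (d * \<alpha> s t * ?f) = single s (1::'k)"
      unfolding S_def single_mult_single[OF ide_Hom[OF h(6)] h(1)]
      using Hom_ide(2)[OF h(1)] \<alpha>_ide_left[OF h(1)] by simp
    then have "d * \<alpha> s t * ?f = 1" by (metis fun_upd_same)
    then show ?thesis by (simp add: mult.assoc)
  qed
  then have "inverse ?f = d * \<alpha> s t" by (intro inverse_unique) (simp add: ac_simps)
  then have ST: "S \<otimes>\<^bsub>A\<^esub> T = hat Y" unfolding ST' hat_single by simp
  have d1: "1 * d * (\<alpha> t s * ?e) = 1" using nz by (simp add: d_def del: inverse_mult_distrib)
  show ?thesis
    using that[OF S T TS ST S_def] transfer_eq[OF i d1] transfer_eq[OF inverse_mors_sym[OF i] d2]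
    unfolding S_def T_def by blast
qed

lemma transfer_in: "\<lbrakk>inverse_mors X Y s t; a \<in> span_of (Hom D X X)\<rbrakk> \<Longrightarrow>
   idem_transfer D \<alpha> (Ide D X) s t a \<in> span_of (Hom D Y Y)"
  by (metis transfer_conj mult_Hom)

lemma transfer_inverse:
  assumes i: "inverse_mors X Y s t" and a: "a \<in> span_of (Hom D X X)"
  shows "idem_transfer D \<alpha> (Ide D Y) t s (idem_transfer D \<alpha> (Ide D X) s t a) = a"
proof -
  note h = inverse_morsD[OF i]
  obtain S T where ST: "S \<in> span_of (Hom D X Y)" "T \<in> span_of (Hom D Y X)"
    "T \<otimes>\<^bsub>A\<^esub> S = hat X" "S \<otimes>\<^bsub>A\<^esub> T = hat Y"
    "\<And>a. a \<in> span_of (Hom D X X) \<Longrightarrow> idem_transfer D \<alpha> (Ide D X) s t a = S \<otimes>\<^bsub>A\<^esub> (a \<otimes>\<^bsub>A\<^esub> T)"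
    "\<And>a. a \<in> span_of (Hom D Y Y) \<Longrightarrow> idem_transfer D \<alpha> (Ide D Y) t s a = T \<otimes>\<^bsub>A\<^esub> (a \<otimes>\<^bsub>A\<^esub> S)"
    using transfer_conj[OF i] by metis
  have "T \<otimes>\<^bsub>A\<^esub> ((S \<otimes>\<^bsub>A\<^esub> (a \<otimes>\<^bsub>A\<^esub> T)) \<otimes>\<^bsub>A\<^esub> S) = (T \<otimes>\<^bsub>A\<^esub> S) \<otimes>\<^bsub>A\<^esub> (a \<otimes>\<^bsub>A\<^esub> (T \<otimes>\<^bsub>A\<^esub> S))"
    by (simp only: mult_assoc)
  also have "\<dots> = a" using a h by (simp add: ST(3) mult_hat_Hom hat_mult_Hom)
  finally show ?thesis using ST(5)[OF a] ST(6)[OF transfer_in[OF i a]] by simp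
qed

lemma transfer_bij:
  assumes i: "inverse_mors X Y s t"
  shows "bij_betw (idem_transfer D \<alpha> (Ide D X) s t) (span_of (Hom D X X)) (span_of (Hom D Y Y))"
  by (rule bij_betwI[of _ _ _ "idem_transfer D \<alpha> (Ide D Y) t s"])
     (auto simp: transfer_in[OF i] transfer_in[OF inverse_mors_sym[OF i]] transfer_inverse[OF i]
        transfer_inverse[OF inverse_mors_sym[OF i]])

lemma transfer_ring_iso:
  assumes i: "inverse_mors X Y s t"
  shows "idem_transfer D \<alpha> (Ide D X) s t \<in> ring_iso (B X) (B Y)"
proof -
  note h = inverse_morsD[OF i]
  note sX = idem_alg_simps[OF h(5)] and sY = idem_alg_simps[OF h(6)]
  obtain S T where ST: "S \<in> span_of (Hom D X Y)" "T \<in> span_of (Hom D Y X)"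
    "T \<otimes>\<^bsub>A\<^esub> S = hat X" "S \<otimes>\<^bsub>A\<^esub> T = hat Y"
    "\<And>a. a \<in> span_of (Hom D X X) \<Longrightarrow> idem_transfer D \<alpha> (Ide D X) s t a = S \<otimes>\<^bsub>A\<^esub> (a \<otimes>\<^bsub>A\<^esub> T)"
    using transfer_conj[OF i] by metis
  have m: "idem_transfer D \<alpha> (Ide D X) s t (a \<otimes>\<^bsub>A\<^esub> b)
      = idem_transfer D \<alpha> (Ide D X) s t a \<otimes>\<^bsub>A\<^esub> idem_transfer D \<alpha> (Ide D X) s t b"
    if ab: "a \<in> span_of (Hom D X X)" "b \<in> span_of (Hom D X X)" for a b
  proof -
    have "(S \<otimes>\<^bsub>A\<^esub> (a \<otimes>\<^bsub>A\<^esub> T)) \<otimes>\<^bsub>A\<^esub> (S \<otimes>\<^bsub>A\<^esub> (b \<otimes>\<^bsub>A\<^esub> T)) = S \<otimes>\<^bsub>A\<^esub> (a \<otimes>\<^bsub>A\<^esub> ((T \<otimes>\<^bsub>A\<^esub> S) \<otimes>\<^bsub>A\<^esub> (b \<otimes>\<^bsub>A\<^esub> T)))"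
      by (simp only: mult_assoc)
    also have "\<dots> = S \<otimes>\<^bsub>A\<^esub> (a \<otimes>\<^bsub>A\<^esub> b \<otimes>\<^bsub>A\<^esub> T)"
      using hat_mult_Hom[OF h(5) mult_Hom[OF ab(2) ST(2)]] by (simp add: ST(3) mult_assoc)
    finally show ?thesis using ST(5) ab mult_Hom[OF ab] by simp
  qed
  have o: "idem_transfer D \<alpha> (Ide D X) s t (hat X) = hat Y"
    using ST(5)[OF hat_in[OF h(5)]] ST(4) hat_mult_Hom[OF h(5) ST(2)] by simp
  have p: "idem_transfer D \<alpha> (Ide D X) s t (\<lambda>r. a r + b r)
      = (\<lambda>r. idem_transfer D \<alpha> (Ide D X) s t a r + idem_transfer D \<alpha> (Ide D X) s t b r)" for a b
    by (simp add: idem_transfer_def distrib_right sum.distrib)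
  show ?thesis
  proof (intro ring_iso_memI)
    fix a b assume a: "a \<in> carrier (B X)"
    then show "idem_transfer D \<alpha> (Ide D X) s t a \<in> carrier (B Y)" using transfer_in[OF i] by (simp only: sX(1) sY(1))
    assume b: "b \<in> carrier (B X)"
    show "idem_transfer D \<alpha> (Ide D X) s t (a \<oplus>\<^bsub>B X\<^esub> b) = idem_transfer D \<alpha> (Ide D X) s t a \<oplus>\<^bsub>B Y\<^esub> idem_transfer D \<alpha> (Ide D X) s t b"
      by (simp only: sX(3) sY(3) p)
    show "idem_transfer D \<alpha> (Ide D X) s t (a \<otimes>\<^bsub>B X\<^esub> b) = idem_transfer D \<alpha> (Ide D X) s t a \<otimes>\<^bsub>B Y\<^esub> idem_transfer D \<alpha> (Ide D X) s t b"
      using a b m[of a b] sX(5)[of a b] sY(5)[OF transfer_in[OF i] transfer_in[OF i], of a b] by (simp only: sX(1))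
  qed (simp_all only: sX(1,4) sY(1,4) o transfer_bij[OF i])
qed

lemma transfer_ide:
  assumes X: "X \<in> Obj D" and a: "a \<in> span_of (Hom D X X)"
  shows "idem_transfer D \<alpha> (Ide D X) (Ide D X) (Ide D X) a = a"
proof -
  let ?e = "\<alpha> (Ide D X) (Ide D X)"
  have nz: "?e \<noteq> 0" using \<alpha>_nz ide_Hom X by blast
  have "single (Ide D X) (inverse ?e) \<otimes>\<^bsub>A\<^esub> (a \<otimes>\<^bsub>A\<^esub> single (Ide D X) (inverse ?e)) = a"
    using hat_mult_Hom[OF X a] mult_hat_Hom[OF X a] by (simp add: hat_single)
  moreover have "inverse ?e * inverse ?e * (?e * ?e) = 1" using nz by (simp add: field_simps)
  ultimately show ?thesis using transfer_eq[OF inverse_mors_ide[OF X] _ a] by metis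
qed

text \<open>The pair of scalars obtained by composing the two conjugations satisfies the normalisation of
  \<open>transfer_eq\<close> for the composite, because it again consists of mutually inverse elements.\<close>

lemma transfer_comp:
  assumes i: "inverse_mors X Y s t" and i': "inverse_mors Y Z s' t'" and a: "a \<in> span_of (Hom D X X)"
  shows "idem_transfer D \<alpha> (Ide D Y) s' t' (idem_transfer D \<alpha> (Ide D X) s t a)
    = idem_transfer D \<alpha> (Ide D X) (s' \<cdot> s) (t \<cdot> t') a"
proof -
  note h = inverse_morsD[OF i] and h' = inverse_morsD[OF i']
  let ?e = "\<alpha> (Ide D X) (Ide D X)" and ?f = "\<alpha> (Ide D Y) (Ide D Y)"
  have nz: "?e \<noteq> 0" "?f \<noteq> 0" "\<alpha> t s \<noteq> 0" "\<alpha> t' s' \<noteq> 0" using \<alpha>_nz h h' ide_Hom by blast+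
  define d where "d = inverse (\<alpha> t s * ?e)"
  define d' where "d' = inverse (\<alpha> t' s' * ?f)"
  have d1: "1 * d * (\<alpha> t s * ?e) = 1" "1 * d' * (\<alpha> t' s' * ?f) = 1" using nz by (simp_all add: d_def d'_def del: inverse_mult_distrib)
  have ss: "single s' 1 \<otimes>\<^bsub>A\<^esub> single s 1 = single (s' \<cdot> s) (\<alpha> s' s)"
    and tt: "single t d \<otimes>\<^bsub>A\<^esub> single t' d' = single (t \<cdot> t') (d * d' * \<alpha> t t')"
    using single_mult_single h h' by (simp, blast)
  have "single t d \<otimes>\<^bsub>A\<^esub> single t' d' \<otimes>\<^bsub>A\<^esub> (single s' 1 \<otimes>\<^bsub>A\<^esub> single s 1) = hat X"
  proof -
    have "single t' d' \<otimes>\<^bsub>A\<^esub> single s' 1 = hat Y"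
      unfolding single_mult_single[OF h'(2,1)] h'(3) hat_single using nz by (simp add: d'_def field_simps)
    moreover have "single t d \<otimes>\<^bsub>A\<^esub> single s 1 = hat X"
      unfolding single_mult_single[OF h(2,1)] h(3) hat_single using nz by (simp add: d_def field_simps)
    moreover have "hat Y \<otimes>\<^bsub>A\<^esub> single s 1 = single s 1"
      by (rule hat_mult_Hom[OF h(6)]) (use h(1) in \<open>auto simp: span_of_def\<close>)
    moreover have "single t d \<otimes>\<^bsub>A\<^esub> single t' d' \<otimes>\<^bsub>A\<^esub> (single s' 1 \<otimes>\<^bsub>A\<^esub> single s 1)
      = single t d \<otimes>\<^bsub>A\<^esub> ((single t' d' \<otimes>\<^bsub>A\<^esub> single s' 1) \<otimes>\<^bsub>A\<^esub> single s 1)" by (simp only: mult_assoc)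
    ultimately show ?thesis by simp
  qed
  then have "single (Ide D X) (d * d' * \<alpha> t t' * \<alpha> s' s * \<alpha> (t \<cdot> t') (s' \<cdot> s)) = single (Ide D X) (inverse ?e)"
    unfolding ss tt single_mult_single[OF comp_Hom[OF h(2) h'(2)] comp_Hom[OF h'(1) h(1)]]
      inverse_morsD(3)[OF inverse_mors_comp[OF i i']] hat_single .
  then have "d * d' * \<alpha> t t' * \<alpha> s' s * \<alpha> (t \<cdot> t') (s' \<cdot> s) = inverse ?e" by (metis fun_upd_same)
  then have cd: "\<alpha> s' s * (d * d' * \<alpha> t t') * (\<alpha> (t \<cdot> t') (s' \<cdot> s) * ?e) = 1"
    using nz by (simp add: field_simps)
  have "idem_transfer D \<alpha> (Ide D Y) s' t' (idem_transfer D \<alpha> (Ide D X) s t a)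
     = single s' 1 \<otimes>\<^bsub>A\<^esub> ((single s 1 \<otimes>\<^bsub>A\<^esub> (a \<otimes>\<^bsub>A\<^esub> single t d)) \<otimes>\<^bsub>A\<^esub> single t' d')"
    using transfer_eq[OF i' d1(2) transfer_in[OF i a]] transfer_eq[OF i d1(1) a] by simp
  also have "\<dots> = (single s' 1 \<otimes>\<^bsub>A\<^esub> single s 1) \<otimes>\<^bsub>A\<^esub> (a \<otimes>\<^bsub>A\<^esub> (single t d \<otimes>\<^bsub>A\<^esub> single t' d'))"
    by (simp only: mult_assoc)
  finally show ?thesis using transfer_eq[OF inverse_mors_comp[OF i i'] cd a] by (simp add: ss tt)
qed

lemma pair_iso_iff:
  assumes X: "X \<in> Obj D" and Y: "Y \<in> Obj D"
  shows "pair_iso D \<alpha> (Ide D X, T) (Ide D Y, T') \<longleftrightarrow>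
    (\<exists>s t. inverse_mors X Y s t \<and> lmod_iso (B X) T (pull_module (idem_transfer D \<alpha> (Ide D X) s t) T'))"
proof -
  have "lmod_iso (B Y) (pull_module (inv_into (carrier (B X)) (idem_transfer D \<alpha> (Ide D X) s t)) T) T' \<longleftrightarrow>
     lmod_iso (B X) T (pull_module (idem_transfer D \<alpha> (Ide D X) s t) T')" if "inverse_mors X Y s t" for s t
    by (rule lmod_iso_pull_inv_into) (use transfer_bij[OF that] in \<open>simp add: idem_alg_simps X Y\<close>)
  then show ?thesis by (auto simp: pair_iso_def idem_iso_by_iff[OF X Y])
qed

lemma is_weight_iff:
  "is_weight D \<alpha> (e, T) \<longleftrightarrow> (\<exists>X\<in>Obj D. e = Ide D X \<and> simple_lmod (B X) T \<and> projective_lmod (B X) T)"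
  by (auto simp: is_weight_def idem_endo_iff)

lemma pair_iso_refl: "is_weight D \<alpha> w \<Longrightarrow> pair_iso D \<alpha> w w"
proof (cases w)
  case (Pair e T)
  assume "is_weight D \<alpha> w"
  then obtain X where X: "X \<in> Obj D" "e = Ide D X" by (auto simp: is_weight_iff Pair)
  have "lmod_iso (B X) (pull_module (\<lambda>a. a) T) (pull_module (idem_transfer D \<alpha> (Ide D X) (Ide D X) (Ide D X)) T)"
    by (rule lmod_iso_pull_cong) (use X in \<open>simp add: idem_alg_simps transfer_ide\<close>)
  then show ?thesis using X inverse_mors_ide[OF X(1)] by (auto simp: Pair pair_iso_iff pull_module_id)
qed

lemma pair_iso_sym:
  assumes w: "is_weight D \<alpha> w" "is_weight D \<alpha> w'" and p: "pair_iso D \<alpha> w w'"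
  shows "pair_iso D \<alpha> w' w"
proof (cases w, cases w')
  fix e T f T' assume e: "w = (e, T)" and f: "w' = (f, T')"
  obtain X where X: "X \<in> Obj D" "e = Ide D X" "simple_lmod (B X) T" using w e by (auto simp: is_weight_iff)
  obtain Y where Y: "Y \<in> Obj D" "f = Ide D Y" using w f by (auto simp: is_weight_iff)
  obtain s t where i: "inverse_mors X Y s t"
     and l: "lmod_iso (B X) T (pull_module (idem_transfer D \<alpha> (Ide D X) s t) T')"
    using p by (auto simp: e f X Y pair_iso_iff[OF X(1) Y(1)])
  let ?\<psi> = "idem_transfer D \<alpha> (Ide D Y) t s"
  have "lmod_iso (B Y) (pull_module ?\<psi> (pull_module (idem_transfer D \<alpha> (Ide D X) s t) T')) (pull_module ?\<psi> T)"
    by (rule lmod_iso_pull[OF lmod_iso_sym[OF l simple_lmodD(1)[OF X(3)]]])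
       (use transfer_in[OF inverse_mors_sym[OF i]] X Y in \<open>simp add: idem_alg_simps\<close>)
  moreover have "lmod_iso (B Y) (pull_module (\<lambda>a. a) T')
      (pull_module ?\<psi> (pull_module (idem_transfer D \<alpha> (Ide D X) s t) T'))"
    unfolding pull_module_pull_module
    by (rule lmod_iso_pull_cong) (use transfer_inverse[OF inverse_mors_sym[OF i]] Y in \<open>simp add: idem_alg_simps\<close>)
  ultimately have "lmod_iso (B Y) T' (pull_module ?\<psi> T)" using lmod_iso_trans by (metis pull_module_id)
  then show ?thesis using inverse_mors_sym[OF i] X Y by (auto simp: e f pair_iso_iff)
qed

lemma pair_iso_trans:
  assumes w: "is_weight D \<alpha> w" "is_weight D \<alpha> w'" "is_weight D \<alpha> w''"
    and p: "pair_iso D \<alpha> w w'" "pair_iso D \<alpha> w' w''"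
  shows "pair_iso D \<alpha> w w''"
proof (cases w, cases w', cases w'')
  fix e T f T' g T'' assume e: "w = (e, T)" and f: "w' = (f, T')" and g: "w'' = (g, T'')"
  obtain X where X: "X \<in> Obj D" "e = Ide D X" using w e by (auto simp: is_weight_iff)
  obtain Y where Y: "Y \<in> Obj D" "f = Ide D Y" using w f by (auto simp: is_weight_iff)
  obtain Z where Z: "Z \<in> Obj D" "g = Ide D Z" using w g by (auto simp: is_weight_iff)
  obtain s t where i: "inverse_mors X Y s t"
     and l: "lmod_iso (B X) T (pull_module (idem_transfer D \<alpha> (Ide D X) s t) T')"
    using p(1) by (auto simp: e f X Y pair_iso_iff[OF X(1) Y(1)])
  obtain s' t' where i': "inverse_mors Y Z s' t'"
     and l': "lmod_iso (B Y) T' (pull_module (idem_transfer D \<alpha> (Ide D Y) s' t') T'')"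
    using p(2) by (auto simp: g f Z Y pair_iso_iff[OF Y(1) Z(1)])
  have "lmod_iso (B X) (pull_module (idem_transfer D \<alpha> (Ide D X) s t) T')
     (pull_module (idem_transfer D \<alpha> (Ide D X) s t) (pull_module (idem_transfer D \<alpha> (Ide D Y) s' t') T''))"
    by (rule lmod_iso_pull[OF l']) (use transfer_in[OF i] X Y in \<open>simp add: idem_alg_simps\<close>)
  moreover have "lmod_iso (B X)
     (pull_module (idem_transfer D \<alpha> (Ide D X) s t) (pull_module (idem_transfer D \<alpha> (Ide D Y) s' t') T''))
     (pull_module (idem_transfer D \<alpha> (Ide D X) (s' \<cdot> s) (t \<cdot> t')) T'')"
    unfolding pull_module_pull_module
    by (rule lmod_iso_pull_cong) (use transfer_comp[OF i i'] X in \<open>simp add: idem_alg_simps\<close>)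
  ultimately have "lmod_iso (B X) T (pull_module (idem_transfer D \<alpha> (Ide D X) (s' \<cdot> s) (t \<cdot> t')) T'')"
    using l lmod_iso_trans by blast
  then show ?thesis using inverse_mors_comp[OF i i'] X Z by (auto simp: e g pair_iso_iff)
qed

text \<open>Simplicity and projectivity are carried along the ring isomorphism given by the transfer, so a
  weight has an isomorphic copy at every object isomorphic to its own.\<close>

lemma weight_transport:
  assumes w: "is_weight D \<alpha> (Ide D Y, T)" and i: "inverse_mors X Y s t"
  defines "T0 \<equiv> pull_module (idem_transfer D \<alpha> (Ide D X) s t) T"
  shows "is_weight D \<alpha> (Ide D X, T0)" "pair_iso D \<alpha> (Ide D X, T0) (Ide D Y, T)"
proof -
  note h = inverse_morsD[OF i]
  have "simple_lmod (B Y) T" "projective_lmod (B Y) T" using w by (auto simp: is_weight_def)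
  then show "is_weight D \<alpha> (Ide D X, T0)" unfolding T0_def is_weight_iff using h(5)
    simple_lmod_pull[OF transfer_ring_iso[OF i] idem_alg_ring[OF h(5)]]
    projective_lmod_pull[OF transfer_ring_iso[OF i] idem_alg_ring[OF h(5)] idem_alg_ring[OF h(6)]] by blast
  show "pair_iso D \<alpha> (Ide D X, T0) (Ide D Y, T)"
    unfolding pair_iso_iff[OF h(5,6)] T0_def using i lmod_iso_refl by blast
qed

end

locale fp_twisted_ei_category = twisted_ei_category D \<alpha>
  for D :: "('o, 'm) cat" (structure) and \<alpha> :: "'m \<Rightarrow> 'm \<Rightarrow> 'k::field" +
  assumes fp: "cocycle D (prime_subfield - {0}) \<alpha>"
begin

lemma idem_cat_fp: assumes X: "X \<in> Obj D" shows "cocycle (idem_cat D (Ide D X)) (prime_subfield - {0}) \<alpha>"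
  using fp by (auto simp: cocycle_def idem_cat_simps[OF X] Hom_def)

lemma gal_idem_ring_iso:
  assumes \<sigma>: "\<sigma> \<in> galois_group" and X: "X \<in> Obj D"
  shows "(\<lambda>a. ginv \<sigma> \<circ> a) \<in> ring_iso (B X) (B X)"
proof -
  interpret I: twisted_ei_category "idem_cat D (Ide D X)" \<alpha> by (rule idem_cat_twisted[OF X])
  show ?thesis using I.gal_ring_iso[OF inv_galois_group[OF \<sigma>] idem_cat_fp[OF X]] .
qed

text \<open>The transfer is conjugation by elements whose coefficients are built from values of the cocycle,
  which lie in the prime field and are fixed by \<open>\<sigma>\<close>.\<close>

lemma gal_transfer:
  assumes \<sigma>: "\<sigma> \<in> galois_group" and i: "inverse_mors X Y s t" and a: "a \<in> span_of (Hom D X X)"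
  shows "\<sigma> \<circ> idem_transfer D \<alpha> (Ide D X) s t a = idem_transfer D \<alpha> (Ide D X) s t (\<sigma> \<circ> a)"
proof -
  note h = inverse_morsD[OF i] and g = galois_group_simps[OF \<sigma>]
  have fixed: "\<sigma> (\<alpha> t s) = \<alpha> t s" if "t \<in> Mor D" "s \<in> Mor D" "Dom D t = Cod D s" for t s
    using fp g(5) that by (auto simp: cocycle_def)
  have ga: "\<sigma> \<circ> a \<in> span_of (Hom D X X)" using a by (auto simp: span_of_def g)
  let ?e = "\<alpha> (Ide D X) (Ide D X)"
  have nz: "?e \<noteq> 0" "\<alpha> t s \<noteq> 0" using \<alpha>_nz h ide_Hom by blast+
  define d where "d = inverse (\<alpha> t s * ?e)"
  have d1: "1 * d * (\<alpha> t s * ?e) = 1" using nz by (simp add: d_def del: inverse_mult_distrib)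
  have d: "\<sigma> d = d"
  proof -
    have "\<sigma> (d * (\<alpha> t s * ?e)) = 1" using d1 g(4) by simp
    then have "\<sigma> d * (\<alpha> t s * ?e) = 1" using fixed HomD h ide_mor by (simp add: g(2))
    then show ?thesis using d1 by (metis mult_cancel_right mult_1 nz no_zero_divisors)
  qed
  have "\<sigma> \<circ> single s 1 = single s 1" "\<sigma> \<circ> single t d = single t d" using g d by (auto simp: fun_eq_iff)
  then show ?thesis unfolding transfer_eq[OF i d1 a] transfer_eq[OF i d1 ga]
    by (simp add: map_mult[of \<sigma>, OF g(1,2,3) fixed])
qed

lemma gal_is_weight:
  assumes \<sigma>: "\<sigma> \<in> galois_group" and w: "is_weight D \<alpha> w" shows "is_weight D \<alpha> (gal_weight \<sigma> w)"
proof (cases w)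
  case (Pair e T)
  then obtain X where X: "X \<in> Obj D" "e = Ide D X" "simple_lmod (B X) T" "projective_lmod (B X) T"
    using w by (auto simp: is_weight_iff)
  then show ?thesis
    using simple_lmod_pull[OF gal_idem_ring_iso[OF \<sigma> X(1)] idem_alg_ring[OF X(1)] X(3)]
      projective_lmod_pull[OF gal_idem_ring_iso[OF \<sigma> X(1)] idem_alg_ring[OF X(1)] idem_alg_ring[OF X(1)] X(4)]
    by (auto simp: Pair gal_weight_def gal_module_def is_weight_iff)
qed

lemma gal_pair_iso:
  assumes \<sigma>: "\<sigma> \<in> galois_group" and w: "is_weight D \<alpha> w" "is_weight D \<alpha> w'" and p: "pair_iso D \<alpha> w w'"
  shows "pair_iso D \<alpha> (gal_weight \<sigma> w) (gal_weight \<sigma> w')"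
proof (cases w, cases w')
  fix e T f T' assume e: "w = (e, T)" and f: "w' = (f, T')"
  obtain X where X: "X \<in> Obj D" "e = Ide D X" using w e by (auto simp: is_weight_iff)
  obtain Y where Y: "Y \<in> Obj D" "f = Ide D Y" using w f by (auto simp: is_weight_iff)
  obtain s t where i: "inverse_mors X Y s t"
     and l: "lmod_iso (B X) T (pull_module (idem_transfer D \<alpha> (Ide D X) s t) T')"
    using p by (auto simp: e f X Y pair_iso_iff[OF X(1) Y(1)])
  let ?\<phi> = "idem_transfer D \<alpha> (Ide D X) s t" and ?g = "\<lambda>a. ginv \<sigma> \<circ> a"
  have c: "?g \<in> carrier (B X) \<rightarrow> carrier (B X)"
    using gal_idem_ring_iso[OF \<sigma> X(1)] by (auto simp: ring_iso_def ring_hom_def)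
  have "lmod_iso (B X) (pull_module ?g T) (pull_module ?g (pull_module ?\<phi> T'))"
    by (rule lmod_iso_pull[OF l c])
  moreover have "lmod_iso (B X) (pull_module ?g (pull_module ?\<phi> T')) (pull_module ?\<phi> (pull_module ?g T'))"
    unfolding pull_module_pull_module
    by (rule lmod_iso_pull_cong) (use gal_transfer[OF inv_galois_group[OF \<sigma>] i] X in \<open>simp add: idem_alg_simps\<close>)
  ultimately have "lmod_iso (B X) (gal_module \<sigma> T) (pull_module ?\<phi> (gal_module \<sigma> T'))"
    unfolding gal_module_def using lmod_iso_trans by blast
  then show ?thesis using i X Y by (auto simp: e f pair_iso_iff gal_weight_def)
qed

end

section \<open>The orbit category of a finite EI-category\<close>

context ei_category
begin

text \<open>The unit of the group \<open>P\<close> is an idempotent endomorphism and hence the identity of \<open>X\<close>; inverses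
  in \<open>P\<close> are therefore inverses in the category.\<close>

lemma p_subgroupD:
  assumes P: "p_subgroup p D X P"
  shows "P \<subseteq> Hom D X X" "X \<in> Obj D" "Ide D X \<in> P" "finite P" "p_unit D P = Ide D X"
    "\<And>x y. \<lbrakk>x \<in> P; y \<in> P\<rbrakk> \<Longrightarrow> x \<cdot> y \<in> P" "\<And>x. x \<in> P \<Longrightarrow> \<exists>y\<in>P. inverse_mors X X x y"
proof -
  show sub: "P \<subseteq> Hom D X X" using P by (simp add: p_subgroup_def)
  obtain u where g: "group \<lparr>carrier = P, monoid.mult = Comp D, one = u\<rparr>" using P by (auto simp: p_subgroup_def)
  interpret g: group "\<lparr>carrier = P, monoid.mult = Comp D, one = u\<rparr>" by (fact g)
  have u: "u \<in> P" "u \<cdot> u = u" using g.one_closed g.l_one[OF g.one_closed] by simp_all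
  then show X: "X \<in> Obj D" using sub HomD by blast
  have id: "y = Ide D X" if "y \<in> P" "y \<cdot> y = y" for y
  proof -
    have "idem_endo D y" using that sub by (auto simp: idem_endo_def Hom_def)
    then show ?thesis using idem_endo_iff sub that ide_mor by (auto simp: Hom_def)
  qed
  then have uX: "u = Ide D X" using u by blast
  then show "Ide D X \<in> P" using u by simp
  show "finite P" using sub finite_mor by (rule_tac finite_subset[OF _ finite_mor]) (auto simp: Hom_def)
  show "p_unit D P = Ide D X" unfolding p_unit_def
  proof (rule the_equality)
    show "Ide D X \<in> P \<and> Ide D X \<cdot> Ide D X = Ide D X" using u unfolding uX by blast
  qed (use id in blast)
  show "x \<cdot> y \<in> P" if "x \<in> P" "y \<in> P" for x y using g.m_closed[of x y] that by simp
  show "\<exists>y\<in>P. inverse_mors X X x y" if x: "x \<in> P" for x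
  proof -
    let ?y = "inv\<^bsub>\<lparr>carrier = P, monoid.mult = Comp D, one = u\<rparr>\<^esub> x"
    have "?y \<in> P" "?y \<cdot> x = u" "x \<cdot> ?y = u"
      using g.inv_closed[of x] g.l_inv[of x] g.r_inv[of x] x by simp_all
    then show ?thesis using subsetD[OF sub] x uX unfolding inverse_mors_def by blast
  qed
qed

lemma p_subgroupI:
  assumes "P \<subseteq> Hom D X X" "Ide D X \<in> P" "card P = p ^ n"
    "\<And>x y. \<lbrakk>x \<in> P; y \<in> P\<rbrakk> \<Longrightarrow> x \<cdot> y \<in> P" "\<And>x. x \<in> P \<Longrightarrow> \<exists>y\<in>P. inverse_mors X X x y"
  shows "p_subgroup p D X P"
proof -
  have "group \<lparr>carrier = P, monoid.mult = Comp D, one = Ide D X\<rparr>"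
  proof (rule groupI)
    fix x assume "x \<in> carrier \<lparr>carrier = P, monoid.mult = Comp D, one = Ide D X\<rparr>"
    then obtain y where "y \<in> P" "inverse_mors X X x y" using assms(5)[of x] by auto
    then show "\<exists>y\<in>carrier \<lparr>carrier = P, monoid.mult = Comp D, one = Ide D X\<rparr>.
        y \<otimes>\<^bsub>\<lparr>carrier = P, monoid.mult = Comp D, one = Ide D X\<rparr>\<^esub> x = \<one>\<^bsub>\<lparr>carrier = P, monoid.mult = Comp D, one = Ide D X\<rparr>\<^esub>"
      by (auto simp: inverse_mors_def)
  next
    fix x y z assume "x \<in> carrier \<lparr>carrier = P, monoid.mult = Comp D, one = Ide D X\<rparr>"
      "y \<in> carrier \<lparr>carrier = P, monoid.mult = Comp D, one = Ide D X\<rparr>"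
      "z \<in> carrier \<lparr>carrier = P, monoid.mult = Comp D, one = Ide D X\<rparr>"
    then have "x \<in> Hom D X X" "y \<in> Hom D X X" "z \<in> Hom D X X" using assms(1) by auto
    then show "x \<otimes>\<^bsub>\<lparr>carrier = P, monoid.mult = Comp D, one = Ide D X\<rparr>\<^esub> y \<otimes>\<^bsub>\<lparr>carrier = P, monoid.mult = Comp D, one = Ide D X\<rparr>\<^esub> z
      = x \<otimes>\<^bsub>\<lparr>carrier = P, monoid.mult = Comp D, one = Ide D X\<rparr>\<^esub> (y \<otimes>\<^bsub>\<lparr>carrier = P, monoid.mult = Comp D, one = Ide D X\<rparr>\<^esub> z)"
      using Hom_assoc by simp
  qed (use assms Hom_ide in auto)
  then show ?thesis unfolding p_subgroup_def using assms(1,3) by blast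
qed

lemma trivial_p_subgroup: "X \<in> Obj D \<Longrightarrow> p_subgroup p D X {Ide D X}"
  by (rule p_subgroupI[where n=0]) (auto simp: ide_Hom Hom_ide[OF ide_Hom] inverse_mors_ide)

text \<open>\<open>tmor p X P Y Q s\<close> states that \<open>s\<close> underlies a transporter morphism \<open>(X, P) \<rightarrow> (Y, Q)\<close>.\<close>

definition tmor :: "nat \<Rightarrow> 'o \<Rightarrow> 'm set \<Rightarrow> 'o \<Rightarrow> 'm set \<Rightarrow> 'm \<Rightarrow> bool" where
  "tmor p X P Y Q s \<longleftrightarrow> s \<in> Hom D X Y \<and> p_subgroup p D X P \<and> p_subgroup p D Y Q \<and>
     (\<forall>x\<in>P. \<exists>y\<in>Q. s \<cdot> x = y \<cdot> s)"

abbreviation oclass :: "'m set \<Rightarrow> 'm set \<Rightarrow> 'm \<Rightarrow> 'm tmor set" where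
  "oclass P Q s \<equiv> orbit_class D (s, P, Q)"

lemma tmorD:
  assumes "tmor p X P Y Q s"
  shows "s \<in> Hom D X Y" "p_subgroup p D X P" "p_subgroup p D Y Q" "\<And>x. x \<in> P \<Longrightarrow> \<exists>y\<in>Q. s \<cdot> x = y \<cdot> s"
  using assms by (auto simp: tmor_def)

lemma Mor_transporter: "Mor (transporter_cat p D) = {(s, P, Q). \<exists>X Y. tmor p X P Y Q s}"
proof -
  have "s \<in> Mor D \<and> p_subgroup p D (Dom D s) P \<and> p_subgroup p D (Cod D s) Q \<and>
       s = s \<cdot> p_unit D P \<and> s = p_unit D Q \<cdot> s \<and> (\<lambda>x. s \<cdot> x) ` P \<subseteq> (\<lambda>y. y \<cdot> s) ` Q \<longleftrightarrow>
      (\<exists>X Y. tmor p X P Y Q s)" for s P Q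
  proof
    assume a: "s \<in> Mor D \<and> p_subgroup p D (Dom D s) P \<and> p_subgroup p D (Cod D s) Q \<and>
       s = s \<cdot> p_unit D P \<and> s = p_unit D Q \<cdot> s \<and> (\<lambda>x. s \<cdot> x) ` P \<subseteq> (\<lambda>y. y \<cdot> s) ` Q"
    then have "\<forall>x\<in>P. \<exists>y\<in>Q. s \<cdot> x = y \<cdot> s" by blast
    then have "tmor p (Dom D s) P (Cod D s) Q s" using a by (simp add: tmor_def Hom_def)
    then show "\<exists>X Y. tmor p X P Y Q s" by blast
  next
    assume "\<exists>X Y. tmor p X P Y Q s"
    then obtain X Y where t: "tmor p X P Y Q s" by blast
    note h = tmorD[OF t]
    have "(\<lambda>x. s \<cdot> x) ` P \<subseteq> (\<lambda>y. y \<cdot> s) ` Q" using h(4) by blast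
    then show "s \<in> Mor D \<and> p_subgroup p D (Dom D s) P \<and> p_subgroup p D (Cod D s) Q \<and>
       s = s \<cdot> p_unit D P \<and> s = p_unit D Q \<cdot> s \<and> (\<lambda>x. s \<cdot> x) ` P \<subseteq> (\<lambda>y. y \<cdot> s) ` Q"
      using h(2,3) HomD[OF h(1)] Hom_ide[OF h(1)] p_subgroupD(5)[OF h(2)] p_subgroupD(5)[OF h(3)] by simp
  qed
  then show ?thesis by (simp add: transporter_cat_def)
qed

lemma tmor_comp:
  assumes "tmor p Y Q Z R t" "tmor p X P Y Q s"
  shows "tmor p X P Z R (t \<cdot> s)"
  unfolding tmor_def
proof (intro conjI ballI)
  note t = tmorD[OF assms(1)] and s = tmorD[OF assms(2)]
  show "t \<cdot> s \<in> Hom D X Z" using comp_Hom[OF t(1) s(1)] .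
  show "p_subgroup p D X P" "p_subgroup p D Z R" using s t by auto
  fix x assume x: "x \<in> P"
  obtain y where y: "y \<in> Q" "s \<cdot> x = y \<cdot> s" using s(4)[OF x] by blast
  obtain z where z: "z \<in> R" "t \<cdot> y = z \<cdot> t" using t(4)[OF y(1)] by blast
  have xh: "x \<in> Hom D X X" and yh: "y \<in> Hom D Y Y" and zh: "z \<in> Hom D Z Z"
    using x y z p_subgroupD(1)[OF s(2)] p_subgroupD(1)[OF s(3)] p_subgroupD(1)[OF t(3)] by auto
  have "t \<cdot> s \<cdot> x = t \<cdot> y \<cdot> s" using Hom_assoc[OF t(1) s(1) xh] Hom_assoc[OF t(1) yh s(1)] y by simp
  also have "\<dots> = z \<cdot> (t \<cdot> s)" using Hom_assoc[OF zh t(1) s(1)] z by simp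
  finally show "\<exists>y\<in>R. t \<cdot> s \<cdot> x = y \<cdot> (t \<cdot> s)" using z by blast
qed

lemma tmor_member: assumes "p_subgroup p D X P" "x \<in> P" shows "tmor p X P X P x"
  unfolding tmor_def
proof (intro conjI ballI)
  note P = p_subgroupD[OF assms(1)]
  show "x \<in> Hom D X X" using P assms by blast
  fix z assume z: "z \<in> P"
  obtain y where y: "y \<in> P" "inverse_mors X X x y" using P(7)[OF assms(2)] by blast
  have "x \<cdot> z = x \<cdot> z \<cdot> y \<cdot> x"
    using inverse_mors_cancel(4)[OF y(2) comp_Hom[of x X X z X]] subsetD[OF P(1) z] subsetD[OF P(1) assms(2)] by simp
  then show "\<exists>y\<in>P. x \<cdot> z = y \<cdot> x" using P(6) z y assms(2) by blast
qed (use assms in auto)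

text \<open>Since \<open>s P\<close> is contained in \<open>Q s\<close>, the double coset \<open>Q s P\<close> is the coset \<open>Q s\<close>.\<close>

lemma oclass_eq:
  assumes "tmor p X P Y Q s" shows "oclass P Q s = {(y \<cdot> s, P, Q) | y. y \<in> Q}"
proof -
  note s = tmorD[OF assms]
  have "\<exists>y'\<in>Q. y \<cdot> (s \<cdot> x) = y' \<cdot> s" if xy: "x \<in> P" "y \<in> Q" for x y
  proof -
    obtain y' where y': "y' \<in> Q" "s \<cdot> x = y' \<cdot> s" using s(4)[OF xy(1)] by blast
    have "y \<cdot> (s \<cdot> x) = y \<cdot> y' \<cdot> s"
      using Hom_assoc[OF subsetD[OF p_subgroupD(1)[OF s(3)] xy(2)] subsetD[OF p_subgroupD(1)[OF s(3)] y'(1)] s(1)] y'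
      by simp
    then show ?thesis using p_subgroupD(6)[OF s(3) xy(2) y'(1)] by blast
  qed
  moreover have "y \<cdot> s = y \<cdot> (s \<cdot> Ide D X)" for y using Hom_ide(1)[OF s(1)] by simp
  ultimately show ?thesis unfolding orbit_class_def using p_subgroupD(3)[OF s(2)] by (auto) metis+
qed

lemma oclass_self: assumes "tmor p X P Y Q s" shows "(s, P, Q) \<in> oclass P Q s"
proof -
  have "(Ide D Y \<cdot> s, P, Q) \<in> oclass P Q s"
    unfolding oclass_eq[OF assms] using p_subgroupD(3)[OF tmorD(3)[OF assms]] by blast
  then show ?thesis by (simp only: Hom_ide(2)[OF tmorD(1)[OF assms]])
qed

lemma oclass_eq_iff:
  assumes s: "tmor p X P Y Q s" and s': "tmor p X' P' Y' Q' s'"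
  shows "oclass P Q s = oclass P' Q' s' \<longleftrightarrow> P = P' \<and> Q = Q' \<and> (\<exists>y\<in>Q. s' = y \<cdot> s)"
proof
  assume "oclass P Q s = oclass P' Q' s'"
  then have "(s', P', Q') \<in> oclass P Q s" using oclass_self[OF s'] by simp
  then show "P = P' \<and> Q = Q' \<and> (\<exists>y\<in>Q. s' = y \<cdot> s)" using oclass_eq[OF s] by auto
next
  assume "P = P' \<and> Q = Q' \<and> (\<exists>y\<in>Q. s' = y \<cdot> s)"
  then obtain y where e: "P' = P" "Q' = Q" and y: "y \<in> Q" "s' = y \<cdot> s" by blast
  note h = tmorD[OF s] note Q = p_subgroupD[OF h(3)]
  obtain y' where y': "y' \<in> Q" "inverse_mors Y Y y y'" using Q(7)[OF y(1)] by blast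
  have *: "z \<cdot> s = z \<cdot> y' \<cdot> (y \<cdot> s)" "z \<cdot> (y \<cdot> s) = z \<cdot> y \<cdot> s" if "z \<in> Q" for z
  proof -
    have zh: "z \<in> Hom D Y Y" and yh: "y \<in> Hom D Y Y" and yh': "y' \<in> Hom D Y Y" using that Q(1) y y' by auto
    show "z \<cdot> s = z \<cdot> y' \<cdot> (y \<cdot> s)"
      using Hom_assoc[OF zh yh' comp_Hom[OF yh h(1)]] inverse_mors_cancel(1)[OF y'(2) h(1)] by simp
    show "z \<cdot> (y \<cdot> s) = z \<cdot> y \<cdot> s" using Hom_assoc[OF zh yh h(1)] by simp
  qed
  have "{(z \<cdot> s, P, Q) | z. z \<in> Q} = {(z \<cdot> (y \<cdot> s), P, Q) | z. z \<in> Q}"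
  proof (intro equalityI subsetI)
    fix x assume "x \<in> {(z \<cdot> s, P, Q) | z. z \<in> Q}"
    then show "x \<in> {(z \<cdot> (y \<cdot> s), P, Q) | z. z \<in> Q}" using *(1) Q(6)[OF _ y'(1)] by blast
  next
    fix x assume "x \<in> {(z \<cdot> (y \<cdot> s), P, Q) | z. z \<in> Q}"
    then show "x \<in> {(z \<cdot> s, P, Q) | z. z \<in> Q}" using *(2) Q(6)[OF _ y(1)] by blast
  qed
  then show "oclass P Q s = oclass P' Q' s'" unfolding oclass_eq[OF s] oclass_eq[OF s'] unfolding e y(2) .
qed

abbreviation Orb :: "nat \<Rightarrow> ('o \<times> 'm set, 'm tmor set) cat" where "Orb p \<equiv> orbit_cat p D"

lemma orbit_simps:
  shows "Obj (Orb p) = {(X, P). X \<in> Obj D \<and> p_subgroup p D X P}"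
    "Mor (Orb p) = {oclass P Q s | X P Y Q s. tmor p X P Y Q s}"
    "tmor p X P Y Q s \<Longrightarrow> Dom (Orb p) (oclass P Q s) = (X, P)"
    "tmor p X P Y Q s \<Longrightarrow> Cod (Orb p) (oclass P Q s) = (Y, Q)"
    "p_subgroup p D X P \<Longrightarrow> Ide (Orb p) (X, P) = oclass P P (Ide D X)"
    "tmor p Y Q Z R t \<Longrightarrow> tmor p X P Y Q s \<Longrightarrow> Comp (Orb p) (oclass Q R t) (oclass P Q s) = oclass P R (t \<cdot> s)"
proof -
  show "Obj (Orb p) = {(X, P). X \<in> Obj D \<and> p_subgroup p D X P}" by (simp add: orbit_cat_def transporter_cat_def)
  show "Mor (Orb p) = {oclass P Q s | X P Y Q s. tmor p X P Y Q s}"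
    unfolding orbit_cat_def by (auto simp: Mor_transporter) blast
  show "Ide (Orb p) (X, P) = oclass P P (Ide D X)" if "p_subgroup p D X P"
    using p_subgroupD(5)[OF that] by (simp add: orbit_cat_def transporter_cat_def)
  have im: "Dom (transporter_cat p D) ` oclass P Q s = {(X, P)} \<and> Cod (transporter_cat p D) ` oclass P Q s = {(Y, Q)}"
    if t: "tmor p X P Y Q s" for X P Y Q s
  proof -
    note h = tmorD[OF t]
    have "Dom D (y \<cdot> s) = X \<and> Cod D (y \<cdot> s) = Y" if "y \<in> Q" for y
      using HomD(2,3)[OF comp_Hom[OF subsetD[OF p_subgroupD(1)[OF h(3)] that] h(1)]] by simp
    then have d: "Dom (transporter_cat p D) x = (X, P) \<and> Cod (transporter_cat p D) x = (Y, Q)" if "x \<in> oclass P Q s" for x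
      using that unfolding oclass_eq[OF t] by (auto simp: transporter_cat_def)
    have "f ` oclass P Q s = {c}" if "\<And>x. x \<in> oclass P Q s \<Longrightarrow> f x = c" for f :: "'m tmor \<Rightarrow> 'o \<times> 'm set" and c
    proof -
      have "f ` oclass P Q s = (\<lambda>_. c) ` oclass P Q s" by (rule image_cong) (use that in auto)
      then show ?thesis using image_constant[OF oclass_self[OF t]] by simp
    qed
    then show ?thesis using d by simp
  qed
  show "Dom (Orb p) (oclass P Q s) = (X, P)" "Cod (Orb p) (oclass P Q s) = (Y, Q)" if "tmor p X P Y Q s"
    using im[OF that] by (simp_all add: orbit_cat_def)
  show "Comp (Orb p) (oclass Q R t) (oclass P Q s) = oclass P R (t \<cdot> s)" if a: "tmor p Y Q Z R t" "tmor p X P Y Q s"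
  proof -
    note t = tmorD[OF a(1)] and s = tmorD[OF a(2)]
    have "Comp (Orb p) (oclass Q R t) (oclass P Q s) = {(z \<cdot> t \<cdot> (y \<cdot> s), P, R) | z y. z \<in> R \<and> y \<in> Q}"
      unfolding oclass_eq[OF a(1)] oclass_eq[OF a(2)] by (auto simp: orbit_cat_def transporter_cat_def) blast
    also have "\<dots> = {(z \<cdot> (t \<cdot> s), P, R) | z. z \<in> R}"
    proof -
      have l: "\<exists>z'\<in>R. z \<cdot> t \<cdot> (y \<cdot> s) = z' \<cdot> (t \<cdot> s)" if zy: "z \<in> R" "y \<in> Q" for z y
      proof -
        obtain z' where z': "z' \<in> R" "t \<cdot> y = z' \<cdot> t" using t(4)[OF zy(2)] by blast
        have h: "z \<in> Hom D Z Z" "z' \<in> Hom D Z Z" "y \<in> Hom D Y Y"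
          using zy z' p_subgroupD(1)[OF t(3)] p_subgroupD(1)[OF t(2)] by auto
        have "z \<cdot> t \<cdot> (y \<cdot> s) = z \<cdot> (t \<cdot> y \<cdot> s)"
          using Hom_assoc[OF h(1) t(1) comp_Hom[OF h(3) s(1)]] Hom_assoc[OF t(1) h(3) s(1)] by simp
        also have "\<dots> = z \<cdot> (z' \<cdot> (t \<cdot> s))" using z' Hom_assoc[OF h(2) t(1) s(1)] by simp
        also have "\<dots> = z \<cdot> z' \<cdot> (t \<cdot> s)" using Hom_assoc[OF h(1) h(2) comp_Hom[OF t(1) s(1)]] by simp
        finally show ?thesis using p_subgroupD(6)[OF t(3) zy(1) z'(1)] by blast
      qed
      have r: "z \<cdot> (t \<cdot> s) = z \<cdot> t \<cdot> (Ide D Y \<cdot> s)" if "z \<in> R" for z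
        using Hom_assoc[OF subsetD[OF p_subgroupD(1)[OF t(3)] that] t(1) s(1)] Hom_ide(2)[OF s(1)] by simp
      show ?thesis
      proof (intro equalityI subsetI)
        fix x assume "x \<in> {(z \<cdot> t \<cdot> (y \<cdot> s), P, R) | z y. z \<in> R \<and> y \<in> Q}"
        then show "x \<in> {(z \<cdot> (t \<cdot> s), P, R) | z. z \<in> R}" using l by blast
      next
        fix x assume "x \<in> {(z \<cdot> (t \<cdot> s), P, R) | z. z \<in> R}"
        then show "x \<in> {(z \<cdot> t \<cdot> (y \<cdot> s), P, R) | z y. z \<in> R \<and> y \<in> Q}"
          using r p_subgroupD(3)[OF s(3)] by blast
      qed
    qed
    finally show ?thesis using oclass_eq[OF tmor_comp[OF a]] by simp
  qed
qed

lemma orbit_MorE: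
  assumes "c \<in> Mor (Orb p)"
  obtains X P Y Q s where "tmor p X P Y Q s" "c = oclass P Q s"
    "Dom (Orb p) c = (X, P)" "Cod (Orb p) c = (Y, Q)"
  using assms orbit_simps(2-4) by auto

lemma orbit_Mor: "tmor p X P Y Q s \<Longrightarrow> oclass P Q s \<in> Mor (Orb p)"
  unfolding orbit_simps(2) by blast

lemma orbit_Hom: "Hom (Orb p) (X, P) (Y, Q) = oclass P Q ` {s. tmor p X P Y Q s}"
proof (intro equalityI subsetI)
  fix c assume "c \<in> Hom (Orb p) (X, P) (Y, Q)"
  then have c: "c \<in> Mor (Orb p)" "Dom (Orb p) c = (X, P)" "Cod (Orb p) c = (Y, Q)" by (auto simp: Hom_def)
  from c(1) show "c \<in> oclass P Q ` {s. tmor p X P Y Q s}"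
    by (rule orbit_MorE) (use c in auto)
qed (auto simp: Hom_def orbit_simps(3,4) orbit_Mor)

lemma tmor_ide: "p_subgroup p D X P \<Longrightarrow> tmor p X P X P (Ide D X)"
  using tmor_member p_subgroupD(3) by blast

text \<open>A transporter morphism \<open>(X, P) \<rightarrow> (Y, Q)\<close> that is invertible in the category conjugates \<open>P\<close>
  injectively into \<open>Q\<close>; if the orders agree then its inverse is a transporter morphism too.\<close>

lemma tmor_conj:
  assumes t: "tmor p X P Y Q s" and i: "inverse_mors X Y s s'"
  shows "inj_on (\<lambda>x. s \<cdot> x \<cdot> s') P" "(\<lambda>x. s \<cdot> x \<cdot> s') ` P \<subseteq> Q" "card P \<le> card Q"
proof -
  note h = tmorD[OF t] and j = inverse_morsD[OF i]
  note P = p_subgroupD[OF h(2)] and Q = p_subgroupD[OF h(3)]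
  show inj: "inj_on (\<lambda>x. s \<cdot> x \<cdot> s') P"
  proof (rule inj_onI)
    fix x y assume "x \<in> P" "y \<in> P" and e: "s \<cdot> x \<cdot> s' = s \<cdot> y \<cdot> s'"
    then have hx: "x \<in> Hom D X X" "y \<in> Hom D X X" using P(1) by auto
    have "s \<cdot> x = s \<cdot> y"
      using e inverse_mors_cancel(4)[OF i comp_Hom[OF j(1) hx(1)]] inverse_mors_cancel(4)[OF i comp_Hom[OF j(1) hx(2)]] by metis
    then show "x = y" using inverse_mors_cancel(1)[OF i hx(1)] inverse_mors_cancel(1)[OF i hx(2)] by metis
  qed
  show "(\<lambda>x. s \<cdot> x \<cdot> s') ` P \<subseteq> Q"
  proof
    fix z assume "z \<in> (\<lambda>x. s \<cdot> x \<cdot> s') ` P"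
    then obtain x where x: "x \<in> P" "z = s \<cdot> x \<cdot> s'" by blast
    obtain y where y: "y \<in> Q" "s \<cdot> x = y \<cdot> s" using h(4)[OF x(1)] by blast
    then show "z \<in> Q" using inverse_mors_cancel(3)[OF i subsetD[OF Q(1) y(1)]] x by simp
  qed
  then show "card P \<le> card Q" using card_inj_on_le[OF inj _ Q(4)] by auto
qed

lemma tmor_inverse:
  assumes t: "tmor p X P Y Q s" and i: "inverse_mors X Y s s'" and le: "card Q \<le> card P"
  shows "tmor p Y Q X P s'"
proof -
  note h = tmorD[OF t] and j = inverse_morsD[OF i] and c = tmor_conj[OF t i]
  note P = p_subgroupD[OF h(2)] and Q = p_subgroupD[OF h(3)]
  let ?c = "\<lambda>x. s \<cdot> x \<cdot> s'"
  have "?c ` P = Q" using card_image[OF c(1)] le c(2) Q(4) by (intro card_seteq) auto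
  have "\<exists>x\<in>P. s' \<cdot> y = x \<cdot> s'" if y: "y \<in> Q" for y
  proof -
    obtain x where x: "x \<in> P" "y = ?c x" using y \<open>?c ` P = Q\<close> by blast
    have hx: "x \<in> Hom D X X" using x P(1) by auto
    have "s' \<cdot> y = x \<cdot> s'" using x inverse_mors_cancel(1)[OF i comp_Hom[OF hx j(2)]] Hom_assoc[OF j(1) hx j(2)] by simp
    then show ?thesis using x by blast
  qed
  then show ?thesis using h j by (simp add: tmor_def)
qed

text \<open>An endomorphism of \<open>(X, P)\<close> is represented by an automorphism \<open>s\<close> of \<open>X\<close> with \<open>s P\<close> contained in
  \<open>P s\<close>; by finiteness of \<open>P\<close> the inverse of \<open>s\<close> represents an inverse.\<close>

lemma orbit_ei: "ei_category (Orb p)"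
proof -
  interpret O: category "Orb p"
  proof unfold_locales
    fix X assume "X \<in> Obj (Orb p)"
    then obtain Y P where Y: "X = (Y, P)" "p_subgroup p D Y P" by (auto simp: orbit_simps(1))
    show "Ide (Orb p) X \<in> Mor (Orb p) \<and> Dom (Orb p) (Ide (Orb p) X) = X \<and> Cod (Orb p) (Ide (Orb p) X) = X"
      unfolding Y(1) orbit_simps(5)[OF Y(2)]
      using orbit_Mor[OF tmor_ide[OF Y(2)]] orbit_simps(3,4)[OF tmor_ide[OF Y(2)]] by simp
  next
    fix s assume "s \<in> Mor (Orb p)"
    then obtain X P Y Q u where u: "tmor p X P Y Q u" "s = oclass P Q u"
      "Dom (Orb p) s = (X, P)" "Cod (Orb p) s = (Y, Q)" by (rule orbit_MorE)
    note h = tmorD[OF u(1)]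
    show "Dom (Orb p) s \<in> Obj (Orb p)" "Cod (Orb p) s \<in> Obj (Orb p)"
      using h(2,3) p_subgroupD(2) by (auto simp: orbit_simps(1) u(3,4))
    show "Comp (Orb p) s (Ide (Orb p) (Dom (Orb p) s)) = s" "Comp (Orb p) (Ide (Orb p) (Cod (Orb p) s)) s = s"
      unfolding u(3,4) orbit_simps(5)[OF h(2)] orbit_simps(5)[OF h(3)]
      unfolding u(2) orbit_simps(6)[OF u(1) tmor_ide[OF h(2)]] orbit_simps(6)[OF tmor_ide[OF h(3)] u(1)]
      using Hom_ide[OF h(1)] by simp_all
  next
    fix t s assume a: "t \<in> Mor (Orb p)" "s \<in> Mor (Orb p)" "Dom (Orb p) t = Cod (Orb p) s"
    from a(1) obtain Y Q Z R u where u: "tmor p Y Q Z R u" "t = oclass Q R u"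
      "Dom (Orb p) t = (Y, Q)" "Cod (Orb p) t = (Z, R)" by (rule orbit_MorE)
    from a(2) obtain X P Y' Q' v where v: "tmor p X P Y' Q' v" "s = oclass P Q' v"
      "Dom (Orb p) s = (X, P)" "Cod (Orb p) s = (Y', Q')" by (rule orbit_MorE)
    have e: "Y' = Y" "Q' = Q" using a(3) u v by auto
    have v1: "tmor p X P Y Q v" using v(1) e by simp
    show "Comp (Orb p) t s \<in> Mor (Orb p) \<and> Dom (Orb p) (Comp (Orb p) t s) = Dom (Orb p) s \<and>
        Cod (Orb p) (Comp (Orb p) t s) = Cod (Orb p) t"
      unfolding u(3,4) v(3,4) unfolding u(2) v(2) e orbit_simps(6)[OF u(1) v1]
      using orbit_Mor[OF tmor_comp[OF u(1) v1]] orbit_simps(3,4)[OF tmor_comp[OF u(1) v1]] by simp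
  next
    fix w t s assume a: "w \<in> Mor (Orb p)" "t \<in> Mor (Orb p)" "s \<in> Mor (Orb p)"
      "Dom (Orb p) w = Cod (Orb p) t" "Dom (Orb p) t = Cod (Orb p) s"
    from a(1) obtain Z R W S c where c: "tmor p Z R W S c" "w = oclass R S c"
      "Dom (Orb p) w = (Z, R)" "Cod (Orb p) w = (W, S)" by (rule orbit_MorE)
    from a(2) obtain Y Q Z' R' u where u: "tmor p Y Q Z' R' u" "t = oclass Q R' u"
      "Dom (Orb p) t = (Y, Q)" "Cod (Orb p) t = (Z', R')" by (rule orbit_MorE)
    from a(3) obtain X P Y' Q' v where v: "tmor p X P Y' Q' v" "s = oclass P Q' v"
      "Dom (Orb p) s = (X, P)" "Cod (Orb p) s = (Y', Q')" by (rule orbit_MorE)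
    have e: "Y' = Y" "Q' = Q" "Z' = Z" "R' = R" using a u v c by auto
    have u1: "tmor p Y Q Z R u" and v1: "tmor p X P Y Q v" using u(1) v(1) e by simp_all
    show "Comp (Orb p) w (Comp (Orb p) t s) = Comp (Orb p) (Comp (Orb p) w t) s"
      unfolding c(2) u(2) v(2) e orbit_simps(6)[OF u1 v1] orbit_simps(6)[OF c(1) u1]
        orbit_simps(6)[OF c(1) tmor_comp[OF u1 v1]] orbit_simps(6)[OF tmor_comp[OF c(1) u1] v1]
      using Hom_assoc[OF tmorD(1)[OF c(1)] tmorD(1)[OF u1] tmorD(1)[OF v1]] by simp
  qed
  have fin: "finite (Mor (Orb p))"
  proof -
    have "P \<subseteq> Mor D \<and> Q \<subseteq> Mor D \<and> s \<in> Mor D" if "tmor p X P Y Q s" for X P Y Q s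
      using tmorD(1)[OF that] p_subgroupD(1)[OF tmorD(2)[OF that]] p_subgroupD(1)[OF tmorD(3)[OF that]]
      by (auto simp: Hom_def)
    then have "Mor (Orb p) \<subseteq> (\<lambda>(s, P, Q). oclass P Q s) ` (Mor D \<times> Pow (Mor D) \<times> Pow (Mor D))"
      unfolding orbit_simps(2) by force
    then show ?thesis using finite_mor by (auto intro: finite_subset)
  qed
  have "is_iso (Orb p) c" if X: "X \<in> Obj (Orb p)" and c: "c \<in> Hom (Orb p) X X" for X c
  proof -
    obtain Y P where YP: "X = (Y, P)" by (cases X)
    obtain s where "tmor p Y P Y P s" "c = oclass P P s" using c unfolding YP orbit_Hom by blast
    note s = YP this
    note h = tmorD[OF s(2)]
    obtain s' where i: "inverse_mors Y Y s s'" using endo_iso h by blast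
    have s': "tmor p Y P Y P s'" using tmor_inverse[OF s(2) i] by simp
    have "oclass P P s' \<in> Hom (Orb p) X X" using s s' orbit_Hom by auto
    moreover have "Comp (Orb p) (oclass P P s') (oclass P P s) = Ide (Orb p) X" "Comp (Orb p) (oclass P P s) (oclass P P s') = Ide (Orb p) X"
      unfolding s(1) orbit_simps(5)[OF h(2)] orbit_simps(6)[OF s' s(2)] orbit_simps(6)[OF s(2) s']
      using inverse_morsD[OF i] by simp_all
    ultimately show ?thesis using c s(3) by (auto simp: is_iso_def Hom_def)
  qed
  then have "EI_category (Orb p)" by (simp add: EI_category_def O.category_axioms)
  then show ?thesis by unfold_locales (auto simp: fin)
qed

text \<open>If \<open>s\<close> and \<open>t\<close> represent mutually inverse classes, then \<open>s\<close> is invertible, because there are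
  morphisms in both directions, and \<open>t s\<close> lies in \<open>P\<close>; so \<open>t\<close> differs from the inverse of \<open>s\<close> by an element of \<open>P\<close>.\<close>

lemma orbit_isoD:
  assumes i: "category.inverse_mors (Orb p) (X, P) (Y, Q) c d"
  obtains s s' where "inverse_mors X Y s s'" "tmor p X P Y Q s" "tmor p Y Q X P s'" "c = oclass P Q s" "d = oclass Q P s'"
proof -
  interpret O: ei_category "Orb p" by (rule orbit_ei)
  note h = O.inverse_morsD[OF i]
  obtain s where s: "tmor p X P Y Q s" "c = oclass P Q s" using h(1) orbit_Hom by auto
  obtain t where t: "tmor p Y Q X P t" "d = oclass Q P t" using h(2) orbit_Hom by auto
  note hs = tmorD[OF s(1)] and ht = tmorD[OF t(1)]
  obtain s' where i': "inverse_mors X Y s s'" using opposed_mors_iso[OF hs(1) ht(1)] by blast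
  note j = inverse_morsD[OF i']
  obtain t' where "inverse_mors Y X t t'" using opposed_mors_iso[OF ht(1) hs(1)] by blast
  then have s': "tmor p Y Q X P s'" using tmor_inverse[OF s(1) i'] tmor_conj(3)[OF t(1)] by blast
  have "oclass P P (Ide D X) = oclass P P (t \<cdot> s)"
    using h(3) unfolding s(2) t(2) orbit_simps(6)[OF t(1) s(1)] orbit_simps(5)[OF hs(2)] by simp
  then obtain x where x: "x \<in> P" "t \<cdot> s = x \<cdot> Ide D X"
    using oclass_eq_iff[OF tmor_ide[OF hs(2)] tmor_comp[OF t(1) s(1)]] by blast
  then have xh: "x \<in> Hom D X X" "t \<cdot> s = x" using p_subgroupD(1)[OF hs(2)] Hom_ide(1) by auto
  have "t = x \<cdot> s'" using inverse_mors_cancel(3)[OF i' ht(1)] xh by simp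
  then have "oclass Q P s' = oclass Q P t" using oclass_eq_iff[OF s' t(1)] x by blast
  then show ?thesis using that[OF i' s(1) s' s(2)] t(2) by simp
qed

text \<open>The group \<open>P\<close> is the conjugate of \<open>Q\<close> under \<open>s\<close>.\<close>

lemma orbit_isoI:
  assumes Q: "p_subgroup p D Y Q" and i: "inverse_mors X Y s s'"
  obtains P where "tmor p X P Y Q s" "tmor p Y Q X P s'"
    "category.inverse_mors (Orb p) (X, P) (Y, Q) (oclass P Q s) (oclass Q P s')"
proof -
  interpret O: ei_category "Orb p" by (rule orbit_ei)
  note q = p_subgroupD[OF Q] and j = inverse_morsD[OF i]
  let ?c = "\<lambda>y. s' \<cdot> (y \<cdot> s)"
  define P where "P = ?c ` Q"
  have ch: "?c y \<in> Hom D X X" if "y \<in> Q" for y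
    using comp_Hom[OF j(2) comp_Hom[OF subsetD[OF q(1) that] j(1)]] .
  have sconst: "s \<cdot> ?c y = y \<cdot> s" if "y \<in> Q" for y
    using inverse_mors_cancel(2)[OF i comp_Hom[OF subsetD[OF q(1) that] j(1)]] .
  have cc: "?c y \<cdot> ?c z = ?c (y \<cdot> z)" if yz: "y \<in> Q" "z \<in> Q" for y z
  proof -
    have yh: "y \<in> Hom D Y Y" "z \<in> Hom D Y Y" using yz q(1) by auto
    have "?c y \<cdot> ?c z = s' \<cdot> (y \<cdot> s \<cdot> ?c z)" using Hom_assoc[OF j(2) comp_Hom[OF yh(1) j(1)] ch[OF yz(2)]] .
    also have "y \<cdot> s \<cdot> ?c z = y \<cdot> (z \<cdot> s)" using Hom_assoc[OF yh(1) j(1) ch[OF yz(2)]] sconst[OF yz(2)] by simp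
    also have "\<dots> = y \<cdot> z \<cdot> s" using Hom_assoc[OF yh j(1)] by simp
    finally show ?thesis .
  qed
  have cI: "?c (Ide D Y) = Ide D X" using Hom_ide(2)[OF j(1)] j(3) by simp
  obtain n where n: "card Q = p ^ n" using Q by (auto simp: p_subgroup_def)
  have inj: "inj_on ?c Q"
  proof (rule inj_onI)
    fix y z assume yz: "y \<in> Q" "z \<in> Q" and "?c y = ?c z"
    then have "y \<cdot> s = z \<cdot> s" using sconst by metis
    then show "y = z" using inverse_mors_cancel(3)[OF i subsetD[OF q(1) yz(1)]] inverse_mors_cancel(3)[OF i subsetD[OF q(1) yz(2)]] by metis
  qed
  have P: "p_subgroup p D X P"
  proof (rule p_subgroupI)
    show "P \<subseteq> Hom D X X" using ch by (auto simp: P_def)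
    show "Ide D X \<in> P" unfolding P_def using q(3) cI by (metis imageI)
    show "card P = p ^ n" unfolding P_def using card_image[OF inj] n by simp
    show "x \<cdot> y \<in> P" if "x \<in> P" "y \<in> P" for x y using that cc q(6) by (auto simp: P_def)
    show "\<exists>y\<in>P. inverse_mors X X x y" if x: "x \<in> P" for x
    proof -
      obtain y where y: "y \<in> Q" "x = ?c y" using x by (auto simp: P_def)
      obtain z where z: "z \<in> Q" "inverse_mors Y Y y z" using q(7)[OF y(1)] by blast
      have "inverse_mors X X x (?c z)"
        using cc[OF y(1) z(1)] cc[OF z(1) y(1)] ch[OF y(1)] ch[OF z(1)] cI inverse_morsD(3,4)[OF z(2)]
        by (simp add: inverse_mors_def y(2))
      then show ?thesis using z by (auto simp: P_def)
    qed
  qed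
  have t: "tmor p X P Y Q s" using P Q j(1) sconst by (auto simp: tmor_def P_def)
  have "card Q \<le> card P" unfolding P_def using card_image[OF inj] by simp
  then have t': "tmor p Y Q X P s'" using tmor_inverse[OF t i] by simp
  have "O.inverse_mors (X, P) (Y, Q) (oclass P Q s) (oclass Q P s')"
    unfolding O.inverse_mors_def orbit_simps(6)[OF t t'] orbit_simps(6)[OF t' t] orbit_simps(5)[OF P] orbit_simps(5)[OF Q]
    using t t' j(3,4) by (auto simp: orbit_Hom)
  then show ?thesis using that t t' by blast
qed

lemma tmor_trivial:
  assumes s: "s \<in> Hom D X Y" and Q: "p_subgroup p D Y Q"
  shows "tmor p X {Ide D X} Y Q s"
  unfolding tmor_def
proof (intro conjI ballI)
  fix x assume "x \<in> {Ide D X}"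
  then have "s \<cdot> x = Ide D Y \<cdot> s" using Hom_ide[OF s] by simp
  then show "\<exists>y\<in>Q. s \<cdot> x = y \<cdot> s" using p_subgroupD(3)[OF Q] by blast
qed (use s Q trivial_p_subgroup HomD(4)[OF s] in blast)+

lemma orbit_embed_oclass: "s \<in> Hom D X Y \<Longrightarrow> orbit_embed D s = oclass {Ide D X} {Ide D Y} s"
  by (simp add: orbit_embed_def Hom_def)

lemma orbit_embed_comp:
  assumes "t \<in> Hom D Y Z" "s \<in> Hom D X Y"
  shows "Comp (Orb p) (orbit_embed D t) (orbit_embed D s) = orbit_embed D (t \<cdot> s)"
  using orbit_simps(6)[OF tmor_trivial[OF assms(1) trivial_p_subgroup] tmor_trivial[OF assms(2) trivial_p_subgroup]]
    assms HomD[OF assms(1)] HomD[OF assms(2)] comp_Hom[OF assms] by (simp add: orbit_embed_oclass)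

lemma res_cocycle:
  assumes \<alpha>: "cocycle (Orb p) U \<alpha>" shows "cocycle D U (res_cocycle D \<alpha>)"
proof -
  have m: "orbit_embed D s \<in> Mor (Orb p) \<and> Dom (Orb p) (orbit_embed D s) = (Dom D s, {Ide D (Dom D s)}) \<and>
      Cod (Orb p) (orbit_embed D s) = (Cod D s, {Ide D (Cod D s)})" if "s \<in> Mor D" for s
  proof -
    have s: "s \<in> Hom D (Dom D s) (Cod D s)" using that by (simp add: Hom_def)
    have "tmor p (Dom D s) {Ide D (Dom D s)} (Cod D s) {Ide D (Cod D s)} s"
      using tmor_trivial[OF s trivial_p_subgroup] that cod_closed by blast
    then show ?thesis using orbit_Mor orbit_simps(3,4) orbit_embed_oclass[OF s] by simp
  qed
  have c: "Comp (Orb p) (orbit_embed D t) (orbit_embed D s) = orbit_embed D (t \<cdot> s)"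
    if "t \<in> Mor D" "s \<in> Mor D" "Dom D t = Cod D s" for t s
    by (rule orbit_embed_comp) (use that in \<open>auto simp: Hom_def\<close>)
  show ?thesis unfolding cocycle_def
  proof (intro conjI ballI impI)
    fix t s assume "t \<in> Mor D" "s \<in> Mor D" "Dom D t = Cod D s"
    then show "res_cocycle D \<alpha> t s \<in> U" using \<alpha> m by (auto simp: cocycle_def res_cocycle_def)
  next
    fix u t s assume a: "u \<in> Mor D" "t \<in> Mor D" "s \<in> Mor D" "Dom D u = Cod D t \<and> Dom D t = Cod D s"
    have "\<alpha> (orbit_embed D u) (Comp (Orb p) (orbit_embed D t) (orbit_embed D s)) * \<alpha> (orbit_embed D t) (orbit_embed D s)
      = \<alpha> (Comp (Orb p) (orbit_embed D u) (orbit_embed D t)) (orbit_embed D s) * \<alpha> (orbit_embed D u) (orbit_embed D t)"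
      using \<alpha> m a unfolding cocycle_def by auto
    then show "res_cocycle D \<alpha> u (t \<cdot> s) * res_cocycle D \<alpha> t s = res_cocycle D \<alpha> (u \<cdot> t) s * res_cocycle D \<alpha> u t"
      using c a by (simp add: res_cocycle_def)
  qed
qed

end

section \<open>The Brauer map of a twisted group algebra\<close>

lemma p_power_root_of_unity:
  fixes x :: "'k::field"
  assumes "prime CHAR('k)" "x ^ (CHAR('k) ^ n) = 1" shows "x = 1"
proof -
  have "((x - 1) + 1) ^ (CHAR('k) ^ n) = (x - 1) ^ (CHAR('k) ^ n) + 1 ^ (CHAR('k) ^ n)"
    by (rule freshmans_dream'[OF assms(1) refl])
  then have "(x - 1) ^ (CHAR('k) ^ n) = 0" using assms(2) by simp
  then show ?thesis by simp
qed

locale brauer_setting = twisted_ei_category D \<alpha>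
  for D :: "('o, 'm) cat" (structure) and \<alpha> :: "'m \<Rightarrow> 'm \<Rightarrow> 'k::field" +
  fixes p :: nat and X :: 'o and P :: "'m set"
  assumes prime: "prime p" and char: "CHAR('k) = p" and P: "p_subgroup p D X P"
begin

definition G where "G = idem_group D (Ide D X)"

lemma X: "X \<in> Obj D" using p_subgroupD(2)[OF P] .

lemma G_simps [simp]: "carrier G = Hom D X X" "monoid.mult G = Comp D" "one G = Ide D X"
  using idem_group_ide[OF X] by (simp_all add: G_def)

sublocale G: group G using idem_group_ide(4)[OF X] by (simp add: G_def)

abbreviation iv where "iv x \<equiv> inv\<^bsub>G\<^esub> x"

lemma iv: assumes "x \<in> Hom D X X" shows "inverse_mors X X x (iv x)" "iv x \<in> Hom D X X"
  using assms G.inv_closed[of x] G.l_inv[of x] G.r_inv[of x] by (simp_all add: inverse_mors_def)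

lemma G_comp [simp]: "\<lbrakk>x \<in> Hom D X X; y \<in> Hom D X X\<rbrakk> \<Longrightarrow> x \<cdot> y \<in> Hom D X X"
  using comp_Hom .

lemma P_sub: "x \<in> P \<Longrightarrow> x \<in> Hom D X X" using p_subgroupD(1)[OF P] by blast

lemma P_subgroup: "subgroup P G"
proof (rule G.subgroupI)
  show "P \<subseteq> carrier G" "P \<noteq> {}" using p_subgroupD(1,3)[OF P] by auto
  show "iv x \<in> P" if x: "x \<in> P" for x
  proof -
    obtain y where y: "y \<in> P" "inverse_mors X X x y" using p_subgroupD(7)[OF P x] by blast
    then show ?thesis using idem_group_inv[OF y(2)] by (simp add: G_def)
  qed
qed (use p_subgroupD(6)[OF P] in simp)

text \<open>The conjugate of \<open>h\<close> by the inverse of \<open>x\<close>: its conjugate by \<open>x\<close> is \<open>h\<close>.\<close>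

definition conj_by :: "'m \<Rightarrow> 'm \<Rightarrow> 'm" where "conj_by x h = iv x \<cdot> (h \<cdot> x)"

lemma conj_by_Hom: "\<lbrakk>x \<in> Hom D X X; h \<in> Hom D X X\<rbrakk> \<Longrightarrow> conj_by x h \<in> Hom D X X"
  unfolding conj_by_def using iv(2) by (intro G_comp)

lemma conj_by_eq_iff:
  assumes "x \<in> Hom D X X" "h \<in> Hom D X X" "g \<in> Hom D X X" shows "conj_by x h = g \<longleftrightarrow> h \<cdot> x = x \<cdot> g"
  unfolding conj_by_def
  using inverse_mors_cancel(1)[OF iv(1)[OF assms(1)] assms(3)]
    inverse_mors_cancel(2)[OF iv(1)[OF assms(1)] G_comp[OF assms(2,1)]] by metis

text \<open>The scalar by which conjugation with \<open>x\<close> in the algebra deviates from conjugation in the group,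
  at the resulting element \<open>h\<close>.\<close>

definition conj_scalar :: "'m \<Rightarrow> 'm \<Rightarrow> 'k" where "conj_scalar x h = \<alpha> x (conj_by x h) / \<alpha> h x"

lemma basis_inverse:
  assumes x: "x \<in> Hom D X X"
  obtains z where "z \<in> span_of (Hom D X X)" "m_inv (B X) (basis_elt x) = z"
    "basis_elt x \<otimes>\<^bsub>A\<^esub> z = hat X" "z \<otimes>\<^bsub>A\<^esub> basis_elt x = hat X"
proof -
  obtain S z where S: "S \<in> span_of (Hom D X X)" "z \<in> span_of (Hom D X X)"
    "z \<otimes>\<^bsub>A\<^esub> S = hat X" "S \<otimes>\<^bsub>A\<^esub> z = hat X" "S = single x 1"
    using transfer_conj[OF iv(1)[OF x]] by metis
  have Sx: "S = basis_elt x" by (simp add: S(5) basis_elt_def)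
  interpret Bx: ring "B X" by (rule idem_alg_ring[OF X])
  note b = idem_alg_simps[OF X]
  have "m_inv (B X) S = z"
    by (rule Bx.inv_unique'[symmetric]) (use S b(5)[OF S(1,2)] b(5)[OF S(2,1)] in \<open>simp_all add: b(1,4)\<close>)
  then show ?thesis using that[of z] S(1-4) by (simp only: Sx)
qed

lemma conj_act_mult:
  assumes x: "x \<in> Hom D X X" and a: "a \<in> span_of (Hom D X X)"
  shows "conj_act (B X) x a \<in> span_of (Hom D X X)"
    "conj_act (B X) x a \<otimes>\<^bsub>A\<^esub> single x 1 = single x 1 \<otimes>\<^bsub>A\<^esub> a"
proof -
  obtain z where z: "z \<in> span_of (Hom D X X)" "m_inv (B X) (basis_elt x) = z"
    "basis_elt x \<otimes>\<^bsub>A\<^esub> z = hat X" "z \<otimes>\<^bsub>A\<^esub> basis_elt x = hat X" using basis_inverse[OF x] by blast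
  have xs: "basis_elt x = single x 1" "basis_elt x \<in> span_of (Hom D X X)"
    using x by (auto simp: basis_elt_def span_of_def)
  note xa = mult_Hom[OF xs(2) a]
  have e: "conj_act (B X) x a = basis_elt x \<otimes>\<^bsub>A\<^esub> a \<otimes>\<^bsub>A\<^esub> z"
    unfolding conj_act_def z(2) using idem_alg_simps(5)[OF X xs(2) a] idem_alg_simps(5)[OF X xa z(1)] by simp
  show "conj_act (B X) x a \<in> span_of (Hom D X X)" unfolding e by (rule mult_Hom[OF xa z(1)])
  have "basis_elt x \<otimes>\<^bsub>A\<^esub> a \<otimes>\<^bsub>A\<^esub> z \<otimes>\<^bsub>A\<^esub> basis_elt x = basis_elt x \<otimes>\<^bsub>A\<^esub> a"
    using mult_hat_Hom[OF X xa] z(4) by (simp only: mult_assoc)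
  then show "conj_act (B X) x a \<otimes>\<^bsub>A\<^esub> single x 1 = single x 1 \<otimes>\<^bsub>A\<^esub> a" unfolding e xs(1) .
qed

text \<open>Multiplying by \<open>x\<close> on the right removes the inverse taken in the algebra; comparing coefficients
  at \<open>h x\<close> gives the formula.\<close>

lemma conj_act_eq:
  assumes x: "x \<in> Hom D X X" and a: "a \<in> span_of (Hom D X X)" and h: "h \<in> Hom D X X"
  shows "conj_act (B X) x a h = a (conj_by x h) * conj_scalar x h"
proof -
  note i = iv(1)[OF x]
  have "(conj_act (B X) x a \<otimes>\<^bsub>A\<^esub> single x 1) (h \<cdot> x) = conj_act (B X) x a h * \<alpha> h x"
    using HomD(1,2)[OF G_comp[OF h x]] inverse_mors_cancel(3)[OF i h] by (simp add: mult_single_iso[OF i])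
  moreover have "(single x 1 \<otimes>\<^bsub>A\<^esub> a) (h \<cdot> x) = a (conj_by x h) * \<alpha> x (conj_by x h)"
    using HomD(1,3)[OF G_comp[OF h x]] by (simp add: single_mult_iso[OF i] conj_by_def)
  ultimately have "conj_act (B X) x a h * \<alpha> h x = a (conj_by x h) * \<alpha> x (conj_by x h)"
    using conj_act_mult(2)[OF x a] by simp
  moreover have "\<alpha> h x \<noteq> 0" using \<alpha>_nz[OF h x] .
  ultimately show ?thesis by (simp add: conj_scalar_def field_simps)
qed

text \<open>On elements commuting with \<open>P\<close> the scalars \<open>conj_scalar x h\<close> form a character of the \<open>p\<close>-group \<open>P\<close>,
  hence are trivial in characteristic \<open>p\<close>.\<close>

lemma conj_scalar_centraliser:
  assumes x: "x \<in> P" and h: "h \<in> centraliser G P"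
  shows "conj_scalar x h = 1"
proof -
  have hH: "h \<in> Hom D X X" and comm: "\<And>y. y \<in> P \<Longrightarrow> h \<cdot> y = y \<cdot> h" using h by (auto simp: centraliser_def)
  have conj_scalar: "conj_scalar y h = \<alpha> y h / \<alpha> h y" if "y \<in> P" for y
    using conj_by_eq_iff[OF P_sub[OF that] hH hH] comm[OF that] by (simp add: conj_scalar_def)
  have mult: "conj_scalar (y \<cdot> z) h = conj_scalar y h * conj_scalar z h" if yz: "y \<in> P" "z \<in> P" for y z
  proof -
    have Y: "y \<in> Hom D X X" and Z: "z \<in> Hom D X X" using P_sub yz by auto
    have yzP: "y \<cdot> z \<in> P" using p_subgroupD(6)[OF P] yz by blast
    have 1: "\<alpha> y (h \<cdot> z) * \<alpha> z h = \<alpha> (y \<cdot> z) h * \<alpha> y z" using \<alpha>_cocycle[OF Y Z hH] comm[OF yz(2)] by simp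
    have 2: "\<alpha> y (h \<cdot> z) * \<alpha> h z = \<alpha> (h \<cdot> y) z * \<alpha> y h" using \<alpha>_cocycle[OF Y hH Z] comm[OF yz(1)] by simp
    have 3: "\<alpha> h (y \<cdot> z) * \<alpha> y z = \<alpha> (h \<cdot> y) z * \<alpha> h y" using \<alpha>_cocycle[OF hH Y Z] .
    have nz: "\<alpha> y z \<noteq> 0" "\<alpha> h z \<noteq> 0" "\<alpha> h y \<noteq> 0" "\<alpha> h (y \<cdot> z) \<noteq> 0" "\<alpha> (h \<cdot> y) z \<noteq> 0"
      using \<alpha>_nz Y Z hH G_comp by blast+
    have "\<alpha> (y \<cdot> z) h * \<alpha> h y * \<alpha> h z * (\<alpha> y z * \<alpha> (h \<cdot> y) z) = \<alpha> y h * \<alpha> z h * \<alpha> h (y \<cdot> z) * (\<alpha> y z * \<alpha> (h \<cdot> y) z)"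
    proof -
      have "\<alpha> (y \<cdot> z) h * \<alpha> h y * \<alpha> h z * (\<alpha> y z * \<alpha> (h \<cdot> y) z)
        = (\<alpha> (y \<cdot> z) h * \<alpha> y z) * (\<alpha> (h \<cdot> y) z * \<alpha> h y) * \<alpha> h z" by (simp only: ac_simps)
      also have "\<dots> = (\<alpha> y (h \<cdot> z) * \<alpha> z h) * (\<alpha> h (y \<cdot> z) * \<alpha> y z) * \<alpha> h z"
        by (simp only: 1 3)
      also have "\<dots> = (\<alpha> y (h \<cdot> z) * \<alpha> h z) * \<alpha> z h * (\<alpha> h (y \<cdot> z) * \<alpha> y z)"
        by (simp only: ac_simps)
      also have "\<dots> = (\<alpha> (h \<cdot> y) z * \<alpha> y h) * \<alpha> z h * (\<alpha> h (y \<cdot> z) * \<alpha> y z)"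
        by (simp only: 2)
      also have "\<dots> = \<alpha> y h * \<alpha> z h * \<alpha> h (y \<cdot> z) * (\<alpha> y z * \<alpha> (h \<cdot> y) z)"
        by (simp only: ac_simps)
      finally show ?thesis .
    qed
    then have "\<alpha> (y \<cdot> z) h * \<alpha> h y * \<alpha> h z = \<alpha> y h * \<alpha> z h * \<alpha> h (y \<cdot> z)" using nz by simp
    then show ?thesis using nz by (simp add: conj_scalar[OF yzP] conj_scalar[OF yz(1)] conj_scalar[OF yz(2)] field_simps)
  qed
  have fin: "finite P" using p_subgroupD(4)[OF P] .
  have bij: "bij_betw (\<lambda>z. x \<cdot> z) P P"
  proof -
    have "inj_on (\<lambda>z. x \<cdot> z) P"
      using inverse_mors_cancel(1)[OF iv(1)[OF P_sub[OF x]] P_sub] by (intro inj_onI) metis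
    moreover have "(\<lambda>z. x \<cdot> z) ` P \<subseteq> P" using p_subgroupD(6)[OF P x] by blast
    ultimately show ?thesis using fin by (simp add: bij_betw_def endo_inj_surj)
  qed
  have "(\<Prod>z\<in>P. conj_scalar z h) = (\<Prod>z\<in>P. conj_scalar (x \<cdot> z) h)" using prod.reindex_bij_betw[OF bij, of "\<lambda>z. conj_scalar z h"] by simp
  also have "\<dots> = (\<Prod>z\<in>P. conj_scalar x h * conj_scalar z h)" by (intro prod.cong refl mult x)
  also have "\<dots> = conj_scalar x h ^ card P * (\<Prod>z\<in>P. conj_scalar z h)" by (simp add: prod.distrib)
  finally have "(\<Prod>z\<in>P. conj_scalar z h) = conj_scalar x h ^ card P * (\<Prod>z\<in>P. conj_scalar z h)" .
  moreover have "(\<Prod>z\<in>P. conj_scalar z h) \<noteq> 0"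
    using fin conj_scalar \<alpha>_nz[OF P_sub hH] \<alpha>_nz[OF hH P_sub] by (simp add: prod_zero_iff)
  ultimately have "conj_scalar x h ^ card P = 1" by simp
  moreover obtain n where "card P = p ^ n" using P by (auto simp: p_subgroup_def)
  ultimately show ?thesis using p_power_root_of_unity[of "conj_scalar x h" n] prime char by simp
qed

lemma finsum_apply:
  assumes "finite I" "f \<in> I \<rightarrow> span_of (Hom D X X)"
  shows "(\<Oplus>\<^bsub>B X\<^esub>i\<in>I. f i) g = (\<Sum>i\<in>I. f i g)"
proof -
  interpret Bx: ring "B X" by (rule idem_alg_ring[OF X])
  show ?thesis using assms
  proof (induction I rule: finite_induct)
    case empty then show ?case by (simp add: idem_alg_simps[OF X])
  next
    case (insert i I)
    then have "(\<Oplus>\<^bsub>B X\<^esub>i\<in>insert i I. f i) = f i \<oplus>\<^bsub>B X\<^esub> (\<Oplus>\<^bsub>B X\<^esub>i\<in>I. f i)"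
      by (intro Bx.finsum_insert) (auto simp: idem_alg_simps(1)[OF X])
    then show ?case using insert by (simp add: idem_alg_simps(3)[OF X])
  qed
qed

lemma finsum_in:
  assumes "f \<in> I \<rightarrow> span_of (Hom D X X)" shows "(\<Oplus>\<^bsub>B X\<^esub>i\<in>I. f i) \<in> span_of (Hom D X X)"
proof -
  interpret Bx: ring "B X" by (rule idem_alg_ring[OF X])
  show ?thesis using Bx.finsum_closed[of f I] assms by (simp add: idem_alg_simps(1)[OF X])
qed

definition cosets :: "'m set \<Rightarrow> 'm set set" where "cosets Q = (\<lambda>x. x <#\<^bsub>G\<^esub> Q) ` P"

lemma coset_eq: "x <#\<^bsub>G\<^esub> Q = {x \<cdot> q | q. q \<in> Q}"
  by (auto simp: l_coset_def)

definition proper_subgroups :: "'m set set" where "proper_subgroups = {Q. subgroup Q G \<and> Q \<subset> P}"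

lemma finite_proper_subgroups: "finite proper_subgroups"
  by (rule finite_subset[of _ "Pow P"]) (use p_subgroupD(4)[OF P] in \<open>auto simp: proper_subgroups_def\<close>)

lemma coset_eq_iff:
  assumes Q: "Q \<in> proper_subgroups" and xy: "x \<in> P" "y \<in> P"
  shows "y \<in> x <#\<^bsub>G\<^esub> Q \<longleftrightarrow> y <#\<^bsub>G\<^esub> Q = x <#\<^bsub>G\<^esub> Q"
proof
  interpret Q: subgroup Q G using Q by (simp add: proper_subgroups_def)
  have Qh: "q \<in> Hom D X X" if "q \<in> Q" for q using Q.subset that by auto
  assume "y \<in> x <#\<^bsub>G\<^esub> Q"
  then obtain q where q: "q \<in> Q" "y = x \<cdot> q" by (auto simp: coset_eq)
  have xh: "x \<in> Hom D X X" using P_sub xy by auto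
  have 1: "y \<cdot> r = x \<cdot> (q \<cdot> r) \<and> q \<cdot> r \<in> Q" if "r \<in> Q" for r
    using Hom_assoc[OF xh Qh[OF q(1)] Qh[OF that]] q Q.m_closed[OF q(1) that] by simp
  have 2: "x \<cdot> r = y \<cdot> (iv q \<cdot> r) \<and> iv q \<cdot> r \<in> Q" if r: "r \<in> Q" for r
  proof -
    have iq: "iv q \<in> Q" using Q.m_inv_closed q by blast
    then have m: "iv q \<cdot> r \<in> Q" using Q.m_closed[OF iq r] by simp
    have "y \<cdot> (iv q \<cdot> r) = x \<cdot> (q \<cdot> (iv q \<cdot> r))" using Hom_assoc[OF xh Qh[OF q(1)] Qh[OF m]] q by simp
    also have "\<dots> = x \<cdot> r" using inverse_mors_cancel(2)[OF iv(1)[OF Qh[OF q(1)]] Qh[OF r]] by simp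
    finally show ?thesis using m by simp
  qed
  show "y <#\<^bsub>G\<^esub> Q = x <#\<^bsub>G\<^esub> Q" unfolding coset_eq using 1 2 by blast
next
  assume "y <#\<^bsub>G\<^esub> Q = x <#\<^bsub>G\<^esub> Q"
  moreover have "Ide D X \<in> Q" using Q subgroup.one_closed[of Q G] by (simp add: proper_subgroups_def)
  moreover have "y \<cdot> Ide D X = y" using Hom_ide(1)[OF P_sub[OF xy(2)]] .
  ultimately show "y \<in> x <#\<^bsub>G\<^esub> Q" unfolding coset_eq by (metis (mono_tags, lifting) mem_Collect_eq)
qed

lemma coset_facts:
  assumes Q: "Q \<in> proper_subgroups" and c: "c \<in> cosets Q"
  shows "c \<subseteq> P" "(SOME x. x \<in> c) \<in> c" "(SOME x. x \<in> c) \<in> P" "\<And>x. x \<in> c \<Longrightarrow> c = x <#\<^bsub>G\<^esub> Q"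
proof -
  obtain x where x: "x \<in> P" "c = x <#\<^bsub>G\<^esub> Q" using c by (auto simp: cosets_def)
  have QP: "Q \<subseteq> P" using Q by (auto simp: proper_subgroups_def)
  then show cP: "c \<subseteq> P" unfolding x(2) coset_eq using p_subgroupD(6)[OF P x(1)] by blast
  have "x \<in> c" using coset_eq_iff[OF Q x(1) x(1)] x by blast
  then show s: "(SOME x. x \<in> c) \<in> c" by (rule someI)
  then show "(SOME x. x \<in> c) \<in> P" using cP by blast
  show "c = y <#\<^bsub>G\<^esub> Q" if "y \<in> c" for y using coset_eq_iff[OF Q x(1), of y] that cP x by blast
qed

lemma finite_cosets: "finite (cosets Q)"
  using p_subgroupD(4)[OF P] by (simp add: cosets_def)

lemma of_nat_card_cosets:
  assumes Q: "Q \<in> proper_subgroups" shows "(of_nat (card (cosets Q)) :: 'k) = 0"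
proof -
  have QP: "Q \<subset> P" using Q by (auto simp: proper_subgroups_def)
  have fin: "finite P" using p_subgroupD(4)[OF P] .
  have cov: "\<Union>(cosets Q) = P"
  proof
    show "\<Union>(cosets Q) \<subseteq> P" using coset_facts(1)[OF Q] by blast
    show "P \<subseteq> \<Union>(cosets Q)" using coset_eq_iff[OF Q] by (auto simp: cosets_def)
  qed
  have "card Q * card (cosets Q) = card (\<Union>(cosets Q))"
  proof (rule card_partition)
    show "finite (cosets Q)" by (rule finite_cosets)
    show "finite (\<Union>(cosets Q))" using cov fin by simp
    show "card c = card Q" if c: "c \<in> cosets Q" for c
    proof -
      obtain x where x: "x \<in> P" "c = x <#\<^bsub>G\<^esub> Q" using c by (auto simp: cosets_def)
      have "inj_on (\<lambda>q. x \<cdot> q) Q"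
      proof (rule inj_onI)
        fix q r assume qr: "q \<in> Q" "r \<in> Q" "x \<cdot> q = x \<cdot> r"
        then show "q = r" using inverse_mors_cancel(1)[OF iv(1)[OF P_sub[OF x(1)]], of q X]
          inverse_mors_cancel(1)[OF iv(1)[OF P_sub[OF x(1)]], of r X] P_sub QP by (metis psubsetD)
      qed
      moreover have "c = (\<lambda>q. x \<cdot> q) ` Q" unfolding x(2) coset_eq by blast
      ultimately show ?thesis by (simp add: card_image)
    qed
    show "c \<inter> d = {}" if cd: "c \<in> cosets Q" "d \<in> cosets Q" "c \<noteq> d" for c d
      using coset_facts(4)[OF Q cd(1)] coset_facts(4)[OF Q cd(2)] cd(3) by blast
  qed
  then have m: "card Q * card (cosets Q) = card P" using cov by simp
  obtain n where n: "card P = p ^ n" using P by (auto simp: p_subgroup_def)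
  have "card (cosets Q) dvd p ^ n" using m n by (metis dvd_triv_right)
  then obtain k where k: "card (cosets Q) = p ^ k" using divides_primepow_nat[OF prime] by blast
  have "card Q < card P" using psubset_card_mono[OF fin QP] .
  then have "k \<noteq> 0" using m k by (cases k) auto
  then have "p dvd card (cosets Q)" using k by (simp add: dvd_power)
  then show ?thesis using char by (simp add: of_nat_eq_0_iff_char_dvd)
qed

definition trace_from :: "'m set \<Rightarrow> ('m \<Rightarrow> 'k) \<Rightarrow> 'm \<Rightarrow> 'k" where "trace_from Q a = rel_trace G (B X) Q P a"

lemma trace_from_in: assumes Q: "Q \<in> proper_subgroups" and a: "a \<in> span_of (Hom D X X)" shows "trace_from Q a \<in> span_of (Hom D X X)"
  unfolding trace_from_def rel_trace_def cosets_def[symmetric]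
  by (rule finsum_in) (use coset_facts(3)[OF Q] P_sub conj_act_mult(1)[OF _ a] in blast)

lemma trace_from_apply:
  assumes Q: "Q \<in> proper_subgroups" and a: "a \<in> span_of (Hom D X X)" and h: "h \<in> Hom D X X"
  shows "trace_from Q a h = (\<Sum>c\<in>cosets Q. a (conj_by (SOME x. x \<in> c) h) * conj_scalar (SOME x. x \<in> c) h)"
proof -
  have c: "(SOME x. x \<in> c) \<in> Hom D X X" if "c \<in> cosets Q" for c using coset_facts(3)[OF Q that] P_sub by blast
  have "trace_from Q a h = (\<Sum>c\<in>cosets Q. conj_act (B X) (SOME x. x \<in> c) a h)"
    unfolding trace_from_def rel_trace_def cosets_def[symmetric]
    by (rule finsum_apply[OF finite_cosets]) (use c conj_act_mult(1)[OF _ a] in blast)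
  then show ?thesis using conj_act_eq[OF c a h] by simp
qed

abbreviation I where "I \<equiv> trace_ideal G (B X) P"

lemma trace_ideal_iff: "i \<in> I \<longleftrightarrow> (\<exists>a. (\<forall>Q\<in>proper_subgroups. a Q \<in> fixed_elts (B X) Q) \<and> i = (\<Oplus>\<^bsub>B X\<^esub>Q\<in>proper_subgroups. trace_from Q (a Q)))"
  unfolding trace_ideal_def trace_from_def proper_subgroups_def by auto

lemma fixed_in: "a \<in> fixed_elts (B X) Q \<Longrightarrow> a \<in> span_of (Hom D X X)"
  by (simp add: fixed_elts_def idem_alg_simps(1)[OF X])

lemma trace_sum_apply:
  assumes a: "\<forall>Q\<in>proper_subgroups. a Q \<in> span_of (Hom D X X)"
  shows "(\<Oplus>\<^bsub>B X\<^esub>Q\<in>proper_subgroups. trace_from Q (a Q)) h = (\<Sum>Q\<in>proper_subgroups. trace_from Q (a Q) h)"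
  by (rule finsum_apply[OF finite_proper_subgroups]) (use a trace_from_in in blast)

text \<open>At an element centralising \<open>P\<close> all conjugates of \<open>a\<close> have the same coefficient.  The trace from
  \<open>Q\<close> multiplies it by the index of \<open>Q\<close> in \<open>P\<close>, which is divisible by \<open>p\<close>.\<close>

lemma trace_ideal_vanishes:
  assumes i: "i \<in> I" and h: "h \<in> centraliser G P" shows "i h = 0"
proof -
  obtain a where a: "\<And>Q. Q \<in> proper_subgroups \<Longrightarrow> a Q \<in> fixed_elts (B X) Q" "i = (\<Oplus>\<^bsub>B X\<^esub>Q\<in>proper_subgroups. trace_from Q (a Q))"
    using i trace_ideal_iff by blast
  note as = fixed_in[OF a(1)]
  have hH: "h \<in> Hom D X X" using h by (simp add: centraliser_def)
  have "trace_from Q (a Q) h = 0" if Q: "Q \<in> proper_subgroups" for Q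
  proof -
    have "a Q (conj_by (SOME x. x \<in> c) h) * conj_scalar (SOME x. x \<in> c) h = a Q h" if c: "c \<in> cosets Q" for c
    proof -
      let ?x = "SOME x. x \<in> c"
      have x: "?x \<in> P" using coset_facts(3)[OF Q c] .
      have "conj_by ?x h = h" using conj_by_eq_iff[OF P_sub[OF x] hH hH] h x by (simp add: centraliser_def)
      then show ?thesis using conj_scalar_centraliser[OF x h] by simp
    qed
    then have "trace_from Q (a Q) h = (\<Sum>c\<in>cosets Q. a Q h)" unfolding trace_from_apply[OF Q as[OF Q] hH] by (rule sum.cong[OF refl])
    then show ?thesis using of_nat_card_cosets[OF Q] by simp
  qed
  moreover have "i h = (\<Sum>Q\<in>proper_subgroups. trace_from Q (a Q) h)" unfolding a(2) by (rule trace_sum_apply) (use as in blast)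
  ultimately show ?thesis by simp
qed

lemma fixed_diff:
  assumes Q: "Q \<subseteq> Hom D X X" and a: "a \<in> fixed_elts (B X) Q" and b: "b \<in> fixed_elts (B X) Q"
  shows "(\<lambda>h. a h - b h) \<in> fixed_elts (B X) Q"
proof -
  note as = fixed_in[OF a] and bs = fixed_in[OF b]
  have d: "(\<lambda>h. a h - b h) \<in> span_of (Hom D X X)" using as bs by (simp add: span_of_def)
  have "conj_act (B X) x (\<lambda>h. a h - b h) = (\<lambda>h. a h - b h)" if x: "x \<in> Q" for x
  proof
    fix h
    have xh: "x \<in> Hom D X X" using Q x by blast
    have e: "conj_act (B X) x a = a" "conj_act (B X) x b = b" using a b x by (auto simp: fixed_elts_def)
    show "conj_act (B X) x (\<lambda>h. a h - b h) h = a h - b h"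
    proof (cases "h \<in> Hom D X X")
      case True
      show ?thesis unfolding conj_act_eq[OF xh d True]
        using conj_act_eq[OF xh as True] conj_act_eq[OF xh bs True] by (simp add: e left_diff_distrib)
    next
      case False then show ?thesis using conj_act_mult(1)[OF xh d] d by (simp add: span_of_def)
    qed
  qed
  then show ?thesis using d by (simp add: fixed_elts_def idem_alg_simps(1)[OF X])
qed

lemma trace_ideal_diff:
  assumes "i \<in> I" "j \<in> I" shows "(\<lambda>h. i h - j h) \<in> I"
proof -
  obtain a where a: "\<And>Q. Q \<in> proper_subgroups \<Longrightarrow> a Q \<in> fixed_elts (B X) Q" "i = (\<Oplus>\<^bsub>B X\<^esub>Q\<in>proper_subgroups. trace_from Q (a Q))"
    using assms(1) trace_ideal_iff by blast
  obtain b where b: "\<And>Q. Q \<in> proper_subgroups \<Longrightarrow> b Q \<in> fixed_elts (B X) Q" "j = (\<Oplus>\<^bsub>B X\<^esub>Q\<in>proper_subgroups. trace_from Q (b Q))"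
    using assms(2) trace_ideal_iff by blast
  note as = fixed_in[OF a(1)] and bs = fixed_in[OF b(1)]
  define d where "d Q = (\<lambda>h. a Q h - b Q h)" for Q
  have d: "d Q \<in> fixed_elts (B X) Q" if Q: "Q \<in> proper_subgroups" for Q
    unfolding d_def by (rule fixed_diff[OF _ a(1)[OF Q] b(1)[OF Q]]) (use Q P_sub in \<open>auto simp: proper_subgroups_def\<close>)
  note ds = fixed_in[OF d]
  have "(\<lambda>h. i h - j h) = (\<Oplus>\<^bsub>B X\<^esub>Q\<in>proper_subgroups. trace_from Q (d Q))"
  proof
    fix h
    have "trace_from Q (d Q) h = trace_from Q (a Q) h - trace_from Q (b Q) h" if Q: "Q \<in> proper_subgroups" for Q
    proof (cases "h \<in> Hom D X X")
      case True
      show ?thesis unfolding trace_from_apply[OF Q ds[OF Q] True] trace_from_apply[OF Q as[OF Q] True] trace_from_apply[OF Q bs[OF Q] True]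
        by (simp add: d_def left_diff_distrib sum_subtractf)
    next
      case False
      then show ?thesis using trace_from_in[OF Q ds[OF Q]] trace_from_in[OF Q as[OF Q]] trace_from_in[OF Q bs[OF Q]] by (simp add: span_of_def)
    qed
    moreover have "i h = (\<Sum>Q\<in>proper_subgroups. trace_from Q (a Q) h)" unfolding a(2) by (rule trace_sum_apply) (use as in blast)
    moreover have "j h = (\<Sum>Q\<in>proper_subgroups. trace_from Q (b Q) h)" unfolding b(2) by (rule trace_sum_apply) (use bs in blast)
    moreover have "(\<Oplus>\<^bsub>B X\<^esub>Q\<in>proper_subgroups. trace_from Q (d Q)) h = (\<Sum>Q\<in>proper_subgroups. trace_from Q (d Q) h)"
      by (rule trace_sum_apply) (use ds in blast)
    ultimately show "i h - j h = (\<Oplus>\<^bsub>B X\<^esub>Q\<in>proper_subgroups. trace_from Q (d Q)) h" by (simp add: sum_subtractf)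
  qed
  then show ?thesis unfolding trace_ideal_iff using d by blast
qed

definition centraliser_part :: "('m \<Rightarrow> 'k) \<Rightarrow> 'm \<Rightarrow> 'k" where
  "centraliser_part a = (\<lambda>h. if h \<in> centraliser G P then a h else 0)"

definition P_orbit :: "'m \<Rightarrow> 'm set" where "P_orbit h = {g \<in> Hom D X X. \<exists>x\<in>P. x \<cdot> g = h \<cdot> x}"

definition P_stab :: "'m \<Rightarrow> 'm set" where "P_stab g = {x \<in> P. x \<cdot> g = g \<cdot> x}"

lemma P_orbit_refl: assumes h: "h \<in> Hom D X X" shows "h \<in> P_orbit h"
proof -
  have "Ide D X \<cdot> h = h \<cdot> Ide D X" using Hom_ide[OF h] by simp
  then show ?thesis using p_subgroupD(3)[OF P] h unfolding P_orbit_def by blast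
qed

lemma P_orbit_eq:
  assumes h: "h \<in> Hom D X X" and g: "g \<in> P_orbit h" shows "P_orbit g = P_orbit h"
proof -
  obtain x where x: "x \<in> P" "x \<cdot> g = h \<cdot> x" and gH: "g \<in> Hom D X X" using g by (auto simp: P_orbit_def)
  note xH = P_sub[OF x(1)]
  have ix: "iv x \<in> P" using subgroup.m_inv_closed[OF P_subgroup x(1)] .
  have "f \<in> P_orbit h" if f: "f \<in> P_orbit g" for f
  proof -
    obtain y where y: "y \<in> P" "y \<cdot> f = g \<cdot> y" "f \<in> Hom D X X" using f by (auto simp: P_orbit_def)
    note yH = P_sub[OF y(1)]
    have "x \<cdot> y \<cdot> f = x \<cdot> (g \<cdot> y)" using Hom_assoc[OF xH yH y(3)] y by simp
    also have "\<dots> = x \<cdot> g \<cdot> y" using Hom_assoc[OF xH gH yH] by simp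
    also have "\<dots> = h \<cdot> (x \<cdot> y)" using x Hom_assoc[OF h xH yH] by simp
    finally show ?thesis using p_subgroupD(6)[OF P x(1) y(1)] y(3) by (auto simp: P_orbit_def)
  qed
  moreover have "f \<in> P_orbit g" if f: "f \<in> P_orbit h" for f
  proof -
    obtain y where y: "y \<in> P" "y \<cdot> f = h \<cdot> y" "f \<in> Hom D X X" using f by (auto simp: P_orbit_def)
    note yH = P_sub[OF y(1)] and iH = P_sub[OF ix]
    have gx: "g \<cdot> iv x = iv x \<cdot> h"
    proof -
      have "x \<cdot> (g \<cdot> iv x) = h" using x Hom_assoc[OF xH gH iH] inverse_mors_cancel(3)[OF iv(1)[OF xH] h] by simp
      then show ?thesis using inverse_mors_cancel(1)[OF iv(1)[OF xH] G_comp[OF gH iH]] by simp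
    qed
    have "iv x \<cdot> y \<cdot> f = iv x \<cdot> (h \<cdot> y)" using Hom_assoc[OF iH yH y(3)] y by simp
    also have "\<dots> = g \<cdot> iv x \<cdot> y" using Hom_assoc[OF iH h yH] gx by simp
    also have "\<dots> = g \<cdot> (iv x \<cdot> y)" using Hom_assoc[OF gH iH yH] .
    finally show ?thesis using p_subgroupD(6)[OF P ix y(1)] y(3) by (auto simp: P_orbit_def)
  qed
  ultimately show ?thesis by blast
qed

lemma P_stab_subgroup: assumes g: "g \<in> Hom D X X" shows "subgroup (P_stab g) G"
proof (rule G.subgroupI)
  show "P_stab g \<subseteq> carrier G" using P_sub by (auto simp: P_stab_def)
  have "Ide D X \<in> P_stab g" using p_subgroupD(3)[OF P] Hom_ide[OF g] by (simp add: P_stab_def)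
  then show "P_stab g \<noteq> {}" by blast
  show "iv x \<in> P_stab g" if x: "x \<in> P_stab g" for x
  proof -
    have x': "x \<in> P" "x \<cdot> g = g \<cdot> x" using x by (auto simp: P_stab_def)
    note xH = P_sub[OF x'(1)] and i = iv[OF P_sub[OF x'(1)]]
    have "x \<cdot> (g \<cdot> iv x) = g"
      using x' Hom_assoc[OF xH g i(2)] inverse_mors_cancel(3)[OF i(1) g] by simp
    then have "g \<cdot> iv x = iv x \<cdot> g" using inverse_mors_cancel(1)[OF i(1) G_comp[OF g i(2)]] by simp
    then show ?thesis using subgroup.m_inv_closed[OF P_subgroup x'(1)] by (simp add: P_stab_def)
  qed
  show "x \<otimes>\<^bsub>G\<^esub> y \<in> P_stab g" if xy: "x \<in> P_stab g" "y \<in> P_stab g" for x y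
  proof -
    have x: "x \<in> P" "x \<cdot> g = g \<cdot> x" "y \<in> P" "y \<cdot> g = g \<cdot> y" using xy by (auto simp: P_stab_def)
    note xH = P_sub[OF x(1)] and yH = P_sub[OF x(3)]
    have "x \<cdot> y \<cdot> g = g \<cdot> (x \<cdot> y)"
      using Hom_assoc[OF xH yH g] Hom_assoc[OF xH g yH] Hom_assoc[OF g xH yH] x by simp
    then show ?thesis using p_subgroupD(6)[OF P x(1,3)] by (simp add: P_stab_def)
  qed
qed

text \<open>Choose a representative \<open>g\<close> of each orbit of \<open>P\<close> outside the centraliser.  Since \<open>a\<close> is fixed by
  \<open>P\<close>, the trace of its term at \<open>g\<close> from the stabiliser of \<open>g\<close>, a proper subgroup of \<open>P\<close>, is the part
  of \<open>a\<close> supported on the orbit.\<close>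

lemma fixed_minus_centraliser_part:
  assumes a: "a \<in> fixed_elts (B X) P" shows "(\<lambda>h. a h - centraliser_part a h) \<in> I"
proof -
  note as = fixed_in[OF a]
  have fixed: "a (conj_by x h) * conj_scalar x h = a h" if "x \<in> P" "h \<in> Hom D X X" for x h
  proof -
    have "conj_act (B X) x a = a" using a that by (auto simp: fixed_elts_def)
    then show ?thesis using conj_act_eq[OF P_sub[OF that(1)] as that(2)] by simp
  qed
  define rp where "rp h = (SOME g. g \<in> P_orbit h)" for h
  have rp: "rp h \<in> P_orbit h" if "h \<in> Hom D X X" for h unfolding rp_def using P_orbit_refl[OF that] by (rule someI)
  have rp_eq: "rp g = rp h" if "h \<in> Hom D X X" "g \<in> P_orbit h" for g h
    unfolding rp_def P_orbit_eq[OF that] ..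
  \<comment> \<open>The chosen orbit representatives outside the centraliser with stabiliser \<open>Q\<close>.\<close>
  define N where "N Q g \<longleftrightarrow> g \<in> Hom D X X \<and> g \<notin> centraliser G P \<and> rp g = g \<and> P_stab g = Q" for Q g
  define f where "f Q = (\<lambda>g. if N Q g then a g else 0)" for Q
  have fs: "f Q \<in> span_of (Hom D X X)" for Q by (auto simp: f_def N_def span_of_def)
  have ff: "f Q \<in> fixed_elts (B X) Q" if Q: "Q \<in> proper_subgroups" for Q
  proof -
    have "conj_act (B X) x (f Q) h = f Q h" if x: "x \<in> Q" for x h
    proof (cases "h \<in> Hom D X X")
      case True
      have xP: "x \<in> P" using x Q by (auto simp: proper_subgroups_def)
      note xH = P_sub[OF xP]
      have s: "conj_by x h = h" if "N Q h"
      proof -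
        have "x \<in> P_stab h" using that x by (simp add: N_def)
        then show ?thesis using conj_by_eq_iff[OF xH True True] by (simp add: P_stab_def)
      qed
      have s': "conj_by x h = h" if n: "N Q (conj_by x h)"
      proof -
        have "x \<in> P_stab (conj_by x h)" using n x by (simp add: N_def)
        then have "x \<cdot> conj_by x h = conj_by x h \<cdot> x" by (simp add: P_stab_def)
        moreover have "h \<cdot> x = x \<cdot> conj_by x h" using conj_by_eq_iff[OF xH True conj_by_Hom[OF xH True]] by simp
        ultimately have "h \<cdot> x = conj_by x h \<cdot> x" by simp
        then show ?thesis using inverse_mors_cancel(3)[OF iv(1)[OF xH] True]
          inverse_mors_cancel(3)[OF iv(1)[OF xH] conj_by_Hom[OF xH True]] by metis
      qed
      have "f Q (conj_by x h) * conj_scalar x h = f Q h"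
      proof (cases "N Q h")
        case True': True
        then show ?thesis using s fixed[OF xP True] by (simp add: f_def)
      next
        case False
        then have "\<not> N Q (conj_by x h)" using s' by metis
        then show ?thesis using False by (simp add: f_def)
      qed
      then show ?thesis using conj_act_eq[OF xH fs True] by simp
    next
      case False
      have xH: "x \<in> Hom D X X" using x Q P_sub by (auto simp: proper_subgroups_def)
      then show ?thesis using False conj_act_mult(1)[OF xH fs, of Q] fs[of Q] by (simp add: span_of_def)
    qed
    then show ?thesis using fs by (auto simp: fixed_elts_def idem_alg_simps(1)[OF X])
  qed
  have tr_f: "trace_from Q (f Q) h = (\<Sum>c\<in>cosets Q. if N Q (conj_by (SOME x. x \<in> c) h) then a h else 0)"
    if Q: "Q \<in> proper_subgroups" and h: "h \<in> Hom D X X" for Q h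
    unfolding trace_from_apply[OF Q fs h]
    by (intro sum.cong refl) (use fixed[OF coset_facts(3)[OF Q] h] in \<open>auto simp: f_def\<close>)
  have "(\<lambda>h. a h - centraliser_part a h) = (\<Oplus>\<^bsub>B X\<^esub>Q\<in>proper_subgroups. trace_from Q (f Q))"
  proof
    fix h
    have sum: "(\<Oplus>\<^bsub>B X\<^esub>Q\<in>proper_subgroups. trace_from Q (f Q)) h = (\<Sum>Q\<in>proper_subgroups. trace_from Q (f Q) h)" by (rule trace_sum_apply) (use fs in blast)
    consider "h \<notin> Hom D X X" | "h \<in> centraliser G P" | "h \<in> Hom D X X" "h \<notin> centraliser G P" by blast
    then show "a h - centraliser_part a h = (\<Oplus>\<^bsub>B X\<^esub>Q\<in>proper_subgroups. trace_from Q (f Q)) h"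
    proof cases
      case 1
      then have "trace_from Q (f Q) h = 0" if "Q \<in> proper_subgroups" for Q using trace_from_in[OF that fs] by (simp add: span_of_def)
      then show ?thesis unfolding sum using 1 as by (simp add: span_of_def centraliser_part_def)
    next
      case 2
      then have h: "h \<in> Hom D X X" by (simp add: centraliser_def)
      have "conj_by x h = h" if "x \<in> P" for x
        using conj_by_eq_iff[OF P_sub[OF that] h h] 2 that by (simp add: centraliser_def)
      then have "trace_from Q (f Q) h = 0" if "Q \<in> proper_subgroups" for Q
        unfolding tr_f[OF that h] using coset_facts(3)[OF that] 2 by (intro sum.neutral) (auto simp: N_def)
      then show ?thesis unfolding sum using 2 by (simp add: centraliser_part_def)
    next
      case 3
      note h = 3(1)
      define g where "g = rp h"
      have g: "g \<in> P_orbit h" "g \<in> Hom D X X" using rp[OF h] by (auto simp: g_def P_orbit_def)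
      obtain x0 where x0: "x0 \<in> P" "x0 \<cdot> g = h \<cdot> x0" using g by (auto simp: P_orbit_def)
      note x0H = P_sub[OF x0(1)]
      have gn: "g \<notin> centraliser G P"
      proof
        assume "g \<in> centraliser G P"
        then have gc: "g \<cdot> y = y \<cdot> g" if "y \<in> P" for y using that by (simp add: centraliser_def)
        have "h \<cdot> x0 = g \<cdot> x0" using x0 gc by simp
        then have "h = g" using inverse_mors_cancel(3)[OF iv(1)[OF x0H] h]
          inverse_mors_cancel(3)[OF iv(1)[OF x0H] g(2)] by metis
        then show False using \<open>g \<in> centraliser G P\<close> 3 by simp
      qed
      have ng: "P_stab g \<in> proper_subgroups"
      proof -
        have "P_stab g \<noteq> P"
        proof
          assume "P_stab g = P"
          then have "y \<in> P_stab g" if "y \<in> P" for y using that by simp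
          then have "g \<cdot> y = y \<cdot> g" if "y \<in> P" for y using that by (simp add: P_stab_def)
          then show False using gn g by (simp add: centraliser_def)
        qed
        then show ?thesis using P_stab_subgroup[OF g(2)] by (auto simp: proper_subgroups_def P_stab_def)
      qed
      have cjo: "conj_by x h \<in> P_orbit h" if "x \<in> P" for x
      proof -
        have "x \<cdot> conj_by x h = h \<cdot> x" using conj_by_eq_iff[OF P_sub[OF that] h conj_by_Hom[OF P_sub[OF that] h]] by simp
        then show ?thesis unfolding P_orbit_def using conj_by_Hom[OF P_sub[OF that] h] that by blast
      qed
      have N: "N Q (conj_by x h) \<longleftrightarrow> conj_by x h = g \<and> Q = P_stab g" if x: "x \<in> P" for x Q
      proof
        assume n: "N Q (conj_by x h)"
        then have "conj_by x h = g" using rp_eq[OF h cjo[OF x]] by (simp add: N_def g_def)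
        then show "conj_by x h = g \<and> Q = P_stab g" using n by (simp add: N_def)
      next
        assume "conj_by x h = g \<and> Q = P_stab g"
        then show "N Q (conj_by x h)" using g gn rp_eq[OF h g(1)] by (simp add: N_def g_def)
      qed
      have z: "trace_from Q (f Q) h = 0" if "Q \<in> proper_subgroups" "Q \<noteq> P_stab g" for Q
        unfolding tr_f[OF that(1) h] using N[OF coset_facts(3)[OF that(1)]] that(2)
        by (intro sum.neutral) auto
      let ?c0 = "x0 <#\<^bsub>G\<^esub> P_stab g"
      have c0: "?c0 \<in> cosets (P_stab g)" using x0 by (simp add: cosets_def)
      \<comment> \<open>Exactly one coset of the stabiliser of \<open>g\<close> conjugates \<open>g\<close> to \<open>h\<close>, so the term of \<open>h\<close> occurs once.\<close>
      have one: "conj_by (SOME x. x \<in> c) h = g \<longleftrightarrow> c = ?c0" if c: "c \<in> cosets (P_stab g)" for c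
      proof -
        let ?x = "SOME x. x \<in> c"
        have x: "?x \<in> c" "?x \<in> P" using coset_facts(2,3)[OF ng c] by auto
        note xH = P_sub[OF x(2)]
        have "conj_by ?x h = g \<longleftrightarrow> ?x \<in> ?c0"
        proof
          assume "conj_by ?x h = g"
          then have e: "h \<cdot> ?x = ?x \<cdot> g" using conj_by_eq_iff[OF xH h g(2)] by simp
          let ?y = "iv x0 \<cdot> ?x"
          have yP: "?y \<in> P" using p_subgroupD(6)[OF P subgroup.m_inv_closed[OF P_subgroup x0(1)] x(2)] .
          note yH = P_sub[OF yP]
          have x0y: "x0 \<cdot> ?y = ?x" using inverse_mors_cancel(2)[OF iv(1)[OF x0H] xH] .
          have "x0 \<cdot> (?y \<cdot> g) = x0 \<cdot> (g \<cdot> ?y)"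
          proof -
            have "x0 \<cdot> (?y \<cdot> g) = ?x \<cdot> g" using Hom_assoc[OF x0H yH g(2)] x0y by simp
            also have "\<dots> = h \<cdot> (x0 \<cdot> ?y)" using e x0y by simp
            also have "\<dots> = x0 \<cdot> g \<cdot> ?y" using Hom_assoc[OF h x0H yH] x0(2) by simp
            also have "\<dots> = x0 \<cdot> (g \<cdot> ?y)" using Hom_assoc[OF x0H g(2) yH] .
            finally show ?thesis .
          qed
          then have "?y \<cdot> g = g \<cdot> ?y" using inverse_mors_cancel(1)[OF iv(1)[OF x0H] G_comp[OF yH g(2)]]
            inverse_mors_cancel(1)[OF iv(1)[OF x0H] G_comp[OF g(2) yH]] by metis
          then have "?y \<in> P_stab g" using yP by (simp add: P_stab_def)
          then show "?x \<in> ?c0" unfolding coset_eq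
            by (intro CollectI exI[of _ ?y] conjI) (simp only: x0y)
        next
          assume "?x \<in> ?c0"
          then obtain q where q: "q \<in> P_stab g" "?x = x0 \<cdot> q" by (auto simp: coset_eq)
          have qP: "q \<in> P" "q \<cdot> g = g \<cdot> q" using q(1) by (auto simp: P_stab_def)
          note qH = P_sub[OF qP(1)]
          have "h \<cdot> (x0 \<cdot> q) = x0 \<cdot> g \<cdot> q" using Hom_assoc[OF h x0H qH] x0(2) by simp
          also have "\<dots> = x0 \<cdot> q \<cdot> g" using Hom_assoc[OF x0H g(2) qH] Hom_assoc[OF x0H qH g(2)] qP(2) by simp
          finally show "conj_by ?x h = g" using conj_by_eq_iff[OF xH h g(2)] q(2) by simp
        qed
        also have "\<dots> \<longleftrightarrow> c = ?c0"
          using coset_eq_iff[OF ng x0(1) x(2)] coset_facts(4)[OF ng c x(1)] by auto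
        finally show ?thesis .
      qed
      have "trace_from (P_stab g) (f (P_stab g)) h = (\<Sum>c\<in>cosets (P_stab g). if c = ?c0 then a h else 0)"
        unfolding tr_f[OF ng h] using N[OF coset_facts(3)[OF ng]] one by (intro sum.cong refl) simp
      also have "\<dots> = a h" using c0 finite_cosets by simp
      finally have t: "trace_from (P_stab g) (f (P_stab g)) h = a h" .
      have "(\<Sum>Q\<in>proper_subgroups. trace_from Q (f Q) h) = (\<Sum>Q\<in>proper_subgroups. if Q = P_stab g then a h else 0)"
        by (intro sum.cong refl) (use z t in auto)
      also have "\<dots> = a h" using ng finite_proper_subgroups by simp
      finally show ?thesis unfolding sum using 3 by (simp add: centraliser_part_def)
    qed
  qed
  then show ?thesis unfolding trace_ideal_iff using ff by blast
qed

text \<open>Modulo the trace ideal a fixed element equals its restriction to the centraliser, and no other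
  element supported there, because elements of the ideal vanish on the centraliser.\<close>

lemma brauer_map_eq:
  assumes a: "a \<in> fixed_elts (B X) P"
  shows "brauer_map (idem_group D (Ide D X)) (B X) P a = centraliser_part a"
proof -
  let ?R = "(B X)\<lparr>carrier := fixed_elts (B X) P\<rparr>"
  have coset: "I +>\<^bsub>?R\<^esub> c = {\<lambda>h. i h + c h | i. i \<in> I}" for c
    by (auto simp: a_r_coset_def r_coset_def idem_alg_simps(3)[OF X])
  have zero: "(\<lambda>_. 0) \<in> I" using trace_ideal_diff[OF fixed_minus_centraliser_part[OF a] fixed_minus_centraliser_part[OF a]] by simp
  have add: "(\<lambda>h. i h + j h) \<in> I" if "i \<in> I" "j \<in> I" for i j
    using trace_ideal_diff[OF that(1) trace_ideal_diff[OF zero that(2)]] by simp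
  have cp: "centraliser_part a \<in> span_of (centraliser G P)" by (auto simp: centraliser_part_def span_of_def)
  have inj: "inj_on (\<lambda>c. I +>\<^bsub>?R\<^esub> c) (span_of (centraliser G P))"
  proof (rule inj_onI)
    fix c d assume c: "c \<in> span_of (centraliser G P)" and d: "d \<in> span_of (centraliser G P)"
      and e: "I +>\<^bsub>?R\<^esub> c = I +>\<^bsub>?R\<^esub> d"
    have "c \<in> I +>\<^bsub>?R\<^esub> c" unfolding coset
      by (intro CollectI exI[of _ "\<lambda>_. 0"] conjI zero) simp
    then have "c \<in> I +>\<^bsub>?R\<^esub> d" unfolding e .
    then obtain i where i: "i \<in> I" "c = (\<lambda>h. i h + d h)" unfolding coset by blast
    show "c = d"
    proof
      fix h show "c h = d h"
      proof (cases "h \<in> centraliser G P")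
        case True then show ?thesis using trace_ideal_vanishes[OF i(1) True] by (simp add: i(2))
      next
        case False then show ?thesis using c d by (simp add: span_of_def)
      qed
    qed
  qed
  note d = fixed_minus_centraliser_part[OF a]
  have "I +>\<^bsub>?R\<^esub> a = I +>\<^bsub>?R\<^esub> centraliser_part a"
  proof (intro equalityI subsetI)
    fix z assume "z \<in> I +>\<^bsub>?R\<^esub> a"
    then obtain i where i: "i \<in> I" "z = (\<lambda>h. i h + a h)" unfolding coset by blast
    have "z = (\<lambda>h. (i h + (a h - centraliser_part a h)) + centraliser_part a h)" using i by simp
    then show "z \<in> I +>\<^bsub>?R\<^esub> centraliser_part a" unfolding coset
      by (intro CollectI exI[of _ "\<lambda>h. i h + (a h - centraliser_part a h)"] conjI add[OF i(1) d])
  next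
    fix z assume "z \<in> I +>\<^bsub>?R\<^esub> centraliser_part a"
    then obtain i where i: "i \<in> I" "z = (\<lambda>h. i h + centraliser_part a h)" unfolding coset by blast
    have "z = (\<lambda>h. (i h - (a h - centraliser_part a h)) + a h)" using i by simp
    then show "z \<in> I +>\<^bsub>?R\<^esub> a" unfolding coset
      by (intro CollectI exI[of _ "\<lambda>h. i h - (a h - centraliser_part a h)"] conjI trace_ideal_diff[OF i(1) d])
  qed
  then show ?thesis unfolding brauer_map_def G_def[symmetric]
    using inv_into_f_f[OF inj cp] by simp
qed

end

section \<open>Weights belonging to a central idempotent\<close>

lemma (in brauer_setting) central_fixed:
  assumes a: "a \<in> span_of (Hom D X X)"
    and c: "\<And>x. x \<in> P \<Longrightarrow> single x 1 \<otimes>\<^bsub>A\<^esub> a = a \<otimes>\<^bsub>A\<^esub> single x 1"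
  shows "a \<in> fixed_elts (B X) P"
proof -
  have "conj_act (B X) x a = a" if x: "x \<in> P" for x
  proof -
    have xH: "x \<in> Hom D X X" using P_sub[OF x] .
    obtain z where z: "z \<in> span_of (Hom D X X)" "m_inv (B X) (basis_elt x) = z"
      "basis_elt x \<otimes>\<^bsub>A\<^esub> z = hat X" using basis_inverse[OF xH] by blast
    have b: "basis_elt x = single x 1" by (simp add: basis_elt_def)
    note k = conj_act_mult[OF xH a]
    have "conj_act (B X) x a = conj_act (B X) x a \<otimes>\<^bsub>A\<^esub> single x 1 \<otimes>\<^bsub>A\<^esub> z"
      using mult_hat_Hom[OF X k(1)] z(3) by (simp add: mult_assoc b)
    also have "\<dots> = a \<otimes>\<^bsub>A\<^esub> single x 1 \<otimes>\<^bsub>A\<^esub> z" using k(2) c[OF x] by simp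
    also have "\<dots> = a" using mult_hat_Hom[OF X a] z(3) by (simp add: mult_assoc b)
    finally show ?thesis .
  qed
  then show ?thesis using a by (simp add: fixed_elts_def idem_alg_simps(1)[OF X])
qed

lemma cocycle_mono: "cocycle D U \<alpha> \<Longrightarrow> U \<subseteq> V \<Longrightarrow> cocycle D V \<alpha>"
  by (auto simp: cocycle_def)

lemma idem_group_cong:
  assumes "Comp D' = Comp D" "Dom D' e = Dom D e" "Hom D' (Dom D e) (Dom D e) = Hom D (Dom D e) (Dom D e)"
  shows "idem_group D' e = idem_group D e" "idem_cat D' e = idem_cat D e"
  using assms by (simp_all add: idem_group_def idem_cat_def)

locale twisted_orbit = ei_category D for D :: "('o, 'm) cat" (structure) +
  fixes p :: nat and \<alpha> :: "'m tmor set \<Rightarrow> 'm tmor set \<Rightarrow> 'k::field"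
  assumes prime: "prime p" and char: "CHAR('k) = p"
    and \<alpha>: "cocycle (Orb p) (prime_subfield - {0}) \<alpha>"
begin

abbreviation \<beta> where "\<beta> \<equiv> res_cocycle D \<alpha>"

lemma \<beta>: "cocycle D (prime_subfield - {0}) \<beta>"
  by (rule res_cocycle[OF \<alpha>])

sublocale base: fp_twisted_ei_category D \<beta>
  by unfold_locales (rule cocycle_mono[OF \<beta>], auto intro: \<beta>)

sublocale O: fp_twisted_ei_category "Orb p" \<alpha>
proof -
  interpret OO: ei_category "Orb p" by (rule orbit_ei)
  show "fp_twisted_ei_category (Orb p) \<alpha>"
    by unfold_locales (rule cocycle_mono[OF \<alpha>], auto intro: \<alpha>)
qed

subsection \<open>The inclusion of the category algebra into that of the orbit category\<close>

abbreviation oe where "oe \<equiv> orbit_embed D"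

lemma oe_Hom: "s \<in> Hom D X Y \<Longrightarrow> oe s \<in> Hom (Orb p) (X, {Ide D X}) (Y, {Ide D Y})"
  using tmor_trivial[OF _ trivial_p_subgroup] HomD(5) by (auto simp: orbit_Hom orbit_embed_oclass)

lemma oe_inj: assumes "s \<in> Mor D" "t \<in> Mor D" "oe s = oe t" shows "s = t"
proof -
  have s: "s \<in> Hom D (Dom D s) (Cod D s)" and t: "t \<in> Hom D (Dom D t) (Cod D t)" using assms by (auto simp: Hom_def)
  note ts = tmor_trivial[OF s trivial_p_subgroup[OF HomD(5)[OF s]], of p]
  note tt = tmor_trivial[OF t trivial_p_subgroup[OF HomD(5)[OF t]], of p]
  have "oclass {Ide D (Dom D s)} {Ide D (Cod D s)} s = oclass {Ide D (Dom D t)} {Ide D (Cod D t)} t"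
    using assms(3) by (simp only: orbit_embed_oclass[OF s] orbit_embed_oclass[OF t])
  then have "\<exists>y\<in>{Ide D (Cod D s)}. t = y \<cdot> s" by (rule oclass_eq_iff[OF ts tt, THEN iffD1, THEN conjunct2, THEN conjunct2])
  then show ?thesis using Hom_ide(2)[OF s] by simp
qed

lemma oe_Mor: "s \<in> Mor D \<Longrightarrow> oe s \<in> Mor (Orb p)"
  using oe_Hom[of s "Dom D s" "Cod D s"] by (simp add: Hom_def)

text \<open>The linear extension of \<open>orbit_embed\<close>; it is the inclusion of the algebra of \<open>C\<close> into that of its
  orbit category.\<close>

definition embed :: "('m \<Rightarrow> 'k) \<Rightarrow> 'm tmor set \<Rightarrow> 'k" where
  "embed a = (\<lambda>c. \<Sum>x | x \<in> Mor D \<and> oe x = c. a x)"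

lemma embed_oe: assumes "x \<in> Mor D" shows "embed a (oe x) = a x"
proof -
  have "{y. y \<in> Mor D \<and> oe y = oe x} = {x}" using oe_inj assms by blast
  then show ?thesis by (simp add: embed_def)
qed

lemma embed_out: assumes "c \<notin> oe ` Mor D" shows "embed a c = 0"
proof -
  have "{x. x \<in> Mor D \<and> oe x = c} = {}" using assms by blast
  then show ?thesis unfolding embed_def by (simp only: sum.empty)
qed

lemma sum_embed: "(\<Sum>c\<in>Mor (Orb p). embed a c * F c) = (\<Sum>x\<in>Mor D. a x * F (oe x))"
proof -
  have "(\<Sum>c\<in>Mor (Orb p). embed a c * F c) = (\<Sum>c\<in>oe ` Mor D. embed a c * F c)"
    by (rule sum.mono_neutral_right) (use O.finite_mor oe_Mor embed_out in auto)
  also have "\<dots> = (\<Sum>x\<in>Mor D. embed a (oe x) * F (oe x))"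
    using oe_inj by (intro sum.reindex_cong[of oe]) (auto simp: inj_on_def)
  finally show ?thesis by (simp add: embed_oe)
qed

lemma embed_single: assumes "s \<in> Mor D" shows "embed (single s c) = single (oe s) c"
proof
  fix d show "embed (single s c) d = single (oe s) c d"
  proof (cases "d \<in> oe ` Mor D")
    case True
    then obtain x where x: "x \<in> Mor D" "d = oe x" by blast
    then show ?thesis using oe_inj[OF x(1) assms] by (auto simp: embed_oe)
  next
    case False then show ?thesis using assms by (auto simp: embed_out)
  qed
qed

lemma sconst_oe: assumes "x \<in> Mor D" "y \<in> Mor D"
  shows "O.sconst (oe x) (oe y) c = (if Dom D x = Cod D y \<and> oe (x \<cdot> y) = c then \<beta> x y else 0)"
proof -
  have x: "x \<in> Hom D (Dom D x) (Cod D x)" and y: "y \<in> Hom D (Dom D y) (Cod D y)" using assms by (auto simp: Hom_def)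
  have "Dom (Orb p) (oe x) = Cod (Orb p) (oe y) \<longleftrightarrow> Dom D x = Cod D y"
    using oe_Hom[OF x] oe_Hom[OF y] by (auto simp: Hom_def)
  moreover have "Comp (Orb p) (oe x) (oe y) = oe (x \<cdot> y)" if "Dom D x = Cod D y"
    by (rule orbit_embed_comp[OF x]) (use y that in simp)
  ultimately show ?thesis by (auto simp: O.sconst_def res_cocycle_def)
qed

lemma embed_mult: "embed a \<otimes>\<^bsub>tw_alg (Orb p) \<alpha>\<^esub> embed b = embed (a \<otimes>\<^bsub>tw_alg D \<beta>\<^esub> b)"
proof
  fix c
  have "(embed a \<otimes>\<^bsub>tw_alg (Orb p) \<alpha>\<^esub> embed b) c = (\<Sum>s\<in>Mor (Orb p). embed a s * (\<Sum>t\<in>Mor (Orb p). embed b t * O.sconst s t c))"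
    by (simp add: O.mult_eq sum_distrib_left mult_ac)
  also have "\<dots> = (\<Sum>x\<in>Mor D. \<Sum>y\<in>Mor D. a x * b y * O.sconst (oe x) (oe y) c)"
    unfolding sum_embed[of a] sum_embed[of b] by (simp only: sum_distrib_left mult.assoc)
  also have "\<dots> = embed (a \<otimes>\<^bsub>tw_alg D \<beta>\<^esub> b) c"
  proof (cases "c \<in> oe ` Mor D")
    case True
    then obtain z where z: "z \<in> Mor D" "c = oe z" by blast
    have *: "O.sconst (oe x) (oe y) c = base.sconst x y z" if "x \<in> Mor D" "y \<in> Mor D" for x y
      using oe_inj[OF _ z(1), of "x \<cdot> y"] comp_mor[OF that] by (auto simp: sconst_oe[OF that] base.sconst_def z(2))
    have "embed (a \<otimes>\<^bsub>tw_alg D \<beta>\<^esub> b) c = (a \<otimes>\<^bsub>tw_alg D \<beta>\<^esub> b) z" by (simp only: z(2) embed_oe[OF z(1)])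
    then show ?thesis unfolding base.mult_eq by (simp add: *)
  next
    case False
    have "O.sconst (oe x) (oe y) c = 0" if "x \<in> Mor D" "y \<in> Mor D" for x y
      using False comp_mor[OF that] by (auto simp: sconst_oe[OF that])
    then show ?thesis using False by (simp add: embed_out)
  qed
  finally show "(embed a \<otimes>\<^bsub>tw_alg (Orb p) \<alpha>\<^esub> embed b) c = embed (a \<otimes>\<^bsub>tw_alg D \<beta>\<^esub> b) c" .
qed

lemma normaliserD:
  assumes P: "p_subgroup p D X P" and x: "x \<in> normaliser (idem_group D (Ide D X)) P"
  shows "tmor p X P X P x"
proof -
  interpret brauer_setting D \<beta> p X P by unfold_locales (use prime char P in auto)
  have xH: "x \<in> Hom D X X" and n: "x <#\<^bsub>G\<^esub> P #>\<^bsub>G\<^esub> m_inv G x = P" using x by (auto simp: normaliser_def G_def[symmetric])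
  have "\<exists>y\<in>P. x \<cdot> z = y \<cdot> x" if z: "z \<in> P" for z
  proof -
    have "x \<cdot> z \<cdot> iv x \<in> x <#\<^bsub>G\<^esub> P #>\<^bsub>G\<^esub> iv x" using z by (auto simp: r_coset_def l_coset_def)
    then have "x \<cdot> z \<cdot> iv x \<in> P" by (simp only: n)
    moreover have "x \<cdot> z \<cdot> iv x \<cdot> x = x \<cdot> z" using inverse_mors_cancel(4)[OF iv(1)[OF xH] G_comp[OF xH P_sub[OF z]]] .
    ultimately show ?thesis by metis
  qed
  then show ?thesis using xH P by (simp add: tmor_def)
qed

lemma centraliser_normaliser:
  assumes P: "p_subgroup p D X P" and x: "x \<in> centraliser (idem_group D (Ide D X)) P"
  shows "x \<in> normaliser (idem_group D (Ide D X)) P"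
proof -
  interpret brauer_setting D \<beta> p X P by unfold_locales (use prime char P in auto)
  have xH: "x \<in> Hom D X X" and c: "\<And>y. y \<in> P \<Longrightarrow> x \<cdot> y = y \<cdot> x" using x by (auto simp: centraliser_def G_def[symmetric])
  have e: "x \<cdot> z \<cdot> iv x = z" if "z \<in> P" for z using c[OF that] inverse_mors_cancel(3)[OF iv(1)[OF xH] P_sub[OF that]] by simp
  have "x <#\<^bsub>G\<^esub> P #>\<^bsub>G\<^esub> m_inv G x = (\<lambda>z. x \<cdot> z \<cdot> iv x) ` P" by (auto simp: r_coset_def l_coset_def)
  also have "\<dots> = (\<lambda>z. z) ` P" by (rule image_cong[OF refl e])
  finally show ?thesis using xH by (simp add: normaliser_def G_def[symmetric])
qed

subsection \<open>The quotient map\<close>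

text \<open>The morphism \<open>(X, 1) \<rightarrow> (X, P)\<close> represented by the identity, with respect to which \<open>quot_map\<close> is
  defined.\<close>

definition u :: "'o \<Rightarrow> 'm set \<Rightarrow> 'm tmor set" where "u X P = oclass {Ide D X} P (Ide D X)"

lemma tmor_u: assumes "p_subgroup p D X P" shows "tmor p X {Ide D X} X P (Ide D X)"
  using tmor_trivial[OF ide_Hom[OF p_subgroupD(2)[OF assms]] assms] .

lemma u_Hom: "p_subgroup p D X P \<Longrightarrow> u X P \<in> Hom (Orb p) (X, {Ide D X}) (X, P)"
  unfolding u_def orbit_Hom using tmor_u by blast

lemma comp_u: assumes "tmor p X P Y Q s"
  shows "Comp (Orb p) (oclass P Q s) (u X P) = oclass {Ide D X} Q s"
  unfolding u_def orbit_simps(6)[OF assms tmor_u[OF tmorD(2)[OF assms]]] Hom_ide(1)[OF tmorD(1)[OF assms]] ..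

lemma u_comp: assumes s: "s \<in> Hom D X Y" and Q: "p_subgroup p D Y Q"
  shows "Comp (Orb p) (u Y Q) (oe s) = oclass {Ide D X} Q s"
  unfolding u_def orbit_embed_oclass[OF s]
    orbit_simps(6)[OF tmor_u[OF Q] tmor_trivial[OF s trivial_p_subgroup[OF HomD(5)[OF s]]]] Hom_ide(2)[OF s] ..

lemma quot_map_in:
  assumes P: "p_subgroup p D X P"
  shows "quot_map D \<alpha> X P a \<in> span_of (Hom (Orb p) (X, P) (X, P))"
  unfolding span_of_def
proof (intro CollectI allI impI)
  fix y assume "y \<notin> Hom (Orb p) (X, P) (X, P)"
  then have "{x. x \<in> normaliser (idem_group D (Ide D X)) P \<and> oclass P P x = y} = {}"
    using normaliserD[OF P] by (auto simp: orbit_Hom)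
  then show "quot_map D \<alpha> X P a y = 0" unfolding quot_map_def Let_def by (simp only: sum.empty)
qed

text \<open>The characterisation of the quotient map \<open>\<theta>\<close> by \<open>u x = \<theta>(x) u\<close>.\<close>

lemma quot_map_u:
  assumes P: "p_subgroup p D X P" and a: "a \<in> span_of (normaliser (idem_group D (Ide D X)) P)"
  shows "quot_map D \<alpha> X P a \<otimes>\<^bsub>tw_alg (Orb p) \<alpha>\<^esub> single (u X P) 1 = single (u X P) 1 \<otimes>\<^bsub>tw_alg (Orb p) \<alpha>\<^esub> embed a"
proof
  fix r
  let ?N = "normaliser (idem_group D (Ide D X)) P"
  note uH = O.HomD[OF u_Hom[OF P]]
  have N: "tmor p X P X P x" "x \<in> Hom D X X" "x \<in> Mor D" if "x \<in> ?N" for x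
    using normaliserD[OF P that] tmorD(1) HomD(1) by blast+
  have finN: "finite ?N" by (rule finite_subset[OF _ finite_mor]) (use N(3) in blast)
  define F where "F x = a x * \<alpha> (u X P) (oe x)" for x
  have q: "quot_map D \<alpha> X P a y = (\<Sum>x\<in>?N. if oclass P P x = y then F x * inverse (\<alpha> y (u X P)) else 0)" for y
  proof -
    have "quot_map D \<alpha> X P a y = (\<Sum>x\<in>{x \<in> ?N. oclass P P x = y}. F x * inverse (\<alpha> y (u X P)))"
      by (simp add: quot_map_def Let_def F_def u_def mult.assoc)
    then show ?thesis by (simp only: sum.inter_filter[OF finN])
  qed
  have "(quot_map D \<alpha> X P a \<otimes>\<^bsub>tw_alg (Orb p) \<alpha>\<^esub> single (u X P) 1) r
      = (\<Sum>y\<in>Mor (Orb p). \<Sum>x\<in>?N. if oclass P P x = y then F x * inverse (\<alpha> y (u X P)) * O.sconst y (u X P) r else 0)"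
    unfolding O.mult_single[OF uH(1)] q sum_distrib_right by (intro sum.cong refl) simp
  also have "\<dots> = (\<Sum>x\<in>?N. \<Sum>y\<in>Mor (Orb p). if oclass P P x = y then F x * inverse (\<alpha> y (u X P)) * O.sconst y (u X P) r else 0)"
    by (rule sum.swap)
  also have "\<dots> = (\<Sum>x\<in>?N. F x * inverse (\<alpha> (oclass P P x) (u X P)) * O.sconst (oclass P P x) (u X P) r)"
    using O.finite_mor orbit_Mor[OF N(1)] by (intro sum.cong refl) simp
  also have "\<dots> = (\<Sum>x\<in>?N. if oclass {Ide D X} P x = r then F x else 0)"
  proof (intro sum.cong refl)
    fix x assume x: "x \<in> ?N"
    have oH: "oclass P P x \<in> Hom (Orb p) (X, P) (X, P)" using N(1)[OF x] by (auto simp: orbit_Hom)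
    have "\<alpha> (oclass P P x) (u X P) \<noteq> 0" using O.\<alpha>_nz[OF oH u_Hom[OF P]] .
    then show "F x * inverse (\<alpha> (oclass P P x) (u X P)) * O.sconst (oclass P P x) (u X P) r = (if oclass {Ide D X} P x = r then F x else 0)"
      using O.HomD(2)[OF oH] uH(3) comp_u[OF N(1)[OF x]] by (simp add: O.sconst_def)
  qed
  also have "\<dots> = (\<Sum>x\<in>?N. a x * O.sconst (u X P) (oe x) r)"
  proof (intro sum.cong refl)
    fix x assume x: "x \<in> ?N"
    show "(if oclass {Ide D X} P x = r then F x else 0) = a x * O.sconst (u X P) (oe x) r"
      using uH(2) O.HomD(3)[OF oe_Hom[OF N(2)[OF x]]] u_comp[OF N(2)[OF x] P] by (simp add: O.sconst_def F_def)
  qed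
  also have "\<dots> = (\<Sum>x\<in>Mor D. a x * O.sconst (u X P) (oe x) r)"
    by (rule sum.mono_neutral_left[OF finite_mor]) (use N(3) a in \<open>auto simp: span_of_def\<close>)
  also have "\<dots> = (single (u X P) 1 \<otimes>\<^bsub>tw_alg (Orb p) \<alpha>\<^esub> embed a) r"
    unfolding O.single_mult[OF uH(1)] using sum_embed[of a "\<lambda>c. O.sconst (u X P) c r"] by simp
  finally show "(quot_map D \<alpha> X P a \<otimes>\<^bsub>tw_alg (Orb p) \<alpha>\<^esub> single (u X P) 1) r
    = (single (u X P) 1 \<otimes>\<^bsub>tw_alg (Orb p) \<alpha>\<^esub> embed a) r" .
qed

text \<open>Right multiplication by \<open>u\<close> is injective: the class of \<open>s\<close> as a morphism from \<open>(X, P)\<close> and as a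
  morphism from \<open>(X, 1)\<close> are both the coset \<open>Q s\<close>.\<close>

lemma u_cancel:
  assumes P: "p_subgroup p D X P"
    and y: "y \<in> span_of (Hom (Orb p) (X, P) (Y, Q))" "z \<in> span_of (Hom (Orb p) (X, P) (Y, Q))"
    and e: "y \<otimes>\<^bsub>tw_alg (Orb p) \<alpha>\<^esub> single (u X P) 1 = z \<otimes>\<^bsub>tw_alg (Orb p) \<alpha>\<^esub> single (u X P) 1"
  shows "y = z"
proof
  fix c show "y c = z c"
  proof (cases "c \<in> Hom (Orb p) (X, P) (Y, Q)")
    case True
    then obtain s where s: "tmor p X P Y Q s" "c = oclass P Q s" by (auto simp: orbit_Hom)
    note uH = O.HomD[OF u_Hom[OF P]]
    have m: "(w \<otimes>\<^bsub>tw_alg (Orb p) \<alpha>\<^esub> single (u X P) 1) (oclass {Ide D X} Q s) = w c * \<alpha> c (u X P)"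
      if w: "w \<in> span_of (Hom (Orb p) (X, P) (Y, Q))" for w
    proof -
      have "w d * 1 * O.sconst d (u X P) (oclass {Ide D X} Q s) = (if c = d then w c * \<alpha> c (u X P) else 0)" for d
      proof (cases "d \<in> Hom (Orb p) (X, P) (Y, Q)")
        case True
        then obtain t where t: "tmor p X P Y Q t" "d = oclass P Q t" by (auto simp: orbit_Hom)
        have "oclass {Ide D X} Q t = oclass {Ide D X} Q s \<longleftrightarrow> d = c"
          unfolding s(2) t(2) oclass_eq_iff[OF t(1) s(1)]
          using oclass_eq_iff[OF tmor_trivial[OF tmorD(1,3)[OF t(1)]] tmor_trivial[OF tmorD(1,3)[OF s(1)]]] by simp
        then show ?thesis using comp_u[OF t(1)] O.HomD(2)[OF True] uH(3) by (auto simp: O.sconst_def t(2))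
      next
        case False
        then show ?thesis using w \<open>c \<in> Hom (Orb p) (X, P) (Y, Q)\<close> by (auto simp: span_of_def)
      qed
      then show ?thesis unfolding O.mult_single[OF uH(1)] using O.HomD(1)[OF \<open>c \<in> _\<close>] O.finite_mor by simp
    qed
    have "\<alpha> c (u X P) \<noteq> 0" using O.\<alpha>_nz[OF True u_Hom[OF P]] .
    then show ?thesis using m[OF y(1)] m[OF y(2)] e by simp
  next
    case False then show ?thesis using y by (simp add: span_of_def)
  qed
qed

end

locale twisted_orbit_idempotent = twisted_orbit D p \<alpha>
  for D :: "('o, 'm) cat" (structure) and p and \<alpha> :: "'m tmor set \<Rightarrow> 'm tmor set \<Rightarrow> 'k::field" +
  fixes b :: "'m \<Rightarrow> 'k"
  assumes b: "central_idempotent (tw_alg D (res_cocycle D \<alpha>)) b"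
begin

abbreviation AD where "AD \<equiv> tw_alg D \<beta>"

lemma b_span: "b \<in> span_of (Mor D)" and b_idem: "b \<otimes>\<^bsub>AD\<^esub> b = b"
  and b_central: "a \<in> span_of (Mor D) \<Longrightarrow> a \<otimes>\<^bsub>AD\<^esub> b = b \<otimes>\<^bsub>AD\<^esub> a"
  using b by (auto simp: central_idempotent_def)

abbreviation b_at where "b_at X \<equiv> idem_part D \<beta> (Ide D X) b"

lemma b_at_hat: "b_at X = base.hat X \<otimes>\<^bsub>AD\<^esub> b"
  by (simp add: base.hat_def)

text \<open>Left and right multiplication by the identity of \<open>X\<close> give the same element, so coefficients of \<open>b\<close>
  at morphisms that are not endomorphisms vanish.\<close>

lemma b_at_apply: assumes X: "X \<in> Obj D" shows "b_at X r = (if r \<in> Hom D X X then b r else 0)"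
proof -
  have "base.hat X \<otimes>\<^bsub>AD\<^esub> b = b \<otimes>\<^bsub>AD\<^esub> base.hat X"
    by (rule b_central) (use base.Hom_span[OF base.hat_in[OF X]] in simp)
  then have "(base.hat X \<otimes>\<^bsub>AD\<^esub> b) r = (b \<otimes>\<^bsub>AD\<^esub> base.hat X) r" by simp
  then show ?thesis unfolding b_at_hat by (auto simp: base.hat_mult[OF X] base.mult_hat[OF X] Hom_def split: if_splits)
qed

lemma b_at_in: "X \<in> Obj D \<Longrightarrow> b_at X \<in> span_of (Hom D X X)"
  by (simp add: span_of_def b_at_apply)

lemma b_at_mult:
  assumes X: "X \<in> Obj D" and a: "a \<in> span_of (Hom D X X)"
  shows "b_at X \<otimes>\<^bsub>AD\<^esub> a = b \<otimes>\<^bsub>AD\<^esub> a" "a \<otimes>\<^bsub>AD\<^esub> b_at X = b \<otimes>\<^bsub>AD\<^esub> a"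
proof -
  have aM: "a \<in> span_of (Mor D)" using base.Hom_span[OF a] .
  show "b_at X \<otimes>\<^bsub>AD\<^esub> a = b \<otimes>\<^bsub>AD\<^esub> a"
    unfolding b_at_hat base.mult_assoc b_central[OF aM, symmetric] using base.hat_mult_Hom[OF X a]
    by (simp flip: base.mult_assoc)
  show "a \<otimes>\<^bsub>AD\<^esub> b_at X = b \<otimes>\<^bsub>AD\<^esub> a"
    unfolding b_at_hat using base.mult_hat_Hom[OF X a] b_central[OF aM] by (simp flip: base.mult_assoc)
qed

lemma b_at_idem: assumes X: "X \<in> Obj D" shows "b_at X \<otimes>\<^bsub>AD\<^esub> b_at X = b_at X"
proof -
  have "b \<otimes>\<^bsub>AD\<^esub> b_at X = b_at X \<otimes>\<^bsub>AD\<^esub> b" using b_central[OF base.Hom_span[OF b_at_in[OF X]]] by simp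
  also have "\<dots> = b_at X" unfolding b_at_hat base.mult_assoc b_idem ..
  finally show ?thesis using b_at_mult(1)[OF X b_at_in[OF X]] by simp
qed

lemma idem_part_central:
  assumes X: "X \<in> Obj D" shows "central_idempotent (base.B X) (b_at X)"
  using b_at_in[OF X] b_at_idem[OF X] b_at_mult[OF X]
  by (simp add: central_idempotent_def base.idem_alg_simps[OF X])

definition b_cent :: "'o \<Rightarrow> 'm set \<Rightarrow> 'm \<Rightarrow> 'k" where
  "b_cent X P = (\<lambda>h. if h \<in> centraliser (idem_group D (Ide D X)) P then b h else 0)"

lemma brauer_map_b:
  assumes P: "p_subgroup p D X P"
  shows "brauer_map (idem_group D (Ide D X)) (base.B X) P (b_at X) = b_cent X P"
proof -
  interpret brauer_setting D \<beta> p X P by unfold_locales (use prime char P in auto)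
  have "b_at X \<in> fixed_elts (base.B X) P"
  proof (rule central_fixed)
    show "b_at X \<in> span_of (Hom D X X)" using b_at_in[OF X] .
    fix x assume "x \<in> P"
    then have "single x (1::'k) \<in> span_of (Hom D X X)" using P_sub by (auto simp: span_of_def)
    then show "single x 1 \<otimes>\<^bsub>AD\<^esub> b_at X = b_at X \<otimes>\<^bsub>AD\<^esub> single x 1" using b_at_mult[OF X] by simp
  qed
  then show ?thesis unfolding brauer_map_eq[OF \<open>b_at X \<in> _\<close>]
    by (auto simp: centraliser_part_def b_cent_def b_at_apply[OF X] G_def[symmetric] centraliser_def)
qed

text \<open>The element whose action on \<open>T\<close> decides whether a weight \<open>(Id, T)\<close> at \<open>(X, P)\<close> is a \<open>b\<close>-weight.\<close>

definition brauer_elt :: "'o \<Rightarrow> 'm set \<Rightarrow> 'm tmor set \<Rightarrow> 'k" where "brauer_elt X P = quot_map D \<alpha> X P (b_cent X P)"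

lemma brauer_elt_in: "p_subgroup p D X P \<Longrightarrow> brauer_elt X P \<in> span_of (Hom (Orb p) (X, P) (X, P))"
  unfolding brauer_elt_def by (rule quot_map_in)

lemma brauer_elt_u:
  assumes P: "p_subgroup p D X P"
  shows "brauer_elt X P \<otimes>\<^bsub>tw_alg (Orb p) \<alpha>\<^esub> single (u X P) 1 = single (u X P) 1 \<otimes>\<^bsub>tw_alg (Orb p) \<alpha>\<^esub> embed (b_cent X P)"
  unfolding brauer_elt_def by (rule quot_map_u[OF P]) (use centraliser_normaliser[OF P] in \<open>auto simp: span_of_def b_cent_def\<close>)

lemma b_weight_iff:
  assumes P: "p_subgroup p D X P"
  shows "is_b_weight p D \<alpha> b (Ide (Orb p) (X, P), T) \<longleftrightarrow>
    is_weight (Orb p) \<alpha> (Ide (Orb p) (X, P), T) \<and> (\<exists>v\<in>carrier T. brauer_elt X P \<odot>\<^bsub>T\<^esub> v \<noteq> \<zero>\<^bsub>T\<^esub>)"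
proof -
  have "Dom (Orb p) (Ide (Orb p) (X, P)) = (X, P)"
    using O.ide_mor[of "(X, P)"] P p_subgroupD(2)[OF P] by (simp add: orbit_simps(1))
  then show ?thesis by (simp add: is_b_weight_def brauer_map_b[OF P] brauer_elt_def)
qed

lemma weight_ide:
  assumes "is_weight (Orb p) \<alpha> w"
  obtains X P T where "w = (Ide (Orb p) (X, P), T)" "p_subgroup p D X P"
  using assms by (cases w) (auto simp: O.is_weight_iff orbit_simps(1))

text \<open>This is \<open>b s = s b\<close> in coefficients, restricted to the centralisers, which are conjugate under \<open>s\<close>.\<close>

lemma b_cent_conj:
  assumes t: "tmor p X P Y Q s" "tmor p Y Q X P s'" and i: "inverse_mors X Y s s'"
  shows "b_cent Y Q \<otimes>\<^bsub>AD\<^esub> single s 1 = single s 1 \<otimes>\<^bsub>AD\<^esub> b_cent X P"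
proof
  fix r
  note j = inverse_morsD[OF i] and P = p_subgroupD[OF tmorD(2)[OF t(1)]] and Q = p_subgroupD[OF tmorD(3)[OF t(1)]]
  have C: "h \<in> centraliser (idem_group D (Ide D Z)) R \<longleftrightarrow> h \<in> Hom D Z Z \<and> (\<forall>y\<in>R. h \<cdot> y = y \<cdot> h)"
    if "Z \<in> Obj D" for h Z R using idem_group_ide[OF that] by (auto simp: centraliser_def)
  show "(b_cent Y Q \<otimes>\<^bsub>AD\<^esub> single s 1) r = (single s 1 \<otimes>\<^bsub>AD\<^esub> b_cent X P) r"
  proof (cases "r \<in> Hom D X Y")
    case True
    note r = HomD[OF True]
    have full: "b (r \<cdot> s') * \<beta> (r \<cdot> s') s = b (s' \<cdot> r) * \<beta> s (s' \<cdot> r)"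
    proof -
      have "single s (1::'k) \<in> span_of (Mor D)" using HomD(1)[OF j(1)] by (auto simp: span_of_def)
      then have "(b \<otimes>\<^bsub>AD\<^esub> single s 1) r = (single s 1 \<otimes>\<^bsub>AD\<^esub> b) r" using b_central by simp
      then show ?thesis using r by (simp add: base.mult_single_iso[OF i] base.single_mult_iso[OF i])
    qed
    have h1: "r \<cdot> s' \<in> Hom D Y Y" and h2: "s' \<cdot> r \<in> Hom D X X" using comp_Hom True j by blast+
    have c: "r \<cdot> s' \<in> centraliser (idem_group D (Ide D Y)) Q \<longleftrightarrow> s' \<cdot> r \<in> centraliser (idem_group D (Ide D X)) P"
      unfolding C[OF j(6)] C[OF j(5)]
    proof (intro iffI conjI ballI h1 h2)
      fix x assume a: "r \<cdot> s' \<in> Hom D Y Y \<and> (\<forall>y\<in>Q. r \<cdot> s' \<cdot> y = y \<cdot> (r \<cdot> s'))" and x: "x \<in> P"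
      have xH: "x \<in> Hom D X X" using P(1) x by blast
      obtain y where y: "y \<in> Q" "s \<cdot> x = y \<cdot> s" using tmorD(4)[OF t(1) x] by blast
      have yH: "y \<in> Hom D Y Y" using Q(1) y by blast
      have xs: "x \<cdot> s' = s' \<cdot> y"
        using inverse_mors_cancel(1)[OF i comp_Hom[OF xH j(2)]] Hom_assoc[OF j(1) xH j(2)] y(2)
          inverse_mors_cancel(3)[OF i yH] by simp
      have "s' \<cdot> r \<cdot> x = s' \<cdot> (r \<cdot> s' \<cdot> (s \<cdot> x))"
        using Hom_assoc[OF j(2) True xH] Hom_assoc[OF True j(2) comp_Hom[OF j(1) xH]] inverse_mors_cancel(1)[OF i xH] by simp
      also have "\<dots> = s' \<cdot> (r \<cdot> s' \<cdot> y \<cdot> s)" using y(2) Hom_assoc[OF h1 yH j(1)] by simp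
      also have "\<dots> = s' \<cdot> (y \<cdot> (r \<cdot> s') \<cdot> s)" using a y(1) by simp
      also have "\<dots> = s' \<cdot> (y \<cdot> r)" using Hom_assoc[OF yH h1 j(1)] inverse_mors_cancel(4)[OF i True] by simp
      also have "\<dots> = x \<cdot> s' \<cdot> r" using Hom_assoc[OF j(2) yH True] xs by simp
      also have "\<dots> = x \<cdot> (s' \<cdot> r)" using Hom_assoc[OF xH j(2) True] .
      finally show "s' \<cdot> r \<cdot> x = x \<cdot> (s' \<cdot> r)" .
    next
      fix y assume a: "s' \<cdot> r \<in> Hom D X X \<and> (\<forall>x\<in>P. s' \<cdot> r \<cdot> x = x \<cdot> (s' \<cdot> r))" and y: "y \<in> Q"
      have yH: "y \<in> Hom D Y Y" using Q(1) y by blast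
      obtain x where x: "x \<in> P" "s' \<cdot> y = x \<cdot> s'" using tmorD(4)[OF t(2) y] by blast
      have xH: "x \<in> Hom D X X" using P(1) x by blast
      have sx: "s \<cdot> x = y \<cdot> s"
        using inverse_mors_cancel(2)[OF i comp_Hom[OF yH j(1)]] Hom_assoc[OF j(2) yH j(1)] x(2)
          inverse_mors_cancel(4)[OF i xH] by simp
      have "r \<cdot> s' \<cdot> y = r \<cdot> (x \<cdot> s')" using Hom_assoc[OF True j(2) yH] x(2) by simp
      also have "\<dots> = s \<cdot> (s' \<cdot> r) \<cdot> (x \<cdot> s')" using inverse_mors_cancel(2)[OF i True] by simp
      also have "\<dots> = s \<cdot> (s' \<cdot> r \<cdot> x \<cdot> s')"
        using Hom_assoc[OF j(1) h2 comp_Hom[OF xH j(2)]] Hom_assoc[OF h2 xH j(2)] by simp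
      also have "\<dots> = s \<cdot> (x \<cdot> (s' \<cdot> r) \<cdot> s')" using a x(1) by simp
      also have "\<dots> = s \<cdot> x \<cdot> (s' \<cdot> r \<cdot> s')"
        using Hom_assoc[OF xH h2 j(2)] Hom_assoc[OF j(1) xH comp_Hom[OF h2 j(2)]] by simp
      also have "\<dots> = y \<cdot> (s \<cdot> (s' \<cdot> r \<cdot> s'))" using sx Hom_assoc[OF yH j(1) comp_Hom[OF h2 j(2)]] by simp
      also have "\<dots> = y \<cdot> (r \<cdot> s')"
        using Hom_assoc[OF j(2) True j(2)] inverse_mors_cancel(2)[OF i h1] by simp
      finally show "r \<cdot> s' \<cdot> y = y \<cdot> (r \<cdot> s')" .
    qed
    show ?thesis unfolding base.mult_single_iso[OF i] base.single_mult_iso[OF i] b_cent_def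
      using r c full by simp
  next
    case False
    have "b_cent Y Q (r \<cdot> s') = 0" if "r \<in> Mor D" "Dom D r = X"
    proof -
      have "r \<cdot> s' \<notin> Hom D Y Y"
        using that False HomD(3)[OF comp_Hom[of r X "Cod D r" s' Y]] j(2) by (auto simp: Hom_def)
      then show ?thesis unfolding b_cent_def C[OF j(6)] by simp
    qed
    moreover have "b_cent X P (s' \<cdot> r) = 0" if "r \<in> Mor D" "Cod D r = Y"
    proof -
      have "s' \<cdot> r \<notin> Hom D X X"
        using that False HomD(2)[OF comp_Hom[of s' Y X r "Dom D r"]] j(2) by (auto simp: Hom_def)
      then show ?thesis unfolding b_cent_def C[OF j(5)] by simp
    qed
    ultimately show ?thesis by (simp add: base.mult_single_iso[OF i] base.single_mult_iso[OF i])
  qed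
qed

text \<open>Right multiplication by \<open>u\<close> is injective and turns the claim into a relation between restrictions
  of \<open>b\<close> to centralisers, which is \<open>b_cent_conj\<close>.\<close>

lemma transfer_brauer_elt:
  assumes i: "O.inverse_mors (X, P) (Y, Q) c d"
  shows "idem_transfer (Orb p) \<alpha> (Ide (Orb p) (X, P)) c d (brauer_elt X P) = brauer_elt Y Q"
proof -
  let ?A = "tw_alg (Orb p) \<alpha>"
  obtain s s' where s: "inverse_mors X Y s s'" "tmor p X P Y Q s" "tmor p Y Q X P s'" "c = oclass P Q s"
    using orbit_isoD[OF i] by metis
  note P = tmorD(2)[OF s(2)] and Q = tmorD(3)[OF s(2)] and sH = tmorD(1)[OF s(2)]
  obtain S T where ST: "S \<in> span_of (Hom (Orb p) (X, P) (Y, Q))" "T \<in> span_of (Hom (Orb p) (Y, Q) (X, P))"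
    "S \<otimes>\<^bsub>?A\<^esub> T = O.hat (Y, Q)" "S = single c 1"
    "\<And>a. a \<in> span_of (Hom (Orb p) (X, P) (X, P)) \<Longrightarrow> idem_transfer (Orb p) \<alpha> (Ide (Orb p) (X, P)) c d a = S \<otimes>\<^bsub>?A\<^esub> (a \<otimes>\<^bsub>?A\<^esub> T)"
    using O.transfer_conj[OF i] by metis
  let ?uP = "single (u X P) (1::'k)" and ?uQ = "single (u Y Q) (1::'k)" and ?s = "single (oe s) (1::'k)"
  have nz: "\<alpha> (u Y Q) (oe s) \<noteq> 0" using O.\<alpha>_nz[OF u_Hom[OF Q] oe_Hom[OF sH]] .
  \<comment> \<open>Both \<open>c u\<close> and \<open>u s\<close> are multiples of the class of \<open>s\<close> from \<open>(X, 1)\<close> to \<open>(Y, Q)\<close>.\<close>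
  define \<kappa> where "\<kappa> = \<alpha> c (u X P) / \<alpha> (u Y Q) (oe s)"
  have cH: "c \<in> Hom (Orb p) (X, P) (Y, Q)" using O.inverse_morsD(1)[OF i] .
  have su: "S \<otimes>\<^bsub>?A\<^esub> ?uP = (\<lambda>r. \<kappa> * (?uQ \<otimes>\<^bsub>?A\<^esub> ?s) r)"
  proof -
    have "S \<otimes>\<^bsub>?A\<^esub> ?uP = single (oclass {Ide D X} Q s) (\<alpha> c (u X P))"
      using O.single_mult_single[OF cH u_Hom[OF P], of 1 1] comp_u[OF s(2)] by (simp add: ST(4) s(4))
    moreover have "?uQ \<otimes>\<^bsub>?A\<^esub> ?s = single (oclass {Ide D X} Q s) (\<alpha> (u Y Q) (oe s))"
      using O.single_mult_single[OF u_Hom[OF Q] oe_Hom[OF sH], of 1 1] u_comp[OF sH Q] by simp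
    ultimately show ?thesis using nz by (auto simp: \<kappa>_def fun_eq_iff)
  qed
  have comm: "embed (b_cent Y Q) \<otimes>\<^bsub>?A\<^esub> ?s = ?s \<otimes>\<^bsub>?A\<^esub> embed (b_cent X P)"
    unfolding embed_single[OF HomD(1)[OF sH], symmetric] embed_mult b_cent_conj[OF s(2,3,1)] ..
  have "brauer_elt Y Q \<otimes>\<^bsub>?A\<^esub> S \<otimes>\<^bsub>?A\<^esub> ?uP = brauer_elt Y Q \<otimes>\<^bsub>?A\<^esub> (\<lambda>r. \<kappa> * (?uQ \<otimes>\<^bsub>?A\<^esub> ?s) r)"
    by (simp only: O.mult_assoc su)
  also have "\<dots> = (\<lambda>r. \<kappa> * ((brauer_elt Y Q \<otimes>\<^bsub>?A\<^esub> ?uQ) \<otimes>\<^bsub>?A\<^esub> ?s) r)" by (simp only: O.mult_scale O.mult_assoc)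
  also have "\<dots> = (\<lambda>r. \<kappa> * (?uQ \<otimes>\<^bsub>?A\<^esub> (embed (b_cent Y Q) \<otimes>\<^bsub>?A\<^esub> ?s)) r)" by (simp only: brauer_elt_u[OF Q] O.mult_assoc)
  also have "\<dots> = (\<lambda>r. \<kappa> * (?uQ \<otimes>\<^bsub>?A\<^esub> ?s) r) \<otimes>\<^bsub>?A\<^esub> embed (b_cent X P)" by (simp only: comm O.scale_mult O.mult_assoc)
  also have "\<dots> = S \<otimes>\<^bsub>?A\<^esub> (?uP \<otimes>\<^bsub>?A\<^esub> embed (b_cent X P))" by (simp only: su[symmetric] O.mult_assoc)
  also have "\<dots> = S \<otimes>\<^bsub>?A\<^esub> brauer_elt X P \<otimes>\<^bsub>?A\<^esub> ?uP" by (simp only: brauer_elt_u[OF P, symmetric] O.mult_assoc)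
  finally have "brauer_elt Y Q \<otimes>\<^bsub>?A\<^esub> S = S \<otimes>\<^bsub>?A\<^esub> brauer_elt X P"
    by (rule u_cancel[OF P O.mult_Hom[OF brauer_elt_in[OF Q] ST(1)] O.mult_Hom[OF ST(1) brauer_elt_in[OF P]]])
  then have "S \<otimes>\<^bsub>?A\<^esub> (brauer_elt X P \<otimes>\<^bsub>?A\<^esub> T) = brauer_elt Y Q \<otimes>\<^bsub>?A\<^esub> (S \<otimes>\<^bsub>?A\<^esub> T)" by (simp only: O.mult_assoc[symmetric])
  also have "\<dots> = brauer_elt Y Q" unfolding ST(3) by (rule O.mult_hat_Hom[OF O.inverse_morsD(6)[OF i] brauer_elt_in[OF Q]])
  finally show ?thesis using ST(5)[OF brauer_elt_in[OF P]] by simp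
qed

lemma b_weight_transport:
  assumes w: "is_b_weight p D \<alpha> b (Ide (Orb p) (Y, Q), T)" and Q: "p_subgroup p D Y Q"
    and i: "inverse_mors X Y s s'"
  obtains P T0 where "p_subgroup p D X P" "is_b_weight p D \<alpha> b (Ide (Orb p) (X, P), T0)"
    "pair_iso (Orb p) \<alpha> (Ide (Orb p) (X, P), T0) (Ide (Orb p) (Y, Q), T)"
proof -
  obtain P where P: "tmor p X P Y Q s" "O.inverse_mors (X, P) (Y, Q) (oclass P Q s) (oclass Q P s')"
    using orbit_isoI[OF Q i] by metis
  note Ps = tmorD(2)[OF P(1)]
  have w': "is_weight (Orb p) \<alpha> (Ide (Orb p) (Y, Q), T)" "\<exists>v\<in>carrier T. brauer_elt Y Q \<odot>\<^bsub>T\<^esub> v \<noteq> \<zero>\<^bsub>T\<^esub>"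
    using w b_weight_iff[OF Q] by auto
  note t = O.weight_transport[OF w'(1) P(2)]
  have "is_b_weight p D \<alpha> b (Ide (Orb p) (X, P), pull_module (idem_transfer (Orb p) \<alpha> (Ide (Orb p) (X, P)) (oclass P Q s) (oclass Q P s')) T)"
    unfolding b_weight_iff[OF Ps] using t(1) w'(2) by (simp add: transfer_brauer_elt[OF P(2)])
  then show ?thesis using that[OF Ps _ t(2)] by blast
qed

subsection \<open>Weights at a fixed object\<close>

text \<open>The orbit category of the group \<open>G\<^sub>X\<close> is literally the full subcategory of the orbit category
  on the objects \<open>(X, P)\<close>, so its weights are the weights of the latter that satisfy the following predicate.\<close>

definition at_obj :: "'o \<Rightarrow> ('m tmor set, 'k) weight_pair \<Rightarrow> bool" where
  "at_obj X w \<longleftrightarrow> (\<exists>P T. p_subgroup p D X P \<and> w = (Ide (Orb p) (X, P), T))"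

context
  fixes X assumes X: "X \<in> Obj D"
begin

abbreviation D' where "D' \<equiv> idem_cat D (Ide D X)"

lemma D'_Hom: "Hom D' X X = Hom D X X"
  by (auto simp: Hom_def[of D'] idem_cat_simps[OF X])

lemma D'_p_subgroup: "p_subgroup p D' X P \<longleftrightarrow> p_subgroup p D X P"
  by (simp add: p_subgroup_def D'_Hom idem_cat_simps(6)[OF X])

lemma D'_orbit_class: "orbit_class D' = orbit_class D"
  by (simp add: orbit_class_def idem_cat_simps(6)[OF X])

lemma D'_Comp: "Comp (orbit_cat p D') = Comp (Orb p)"
  by (simp add: orbit_cat_def transporter_cat_def idem_cat_simps(6)[OF X])

lemma D'_ei: "ei_category D'" by (rule idem_cat_ei[OF X])

lemma D'_tmor: "ei_category.tmor D' p X P X Q s \<longleftrightarrow> tmor p X P X Q s"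
  unfolding ei_category.tmor_def[OF D'_ei] tmor_def D'_Hom D'_p_subgroup idem_cat_simps(6)[OF X] ..

lemma D'_orbit_Hom: "Hom (orbit_cat p D') (X, P) (X, Q) = Hom (Orb p) (X, P) (X, Q)"
  unfolding ei_category.orbit_Hom[OF D'_ei] orbit_Hom D'_tmor D'_orbit_class ..

lemma D'_Ide: "p_subgroup p D X P \<Longrightarrow> Ide (orbit_cat p D') (X, P) = Ide (Orb p) (X, P)"
  using ei_category.orbit_simps(5)[OF D'_ei, of p X P] orbit_simps(5)[of p X P]
  by (simp add: D'_p_subgroup D'_orbit_class idem_cat_simps[OF X])

lemma D'_Dom:
  assumes P: "p_subgroup p D X P"
  shows "Dom (orbit_cat p D') (Ide (Orb p) (X, P)) = (X, P)" "Dom (Orb p) (Ide (Orb p) (X, P)) = (X, P)"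
proof -
  show d: "Dom (Orb p) (Ide (Orb p) (X, P)) = (X, P)" using O.ide_mor[of "(X, P)"] X P by (simp add: orbit_simps(1))
  have "Ide (Orb p) (X, P) \<in> Hom (Orb p) (X, P) (X, P)" using O.ide_Hom[of "(X, P)"] X P by (simp add: orbit_simps(1))
  then show "Dom (orbit_cat p D') (Ide (Orb p) (X, P)) = (X, P)"
    unfolding D'_orbit_Hom[symmetric] by (simp add: Hom_def)
qed

lemma D'_idem:
  assumes P: "p_subgroup p D X P"
  shows "idem_group (orbit_cat p D') (Ide (Orb p) (X, P)) = idem_group (Orb p) (Ide (Orb p) (X, P))"
    "idem_cat (orbit_cat p D') (Ide (Orb p) (X, P)) = idem_cat (Orb p) (Ide (Orb p) (X, P))"
  by (rule idem_group_cong; simp add: D'_Comp D'_Dom[OF P] D'_orbit_Hom)+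

lemma D'_weight: "is_weight (orbit_cat p D') \<alpha> w \<longleftrightarrow> is_weight (Orb p) \<alpha> w \<and> at_obj X w"
proof -
  interpret D': ei_category D' by (rule D'_ei)
  interpret O': ei_category "orbit_cat p D'" by (rule D'.orbit_ei)
  obtain e T where w: "w = (e, T)" by (cases w)
  have O': "idem_endo (orbit_cat p D') e \<longleftrightarrow> (\<exists>P. p_subgroup p D X P \<and> e = Ide (Orb p) (X, P))"
    unfolding O'.idem_endo_iff D'.orbit_simps(1) using D'_Ide
    by (auto simp: idem_cat_simps[OF X] D'_p_subgroup)
  have ide: "idem_endo (Orb p) (Ide (Orb p) (X, P))" if "p_subgroup p D X P" for P
    using that X by (auto simp: O.idem_endo_iff orbit_simps(1))
  show ?thesis
  proof
    assume a: "is_weight (orbit_cat p D') \<alpha> w"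
    then obtain P where P: "p_subgroup p D X P" "e = Ide (Orb p) (X, P)" using O' by (auto simp: w is_weight_def)
    then show "is_weight (Orb p) \<alpha> w \<and> at_obj X w"
      using a ide[OF P(1)] by (auto simp: w is_weight_def at_obj_def D'_idem[OF P(1)])
  next
    assume a: "is_weight (Orb p) \<alpha> w \<and> at_obj X w"
    then obtain P where P: "p_subgroup p D X P" "e = Ide (Orb p) (X, P)" by (auto simp: w at_obj_def)
    then show "is_weight (orbit_cat p D') \<alpha> w"
      using a O' by (auto simp: w is_weight_def D'_idem[OF P(1)])
  qed
qed

lemma D'_pair_iso:
  assumes "at_obj X w" "at_obj X w'"
  shows "pair_iso (orbit_cat p D') \<alpha> w w' \<longleftrightarrow> pair_iso (Orb p) \<alpha> w w'"
proof -
  obtain P T where w: "p_subgroup p D X P" "w = (Ide (Orb p) (X, P), T)" using assms(1) by (auto simp: at_obj_def)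
  obtain Q T' where w': "p_subgroup p D X Q" "w' = (Ide (Orb p) (X, Q), T')" using assms(2) by (auto simp: at_obj_def)
  have "idem_transfer (orbit_cat p D') \<alpha> (Ide (Orb p) (X, P)) s t = idem_transfer (Orb p) \<alpha> (Ide (Orb p) (X, P)) s t"
    for s t by (rule ext) (simp add: idem_transfer_def D'_Comp D'_idem[OF w(1)])
  then show ?thesis
    by (simp add: w(2) w'(2) pair_iso_def idem_iso_by_def D'_Comp D'_orbit_Hom
      D'_Dom[OF w(1)] D'_Dom[OF w'(1)] D'_idem[OF w(1)] D'_idem[OF w'(1)])
qed

lemma D'_b_weight:
  "is_b_weight p D' \<alpha> (b_at X) w \<longleftrightarrow> is_b_weight p D \<alpha> b w \<and> at_obj X w"
proof (cases "is_weight (Orb p) \<alpha> w \<and> at_obj X w")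
  case False
  then have "\<not> is_weight (orbit_cat p D') \<alpha> w" using D'_weight by simp
  then show ?thesis using False by (auto simp: is_b_weight_def)
next
  case True
  then obtain P T where w: "p_subgroup p D X P" "w = (Ide (Orb p) (X, P), T)" by (auto simp: at_obj_def)
  have dI: "Dom D' (Ide D X) = X" "Dom D (Ide D X) = X" using ide_mor X by (auto simp: idem_cat_simps[OF X])
  have grp: "idem_group D' (Ide D X) = idem_group D (Ide D X)" "idem_cat D' (Ide D X) = D'"
    by (rule idem_group_cong; simp add: idem_cat_simps[OF X] D'_Hom dI)+
  have oe': "orbit_embed D' x = oe x" if "x \<in> Hom D X X" for x
    using that by (simp add: orbit_embed_def D'_orbit_class idem_cat_simps[OF X] Hom_def)
  have res: "res_cocycle D' \<alpha> t s = \<beta> t s" if "t \<in> Hom D X X" "s \<in> Hom D X X" for t s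
    using that by (simp add: res_cocycle_def oe')
  have IX: "Ide D X \<in> Hom D X X" by (rule ide_Hom[OF X])
  have alg: "tw_alg D' (res_cocycle D' \<alpha>) = tw_alg D' \<beta>"
    unfolding tw_alg_def
    by (auto simp: idem_cat_simps[OF X] res[OF IX IX] fun_eq_iff intro!: sum.cong arg_cong2[of _ _ _ _ "(*)"] res)
  have hat: "idem_hat (res_cocycle D' \<alpha>) (Ide D X) = idem_hat \<beta> (Ide D X)"
    by (simp add: idem_hat_def res[OF IX IX])
  have "idem_part D' (res_cocycle D' \<alpha>) (Ide D X) (b_at X) = b_at X"
  proof -
    interpret BX: ring "base.B X" by (rule base.idem_alg_ring[OF X])
    have "\<one>\<^bsub>base.B X\<^esub> \<otimes>\<^bsub>base.B X\<^esub> b_at X = b_at X"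
      by (rule BX.l_one) (use b_at_in[OF X] in \<open>simp add: base.idem_alg_simps(1)[OF X]\<close>)
    then show ?thesis unfolding alg hat by (simp add: base.idem_alg_simps(4)[OF X] base.hat_def)
  qed
  moreover have "quot_map D' \<alpha> X P a = quot_map D \<alpha> X P a" for a
  proof -
    have "orbit_embed D' x = oe x" if "x \<in> normaliser (idem_group D (Ide D X)) P" for x
      using oe' tmorD(1)[OF normaliserD[OF w(1) that]] by blast
    then show ?thesis unfolding quot_map_def Let_def idem_cat_simps(5)[OF X] D'_orbit_class grp
      by (intro ext sum.cong) auto
  qed
  ultimately show ?thesis using True D'_weight[of w]
    by (simp add: is_b_weight_def Let_def w(2) D'_Dom[OF w(1)] idem_cat_simps(5)[OF X] grp alg)
qed

end

end

section \<open>Isomorphism classes of simple modules and corners\<close>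

definition nonzero_on :: "'r \<Rightarrow> ('r, 'v) module \<Rightarrow> bool" where
  "nonzero_on j M \<longleftrightarrow> (\<exists>u\<in>carrier M. j \<odot>\<^bsub>M\<^esub> u \<noteq> \<zero>\<^bsub>M\<^esub>)"

lemma nonzero_on_iso:
  assumes iso: "lmod_iso R M N" and M: "left_module R M" and N: "left_module R N" and j: "j \<in> carrier R"
    and nz: "nonzero_on j M"
  shows "nonzero_on j N"
proof -
  interpret M: left_module R M by fact
  interpret N: left_module R N by fact
  obtain h where h: "bij_betw h (carrier M) (carrier N)"
     "\<And>a v. a\<in>carrier R \<Longrightarrow> v\<in>carrier M \<Longrightarrow> h (a \<odot>\<^bsub>M\<^esub> v) = a \<odot>\<^bsub>N\<^esub> h v"
    using iso by (auto simp: lmod_iso_iff)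
  obtain u where u: "u \<in> carrier M" "j \<odot>\<^bsub>M\<^esub> u \<noteq> \<zero>\<^bsub>M\<^esub>" using nz by (auto simp: nonzero_on_def)
  have hu: "h u \<in> carrier N" using h(1) u by (auto dest: bij_betwE)
  have "h \<zero>\<^bsub>M\<^esub> = \<zero>\<^bsub>N\<^esub>"
    using h(2)[of "\<zero>\<^bsub>R\<^esub>" u] u hu by (simp add: M.zero_lsmult N.zero_lsmult)
  moreover have "h (j \<odot>\<^bsub>M\<^esub> u) \<noteq> h \<zero>\<^bsub>M\<^esub>"
    using h(1) u(2) M.lsmult_closed[OF j u(1)] M.M.zero_closed unfolding bij_betw_def inj_on_def by blast
  ultimately show ?thesis using h(2)[OF j u(1)] hu by (auto simp: nonzero_on_def)
qed

definition classes_on :: "'r ring \<Rightarrow> 'r \<Rightarrow> ('r, 'v) module set set" where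
  "classes_on R j = iso_class R ` {M. simple_lmod R M \<and> nonzero_on j M}"

text \<open>The modules in an isomorphism class have isomorphic corners; the union avoids choosing one of them.\<close>

definition corner_class :: "'r ring \<Rightarrow> 'r \<Rightarrow> ('r, 'v) module set \<Rightarrow> ('r, 'v) module set" where
  "corner_class R j K = (\<Union>M\<in>K. iso_class (corner_ring R j) (corner_module j M))"

context corner
begin

lemma corner_simple:
  assumes "simple_lmod R M" "nonzero_on j M" shows "simple_lmod (corner_ring R j) (corner_module j M)"
proof -
  interpret corner_mod R j M by (intro corner_mod.intro corner_axioms simple_lmodD(1)[OF assms(1)])
  show ?thesis using corner_module_simple[OF assms(1)] assms(2) by (auto simp: nonzero_on_def)
qed

lemma corner_sub: "carrier (corner_ring R j) \<subseteq> carrier R"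
  using corner_carrier_iff by blast

lemma corner_class_iso_class:
  assumes M: "simple_lmod R M" "nonzero_on j M"
  shows "corner_class R j (iso_class R M) = iso_class (corner_ring R j) (corner_module j M)"
proof -
  have "iso_class (corner_ring R j) (corner_module j N) = iso_class (corner_ring R j) (corner_module j M)"
    if N: "N \<in> iso_class R M" for N
  proof -
    have N': "simple_lmod R N" "lmod_iso R M N" using N by (auto simp: iso_class_def)
    have nz: "nonzero_on j N"
      by (rule nonzero_on_iso[OF N'(2) simple_lmodD(1)[OF M(1)] simple_lmodD(1)[OF N'(1)] j_closed M(2)])
    have "lmod_iso (corner_ring R j) (corner_module j M) (corner_module j N)"
      by (rule corner_module_lmod_iso[OF N'(2) j_closed simple_lmodD(1)[OF M(1)] corner_sub])
    then show ?thesis using iso_class_eq_iff[OF corner_simple[OF M] corner_simple[OF N'(1) nz]] by simp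
  qed
  moreover have "M \<in> iso_class R M" using M lmod_iso_refl by (auto simp: iso_class_def)
  ultimately show ?thesis unfolding corner_class_def by blast
qed

text \<open>Injectivity compares annihilators of generators (\<open>simple_lmod_iso_of_corner_iso\<close>); surjectivity is
  the construction of a simple module with a given corner (\<open>exists_simple_lmod_with_corner\<close>).\<close>

lemma corner_class_bij:
  assumes cnt: "countable (carrier R)" and inf: "infinite (UNIV :: 'v set)"
  shows "bij_betw (corner_class R j) (classes_on R j :: ('r, 'v) module set set)
     (iso_class (corner_ring R j) ` {V. simple_lmod (corner_ring R j) V})"
proof (rule bij_betw_imageI)
  show "inj_on (corner_class R j) (classes_on R j :: ('r, 'v) module set set)"
  proof (rule inj_onI)
    fix K L :: "('r, 'v) module set"
    assume "K \<in> classes_on R j" "L \<in> classes_on R j" and e: "corner_class R j K = corner_class R j L"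
    then obtain M N where M: "simple_lmod R M" "nonzero_on j M" "K = iso_class R M"
      and N: "simple_lmod R N" "nonzero_on j N" "L = iso_class R N" by (auto simp: classes_on_def)
    obtain v where v: "v \<in> carrier M" "j \<odot>\<^bsub>M\<^esub> v \<noteq> \<zero>\<^bsub>M\<^esub>" using M(2) by (auto simp: nonzero_on_def)
    have "lmod_iso (corner_ring R j) (corner_module j M) (corner_module j N)"
      using e corner_class_iso_class[OF M(1,2)] corner_class_iso_class[OF N(1,2)]
        iso_class_eq_iff[OF corner_simple[OF M(1,2)] corner_simple[OF N(1,2)]] M N by simp
    then have "lmod_iso R M N" by (rule simple_lmod_iso_of_corner_iso[OF M(1) N(1) corner_axioms v])
    then show "K = L" using iso_class_eq_iff[OF M(1) N(1)] M N by simp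
  qed
  show "corner_class R j ` (classes_on R j :: ('r, 'v) module set set)
    = iso_class (corner_ring R j) ` {V. simple_lmod (corner_ring R j) V}"
  proof (intro equalityI subsetI)
    fix L :: "('r, 'v) module set" assume "L \<in> corner_class R j ` classes_on R j"
    then obtain M where M: "simple_lmod R M" "nonzero_on j M" "L = corner_class R j (iso_class R M)"
      by (auto simp: classes_on_def)
    then show "L \<in> iso_class (corner_ring R j) ` {V. simple_lmod (corner_ring R j) V}"
      using corner_class_iso_class[OF M(1,2)] corner_simple[OF M(1,2)] by blast
  next
    fix L :: "('r, 'v) module set" assume "L \<in> iso_class (corner_ring R j) ` {V. simple_lmod (corner_ring R j) V}"
    then obtain V where V: "simple_lmod (corner_ring R j) V" "L = iso_class (corner_ring R j) V" by blast
    obtain M :: "('r, 'v) module" and u where M: "simple_lmod R M" "u \<in> carrier M" "j \<odot>\<^bsub>M\<^esub> u \<noteq> \<zero>\<^bsub>M\<^esub>"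
      "lmod_iso (corner_ring R j) (corner_module j M) V"
      using exists_simple_lmod_with_corner[OF V(1) cnt inf] by blast
    have nz: "nonzero_on j M" using M by (auto simp: nonzero_on_def)
    have "corner_class R j (iso_class R M) = L"
      unfolding corner_class_iso_class[OF M(1) nz] V(2)
      using iso_class_eq_iff[OF corner_simple[OF M(1) nz] V(1)] M(4) by simp
    then show "L \<in> corner_class R j ` classes_on R j" using M(1) nz by (auto simp: classes_on_def)
  qed
qed

end

lemma block_alg_eq_corner:
  assumes R: "ring R" and b: "central_idempotent R b" shows "block_alg R b = corner_ring R b"
proof -
  interpret ring R by fact
  have "b \<otimes>\<^bsub>R\<^esub> a \<otimes>\<^bsub>R\<^esub> b = a \<otimes>\<^bsub>R\<^esub> b" if "a \<in> carrier R" for a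
    using b that unfolding central_idempotent_def by (metis m_assoc)
  then have "(\<lambda>a. b \<otimes>\<^bsub>R\<^esub> a \<otimes>\<^bsub>R\<^esub> b) ` carrier R = (\<lambda>a. a \<otimes>\<^bsub>R\<^esub> b) ` carrier R" by (intro image_cong) auto
  then show ?thesis by (simp add: block_alg_def corner_ring_def)
qed

lemma simple_classes_cong:
  fixes R S :: "('m \<Rightarrow> 'k::field) ring"
  assumes R: "ring R" and S: "ring S" and c: "carrier R = carrier S" "one R = one S" "add R = add S"
    and m: "\<And>a c. \<lbrakk>a \<in> carrier S; c \<in> carrier S\<rbrakk> \<Longrightarrow> a \<otimes>\<^bsub>R\<^esub> c = a \<otimes>\<^bsub>S\<^esub> c"
  shows "simple_classes R = simple_classes S"
proof -
  have i: "(\<lambda>a. a) \<in> ring_iso R S" "(\<lambda>a. a) \<in> ring_iso S R"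
    using c m by (auto simp: ring_iso_def ring_hom_def bij_betw_def)
  have s: "simple_lmod R M \<longleftrightarrow> simple_lmod S M" for M :: "('m, 'k) kmod"
    using simple_lmod_pull[OF i(1) R, of M] simple_lmod_pull[OF i(2) S, of M] by (auto simp: pull_module_id)
  have "lmod_iso R M N \<longleftrightarrow> lmod_iso S M N" for M N :: "('m, 'k) kmod"
    by (simp add: lmod_iso_iff c(1))
  then show ?thesis by (simp add: simple_classes_iso_class iso_class_def s)
qed

lemma gal_iso_class:
  fixes R :: "('m \<Rightarrow> 'k::field) ring"
  assumes R: "ring R" and \<sigma>: "\<sigma> \<in> galois_group"
    and i: "(\<lambda>a. \<sigma> \<circ> a) \<in> ring_iso R R" "(\<lambda>a. ginv \<sigma> \<circ> a) \<in> ring_iso R R"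
    and M: "simple_lmod R M"
  shows "simple_lmod R (gal_module \<sigma> M)" "gal_module \<sigma> ` iso_class R M = iso_class R (gal_module \<sigma> M)"
proof -
  have gs: "simple_lmod R (gal_module \<sigma> N)" if "simple_lmod R N" for N :: "('m, 'k) kmod"
    unfolding gal_module_def by (rule simple_lmod_pull[OF i(2) R that])
  have gi: "lmod_iso R (gal_module \<sigma> N) (gal_module \<sigma> L)" if "lmod_iso R N L" for N L :: "('m, 'k) kmod"
    unfolding gal_module_def
    by (rule lmod_iso_pull[OF that]) (use i(2) in \<open>auto simp: ring_iso_def ring_hom_def\<close>)
  have gs': "simple_lmod R (gal_module (ginv \<sigma>) N)" if "simple_lmod R N" for N :: "('m, 'k) kmod"
    unfolding gal_module_def inv_inv_galois[OF \<sigma>] by (rule simple_lmod_pull[OF i(1) R that])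
  have gi': "lmod_iso R (gal_module (ginv \<sigma>) N) (gal_module (ginv \<sigma>) L)" if "lmod_iso R N L" for N L :: "('m, 'k) kmod"
    unfolding gal_module_def inv_inv_galois[OF \<sigma>]
    by (rule lmod_iso_pull[OF that]) (use i(1) in \<open>auto simp: ring_iso_def ring_hom_def\<close>)
  show "simple_lmod R (gal_module \<sigma> M)" by (rule gs[OF M])
  show "gal_module \<sigma> ` iso_class R M = iso_class R (gal_module \<sigma> M)"
  proof (intro equalityI subsetI)
    fix N assume "N \<in> gal_module \<sigma> ` iso_class R M"
    then show "N \<in> iso_class R (gal_module \<sigma> M)" using gs gi by (auto simp: iso_class_def)
  next
    fix N assume "N \<in> iso_class R (gal_module \<sigma> M)"
    then have N: "simple_lmod R N" "lmod_iso R (gal_module \<sigma> M) N" by (auto simp: iso_class_def)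
    have "gal_module (ginv \<sigma>) N \<in> iso_class R M"
      using gs'[OF N(1)] gi'[OF N(2)] by (simp add: iso_class_def gal_module_inv[OF \<sigma>])
    moreover have "N = gal_module \<sigma> (gal_module (ginv \<sigma>) N)" by (simp only: gal_module_inv[OF \<sigma>])
    ultimately show "N \<in> gal_module \<sigma> ` iso_class R M" by (rule rev_image_eqI)
  qed
qed

lemma gal_corner_module:
  assumes "ginv \<sigma> \<circ> j = j" shows "corner_module j (gal_module \<sigma> M) = gal_module \<sigma> (corner_module j M)"
  by (simp add: corner_module_def gal_module_def pull_module_def assms)

lemma gal_nonzero_on:
  assumes "ginv \<sigma> \<circ> j = j" shows "nonzero_on j (gal_module \<sigma> M) \<longleftrightarrow> nonzero_on j M"
  by (simp add: nonzero_on_def gal_module_def assms)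

lemma glue_bijections:
  assumes S: "disjoint_family_on S I" and W: "disjoint_family_on W I"
    and ex: "\<And>X. X \<in> I \<Longrightarrow> \<exists>h. bij_betw h (S X) (W X) \<and> (\<forall>\<sigma>\<in>\<Gamma>. \<forall>K\<in>S X. g \<sigma> K \<in> S X \<and> h (g \<sigma> K) = g' \<sigma> (h K))"
  shows "\<exists>h. bij_betw h (\<Union>X\<in>I. S X) (\<Union>X\<in>I. W X) \<and> (\<forall>\<sigma>\<in>\<Gamma>. \<forall>K\<in>(\<Union>X\<in>I. S X). h (g \<sigma> K) = g' \<sigma> (h K))"
proof -
  obtain h where h: "\<And>X. X \<in> I \<Longrightarrow> bij_betw (h X) (S X) (W X)"
    "\<And>X \<sigma> K. \<lbrakk>X \<in> I; \<sigma> \<in> \<Gamma>; K \<in> S X\<rbrakk> \<Longrightarrow> g \<sigma> K \<in> S X \<and> h X (g \<sigma> K) = g' \<sigma> (h X K)"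
    using ex by metis
  define k where "k K = h (SOME X. X \<in> I \<and> K \<in> S X) K" for K
  have k: "k K = h X K" if "X \<in> I" "K \<in> S X" for X K
  proof -
    have "(SOME Y. Y \<in> I \<and> K \<in> S Y) = X"
    proof (rule some_equality)
      fix Y assume "Y \<in> I \<and> K \<in> S Y"
      then show "Y = X" using S that unfolding disjoint_family_on_def by blast
    qed (use that in simp)
    then show ?thesis by (simp add: k_def)
  qed
  have "bij_betw k (S X) (W X)" if "X \<in> I" for X
    using h(1)[OF that] k[OF that] bij_betw_cong[of "S X" k "h X" "W X"] by simp
  then have "bij_betw k (\<Union>X\<in>I. S X) (\<Union>X\<in>I. W X)" by (rule bij_betw_UNION_disjoint[OF W])
  moreover have "k (g \<sigma> K) = g' \<sigma> (k K)" if "\<sigma> \<in> \<Gamma>" "K \<in> (\<Union>X\<in>I. S X)" for \<sigma> K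
    using that(2) h(2)[OF _ that(1)] k by auto
  ultimately show ?thesis by blast
qed

lemma countable_alg_closure_Fp:
  assumes "alg_closure_Fp p TYPE('k::alg_closed_field)" shows "countable (UNIV :: 'k set)"
proof -
  let ?C = "prime_subfield :: 'k set"
  let ?F = "{f :: 'k poly. f \<noteq> 0 \<and> range (coeff f) \<subseteq> ?C}"
  have "countable ?C" by (simp add: prime_subfield_def)
  then have "countable (lists ?C)" by (rule countable_lists)
  moreover have "coeffs ` ?F \<subseteq> lists ?C"
    by (auto simp: coeffs_def image_subset_iff)
  ultimately have "countable (coeffs ` ?F)" by (rule countable_subset[rotated])
  then have "countable ?F" 
    by (rule countable_image_inj_on) (rule inj_onI, erule coeffs_eq_iff[THEN iffD2])
  then have "countable (\<Union>f\<in>?F. {x. poly f x = 0})"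
    by (rule countable_UN) (auto intro: countable_finite poly_roots_finite)
  moreover have "(UNIV :: 'k set) \<subseteq> (\<Union>f\<in>?F. {x. poly f x = 0})"
    using assms by (force simp: alg_closure_Fp_def)
  ultimately show ?thesis by (rule countable_subset[rotated])
qed

lemma countable_span_of:
  assumes "countable (UNIV :: 'k::field set)" "finite S" shows "countable (span_of S :: ('m \<Rightarrow> 'k) set)"
  using assms(2)
proof (induction S rule: finite_induct)
  case empty
  have "span_of {} = {\<lambda>_ :: 'm. 0 :: 'k}" by (auto simp: span_of_def)
  then show ?case by simp
next
  case (insert s S)
  have "(span_of (insert s S) :: ('m \<Rightarrow> 'k) set) \<subseteq> (\<lambda>(c, a). a(s := c)) ` (UNIV \<times> span_of S)"
  proof
    fix a :: "'m \<Rightarrow> 'k" assume a: "a \<in> span_of (insert s S)"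
    have "a(s := 0) \<in> span_of S" using a by (auto simp: span_of_def)
    then show "a \<in> (\<lambda>(c, a). a(s := c)) ` (UNIV \<times> span_of S)"
      by (intro image_eqI[of _ _ "(a s, a(s := 0))"]) simp_all
  qed
  moreover have "countable ((\<lambda>(c, a). a(s := c)) ` ((UNIV :: 'k set) \<times> (span_of S :: ('m \<Rightarrow> 'k) set)))"
    using insert.IH assms(1) by (intro countable_image countable_SIGMA)
  ultimately show ?case by (rule countable_subset)
qed

lemma infinite_sequences: "infinite (UNIV :: (nat \<Rightarrow> 'k::field) set)"
proof -
  have "inj (\<lambda>n m. if m = n then 1 else (0::'k))"
    by (rule injI) (metis zero_neq_one)
  then show ?thesis using finite_subset infinite_UNIV_nat finite_imageD by (metis subset_UNIV)
qed

section \<open>Gluing over the isomorphism classes of objects\<close>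

context twisted_orbit_idempotent
begin

abbreviation R where "R \<equiv> block_alg AD b"

lemma R_corner: "R = corner_ring AD b"
  by (rule block_alg_eq_corner[OF base.alg_ring b])

lemma corner_b: "corner AD b"
  by unfold_locales (use b_span b_idem in simp_all)

lemma R_ring: "ring R"
  unfolding R_corner by (rule corner.corner_is_ring[OF corner_b])

lemma R_carrier: "a \<in> carrier R \<longleftrightarrow> a \<in> span_of (Mor D) \<and> b \<otimes>\<^bsub>AD\<^esub> a = a"
  unfolding R_corner corner.corner_carrier_iff[OF corner_b] using b_central by auto

lemma R_simps [simp]: "monoid.mult R = monoid.mult AD" "add R = add AD" "zero R = zero AD" "one R = b"
  by (simp_all add: block_alg_def)

lemma b_at_R: assumes X: "X \<in> Obj D" shows "b_at X \<in> carrier R"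
  unfolding R_carrier using base.Hom_span[OF b_at_in[OF X]] b_at_mult(1)[OF X b_at_in[OF X]] b_at_idem[OF X] by simp

lemma corner_b_at: assumes X: "X \<in> Obj D" shows "corner R (b_at X)"
  by (intro corner.intro corner_axioms.intro R_ring b_at_R[OF X]) (simp add: b_at_idem[OF X])

lemma block_classes:
  assumes X: "X \<in> Obj D"
  shows "simple_classes (block_alg (base.B X) (b_at X)) = simple_classes (corner_ring R (b_at X))"
proof (rule simple_classes_cong)
  note B = base.idem_alg_simps[OF X] and j = b_at_in[OF X]
  have cB: "corner (base.B X) (b_at X)"
    by (intro corner.intro corner_axioms.intro base.idem_alg_ring[OF X])
       (use j b_at_idem[OF X] B(5)[OF j j] in \<open>simp_all add: B(1)\<close>)
  have eq: "block_alg (base.B X) (b_at X) = corner_ring (base.B X) (b_at X)"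
    by (rule block_alg_eq_corner[OF base.idem_alg_ring[OF X] idem_part_central[OF X]])
  show "ring (block_alg (base.B X) (b_at X))" unfolding eq by (rule corner.corner_is_ring[OF cB])
  show "ring (corner_ring R (b_at X))" by (rule corner.corner_is_ring[OF corner_b_at[OF X]])
  have sub: "a \<in> span_of (Hom D X X)" if "b_at X \<otimes>\<^bsub>AD\<^esub> a = a" "a \<otimes>\<^bsub>AD\<^esub> b_at X = a" "a \<in> span_of (Mor D)" for a
  proof -
    have "base.hat X \<otimes>\<^bsub>AD\<^esub> a = a"
      using that(1) base.hat_mult_Hom[OF X j] by (metis base.mult_assoc)
    moreover have "a \<otimes>\<^bsub>AD\<^esub> base.hat X = a"
      using that(2) base.mult_hat_Hom[OF X j] by (metis base.mult_assoc)
    ultimately show ?thesis unfolding span_of_def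
      using base.hat_mult[OF X, of a] base.mult_hat[OF X, of a] by (auto simp: Hom_def) metis+
  qed
  have "a \<in> carrier (corner_ring (base.B X) (b_at X)) \<longleftrightarrow> a \<in> carrier (corner_ring R (b_at X))" for a
  proof
    assume "a \<in> carrier (corner_ring (base.B X) (b_at X))"
    then have a: "a \<in> span_of (Hom D X X)" "b_at X \<otimes>\<^bsub>base.B X\<^esub> a = a" "a \<otimes>\<^bsub>base.B X\<^esub> b_at X = a"
      unfolding corner.corner_carrier_iff[OF cB] B(1) by auto
    have "b_at X \<otimes>\<^bsub>AD\<^esub> a = a" "a \<otimes>\<^bsub>AD\<^esub> b_at X = a" using a B(5)[OF j a(1)] B(5)[OF a(1) j] by simp_all
    then show "a \<in> carrier (corner_ring R (b_at X))"
      unfolding corner.corner_carrier_iff[OF corner_b_at[OF X]] R_carrier using b_at_mult(1)[OF X a(1)] base.Hom_span[OF a(1)] by simp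
  next
    assume "a \<in> carrier (corner_ring R (b_at X))"
    then have a: "a \<in> span_of (Mor D)" "b_at X \<otimes>\<^bsub>AD\<^esub> a = a" "a \<otimes>\<^bsub>AD\<^esub> b_at X = a"
      unfolding corner.corner_carrier_iff[OF corner_b_at[OF X]] R_carrier by auto
    note as = sub[OF a(2,3,1)]
    show "a \<in> carrier (corner_ring (base.B X) (b_at X))"
      unfolding corner.corner_carrier_iff[OF cB] B(1) using as a B(5)[OF j as] B(5)[OF as j] by simp
  qed
  then show car: "carrier (block_alg (base.B X) (b_at X)) = carrier (corner_ring R (b_at X))" unfolding eq by blast
  show "one (block_alg (base.B X) (b_at X)) = one (corner_ring R (b_at X))" by (simp add: eq)
  show "add (block_alg (base.B X) (b_at X)) = add (corner_ring R (b_at X))"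
    by (intro ext) (simp add: eq B(3))
  fix a c assume ac: "a \<in> carrier (corner_ring R (b_at X))" "c \<in> carrier (corner_ring R (b_at X))"
  have "a \<in> span_of (Hom D X X)" "c \<in> span_of (Hom D X X)"
    using ac sub unfolding corner.corner_carrier_iff[OF corner_b_at[OF X]] R_carrier by auto
  then show "a \<otimes>\<^bsub>block_alg (base.B X) (b_at X)\<^esub> c = a \<otimes>\<^bsub>corner_ring R (b_at X)\<^esub> c" using B(5) by (simp add: eq)
qed

lemma gal_b:
  assumes "\<sigma> \<in> gal_stab b"
  shows "\<sigma> \<in> galois_group" "\<sigma> \<circ> b = b" "ginv \<sigma> \<circ> b = b"
    "X \<in> Obj D \<Longrightarrow> \<sigma> \<circ> b_at X = b_at X" "X \<in> Obj D \<Longrightarrow> ginv \<sigma> \<circ> b_at X = b_at X"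
proof -
  show s: "\<sigma> \<in> galois_group" and sb: "\<sigma> \<circ> b = b" using assms by (auto simp: gal_stab_def)
  note g = galois_group_simps[OF s] and g' = galois_group_simps[OF inv_galois_group[OF s]]
  show ib: "ginv \<sigma> \<circ> b = b"
  proof
    fix r show "(ginv \<sigma> \<circ> b) r = b r" using fun_cong[OF sb, of r] g(7)[of "b r"] by simp
  qed
  show "\<sigma> \<circ> b_at X = b_at X" if "X \<in> Obj D"
    using fun_cong[OF sb] by (auto simp: fun_eq_iff b_at_apply[OF that] g(3))
  show "ginv \<sigma> \<circ> b_at X = b_at X" if "X \<in> Obj D"
    using fun_cong[OF ib] by (auto simp: fun_eq_iff b_at_apply[OF that] g'(3))
qed

lemma gal_corner_ring_iso:
  assumes S: "corner S j" and \<tau>: "(\<lambda>a. \<tau> \<circ> a) \<in> ring_iso S S" "(\<lambda>a. \<tau>' \<circ> a) \<in> ring_iso S S"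
    and inv: "\<And>x. \<tau> (\<tau>' x) = (x::'k)" and j: "\<tau> \<circ> j = j" "\<tau>' \<circ> j = j"
  shows "(\<lambda>a. \<tau> \<circ> a) \<in> ring_iso (corner_ring S j) (corner_ring S j)"
proof -
  interpret corner S j by fact
  note h = ring_iso_memE[OF \<tau>(1)] and h' = ring_iso_memE[OF \<tau>(2)]
  have cl: "\<tau> \<circ> a \<in> carrier (corner_ring S j)" if "a \<in> carrier (corner_ring S j)" for a
    using that h(1,2) j(1) j_closed unfolding corner_carrier_iff by (metis)
  have cl': "\<tau>' \<circ> a \<in> carrier (corner_ring S j)" if "a \<in> carrier (corner_ring S j)" for a
    using that h'(1,2) j(2) j_closed unfolding corner_carrier_iff by (metis)
  show ?thesis
  proof (rule ring_iso_memI)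
    show "bij_betw (\<lambda>a. \<tau> \<circ> a) (carrier (corner_ring S j)) (carrier (corner_ring S j))"
    proof (rule bij_betw_imageI)
      show "inj_on (\<lambda>a. \<tau> \<circ> a) (carrier (corner_ring S j))"
        by (rule inj_on_subset[OF _ corner_sub]) (use h(5) in \<open>simp add: bij_betw_def\<close>)
      show "(\<lambda>a. \<tau> \<circ> a) ` carrier (corner_ring S j) = carrier (corner_ring S j)"
      proof
        show "carrier (corner_ring S j) \<subseteq> (\<lambda>a. \<tau> \<circ> a) ` carrier (corner_ring S j)"
        proof
          fix a assume a: "a \<in> carrier (corner_ring S j)"
          have "a = \<tau> \<circ> (\<tau>' \<circ> a)" by (simp add: fun_eq_iff inv)
          then show "a \<in> (\<lambda>a. \<tau> \<circ> a) ` carrier (corner_ring S j)" using cl'[OF a] by (rule image_eqI)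
        qed
      qed (use cl in blast)
    qed
    show "\<tau> \<circ> \<one>\<^bsub>corner_ring S j\<^esub> = \<one>\<^bsub>corner_ring S j\<^esub>" by (simp add: j)
  next
    fix a c assume a: "a \<in> carrier (corner_ring S j)"
    then show "\<tau> \<circ> a \<in> carrier (corner_ring S j)" by (rule cl)
    assume c: "c \<in> carrier (corner_ring S j)"
    have "a \<in> carrier S" "c \<in> carrier S" using a c corner_sub by blast+
    then show "\<tau> \<circ> a \<otimes>\<^bsub>corner_ring S j\<^esub> c = (\<tau> \<circ> a) \<otimes>\<^bsub>corner_ring S j\<^esub> (\<tau> \<circ> c)"
      "\<tau> \<circ> a \<oplus>\<^bsub>corner_ring S j\<^esub> c = (\<tau> \<circ> a) \<oplus>\<^bsub>corner_ring S j\<^esub> (\<tau> \<circ> c)"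
      using h(2,3) by simp_all
  qed
qed

lemma gal_R_iso:
  assumes \<sigma>: "\<sigma> \<in> gal_stab b"
  shows "(\<lambda>a. \<sigma> \<circ> a) \<in> ring_iso R R" "(\<lambda>a. ginv \<sigma> \<circ> a) \<in> ring_iso R R"
proof -
  note g = gal_b[OF \<sigma>] and s = galois_group_simps[OF gal_b(1)[OF \<sigma>]]
  have i: "(\<lambda>a. \<sigma> \<circ> a) \<in> ring_iso AD AD" "(\<lambda>a. ginv \<sigma> \<circ> a) \<in> ring_iso AD AD"
    using base.gal_ring_iso[OF g(1) base.fp] base.gal_ring_iso[OF inv_galois_group[OF g(1)] base.fp] by simp_all
  show "(\<lambda>a. \<sigma> \<circ> a) \<in> ring_iso R R" unfolding R_corner
    by (rule gal_corner_ring_iso[OF corner_b i s(8) g(2,3)])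
  show "(\<lambda>a. ginv \<sigma> \<circ> a) \<in> ring_iso R R" unfolding R_corner
    by (rule gal_corner_ring_iso[OF corner_b i(2,1) s(7) g(3,2)])
qed

lemma gal_RX_iso:
  assumes \<sigma>: "\<sigma> \<in> gal_stab b" and X: "X \<in> Obj D"
  shows "(\<lambda>a. \<sigma> \<circ> a) \<in> ring_iso (corner_ring R (b_at X)) (corner_ring R (b_at X))"
    "(\<lambda>a. ginv \<sigma> \<circ> a) \<in> ring_iso (corner_ring R (b_at X)) (corner_ring R (b_at X))"
proof -
  note g = gal_b[OF \<sigma>] and s = galois_group_simps[OF gal_b(1)[OF \<sigma>]] and i = gal_R_iso[OF \<sigma>]
  show "(\<lambda>a. \<sigma> \<circ> a) \<in> ring_iso (corner_ring R (b_at X)) (corner_ring R (b_at X))"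
    by (rule gal_corner_ring_iso[OF corner_b_at[OF X] i s(8) g(4,5)[OF X]])
  show "(\<lambda>a. ginv \<sigma> \<circ> a) \<in> ring_iso (corner_ring R (b_at X)) (corner_ring R (b_at X))"
    by (rule gal_corner_ring_iso[OF corner_b_at[OF X] i(2,1) s(7) g(5,4)[OF X]])
qed

lemma gal_corner_class:
  assumes \<sigma>: "\<sigma> \<in> gal_stab b" and X: "X \<in> Obj D" and K: "K \<in> classes_on R (b_at X)"
  shows "gal_module \<sigma> ` K \<in> classes_on R (b_at X)"
    "corner_class R (b_at X) (gal_module \<sigma> ` K) = gal_module \<sigma> ` corner_class R (b_at X) K"
proof -
  interpret c: corner R "b_at X" by (rule corner_b_at[OF X])
  note g = gal_b[OF \<sigma>]
  obtain M where M: "simple_lmod R M" "nonzero_on (b_at X) M" "K = iso_class R M" using K by (auto simp: classes_on_def)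
  note G = gal_iso_class[OF R_ring g(1) gal_R_iso[OF \<sigma>] M(1)]
  have nz: "nonzero_on (b_at X) (gal_module \<sigma> M)" using gal_nonzero_on[OF g(5)[OF X]] M(2) by simp
  show "gal_module \<sigma> ` K \<in> classes_on R (b_at X)" unfolding M(3) G(2) classes_on_def using G(1) nz by blast
  have "corner_class R (b_at X) (gal_module \<sigma> ` K) = iso_class (corner_ring R (b_at X)) (gal_module \<sigma> (corner_module (b_at X) M))"
    unfolding M(3) G(2) c.corner_class_iso_class[OF G(1) nz] gal_corner_module[OF g(5)[OF X]] ..
  also have "\<dots> = gal_module \<sigma> ` iso_class (corner_ring R (b_at X)) (corner_module (b_at X) M)"
    using gal_iso_class(2)[OF c.corner_is_ring g(1) gal_RX_iso[OF \<sigma> X] c.corner_simple[OF M(1,2)]] by simp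
  finally show "corner_class R (b_at X) (gal_module \<sigma> ` K) = gal_module \<sigma> ` corner_class R (b_at X) K"
    unfolding M(3) c.corner_class_iso_class[OF M(1,2)] .
qed

subsection \<open>Representatives of the isomorphism classes of objects\<close>

definition iso_obj :: "'o \<Rightarrow> 'o \<Rightarrow> bool" where "iso_obj X Y \<longleftrightarrow> (\<exists>s t. inverse_mors X Y s t)"

lemma iso_obj_equiv:
  "X \<in> Obj D \<Longrightarrow> iso_obj X X" "iso_obj X Y \<Longrightarrow> iso_obj Y X" "\<lbrakk>iso_obj X Y; iso_obj Y Z\<rbrakk> \<Longrightarrow> iso_obj X Z"
  unfolding iso_obj_def using inverse_mors_ide inverse_mors_sym inverse_mors_comp by blast+

definition rep :: "'o \<Rightarrow> 'o" where "rep X = (SOME Y. iso_obj X Y)"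

definition reps :: "'o set" where "reps = rep ` Obj D"

lemma rep: assumes "X \<in> Obj D" shows "iso_obj X (rep X)" "rep X \<in> reps"
  unfolding rep_def reps_def using assms iso_obj_equiv(1) by (auto intro: someI)

lemma reps_unique: assumes "X \<in> reps" "Y \<in> reps" "iso_obj X Y" shows "X = Y"
proof -
  obtain X' Y' where X': "X' \<in> Obj D" "X = rep X'" "Y' \<in> Obj D" "Y = rep Y'" using assms by (auto simp: reps_def)
  have "iso_obj X' Y'" using rep(1)[OF X'(1)] rep(1)[OF X'(3)] assms(3) X' iso_obj_equiv by metis
  then have "iso_obj X' = iso_obj Y'" using iso_obj_equiv by blast
  then show ?thesis unfolding X' rep_def by simp
qed

lemma reps_Obj: "X \<in> reps \<Longrightarrow> X \<in> Obj D"
  using rep(1) by (auto simp: reps_def iso_obj_def dest: inverse_morsD(6))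

text \<open>The unit \<open>b\<close> of \<open>R\<close> is the sum of the elements \<open>b_at X\<close>.\<close>

lemma nonzero_on_some_b_at:
  assumes M: "simple_lmod R M" obtains X where "X \<in> Obj D" "nonzero_on (b_at X) M"
proof -
  interpret left_module R M using simple_lmodD(1)[OF M] .
  obtain v where v: "v \<in> carrier M" "v \<noteq> \<zero>\<^bsub>M\<^esub>" using simple_lmodD(2)[OF M] by blast
  have "\<exists>X\<in>Obj D. b_at X \<odot>\<^bsub>M\<^esub> v \<noteq> \<zero>\<^bsub>M\<^esub>"
  proof (rule ccontr)
    assume "\<not> ?thesis"
    then have z: "b_at X \<odot>\<^bsub>M\<^esub> v = \<zero>\<^bsub>M\<^esub>" if "X \<in> Obj D" for X using that by blast
    have "(\<lambda>r. \<Sum>X\<in>F. b_at X r) \<in> carrier R \<and> (\<lambda>r. \<Sum>X\<in>F. b_at X r) \<odot>\<^bsub>M\<^esub> v = \<zero>\<^bsub>M\<^esub>"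
      if "finite F" "F \<subseteq> Obj D" for F
      using that
    proof (induction F rule: finite_induct)
      case empty
      have "\<zero>\<^bsub>R\<^esub> \<in> carrier R" "\<zero>\<^bsub>R\<^esub> \<odot>\<^bsub>M\<^esub> v = \<zero>\<^bsub>M\<^esub>" using zero_lsmult[OF v(1)] R.zero_closed by blast+
      then show ?case by (simp only: R_simps base.alg_simps sum.empty)
    next
      case (insert X F)
      have X: "X \<in> Obj D" using insert by simp
      have e: "(\<lambda>r. \<Sum>X\<in>insert X F. b_at X r) = b_at X \<oplus>\<^bsub>R\<^esub> (\<lambda>r. \<Sum>X\<in>F. b_at X r)"
        using insert(1,2) by simp
      show ?case unfolding e using insert lsmult_l_distr[OF b_at_R[OF X] _ v(1)] z[OF X] b_at_R[OF X]
        by (simp only: insert_subset R.add.m_closed M.l_zero M.zero_closed simp_thms)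
    qed
    from this[OF base.finite_obj subset_refl] have "(\<lambda>r. \<Sum>X\<in>Obj D. b_at X r) \<odot>\<^bsub>M\<^esub> v = \<zero>\<^bsub>M\<^esub>" by blast
    moreover have "(\<lambda>r. \<Sum>X\<in>Obj D. b_at X r) = b"
    proof -
      have o: "\<one>\<^bsub>AD\<^esub> = (\<lambda>r. \<Sum>X\<in>Obj D. base.hat X r)" using base.one_eq by blast
      have "\<one>\<^bsub>AD\<^esub> \<otimes>\<^bsub>AD\<^esub> b = b" using base.l_one[of b] b_span by simp
      then show ?thesis unfolding o base.mult_sum_left[abs_def] b_at_hat
        by (metis (no_types) base.mult_sum_left ext)
    qed
    ultimately show False using lsmult_one[OF v(1)] v(2) by simp
  qed
  then show ?thesis using that v(1) by (auto simp: nonzero_on_def)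
qed

text \<open>An isomorphism of \<open>X\<close> with \<open>Y\<close> gives a factorisation \<open>b_at Y = x (b_at X) y\<close> in \<open>R\<close>.\<close>

lemma nonzero_on_iso_obj:
  assumes M: "left_module R M" and i: "iso_obj X Y" and nz: "nonzero_on (b_at Y) M"
  shows "nonzero_on (b_at X) M"
proof -
  interpret left_module R M by fact
  obtain s t where i': "inverse_mors X Y s t" using i by (auto simp: iso_obj_def)
  note h = inverse_morsD[OF i']
  obtain S T where ST: "S \<in> span_of (Hom D X Y)" "T \<in> span_of (Hom D Y X)"
    "S \<otimes>\<^bsub>AD\<^esub> T = base.hat Y" using base.transfer_conj[OF i'] by metis
  have bR: "b \<otimes>\<^bsub>AD\<^esub> a \<in> carrier R" if "a \<in> span_of (Mor D)" for a
    unfolding R_carrier using base.mult_span b_idem by (simp flip: base.mult_assoc)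
  note Sm = base.Hom_span[OF ST(1)] and Tm = base.Hom_span[OF ST(2)]
  have e: "b_at Y = (b \<otimes>\<^bsub>AD\<^esub> S) \<otimes>\<^bsub>AD\<^esub> (b_at X \<otimes>\<^bsub>AD\<^esub> (b \<otimes>\<^bsub>AD\<^esub> T))"
  proof -
    have "b_at X \<otimes>\<^bsub>AD\<^esub> (b \<otimes>\<^bsub>AD\<^esub> T) = base.hat X \<otimes>\<^bsub>AD\<^esub> (b \<otimes>\<^bsub>AD\<^esub> b \<otimes>\<^bsub>AD\<^esub> T)" by (simp only: b_at_hat base.mult_assoc)
    also have "\<dots> = base.hat X \<otimes>\<^bsub>AD\<^esub> (T \<otimes>\<^bsub>AD\<^esub> b)" by (simp only: b_idem b_central[OF Tm])
    also have "\<dots> = T \<otimes>\<^bsub>AD\<^esub> b" using base.hat_mult_Hom[OF h(5) ST(2)] by (simp flip: base.mult_assoc)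
    finally have 1: "b_at X \<otimes>\<^bsub>AD\<^esub> (b \<otimes>\<^bsub>AD\<^esub> T) = T \<otimes>\<^bsub>AD\<^esub> b" .
    have "(b \<otimes>\<^bsub>AD\<^esub> S) \<otimes>\<^bsub>AD\<^esub> (T \<otimes>\<^bsub>AD\<^esub> b) = b \<otimes>\<^bsub>AD\<^esub> ((S \<otimes>\<^bsub>AD\<^esub> T) \<otimes>\<^bsub>AD\<^esub> b)" by (simp only: base.mult_assoc)
    also have "\<dots> = b \<otimes>\<^bsub>AD\<^esub> b_at Y" by (simp only: ST(3) b_at_hat)
    also have "\<dots> = b_at Y" using b_at_mult(1)[OF h(6) b_at_in[OF h(6)]] b_at_idem[OF h(6)] by simp
    finally show ?thesis by (simp only: 1)
  qed
  obtain v where v: "v \<in> carrier M" "b_at Y \<odot>\<^bsub>M\<^esub> v \<noteq> \<zero>\<^bsub>M\<^esub>" using nz by (auto simp: nonzero_on_def)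
  let ?w = "(b \<otimes>\<^bsub>AD\<^esub> T) \<odot>\<^bsub>M\<^esub> v"
  have w: "?w \<in> carrier M" using lsmult_closed[OF bR[OF Tm] v(1)] .
  have "b_at Y \<odot>\<^bsub>M\<^esub> v = (b \<otimes>\<^bsub>AD\<^esub> S) \<odot>\<^bsub>M\<^esub> (b_at X \<odot>\<^bsub>M\<^esub> ?w)"
    using lsmult_assoc[OF bR[OF Sm] R.m_closed[OF b_at_R[OF h(5)] bR[OF Tm]] v(1)]
      lsmult_assoc[OF b_at_R[OF h(5)] bR[OF Tm] v(1)] e by simp
  then have "b_at X \<odot>\<^bsub>M\<^esub> ?w \<noteq> \<zero>\<^bsub>M\<^esub>" using v(2) lsmult_zero[OF bR[OF Sm]] by auto
  then show ?thesis using w by (auto simp: nonzero_on_def)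
qed

text \<open>If \<open>X\<close> and \<open>Y\<close> are not isomorphic, one of the two sets of morphisms between them is empty, and
  then \<open>b_at X R b_at Y R b_at X = 0\<close>.\<close>

lemma nonzero_on_two:
  assumes M: "simple_lmod R M" and X: "X \<in> Obj D" and Y: "Y \<in> Obj D"
    and nz: "nonzero_on (b_at X) M" "nonzero_on (b_at Y) M"
  shows "iso_obj X Y"
proof (rule ccontr)
  assume n: "\<not> iso_obj X Y"
  have between: "b_at Z \<otimes>\<^bsub>AD\<^esub> a \<otimes>\<^bsub>AD\<^esub> b_at W \<in> span_of (Hom D W Z)" if Z: "Z \<in> Obj D" and W: "W \<in> Obj D" for Z W a
  proof -
    let ?w = "b_at Z \<otimes>\<^bsub>AD\<^esub> a \<otimes>\<^bsub>AD\<^esub> b_at W"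
    have 1: "base.hat Z \<otimes>\<^bsub>AD\<^esub> ?w = ?w" using base.hat_mult_Hom[OF Z b_at_in[OF Z]] by (simp flip: base.mult_assoc)
    have 2: "?w \<otimes>\<^bsub>AD\<^esub> base.hat W = ?w" using base.mult_hat_Hom[OF W b_at_in[OF W]] by (simp add: base.mult_assoc)
    have "?w r = 0" if "r \<notin> Hom D W Z" for r
      using fun_cong[OF 1, of r] fun_cong[OF 2, of r] that
      unfolding base.hat_mult[OF Z] base.mult_hat[OF W] by (auto simp: Hom_def split: if_splits)
    then show ?thesis by (simp add: span_of_def)
  qed
  have empty: "Hom D X Y = {} \<or> Hom D Y X = {}"
    using n opposed_mors_iso unfolding iso_obj_def by (metis ex_in_conv)
  have "b_at X \<otimes>\<^bsub>R\<^esub> a \<otimes>\<^bsub>R\<^esub> b_at Y \<otimes>\<^bsub>R\<^esub> c \<otimes>\<^bsub>R\<^esub> b_at X = \<zero>\<^bsub>R\<^esub>" if ac: "a \<in> carrier R" "c \<in> carrier R" for a c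
  proof -
    have "b_at Y \<otimes>\<^bsub>AD\<^esub> b_at Y = b_at Y" using b_at_idem[OF Y] .
    then have e: "b_at X \<otimes>\<^bsub>AD\<^esub> a \<otimes>\<^bsub>AD\<^esub> b_at Y \<otimes>\<^bsub>AD\<^esub> c \<otimes>\<^bsub>AD\<^esub> b_at X
      = (b_at X \<otimes>\<^bsub>AD\<^esub> a \<otimes>\<^bsub>AD\<^esub> b_at Y) \<otimes>\<^bsub>AD\<^esub> (b_at Y \<otimes>\<^bsub>AD\<^esub> c \<otimes>\<^bsub>AD\<^esub> b_at X)"
      by (metis base.mult_assoc)
    have "b_at X \<otimes>\<^bsub>AD\<^esub> a \<otimes>\<^bsub>AD\<^esub> b_at Y = (\<lambda>_. 0) \<or> b_at Y \<otimes>\<^bsub>AD\<^esub> c \<otimes>\<^bsub>AD\<^esub> b_at X = (\<lambda>_. 0)"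
      using between[OF X Y, of a] between[OF Y X, of c] empty by (auto simp: span_of_def)
    then show ?thesis unfolding R_simps e base.alg_simps by (auto simp: base.mult_eq)
  qed
  note o = this
  obtain v where v: "v \<in> carrier M" "b_at X \<odot>\<^bsub>M\<^esub> v \<noteq> \<zero>\<^bsub>M\<^esub>" using nz(1) by (auto simp: nonzero_on_def)
  obtain w where w: "w \<in> carrier M" "b_at Y \<odot>\<^bsub>M\<^esub> w \<noteq> \<zero>\<^bsub>M\<^esub>" using nz(2) by (auto simp: nonzero_on_def)
  have "b_at Y \<odot>\<^bsub>M\<^esub> w = \<zero>\<^bsub>M\<^esub>"
    by (rule simple_lmod_orthogonal_idempotents[OF M b_at_R[OF X] _ b_at_R[OF Y] o v w(1)]) (simp add: b_at_idem[OF X])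
  then show False using w(2) by simp
qed

lemma simple_classes_partition:
  "simple_classes R = (\<Union>X\<in>reps. classes_on R (b_at X))"
  "disjoint_family_on (\<lambda>X. classes_on R (b_at X) :: ('m, 'k) kmod set set) reps"
proof -
  show "simple_classes R = (\<Union>X\<in>reps. classes_on R (b_at X))"
  proof (intro equalityI subsetI)
    fix K :: "('m, 'k) kmod set" assume "K \<in> simple_classes R"
    then obtain M where M: "simple_lmod R M" "K = iso_class R M" by (auto simp: simple_classes_iso_class)
    obtain Y where Y: "Y \<in> Obj D" "nonzero_on (b_at Y) M" using nonzero_on_some_b_at[OF M(1)] by blast
    have "nonzero_on (b_at (rep Y)) M"
      by (rule nonzero_on_iso_obj[OF simple_lmodD(1)[OF M(1)] iso_obj_equiv(2)[OF rep(1)[OF Y(1)]] Y(2)])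
    then show "K \<in> (\<Union>X\<in>reps. classes_on R (b_at X))" using M rep(2)[OF Y(1)] by (auto simp: classes_on_def)
  next
    fix K :: "('m, 'k) kmod set" assume "K \<in> (\<Union>X\<in>reps. classes_on R (b_at X))"
    then show "K \<in> simple_classes R" by (auto simp: simple_classes_iso_class classes_on_def)
  qed
  show "disjoint_family_on (\<lambda>X. classes_on R (b_at X) :: ('m, 'k) kmod set set) reps"
    unfolding disjoint_family_on_def
  proof (intro ballI impI equals0I)
    fix X Y and K :: "('m, 'k) kmod set"
    assume X: "X \<in> reps" and Y: "Y \<in> reps" and ne: "X \<noteq> Y" and "K \<in> classes_on R (b_at X) \<inter> classes_on R (b_at Y)"
    then obtain M N where M: "simple_lmod R M" "nonzero_on (b_at X) M" "K = iso_class R M"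
      and N: "simple_lmod R N" "nonzero_on (b_at Y) N" "K = iso_class R N" by (auto simp: classes_on_def)
    have "lmod_iso R N M" using M N iso_class_eq_iff[OF N(1) M(1)] by simp
    then have "nonzero_on (b_at Y) M"
      by (rule nonzero_on_iso[OF _ simple_lmodD(1)[OF N(1)] simple_lmodD(1)[OF M(1)] b_at_R[OF reps_Obj[OF Y]] N(2)])
    then show False using nonzero_on_two[OF M(1) reps_Obj[OF X] reps_Obj[OF Y] M(2)] reps_unique[OF X Y] ne by blast
  qed
qed

subsection \<open>Isomorphism classes of weights\<close>

definition weight_class :: "('m tmor set, 'k) weight_pair \<Rightarrow> ('m tmor set, 'k) weight_pair set" where
  "weight_class w = {w'. is_weight (Orb p) \<alpha> w' \<and> pair_iso (Orb p) \<alpha> w w'}"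

definition weight_classes_at :: "'o \<Rightarrow> ('m tmor set, 'k) weight_pair set set" where
  "weight_classes_at X = weight_class ` {w. is_b_weight p D \<alpha> b w \<and> at_obj X w}"

text \<open>The isomorphism classes of weights of \<open>G\<^sub>X\<close> are the intersections of classes of the full orbit
  category with the weights at \<open>X\<close>; this map recovers the full classes.\<close>

definition saturate :: "('m tmor set, 'k) weight_pair set \<Rightarrow> ('m tmor set, 'k) weight_pair set" where
  "saturate L = (\<Union>w\<in>L. weight_class w)"

lemma b_weight_weight: "is_b_weight p D \<alpha> b w \<Longrightarrow> is_weight (Orb p) \<alpha> w"
  by (auto simp: is_b_weight_def)

lemma weight_class_eq_iff:
  assumes "is_weight (Orb p) \<alpha> w" "is_weight (Orb p) \<alpha> w'"
  shows "weight_class w = weight_class w' \<longleftrightarrow> pair_iso (Orb p) \<alpha> w w'"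
proof
  assume "weight_class w = weight_class w'"
  moreover have "w' \<in> weight_class w'" using assms O.pair_iso_refl by (simp add: weight_class_def)
  ultimately show "pair_iso (Orb p) \<alpha> w w'" by (auto simp: weight_class_def)
next
  assume p: "pair_iso (Orb p) \<alpha> w w'"
  show "weight_class w = weight_class w'"
    unfolding weight_class_def
    using O.pair_iso_trans[OF assms _ p] O.pair_iso_trans[OF assms(2,1) _ O.pair_iso_sym[OF assms p]] by blast
qed

lemma weight_classes_eq: "weight_classes p D \<alpha> b = weight_class ` {w. is_b_weight p D \<alpha> b w}"
  using b_weight_weight by (auto simp: weight_classes_def quotient_def weight_class_def)

lemma weight_classes_at_eq:
  assumes X: "X \<in> Obj D"
  shows "weight_classes p (idem_cat D (Ide D X)) \<alpha> (b_at X)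
    = (\<lambda>w. weight_class w \<inter> {w. at_obj X w}) ` {w. is_b_weight p D \<alpha> b w \<and> at_obj X w}"
proof -
  let ?O' = "orbit_cat p (idem_cat D (Ide D X))"
  have e: "{w'. is_weight ?O' \<alpha> w \<and> is_weight ?O' \<alpha> w' \<and> pair_iso ?O' \<alpha> w w'} = weight_class w \<inter> {w. at_obj X w}"
    if "is_b_weight p D \<alpha> b w" "at_obj X w" for w
    using that b_weight_weight D'_weight[OF X] D'_pair_iso[OF X that(2)] by (auto simp: weight_class_def)
  have "weight_classes p (idem_cat D (Ide D X)) \<alpha> (b_at X)
    = (\<lambda>w. {w'. is_weight ?O' \<alpha> w \<and> is_weight ?O' \<alpha> w' \<and> pair_iso ?O' \<alpha> w w'}) ` {w. is_b_weight p D \<alpha> b w \<and> at_obj X w}"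
    unfolding weight_classes_def quotient_def by (auto simp: D'_b_weight[OF X])
  also have "\<dots> = (\<lambda>w. weight_class w \<inter> {w. at_obj X w}) ` {w. is_b_weight p D \<alpha> b w \<and> at_obj X w}"
    by (rule image_cong[OF refl]) (use e in simp)
  finally show ?thesis .
qed

lemma saturate_class:
  assumes w: "is_weight (Orb p) \<alpha> w" "at_obj X w"
  shows "saturate (weight_class w \<inter> {w. at_obj X w}) = weight_class w"
proof -
  have "weight_class w' = weight_class w" if "w' \<in> weight_class w" for w'
    using weight_class_eq_iff[OF w(1), of w'] that by (auto simp: weight_class_def)
  moreover have "w \<in> weight_class w" using w(1) O.pair_iso_refl by (simp add: weight_class_def)
  ultimately show ?thesis using w(2) unfolding saturate_def by blast
qed

lemma saturate_bij:
  assumes X: "X \<in> Obj D"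
  shows "bij_betw saturate (weight_classes p (idem_cat D (Ide D X)) \<alpha> (b_at X)) (weight_classes_at X)"
proof (rule bij_betw_imageI)
  have s: "saturate (weight_class w \<inter> {w. at_obj X w}) = weight_class w" if "is_b_weight p D \<alpha> b w" "at_obj X w" for w
    by (rule saturate_class[OF b_weight_weight[OF that(1)] that(2)])
  show "inj_on saturate (weight_classes p (idem_cat D (Ide D X)) \<alpha> (b_at X))"
    unfolding weight_classes_at_eq[OF X] by (rule inj_onI) (auto simp: s)
  show "saturate ` weight_classes p (idem_cat D (Ide D X)) \<alpha> (b_at X) = weight_classes_at X"
    unfolding weight_classes_at_eq[OF X] weight_classes_at_def image_image by (rule image_cong[OF refl]) (use s in simp)
qed

text \<open>For the inclusion from left to right one applies the inverse automorphism to the isomorphism.\<close>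

lemma gal_weight_class:
  assumes \<sigma>: "\<sigma> \<in> galois_group" and w: "is_weight (Orb p) \<alpha> w"
  shows "weight_class (gal_weight \<sigma> w) = gal_weight \<sigma> ` weight_class w"
proof (intro equalityI subsetI)
  note i = inv_galois_group[OF \<sigma>] and g = gal_weight_inv[OF \<sigma>]
  fix w' assume "w' \<in> weight_class (gal_weight \<sigma> w)"
  then have w': "is_weight (Orb p) \<alpha> w'" "pair_iso (Orb p) \<alpha> (gal_weight \<sigma> w) w'" by (auto simp: weight_class_def)
  have "gal_weight (ginv \<sigma>) w' \<in> weight_class w"
    using O.gal_is_weight[OF i w'(1)] O.gal_pair_iso[OF i O.gal_is_weight[OF \<sigma> w] w']
    by (simp add: weight_class_def g)
  moreover have "w' = gal_weight \<sigma> (gal_weight (ginv \<sigma>) w')" by (simp only: g)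
  ultimately show "w' \<in> gal_weight \<sigma> ` weight_class w" by (rule rev_image_eqI)
next
  fix w' assume "w' \<in> gal_weight \<sigma> ` weight_class w"
  then show "w' \<in> weight_class (gal_weight \<sigma> w)"
    using O.gal_is_weight[OF \<sigma>] O.gal_pair_iso[OF \<sigma> w] by (auto simp: weight_class_def)
qed

lemma gal_saturate:
  assumes \<sigma>: "\<sigma> \<in> galois_group" and L: "\<And>w. w \<in> L \<Longrightarrow> is_weight (Orb p) \<alpha> w"
  shows "saturate (gal_weight \<sigma> ` L) = gal_weight \<sigma> ` saturate L"
  unfolding saturate_def using gal_weight_class[OF \<sigma> L] by auto

text \<open>A \<open>b\<close>-weight can be transported to the representative of its object and stays a \<open>b\<close>-weight;
  isomorphic weights lie over isomorphic objects.\<close>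

lemma weight_classes_partition:
  "weight_classes p D \<alpha> b = (\<Union>X\<in>reps. weight_classes_at X)" "disjoint_family_on weight_classes_at reps"
proof -
  show "weight_classes p D \<alpha> b = (\<Union>X\<in>reps. weight_classes_at X)"
  proof (intro equalityI subsetI)
    fix K assume "K \<in> weight_classes p D \<alpha> b"
    then obtain w where w: "is_b_weight p D \<alpha> b w" "K = weight_class w" by (auto simp: weight_classes_eq)
    obtain Y Q T where Y: "w = (Ide (Orb p) (Y, Q), T)" "p_subgroup p D Y Q"
      using weight_ide[OF b_weight_weight[OF w(1)]] by blast
    have YO: "Y \<in> Obj D" using p_subgroupD(2)[OF Y(2)] .
    obtain s s' where s: "inverse_mors (rep Y) Y s s'" using iso_obj_equiv(2)[OF rep(1)[OF YO]] by (auto simp: iso_obj_def)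
    obtain P T0 where P: "p_subgroup p D (rep Y) P" "is_b_weight p D \<alpha> b (Ide (Orb p) (rep Y, P), T0)"
      "pair_iso (Orb p) \<alpha> (Ide (Orb p) (rep Y, P), T0) (Ide (Orb p) (Y, Q), T)"
      using b_weight_transport[OF w(1)[unfolded Y(1)] Y(2) s] by blast
    have "K = weight_class (Ide (Orb p) (rep Y, P), T0)"
      unfolding w(2) using weight_class_eq_iff[OF b_weight_weight[OF P(2)] b_weight_weight[OF w(1)]] P(3) Y(1) by simp
    moreover have "at_obj (rep Y) (Ide (Orb p) (rep Y, P), T0)" using P(1) by (auto simp: at_obj_def)
    ultimately show "K \<in> (\<Union>X\<in>reps. weight_classes_at X)" using P(2) rep(2)[OF YO] by (auto simp: weight_classes_at_def)
  next
    fix K assume "K \<in> (\<Union>X\<in>reps. weight_classes_at X)"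
    then show "K \<in> weight_classes p D \<alpha> b" by (auto simp: weight_classes_eq weight_classes_at_def)
  qed
  show "disjoint_family_on weight_classes_at reps"
    unfolding disjoint_family_on_def
  proof (intro ballI impI equals0I)
    fix X Y K assume X: "X \<in> reps" and Y: "Y \<in> reps" and ne: "X \<noteq> Y" and "K \<in> weight_classes_at X \<inter> weight_classes_at Y"
    then obtain w w' where w: "is_b_weight p D \<alpha> b w" "at_obj X w" "K = weight_class w"
      and w': "is_b_weight p D \<alpha> b w'" "at_obj Y w'" "K = weight_class w'" by (auto simp: weight_classes_at_def)
    obtain P T where P: "p_subgroup p D X P" "w = (Ide (Orb p) (X, P), T)" using w(2) by (auto simp: at_obj_def)
    obtain Q T' where Q: "p_subgroup p D Y Q" "w' = (Ide (Orb p) (Y, Q), T')" using w'(2) by (auto simp: at_obj_def)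
    have o: "(X, P) \<in> Obj (Orb p)" "(Y, Q) \<in> Obj (Orb p)" using P Q X Y reps_Obj by (auto simp: orbit_simps(1))
    have "pair_iso (Orb p) \<alpha> w w'"
      using weight_class_eq_iff[OF b_weight_weight[OF w(1)] b_weight_weight[OF w'(1)]] w(3) w'(3) by simp
    then obtain c d where "O.inverse_mors (X, P) (Y, Q) c d" unfolding P(2) Q(2) O.pair_iso_iff[OF o] by blast
    then have "iso_obj X Y" using orbit_isoD unfolding iso_obj_def by metis
    then show False using reps_unique[OF X Y] ne by blast
  qed
qed

text \<open>On the piece of \<open>X\<close> the bijection is the composite of passing to the corner, the given bijection
  for \<open>G\<^sub>X\<close>, and saturation.  That the stabiliser of \<open>b\<close> preserves the classes of \<open>b\<close>-weights comes with the
  equivariance of the given bijections.\<close>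

lemma equivariant_bijection_glue:
  assumes cnt: "countable (UNIV :: 'k set)"
    and hyp: "\<And>X. X \<in> Obj D \<Longrightarrow> \<exists>f. equivariant_bij (gal_stab b) (simple_classes (block_alg (base.B X) (b_at X)))
        (weight_classes p (idem_cat D (Ide D X)) \<alpha> (b_at X)) f"
  shows "\<exists>f. equivariant_bij (gal_stab b) (simple_classes R) (weight_classes p D \<alpha> b) f"
proof -
  have cR: "countable (carrier R)"
    by (rule countable_subset[OF _ countable_span_of[OF cnt finite_mor]]) (use R_carrier in blast)
  have pieces: "\<exists>h. bij_betw h (classes_on R (b_at X) :: ('m, 'k) kmod set set) (weight_classes_at X) \<and>
      (\<forall>\<sigma>\<in>gal_stab b. \<forall>K\<in>classes_on R (b_at X). gal_module \<sigma> ` K \<in> classes_on R (b_at X) \<and>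
         h (gal_module \<sigma> ` K) = gal_weight \<sigma> ` h K)" if "X \<in> reps" for X
  proof -
    have X: "X \<in> Obj D" using reps_Obj that by blast
    interpret c: corner R "b_at X" by (rule corner_b_at[OF X])
    let ?S = "simple_classes (corner_ring R (b_at X))" and ?W = "weight_classes p (idem_cat D (Ide D X)) \<alpha> (b_at X)"
    obtain f where f: "bij_betw f ?S ?W" "\<And>\<sigma> K. \<lbrakk>\<sigma> \<in> gal_stab b; K \<in> ?S\<rbrakk> \<Longrightarrow> f (gal_module \<sigma> ` K) = gal_weight \<sigma> ` f K"
      using hyp[OF X] unfolding block_classes[OF X] equivariant_bij_def by blast
    have r: "bij_betw (corner_class R (b_at X)) (classes_on R (b_at X)) ?S"
      unfolding simple_classes_iso_class by (rule c.corner_class_bij[OF cR infinite_sequences])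
    let ?h = "saturate \<circ> (f \<circ> corner_class R (b_at X))"
    have "bij_betw ?h (classes_on R (b_at X)) (weight_classes_at X)"
      by (rule bij_betw_trans[OF bij_betw_trans[OF r f(1)] saturate_bij[OF X]])
    moreover have "?h (gal_module \<sigma> ` K) = gal_weight \<sigma> ` ?h K" if \<sigma>: "\<sigma> \<in> gal_stab b" and K: "K \<in> classes_on R (b_at X)" for \<sigma> K
    proof -
      have cK: "corner_class R (b_at X) K \<in> ?S" using r K by (auto dest: bij_betwE)
      then have "f (corner_class R (b_at X) K) \<in> ?W" using f(1) by (auto dest: bij_betwE)
      then have "is_weight (Orb p) \<alpha> w" if "w \<in> f (corner_class R (b_at X) K)" for w
        using that unfolding weight_classes_at_eq[OF X] by (auto simp: weight_class_def)
      then show ?thesis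
        using gal_corner_class(2)[OF \<sigma> X K] f(2)[OF \<sigma> cK] gal_saturate[OF gal_b(1)[OF \<sigma>]] by simp
    qed
    ultimately show ?thesis using gal_corner_class(1)[OF _ X] by blast
  qed
  have "\<exists>h. bij_betw h (\<Union>X\<in>reps. classes_on R (b_at X) :: ('m, 'k) kmod set set) (\<Union>X\<in>reps. weight_classes_at X) \<and>
     (\<forall>\<sigma>\<in>gal_stab b. \<forall>K\<in>(\<Union>X\<in>reps. classes_on R (b_at X)). h (gal_module \<sigma> ` K) = gal_weight \<sigma> ` h K)"
    by (rule glue_bijections[OF simple_classes_partition(2) weight_classes_partition(2)]) (rule pieces)
  then show ?thesis unfolding equivariant_bij_def simple_classes_partition(1) weight_classes_partition(1) by blast
qed

end

theorem theorem1p14: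
  fixes p :: nat
    and C :: "('o, 'm) cat"
    and \<alpha> :: "'m tmor set \<Rightarrow> 'm tmor set \<Rightarrow> 'k::alg_closed_field"
    and b :: "'m \<Rightarrow> 'k"
  assumes "alg_closure_Fp p TYPE('k)"
    and "finite_category C"
    and "EI_category C"
    and "cocycle (orbit_cat p C) (prime_subfield - {0}) \<alpha>"
    and "central_idempotent (tw_alg C (res_cocycle C \<alpha>)) b"
  shows "(\<forall>e. idem_endo C e \<longrightarrow>
            central_idempotent (idem_alg C (res_cocycle C \<alpha>) e) (idem_part C (res_cocycle C \<alpha>) e b)) \<and>
         ((\<forall>e. idem_endo C e \<longrightarrow>
             (\<exists>f. equivariant_bij (gal_stab b)
                (simple_classes (block_alg (idem_alg C (res_cocycle C \<alpha>) e)
                                           (idem_part C (res_cocycle C \<alpha>) e b)))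
                (weight_classes p (idem_cat C e) \<alpha> (idem_part C (res_cocycle C \<alpha>) e b)) f)) \<longrightarrow>
          (\<exists>f. equivariant_bij (gal_stab b)
                (simple_classes (block_alg (tw_alg C (res_cocycle C \<alpha>)) b))
                (weight_classes p C \<alpha> b) f))"
proof -
  interpret ei_category C
    using assms(2,3) by (simp add: ei_category_def ei_category_axioms_def)
  interpret twisted_orbit_idempotent C p \<alpha> b
    by unfold_locales (use assms(1,4,5) in \<open>auto simp: alg_closure_Fp_def\<close>)
  show ?thesis
  proof (intro conjI allI impI)
    fix e assume "idem_endo C e"
    then obtain X where "X \<in> Obj C" "e = Ide C X" by (auto simp: idem_endo_iff)
    then show "central_idempotent (idem_alg C (res_cocycle C \<alpha>) e) (idem_part C (res_cocycle C \<alpha>) e b)"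
      using idem_part_central by simp
  next
    assume hyp: "\<forall>e. idem_endo C e \<longrightarrow>
             (\<exists>f. equivariant_bij (gal_stab b)
                (simple_classes (block_alg (idem_alg C (res_cocycle C \<alpha>) e)
                                           (idem_part C (res_cocycle C \<alpha>) e b)))
                (weight_classes p (idem_cat C e) \<alpha> (idem_part C (res_cocycle C \<alpha>) e b)) f)"
    show "\<exists>f. equivariant_bij (gal_stab b)
                (simple_classes (block_alg (tw_alg C (res_cocycle C \<alpha>)) b))
                (weight_classes p C \<alpha> b) f"
      by (rule equivariant_bijection_glue[OF countable_alg_closure_Fp[OF assms(1)]]) (use hyp idem_endo_iff in blast)
  qed
qed

end
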